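(* Let $\beta(x)=[\beta_{jk}(x)]_{j,k=1,2}$ and $\gamma(x)=[\gamma_{jk}(x)]_{j,k=1,2}$ be $2\times2$ matrices whose entries are real-valued smooth functions on $\mathbb{T}$, let $I$ be the $2\times 2$ identity matrix, $J=\begin{bmatrix}0&-1\\1&0\end{bmatrix}$, and $$\mathscr{L}=I\frac{\partial}{\partial t}+J\frac{\partial^4}{\partial x^4}+\beta(x)\frac{\partial^2}{\partial x^2}+\gamma(x)\frac{\partial}{\partial x}.$$ The initial value problem $$\mathscr{L}\vec{w}=\vec{h}(t,x)\ \text{ in }\ \mathbb{R}\times\mathbb{T},\qquad \vec{w}(0,x)=\vec{w}_0(x)\ \text{ in }\ \mathbb{T},$$ for an $\mathbb{R}^2$-valued unknown $\vec{w}(t,x)$ is $L^2$-well-posed if and only if $$\int_0^{2\pi}\operatorname{tr}\bigl(\beta(x)\bigr)\,dx=0\qquad\text{and}\qquad \int_0^{2\pi}\operatorname{tr}\bigl(J\gamma(x)\bigr)\,dx=0,$$ where $\operatorname{tr}(\beta(x))=\beta_{11}(x)+\beta_{22}(x)$ and $\operatorname{tr}(J\gamma(x))=\gamma_{12}(x)-\gamma_{21}(x)$.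
   Context: $\mathbb{T}=\mathbb{R}/2\pi\mathbb{Z}$, and $L^2(\mathbb{T};\mathbb{R}^2)$ is the set of $\mathbb{R}^2$-valued square-integrable functions on $\mathbb{T}$. $L^2$-well-posedness means: for any $\vec{w}_0\in L^2(\mathbb{T};\mathbb{R}^2)$ and any $\vec{h}\in L^1_{\mathrm{loc}}(\mathbb{R};L^2(\mathbb{T};\mathbb{R}^2))$ (locally integrable $L^2(\mathbb{T};\mathbb{R}^2)$-valued functions of $t\in\mathbb{R}$), the initial value problem has a unique solution $\vec{w}\in C(\mathbb{R};L^2(\mathbb{T};\mathbb{R}^2))$, the equation being understood in the sense of distributions. *)

theory Defs
  imports "HOL-Analysis.Analysis"
begin

section \<open>The space $L^2(\mathbb{T};\mathbb{R}^2)$\<close>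

text \<open>The torus $\mathbb{R}/2\pi\mathbb{Z}$ is represented by its fundamental domain $[0,2\pi)$;
  smooth functions on it are $2\pi$-periodic functions on the line.\<close>

definition torus :: "real measure" where
  "torus = restrict_space lborel {0..<2*pi}"

definition square_integrable :: "(real \<Rightarrow> real^2) \<Rightarrow> bool" where
  "square_integrable f \<longleftrightarrow>
     f \<in> borel_measurable torus \<and> integrable torus (\<lambda>x. (norm (f x))\<^sup>2)"

definition L2_rel :: "(real \<Rightarrow> real^2) \<Rightarrow> (real \<Rightarrow> real^2) \<Rightarrow> bool" where
  "L2_rel f g \<longleftrightarrow> square_integrable f \<and> square_integrable g \<and> (AE x in torus. f x = g x)"

lemma finite_measure_torus: "finite_measure torus"
  unfolding torus_def
  by (rule finite_measureI) (simp add: emeasure_restrict_space space_restrict_space)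

interpretation torus: finite_measure torus
  by (rule finite_measure_torus)

lemma square_integrable_measurable: "square_integrable f \<Longrightarrow> f \<in> borel_measurable torus"
  by (simp add: square_integrable_def)

lemma square_integrable_inner:
  assumes "square_integrable f" "square_integrable g"
  shows "integrable torus (\<lambda>x. f x \<bullet> g x)"
proof -
  have [measurable]: "f \<in> borel_measurable torus" "g \<in> borel_measurable torus"
    using assms by (auto simp: square_integrable_def)
  show ?thesis
  proof (rule Bochner_Integration.integrable_bound)
    show "integrable torus (\<lambda>x. (norm (f x))\<^sup>2 + (norm (g x))\<^sup>2)"
      using assms by (auto simp: square_integrable_def)
    show "AE x in torus. norm (f x \<bullet> g x) \<le> norm ((norm (f x))\<^sup>2 + (norm (g x))\<^sup>2)"
    proof (rule AE_I2)
      fix x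
      have "\<bar>f x \<bullet> g x\<bar> \<le> norm (f x) * norm (g x)"
        by (rule Cauchy_Schwarz_ineq2)
      also have "\<dots> \<le> (norm (f x))\<^sup>2 + (norm (g x))\<^sup>2"
        using sum_squares_bound[of "norm (f x)" "norm (g x)"]
              mult_nonneg_nonneg[OF norm_ge_zero norm_ge_zero, of "f x" "g x"]
        by linarith
      finally show "norm (f x \<bullet> g x) \<le> norm ((norm (f x))\<^sup>2 + (norm (g x))\<^sup>2)"
        by simp
    qed
  qed measurable
qed

lemma square_integrable_zero: "square_integrable (\<lambda>_. 0)"
  by (simp add: square_integrable_def)

lemma square_integrable_add:
  assumes "square_integrable f" "square_integrable g"
  shows "square_integrable (\<lambda>x. f x + g x)"
proof -
  have [measurable]: "f \<in> borel_measurable torus" "g \<in> borel_measurable torus"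
    using assms by (auto simp: square_integrable_def)
  have "(\<lambda>x. (norm (f x + g x))\<^sup>2) = (\<lambda>x. (norm (f x))\<^sup>2 + 2 * (f x \<bullet> g x) + (norm (g x))\<^sup>2)"
    by (auto simp: power2_norm_eq_inner inner_add_left inner_add_right inner_commute)
  moreover have "integrable torus (\<lambda>x. (norm (f x))\<^sup>2 + 2 * (f x \<bullet> g x) + (norm (g x))\<^sup>2)"
    using assms square_integrable_inner[OF assms] by (auto simp: square_integrable_def)
  ultimately show ?thesis
    by (simp add: square_integrable_def)
qed

lemma square_integrable_scaleR:
  assumes "square_integrable f"
  shows "square_integrable (\<lambda>x. c *\<^sub>R f x)"
  using assms by (auto simp: square_integrable_def power_mult_distrib)

lemma square_integrable_uminus:
  assumes "square_integrable f"
  shows "square_integrable (\<lambda>x. - f x)"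
  using assms by (auto simp: square_integrable_def)

lemma square_integrable_diff:
  assumes "square_integrable f" "square_integrable g"
  shows "square_integrable (\<lambda>x. f x - g x)"
  using square_integrable_add[OF assms(1) square_integrable_uminus[OF assms(2)]] by simp

lemma part_equivp_L2_rel: "part_equivp L2_rel"
proof (rule part_equivpI)
  show "\<exists>f. L2_rel f f"
    using square_integrable_zero by (auto simp: L2_rel_def)
  show "symp L2_rel"
    by (auto simp: symp_def L2_rel_def elim: eventually_mono)
  show "transp L2_rel"
    unfolding transp_def L2_rel_def by (auto elim: eventually_elim2)
qed

text \<open>Square-integrable functions modulo equality almost everywhere; \<open>L2_class f\<close> is meaningful
  only for square-integrable \<open>f\<close>.\<close>

quotient_type L2_torus = "real \<Rightarrow> real^2" / partial: L2_rel
  morphisms rep_L2 L2_class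
  by (rule part_equivp_L2_rel)

lemma L2_rel_refl: "square_integrable f \<Longrightarrow> L2_rel f f"
  by (simp add: L2_rel_def)

instantiation L2_torus :: real_inner
begin

lift_definition zero_L2_torus :: L2_torus is "\<lambda>_. 0"
  by (simp add: L2_rel_def square_integrable_zero)

lift_definition plus_L2_torus :: "L2_torus \<Rightarrow> L2_torus \<Rightarrow> L2_torus" is "\<lambda>f g x. f x + g x"
  by (auto simp: L2_rel_def square_integrable_add elim: eventually_elim2)

lift_definition uminus_L2_torus :: "L2_torus \<Rightarrow> L2_torus" is "\<lambda>f x. - f x"
  by (auto simp: L2_rel_def square_integrable_uminus elim: eventually_mono)

lift_definition minus_L2_torus :: "L2_torus \<Rightarrow> L2_torus \<Rightarrow> L2_torus" is "\<lambda>f g x. f x - g x"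
  by (auto simp: L2_rel_def square_integrable_diff elim: eventually_elim2)

lift_definition scaleR_L2_torus :: "real \<Rightarrow> L2_torus \<Rightarrow> L2_torus" is "\<lambda>c f x. c *\<^sub>R f x"
  by (auto simp: L2_rel_def square_integrable_scaleR elim: eventually_mono)

lift_definition inner_L2_torus :: "L2_torus \<Rightarrow> L2_torus \<Rightarrow> real"
  is "\<lambda>f g. LINT x|torus. f x \<bullet> g x"
proof -
  fix f f' g g' assume "L2_rel f f'" "L2_rel g g'"
  then have [measurable]: "f \<in> borel_measurable torus" "g \<in> borel_measurable torus"
      "f' \<in> borel_measurable torus" "g' \<in> borel_measurable torus"
    and ae: "AE x in torus. f x = f' x" "AE x in torus. g x = g' x"
    by (auto simp: L2_rel_def square_integrable_def)
  show "(LINT x|torus. f x \<bullet> g x) = (LINT x|torus. f' x \<bullet> g' x)"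
    by (rule integral_cong_AE) (use ae in \<open>auto elim: eventually_elim2\<close>)
qed

definition norm_L2_torus :: "L2_torus \<Rightarrow> real" where
  "norm_L2_torus u = sqrt (u \<bullet> u)"

definition sgn_L2_torus :: "L2_torus \<Rightarrow> L2_torus" where
  "sgn_L2_torus u = inverse (norm u) *\<^sub>R u"

definition dist_L2_torus :: "L2_torus \<Rightarrow> L2_torus \<Rightarrow> real" where
  "dist_L2_torus u v = norm (u - v)"

definition uniformity_L2_torus :: "(L2_torus \<times> L2_torus) filter" where
  "uniformity_L2_torus = (INF e\<in>{0 <..}. principal {(x, y). dist x y < e})"

definition open_L2_torus :: "L2_torus set \<Rightarrow> bool" where
  "open_L2_torus U \<longleftrightarrow> (\<forall>x\<in>U. \<forall>\<^sub>F (x', y) in uniformity. x' = x \<longrightarrow> y \<in> U)"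

instance
proof
  fix u v w :: L2_torus and a b :: real
  show "u + v + w = u + (v + w)"
    by transfer (auto simp: L2_rel_def add.assoc square_integrable_add)
  show "u + v = v + u"
    by transfer (auto simp: L2_rel_def add.commute square_integrable_add)
  show "0 + u = u"
    by transfer (auto simp: L2_rel_def)
  show "- u + u = 0"
    by transfer (auto simp: L2_rel_def square_integrable_zero)
  show "u - v = u + - v"
    by transfer (auto simp: L2_rel_def square_integrable_diff)
  show "a *\<^sub>R (u + v) = a *\<^sub>R u + a *\<^sub>R v"
    by transfer (auto simp: L2_rel_def scaleR_add_right square_integrable_add square_integrable_scaleR)
  show "(a + b) *\<^sub>R u = a *\<^sub>R u + b *\<^sub>R u"
    by transfer (auto simp: L2_rel_def scaleR_add_left square_integrable_add square_integrable_scaleR)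
  show "a *\<^sub>R b *\<^sub>R u = (a * b) *\<^sub>R u"
    by transfer (auto simp: L2_rel_def square_integrable_scaleR)
  show "1 *\<^sub>R u = u"
    by transfer (auto simp: L2_rel_def)
  show "u \<bullet> v = v \<bullet> u"
    by transfer (simp add: inner_commute)
  show "(u + v) \<bullet> w = u \<bullet> w + v \<bullet> w"
    by transfer (auto simp: L2_rel_def inner_add_left square_integrable_inner)
  show "a *\<^sub>R u \<bullet> v = a * (u \<bullet> v)"
    by transfer (auto simp: L2_rel_def square_integrable_inner)
  show "0 \<le> u \<bullet> u"
    by transfer auto
  show "u \<bullet> u = 0 \<longleftrightarrow> u = 0"
  proof (transfer, goal_cases)
    case (1 f)
    then have "square_integrable f" by (simp add: L2_rel_def)
    then show ?case
      using square_integrable_inner[of f f]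
      by (auto simp: L2_rel_def square_integrable_zero integral_nonneg_eq_0_iff_AE)
  qed
qed (auto simp: norm_L2_torus_def sgn_L2_torus_def dist_L2_torus_def
      uniformity_L2_torus_def open_L2_torus_def)

end


lemma L2_class_add:
  "square_integrable f \<Longrightarrow> square_integrable g \<Longrightarrow>
    L2_class f + L2_class g = L2_class (\<lambda>x. f x + g x)"
  by (simp add: plus_L2_torus.abs_eq L2_rel_refl)

lemma L2_class_diff:
  "square_integrable f \<Longrightarrow> square_integrable g \<Longrightarrow>
    L2_class f - L2_class g = L2_class (\<lambda>x. f x - g x)"
  by (simp add: minus_L2_torus.abs_eq L2_rel_refl)

lemma L2_class_scaleR:
  "square_integrable f \<Longrightarrow> c *\<^sub>R L2_class f = L2_class (\<lambda>x. c *\<^sub>R f x)"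
  by (simp add: scaleR_L2_torus.abs_eq L2_rel_refl)

lemma L2_class_sum:
  assumes "finite I" "\<And>i. i \<in> I \<Longrightarrow> square_integrable (f i)"
  shows "square_integrable (\<lambda>x. \<Sum>i\<in>I. f i x) \<and>
    (\<Sum>i\<in>I. L2_class (f i)) = L2_class (\<lambda>x. \<Sum>i\<in>I. f i x)"
  using assms
  by (induction I rule: finite_induct)
     (auto simp: square_integrable_zero zero_L2_torus.abs_eq square_integrable_add L2_class_add)

lemma L2_class_inner:
  "square_integrable f \<Longrightarrow> square_integrable g \<Longrightarrow>
    L2_class f \<bullet> L2_class g = (LINT x|torus. f x \<bullet> g x)"
  by (simp add: inner_L2_torus.abs_eq L2_rel_refl)

lemma L2_class_norm:
  "square_integrable f \<Longrightarrow> (norm (L2_class f))\<^sup>2 = (LINT x|torus. (norm (f x))\<^sup>2)"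
  by (simp add: power2_norm_eq_inner L2_class_inner)

lemma L2_class_cases:
  obtains f where "square_integrable f" "u = L2_class f"
proof (induction u rule: L2_torus.abs_induct)
  case (1 f)
  then show ?case by (auto simp: L2_rel_def)
qed

lemma square_integrable_bounded:
  assumes [measurable]: "f \<in> borel_measurable torus" and "\<And>x. norm (f x) \<le> B"
  shows "square_integrable f"
  unfolding square_integrable_def
proof
  show "integrable torus (\<lambda>x. (norm (f x))\<^sup>2)"
    by (rule torus.integrable_const_bound[where B = "B\<^sup>2"]) (auto intro!: power_mono assms(2))
qed (rule assms(1))

lemma L2_class_dominated:
  assumes s: "\<And>n. square_integrable (s n)" and f: "square_integrable f"
    and lim: "\<And>x. x \<in> space torus \<Longrightarrow> (\<lambda>n. s n x) \<longlonglongrightarrow> f x"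
    and bnd: "\<And>n x. x \<in> space torus \<Longrightarrow> norm (s n x) \<le> 2 * norm (f x)"
  shows "(\<lambda>n. L2_class (s n)) \<longlonglongrightarrow> L2_class f"
proof -
  have [measurable]: "\<And>n. s n \<in> borel_measurable torus" "f \<in> borel_measurable torus"
    using s f by (auto simp: square_integrable_def)
  have "(\<lambda>n. LINT x|torus. (norm (s n x - f x))\<^sup>2) \<longlonglongrightarrow> (LINT x|torus. (0::real))"
  proof (rule integral_dominated_convergence)
    show "integrable torus (\<lambda>x. 9 * (norm (f x))\<^sup>2)"
      using f by (auto simp: square_integrable_def)
    show "AE x in torus. (\<lambda>n. (norm (s n x - f x))\<^sup>2) \<longlonglongrightarrow> 0"
    proof (rule AE_I2)
      fix x assume "x \<in> space torus"
      from tendsto_power[OF tendsto_norm[OF LIM_zero[OF lim[OF this]]], of 2]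
      show "(\<lambda>n. (norm (s n x - f x))\<^sup>2) \<longlonglongrightarrow> 0" by simp
    qed
    fix n
    show "AE x in torus. norm ((norm (s n x - f x))\<^sup>2) \<le> 9 * (norm (f x))\<^sup>2"
    proof (rule AE_I2)
      fix x assume "x \<in> space torus"
      then have "norm (s n x - f x) \<le> 3 * norm (f x)"
        using bnd[of x n] norm_triangle_ineq4[of "s n x" "f x"] by linarith
      then have "(norm (s n x - f x))\<^sup>2 \<le> (3 * norm (f x))\<^sup>2"
        by (rule power_mono) simp
      then show "norm ((norm (s n x - f x))\<^sup>2) \<le> 9 * (norm (f x))\<^sup>2"
        by (simp add: power_mult_distrib)
    qed
  qed measurable
  then have "(\<lambda>n. (norm (L2_class (s n) - L2_class f))\<^sup>2) \<longlonglongrightarrow> 0"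
    using s f by (simp add: L2_class_diff L2_class_norm square_integrable_diff)
  from tendsto_real_sqrt[OF this] show ?thesis
    by (simp add: LIM_zero_iff tendsto_norm_zero_iff)
qed

lemma L2_norm_bounds_L1:
  assumes f: "square_integrable f"
  shows "integrable torus f"
    and "(LINT x|torus. norm (f x)) \<le> norm (L2_class (\<lambda>_. axis 1 1)) * norm (L2_class f)"
proof -
  have [measurable]: "f \<in> borel_measurable torus"
    using f by (simp add: square_integrable_def)
  let ?g = "\<lambda>x. norm (f x) *\<^sub>R (axis 1 1 :: real^2)"
  have 1: "square_integrable (\<lambda>_. axis 1 1)"
    by (rule square_integrable_bounded[where B = 1]) auto
  have g: "square_integrable ?g"
    using f by (auto simp: square_integrable_def)
  have "integrable torus (\<lambda>x. norm (f x))"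
    using square_integrable_inner[OF 1 g] by (simp add: inner_axis_axis)
  then show "integrable torus f"
    by (simp add: integrable_norm_iff)
  have "(norm (L2_class ?g))\<^sup>2 = (norm (L2_class f))\<^sup>2"
    by (simp add: L2_class_norm f g)
  then have "norm (L2_class ?g) = norm (L2_class f)"
    by (simp add: power2_eq_iff_nonneg)
  moreover have "(LINT x|torus. norm (f x)) = L2_class (\<lambda>_. axis 1 1) \<bullet> L2_class ?g"
    by (simp add: L2_class_inner 1 g inner_axis_axis)
  ultimately show "(LINT x|torus. norm (f x)) \<le> norm (L2_class (\<lambda>_. axis 1 1)) * norm (L2_class f)"
    using norm_cauchy_schwarz[of "L2_class (\<lambda>_. axis 1 1)" "L2_class ?g"] by simp
qed

instance L2_torus :: banach
proof
  fix X :: "nat \<Rightarrow> L2_torus" assume X: "Cauchy X"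
  have "\<exists>f. \<forall>n. square_integrable (f n) \<and> X n = L2_class (f n)"
    by (rule choice) (metis L2_class_cases)
  then obtain f where f: "\<And>n. square_integrable (f n)" and Xf: "\<And>n. X n = L2_class (f n)"
    by blast
  have [measurable]: "\<And>n. f n \<in> borel_measurable torus"
    using f by (auto simp: square_integrable_def)
  let ?K = "norm (L2_class (\<lambda>_. axis 1 1))"
  have dist: "dist (X m) (X n) = norm (L2_class (\<lambda>x. f m x - f n x))" for m n
    by (simp add: dist_norm Xf L2_class_diff f)
  obtain r where r: "strict_mono r" and ae: "AE x in torus. Cauchy (\<lambda>i. f (r i) x)"
  proof (rule cauchy_L1_AE_cauchy_subseq[of torus f])
    show "integrable torus (f n)" for n
      by (rule L2_norm_bounds_L1) (rule f)
    fix e :: real assume "e > 0"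
    then have "e / (?K + 1) > 0"
      by (intro divide_pos_pos add_nonneg_pos) auto
    from metric_CauchyD[OF X this] obtain N
      where N: "\<And>m n. m \<ge> N \<Longrightarrow> n \<ge> N \<Longrightarrow> dist (X m) (X n) < e / (?K + 1)" by blast
    have "(LINT x|torus. norm (f m x - f n x)) < e" if "m \<ge> N" "n \<ge> N" for m n
    proof -
      have "(LINT x|torus. norm (f m x - f n x)) \<le> ?K * dist (X m) (X n)"
        unfolding dist by (rule L2_norm_bounds_L1) (intro square_integrable_diff f)
      also have "\<dots> \<le> (?K + 1) * dist (X m) (X n)"
        by (intro mult_right_mono) auto
      also have "\<dots> < e"
        using N[OF that] by (simp add: pos_less_divide_eq add_nonneg_pos mult.commute)
      finally show ?thesis .
    qed
    then show "\<exists>N. \<forall>i\<ge>N. \<forall>j\<ge>N. (LINT x|torus. norm (f i x - f j x)) < e" by blast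
  qed blast
  define F where "F x = lim (\<lambda>i. f (r i) x)" for x
  have [measurable]: "F \<in> borel_measurable torus"
    unfolding F_def by measurable
  have lim: "AE x in torus. (\<lambda>i. f (r i) x) \<longlonglongrightarrow> F x"
    using ae by eventually_elim (auto simp: F_def Cauchy_convergent_iff convergent_LIMSEQ_iff)
  have fatou: "square_integrable (\<lambda>x. F x - f n x) \<and> norm (L2_class (\<lambda>x. F x - f n x)) \<le> e"
    if e: "e > 0" and N: "\<And>m. m \<ge> N \<Longrightarrow> dist (X m) (X n) < e" for e N n
  proof -
    have "(\<integral>\<^sup>+x. ennreal ((norm (F x - f n x))\<^sup>2) \<partial>torus) =
        (\<integral>\<^sup>+x. liminf (\<lambda>i. ennreal ((norm (f (r i) x - f n x))\<^sup>2)) \<partial>torus)"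
    proof (rule nn_integral_cong_AE)
      show "AE x in torus. ennreal ((norm (F x - f n x))\<^sup>2) =
          liminf (\<lambda>i. ennreal ((norm (f (r i) x - f n x))\<^sup>2))"
        using lim
      proof eventually_elim
        case (elim x)
        have "(\<lambda>i. ennreal ((norm (f (r i) x - f n x))\<^sup>2)) \<longlonglongrightarrow> ennreal ((norm (F x - f n x))\<^sup>2)"
          by (intro tendsto_intros elim)
        from lim_imp_Liminf[OF _ this] show ?case by simp
      qed
    qed
    also have "\<dots> \<le> liminf (\<lambda>i. \<integral>\<^sup>+x. ennreal ((norm (f (r i) x - f n x))\<^sup>2) \<partial>torus)"
      by (rule nn_integral_liminf) measurable
    also have "\<dots> \<le> ennreal (e\<^sup>2)"
    proof (rule Liminf_le)
      show "\<forall>\<^sub>F i in sequentially. (\<integral>\<^sup>+x. ennreal ((norm (f (r i) x - f n x))\<^sup>2) \<partial>torus) \<le> ennreal (e\<^sup>2)"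
        using eventually_ge_at_top[of N]
      proof eventually_elim
        case (elim i)
        then have "dist (X (r i)) (X n) < e"
          using seq_suble[OF r, of i] by (intro N) linarith
        then have "(dist (X (r i)) (X n))\<^sup>2 \<le> e\<^sup>2"
          by (intro power_mono) auto
        moreover have "square_integrable (\<lambda>x. f (r i) x - f n x)"
          by (intro square_integrable_diff f)
        ultimately show ?case
          unfolding dist
          by (subst nn_integral_eq_integral) (auto simp: square_integrable_def L2_class_norm)
      qed
    qed simp
    finally have le: "(\<integral>\<^sup>+x. ennreal ((norm (F x - f n x))\<^sup>2) \<partial>torus) \<le> ennreal (e\<^sup>2)" .
    then have int: "integrable torus (\<lambda>x. (norm (F x - f n x))\<^sup>2)"
      by (intro integrableI_bounded) (simp_all add: le_less_trans[OF _ ennreal_less_top])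
    then have sq: "square_integrable (\<lambda>x. F x - f n x)"
      by (simp add: square_integrable_def)
    have "(\<integral>\<^sup>+x. ennreal ((norm (F x - f n x))\<^sup>2) \<partial>torus) =
        ennreal ((norm (L2_class (\<lambda>x. F x - f n x)))\<^sup>2)"
      unfolding L2_class_norm[OF sq] by (rule nn_integral_eq_integral[OF int]) simp
    with le have "(norm (L2_class (\<lambda>x. F x - f n x)))\<^sup>2 \<le> e\<^sup>2"
      by (metis ennreal_le_iff zero_le_power2)
    then have "norm (L2_class (\<lambda>x. F x - f n x)) \<le> e"
      by (rule power2_le_imp_le) (use e in simp)
    with sq show ?thesis by simp
  qed
  obtain N where N: "\<And>m n. m \<ge> N \<Longrightarrow> n \<ge> N \<Longrightarrow> dist (X m) (X n) < 1"
    using metric_CauchyD[OF X, of 1] by auto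
  have "square_integrable (\<lambda>x. F x - f N x)"
    using fatou[of 1 N N] N by auto
  from square_integrable_add[OF this f[of N]] have F: "square_integrable F"
    by simp
  have "X \<longlonglongrightarrow> L2_class F"
  proof (rule metric_LIMSEQ_I)
    fix e :: real assume "e > 0"
    then obtain N where N: "\<And>m n. m \<ge> N \<Longrightarrow> n \<ge> N \<Longrightarrow> dist (X m) (X n) < e / 2"
      using metric_CauchyD[OF X, of "e / 2"] by auto
    have "dist (X n) (L2_class F) < e" if "n \<ge> N" for n
    proof -
      have "norm (L2_class (\<lambda>x. F x - f n x)) \<le> e / 2"
        using fatou[of "e / 2" N n] N that \<open>e > 0\<close> by auto
      moreover have "dist (X n) (L2_class F) = norm (L2_class (\<lambda>x. F x - f n x))"
        by (subst dist_commute) (simp add: dist_norm Xf L2_class_diff F f)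
      ultimately show ?thesis
        using \<open>e > 0\<close> by linarith
    qed
    then show "\<exists>no. \<forall>n\<ge>no. dist (X n) (L2_class F) < e" by blast
  qed
  then show "convergent X" by (rule convergentI)
qed


lemma L2_class_eqI:
  assumes "square_integrable f" "square_integrable g" "\<And>x. x \<in> {0..<2*pi} \<Longrightarrow> f x = g x"
  shows "L2_class f = L2_class g"
proof -
  have "AE x in torus. f x = g x"
    by (rule AE_I2) (simp add: assms(3) torus_def space_restrict_space)
  then show ?thesis
    using assms(1,2) by (intro Quotient_rel_abs[OF Quotient_L2_torus]) (simp add: L2_rel_def)
qed

lemma borel_measurable_torusI:
  fixes f :: "real \<Rightarrow> 'a::topological_space"
  shows "f \<in> borel_measurable borel \<Longrightarrow> f \<in> borel_measurable torus"
  unfolding torus_def by (intro measurable_restrict_space1) simp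

lemma square_integrable_indicator:
  fixes c :: "real^2"
  assumes [measurable]: "A \<in> sets borel"
  shows "square_integrable (\<lambda>x. indicator A x *\<^sub>R c)"
  by (rule square_integrable_bounded[where B = "norm c"])
     (auto intro!: borel_measurable_torusI simp: indicator_def)

lemma real_borel_eq_rat_lessThan: "sets borel = sigma_sets UNIV (lessThan ` (\<rat> :: real set))"
proof (rule antisym)
  show "sigma_sets UNIV (lessThan ` (\<rat> :: real set)) \<subseteq> sets borel"
    using sets.sigma_sets_subset[of "lessThan ` \<rat>" "borel :: real measure"]
    by (simp add: image_subset_iff)
  have "range lessThan \<subseteq> sigma_sets UNIV (lessThan ` (\<rat> :: real set))"
  proof safe
    fix a :: real
    have "{..<a} = (\<Union>q\<in>{q\<in>\<rat>. q < a}. {..<q})"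
      using Rats_dense_in_real by (force intro: less_trans)
    also have "\<dots> \<in> sigma_sets UNIV (lessThan ` (\<rat> :: real set))"
    proof (rule sigma_sets_UNION)
      show "countable (lessThan ` {q\<in>\<rat>. q < a})"
        by (intro countable_image countable_subset[OF _ countable_rat]) auto
    qed auto
    finally show "{..<a} \<in> sigma_sets UNIV (lessThan ` (\<rat> :: real set))" .
  qed
  then show "sets borel \<subseteq> sigma_sets UNIV (lessThan ` (\<rat> :: real set))"
    unfolding borel_Iio by (simp add: sigma_sets_mono)
qed

text \<open>Separability, needed because the Bochner integral of the library requires a second
  countable codomain: rational combinations of the functions $1_{(-\infty,q)}b$ with rational $q$
  and $b$ in the standard basis are dense.\<close>

definition L2_generators :: "L2_torus set" where
  "L2_generators =
     (\<lambda>(q, b). L2_class (\<lambda>x. indicator {..<q} x *\<^sub>R b)) ` (\<rat> \<times> Basis)"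

definition L2_dense :: "L2_torus set" where
  "L2_dense = (\<lambda>l. \<Sum>(q, u)\<leftarrow>l. q *\<^sub>R u) ` lists (\<rat> \<times> L2_generators)"

lemma countable_L2_dense: "countable L2_dense"
  unfolding L2_dense_def L2_generators_def
  by (intro countable_image countable_lists countable_SIGMA countable_rat countable_finite finite_Basis)

lemma L2_dense_add:
  assumes "u \<in> L2_dense" "v \<in> L2_dense" shows "u + v \<in> L2_dense"
proof -
  obtain k l where "k \<in> lists (\<rat> \<times> L2_generators)" "u = (\<Sum>(q, u)\<leftarrow>k. q *\<^sub>R u)"
      "l \<in> lists (\<rat> \<times> L2_generators)" "v = (\<Sum>(q, u)\<leftarrow>l. q *\<^sub>R u)"
    using assms by (auto simp: L2_dense_def)
  then show ?thesis
    unfolding L2_dense_def by (intro image_eqI[of _ _ "k @ l"]) auto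
qed

lemma L2_dense_scaleR:
  assumes "u \<in> L2_dense" "r \<in> \<rat>" shows "r *\<^sub>R u \<in> L2_dense"
proof -
  obtain l where l: "l \<in> lists (\<rat> \<times> L2_generators)" and u: "u = (\<Sum>(q, u)\<leftarrow>l. q *\<^sub>R u)"
    using assms by (auto simp: L2_dense_def)
  let ?l = "map (\<lambda>(q, u). (r * q, u)) l"
  have "r *\<^sub>R (\<Sum>(q, u)\<leftarrow>l. q *\<^sub>R u) = (\<Sum>(q, u)\<leftarrow>?l. q *\<^sub>R u)"
    by (induction l) (auto simp: scaleR_add_right)
  moreover have "?l \<in> lists (\<rat> \<times> L2_generators)"
    using l assms(2) by (induction l) auto
  ultimately show ?thesis
    unfolding u L2_dense_def by blast
qed

lemma subspace_closure_L2_dense: "subspace (closure L2_dense)"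
  unfolding subspace_def
proof (intro conjI ballI allI)
  have "0 \<in> L2_dense"
    unfolding L2_dense_def by (intro image_eqI[of _ _ "[]"]) auto
  then show "0 \<in> closure L2_dense"
    using closure_subset by blast
next
  fix u v assume "u \<in> closure L2_dense" "v \<in> closure L2_dense"
  then obtain s t where st: "\<And>n. s n \<in> L2_dense" "s \<longlonglongrightarrow> u" "\<And>n. t n \<in> L2_dense" "t \<longlonglongrightarrow> v"
    by (auto simp: closure_sequential)
  then have "(\<lambda>n. s n + t n) \<longlonglongrightarrow> u + v"
    by (intro tendsto_add)
  with st show "u + v \<in> closure L2_dense"
    unfolding closure_sequential by (intro exI[of _ "\<lambda>n. s n + t n"]) (auto intro: L2_dense_add)
next
  fix c :: real and u assume "u \<in> closure L2_dense"
  moreover have "c \<in> closure \<rat>"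
    by (simp add: Rats_closure_real)
  ultimately obtain s t where st: "\<And>n. s n \<in> L2_dense" "s \<longlonglongrightarrow> u" "\<And>n. t n \<in> \<rat>" "t \<longlonglongrightarrow> c"
    by (auto simp: closure_sequential)
  then have "(\<lambda>n. t n *\<^sub>R s n) \<longlonglongrightarrow> c *\<^sub>R u"
    by (intro tendsto_scaleR)
  with st show "c *\<^sub>R u \<in> closure L2_dense"
    unfolding closure_sequential by (intro exI[of _ "\<lambda>n. t n *\<^sub>R s n"]) (auto intro: L2_dense_scaleR)
qed

lemma L2_generators_subset: "L2_generators \<subseteq> closure L2_dense"
proof
  fix u assume "u \<in> L2_generators"
  then have "u \<in> L2_dense"
    unfolding L2_dense_def by (intro image_eqI[of _ _ "[(1, u)]"]) auto
  then show "u \<in> closure L2_dense"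
    using closure_subset by blast
qed

lemma indicator_Basis_in_closure:
  fixes b :: "real^2"
  assumes "A \<in> sets borel" and b: "b \<in> Basis"
  shows "L2_class (\<lambda>x. indicator A x *\<^sub>R b) \<in> closure L2_dense"
proof -
  note sub = subspace_closure_L2_dense
  let ?P = "\<lambda>A. L2_class (\<lambda>x. indicator A x *\<^sub>R b) \<in> closure L2_dense"
  have "Int_stable (lessThan ` (\<rat> :: real set))"
  proof (rule Int_stableI_image)
    fix p q :: real assume "p \<in> \<rat>" "q \<in> \<rat>"
    then show "\<exists>k\<in>\<rat>. {..<p} \<inter> {..<q} = {..<k}"
      by (intro bexI[of _ "min p q"]) (auto simp: min_def)
  qed
  moreover have "lessThan ` (\<rat> :: real set) \<subseteq> Pow UNIV" by simp
  moreover have "A \<in> sigma_sets UNIV (lessThan ` \<rat>)"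
    using assms(1) by (simp add: real_borel_eq_rat_lessThan)
  ultimately show ?thesis
  proof (induction rule: sigma_sets_induct_disjoint)
    case (basic A)
    then have "L2_class (\<lambda>x. indicator A x *\<^sub>R b) \<in> L2_generators"
      using b by (auto simp: L2_generators_def)
    then show ?case using L2_generators_subset by blast
  next
    case empty
    show ?case
      using subspace_0[OF sub] by (simp add: zero_L2_torus.abs_eq)
  next
    case (compl A)
    then have A: "A \<in> sets borel" by (simp add: real_borel_eq_rat_lessThan)
    have "(7::real) \<in> \<rat>" by simp
    then have "L2_class (\<lambda>x. indicator {..<7::real} x *\<^sub>R b) \<in> L2_generators"
      using b unfolding L2_generators_def by (intro image_eqI[of _ _ "(7, b)"]) auto
    then have 7: "?P {..<7}"
      using L2_generators_subset by blast
    have "L2_class (\<lambda>x. indicator (UNIV - A) x *\<^sub>R b) =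
        L2_class (\<lambda>x. indicator {..<7} x *\<^sub>R b - indicator A x *\<^sub>R b)"
    proof (rule L2_class_eqI)
      fix x :: real assume "x \<in> {0..<2*pi}"
      then have "x < 7" using pi_less_4 pi_approx by auto
      then show "indicator (UNIV - A) x *\<^sub>R b = indicator {..<7} x *\<^sub>R b - indicator A x *\<^sub>R b"
        by (auto simp: indicator_def)
    qed (use A in \<open>auto intro!: square_integrable_diff square_integrable_indicator\<close>)
    also have "\<dots> = L2_class (\<lambda>x. indicator {..<7} x *\<^sub>R b) - L2_class (\<lambda>x. indicator A x *\<^sub>R b)"
      by (rule L2_class_diff[symmetric]) (auto intro!: square_integrable_indicator A)
    also have "\<dots> \<in> closure L2_dense"
      by (rule subspace_diff[OF sub 7 compl(2)])
    finally show ?case .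
  next
    case (union A)
    have A: "\<And>i. A i \<in> sets borel"
      using union(2) by (auto simp: real_borel_eq_rat_lessThan)
    have P: "?P (\<Union>i<n. A i)" for n
    proof -
      have "(\<lambda>x. indicator (\<Union>i<n. A i) x *\<^sub>R b) = (\<lambda>x. \<Sum>i<n. indicator (A i) x *\<^sub>R b)"
        using union(1)
        by (intro ext, subst indicator_UN_disjoint)
           (auto simp: scaleR_sum_left disjoint_family_on_def)
      moreover have "L2_class (\<lambda>x. \<Sum>i<n. indicator (A i) x *\<^sub>R b) =
          (\<Sum>i<n. L2_class (\<lambda>x. indicator (A i) x *\<^sub>R b))"
        by (intro L2_class_sum[THEN conjunct2, symmetric] square_integrable_indicator A) simp
      ultimately show ?thesis
        using subspace_sum[OF sub, of "{..<n}"] union(3) by auto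
    qed
    have "(\<lambda>n. L2_class (\<lambda>x. indicator (\<Union>i<n. A i) x *\<^sub>R b)) \<longlonglongrightarrow>
        L2_class (\<lambda>x. indicator (\<Union>i. A i) x *\<^sub>R b)"
    proof (rule L2_class_dominated)
      show "(\<lambda>n. indicator (\<Union>i<n. A i) x *\<^sub>R b) \<longlonglongrightarrow> indicator (\<Union>i. A i) x *\<^sub>R b" for x
        by (intro tendsto_scaleR tendsto_const LIMSEQ_indicator_UN)
      show "norm (indicator (\<Union>i<n. A i) x *\<^sub>R b) \<le> 2 * norm (indicator (\<Union>i. A i) x *\<^sub>R b)" for n x
        by (auto simp: indicator_def)
    qed (auto intro!: square_integrable_indicator A)
    with P show ?case
      by (rule closed_sequentially[OF closed_closure])
  qed
qed

lemma indicator_in_closure: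
  fixes c :: "real^2"
  assumes A: "A \<in> sets borel"
  shows "L2_class (\<lambda>x. indicator A x *\<^sub>R c) \<in> closure L2_dense"
proof -
  have "(\<lambda>x. indicator A x *\<^sub>R c) = (\<lambda>x. \<Sum>b\<in>Basis. (c \<bullet> b) *\<^sub>R (indicator A x *\<^sub>R b))"
    by (subst (1) euclidean_representation[of c, symmetric])
       (simp add: scaleR_sum_right mult.commute)
  then have "L2_class (\<lambda>x. indicator A x *\<^sub>R c) =
      (\<Sum>b\<in>Basis. L2_class (\<lambda>x. (c \<bullet> b) *\<^sub>R (indicator A x *\<^sub>R b)))"
    by (simp only:)
       (intro L2_class_sum[THEN conjunct2, symmetric] finite_Basis square_integrable_scaleR
          square_integrable_indicator A)
  also have "\<dots> = (\<Sum>b\<in>Basis. (c \<bullet> b) *\<^sub>R L2_class (\<lambda>x. indicator A x *\<^sub>R b))"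
    by (intro sum.cong refl L2_class_scaleR[symmetric] square_integrable_indicator A)
  also have "\<dots> \<in> closure L2_dense"
    by (intro subspace_sum subspace_scale subspace_closure_L2_dense indicator_Basis_in_closure A)
  finally show ?thesis .
qed

lemma closure_L2_dense: "closure L2_dense = UNIV"
proof (intro equalityI subset_UNIV subsetI)
  fix u :: L2_torus
  obtain f where f: "square_integrable f" and u: "u = L2_class f"
    by (rule L2_class_cases)
  from borel_measurable_implies_sequence_metric[OF square_integrable_measurable[OF f], of 0]
  obtain s where s: "\<And>i. simple_function torus (s i)"
      "\<And>x. x \<in> space torus \<Longrightarrow> (\<lambda>i. s i x) \<longlonglongrightarrow> f x"
      "\<And>i x. x \<in> space torus \<Longrightarrow> norm (s i x) \<le> 2 * norm (f x)"
    by (simp add: dist_norm) blast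
  have sq: "square_integrable (s i) \<and> L2_class (s i) \<in> closure L2_dense" for i
  proof -
    let ?I = "s i ` space torus" and ?A = "\<lambda>y. s i -` {y} \<inter> space torus"
    have fin: "finite ?I" using s(1) by (simp add: simple_function_def)
    have A: "?A y \<in> sets borel" for y
    proof -
      have "?A y \<in> sets torus"
        using s(1)[of i] by (rule simple_functionD)
      then show ?thesis
        by (auto simp: torus_def sets_restrict_space)
    qed
    have rep: "s i x = (\<Sum>y\<in>?I. indicator (?A y) x *\<^sub>R y)" if "x \<in> space torus" for x
    proof -
      have "(\<Sum>y\<in>?I. indicator (?A y) x *\<^sub>R y) = (\<Sum>y\<in>?I. if y = s i x then y else 0)"
        using that by (intro sum.cong) (auto simp: indicator_def)
      also have "\<dots> = s i x"
        using fin that by simp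
      finally show ?thesis by simp
    qed
    have *: "square_integrable (\<lambda>x. \<Sum>y\<in>?I. indicator (?A y) x *\<^sub>R y)"
        "(\<Sum>y\<in>?I. L2_class (\<lambda>x. indicator (?A y) x *\<^sub>R y)) =
          L2_class (\<lambda>x. \<Sum>y\<in>?I. indicator (?A y) x *\<^sub>R y)"
      using L2_class_sum[of ?I "\<lambda>y x. indicator (?A y) x *\<^sub>R y"] fin A
      by (auto intro: square_integrable_indicator)
    have 1: "square_integrable (s i)"
      unfolding square_integrable_def
    proof
      show m: "s i \<in> borel_measurable torus"
        using s(1)[of i] by (rule borel_measurable_simple_function)
      have "integrable torus (\<lambda>x. (norm (s i x))\<^sup>2) \<longleftrightarrow>
          integrable torus (\<lambda>x. (norm (\<Sum>y\<in>?I. indicator (?A y) x *\<^sub>R y))\<^sup>2)"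
        by (rule Bochner_Integration.integrable_cong) (simp_all only: rep)
      then show "integrable torus (\<lambda>x. (norm (s i x))\<^sup>2)"
        using *(1) by (simp only: square_integrable_def)
    qed
    have "L2_class (s i) = L2_class (\<lambda>x. \<Sum>y\<in>?I. indicator (?A y) x *\<^sub>R y)"
      by (rule L2_class_eqI[OF 1 *(1)]) (rule rep, simp add: torus_def space_restrict_space)
    also have "\<dots> = (\<Sum>y\<in>?I. L2_class (\<lambda>x. indicator (?A y) x *\<^sub>R y))"
      by (rule *(2)[symmetric])
    also have "\<dots> \<in> closure L2_dense"
      by (intro subspace_sum subspace_closure_L2_dense indicator_in_closure A)
    finally show ?thesis using 1 by blast
  qed
  have "(\<lambda>i. L2_class (s i)) \<longlonglongrightarrow> u"
    unfolding u using sq s f by (intro L2_class_dominated) auto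
  then show "u \<in> closure L2_dense"
    by (rule closed_sequentially[OF closed_closure, rotated]) (use sq in blast)
qed

instance L2_torus :: second_countable_topology
proof
  let ?B = "(\<lambda>(u, r). ball u r) ` (L2_dense \<times> {r\<in>\<rat>. 0 < r})"
  have "topological_basis ?B"
  proof (rule topological_basisI)
    fix U and u :: L2_torus assume "open U" "u \<in> U"
    then obtain e where e: "e > 0" "ball u e \<subseteq> U"
      by (auto simp: open_contains_ball)
    obtain r where r: "r \<in> \<rat>" "0 < r" "r < e / 2"
      using Rats_dense_in_real[of 0 "e / 2"] e by auto
    have "u \<in> closure L2_dense" by (simp add: closure_L2_dense)
    then obtain v where v: "v \<in> L2_dense" "dist v u < r"
      using r(2) by (auto simp: closure_approachable)
    have "ball v r \<subseteq> ball u e"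
    proof
      fix w assume "w \<in> ball v r"
      then show "w \<in> ball u e"
        using v(2) r(3) dist_triangle[of u w v] by (auto simp: dist_commute)
    qed
    then show "\<exists>B'\<in>?B. u \<in> B' \<and> B' \<subseteq> U"
      using v r e by (intro bexI[of _ "ball v r"]) auto
  qed auto
  moreover have "countable ?B"
    by (intro countable_image countable_SIGMA countable_L2_dense
          countable_subset[OF _ countable_rat]) auto
  ultimately show "\<exists>B :: L2_torus set set. countable B \<and> open = generate_topology B"
    by (blast intro: topological_basis_imp_subbasis)
qed



section \<open>Distributions on $\mathbb{R}\times\mathbb{T}$\<close>

definition partial_t :: "(real \<Rightarrow> real \<Rightarrow> real^2) \<Rightarrow> real \<Rightarrow> real \<Rightarrow> real^2" where
  "partial_t \<phi> = (\<lambda>t x. vector_derivative (\<lambda>s. \<phi> s x) (at t))"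

definition partial_x :: "(real \<Rightarrow> real \<Rightarrow> real^2) \<Rightarrow> real \<Rightarrow> real \<Rightarrow> real^2" where
  "partial_x \<phi> = (\<lambda>t x. vector_derivative (\<lambda>y. \<phi> t y) (at x))"

text \<open>Joint $C^k$ regularity in $(t,x)$: all iterated partial derivatives up to order $k$, in any
  order, exist and are jointly continuous.\<close>

primrec C_k :: "nat \<Rightarrow> (real \<Rightarrow> real \<Rightarrow> real^2) \<Rightarrow> bool" where
  "C_k 0 \<phi> \<longleftrightarrow> continuous_on UNIV (\<lambda>(t, x). \<phi> t x)"
| "C_k (Suc k) \<phi> \<longleftrightarrow>
     continuous_on UNIV (\<lambda>(t, x). \<phi> t x) \<and>
     (\<forall>t x. (\<lambda>s. \<phi> s x) differentiable (at t) \<and> (\<lambda>y. \<phi> t y) differentiable (at x)) \<and>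
     C_k k (partial_t \<phi>) \<and> C_k k (partial_x \<phi>)"

definition test_function :: "(real \<Rightarrow> real \<Rightarrow> real^2) \<Rightarrow> bool" where
  "test_function \<phi> \<longleftrightarrow>
     (\<forall>k. C_k k \<phi>) \<and>
     (\<forall>t x. \<phi> t (x + 2*pi) = \<phi> t x) \<and>
     (\<exists>R. \<forall>t x. R < \<bar>t\<bar> \<longrightarrow> \<phi> t x = 0)"

text \<open>Distributions are linear functionals on $\mathbb{R}^2$-valued test functions; only their values
  on functions satisfying \<^const>\<open>test_function\<close> matter.  A function $w$ of $t$ with values in
  $L^2(\mathbb{T};\mathbb{R}^2)$ acts by
  $\varphi\mapsto\int_{\mathbb{R}}\int_{\mathbb{T}} w(t,x)\cdot\varphi(t,x)\,dx\,dt$, and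
  derivatives and matrix coefficients act by transposition.\<close>

type_synonym distribution = "(real \<Rightarrow> real \<Rightarrow> real^2) \<Rightarrow> real"

definition distribution_of :: "(real \<Rightarrow> L2_torus) \<Rightarrow> distribution" where
  "distribution_of w = (\<lambda>\<phi>. LINT t|lborel. w t \<bullet> L2_class (\<phi> t))"

definition dist_deriv_t :: "distribution \<Rightarrow> distribution" where
  "dist_deriv_t u = (\<lambda>\<phi>. - u (partial_t \<phi>))"

definition dist_deriv_x :: "distribution \<Rightarrow> distribution" where
  "dist_deriv_x u = (\<lambda>\<phi>. - u (partial_x \<phi>))"

definition dist_mult :: "(real \<Rightarrow> real^2^2) \<Rightarrow> distribution \<Rightarrow> distribution" where
  "dist_mult A u = (\<lambda>\<phi>. u (\<lambda>t x. transpose (A x) *v \<phi> t x))"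


section \<open>The initial value problem\<close>

definition smooth_periodic :: "(real \<Rightarrow> real) \<Rightarrow> bool" where
  "smooth_periodic f \<longleftrightarrow>
     (\<forall>n x. (deriv ^^ n) f field_differentiable (at x)) \<and> (\<forall>x. f (x + 2*pi) = f x)"

definition J :: "real^2^2" where
  "J = vector [vector [0, -1], vector [1, 0]]"

lemma trace_J_mult: "trace (J ** A) = A $ 1 $ 2 - A $ 2 $ 1"
  by (simp add: trace_def J_def matrix_matrix_mult_def sum_2)

definition operator_L ::
  "(real \<Rightarrow> real^2^2) \<Rightarrow> (real \<Rightarrow> real^2^2) \<Rightarrow> distribution \<Rightarrow> distribution" where
  "operator_L \<beta> \<gamma> u = (\<lambda>\<phi>.
     dist_deriv_t u \<phi>
     + dist_mult (\<lambda>_. J) ((dist_deriv_x ^^ 4) u) \<phi>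
     + dist_mult \<beta> ((dist_deriv_x ^^ 2) u) \<phi>
     + dist_mult \<gamma> (dist_deriv_x u) \<phi>)"

text \<open>This is Bochner integrability in $L^2(\mathbb{T};\mathbb{R}^2)$ on every compact
  interval.\<close>

definition locally_integrable :: "(real \<Rightarrow> L2_torus) \<Rightarrow> bool" where
  "locally_integrable h \<longleftrightarrow> (\<forall>a b. set_integrable lborel {a..b} h)"

definition is_solution ::
  "(real \<Rightarrow> real^2^2) \<Rightarrow> (real \<Rightarrow> real^2^2) \<Rightarrow> (real \<Rightarrow> L2_torus) \<Rightarrow> L2_torus \<Rightarrow>
    (real \<Rightarrow> L2_torus) \<Rightarrow> bool" where
  "is_solution \<beta> \<gamma> h w0 w \<longleftrightarrow>
     continuous_on UNIV w \<and>
     (\<forall>\<phi>. test_function \<phi> \<longrightarrow>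
        operator_L \<beta> \<gamma> (distribution_of w) \<phi> = distribution_of h \<phi>) \<and>
     w 0 = w0"

definition L2_well_posed :: "(real \<Rightarrow> real^2^2) \<Rightarrow> (real \<Rightarrow> real^2^2) \<Rightarrow> bool" where
  "L2_well_posed \<beta> \<gamma> \<longleftrightarrow>
     (\<forall>w0 h. locally_integrable h \<longrightarrow> (\<exists>!w. is_solution \<beta> \<gamma> h w0 w))"

end

theory Submission
  imports Defs
begin

text \<open>Identify \<open>\<real>\<^sup>2\<close> with \<open>\<complex>\<close>, so that \<open>J\<close> becomes multiplication by \<open>\<i>\<close> and the equation reads
  \<open>w\<^sub>t + \<i> w'''' + b w'' + b' cnj w'' + c w' + c' cnj w' = h\<close> with \<open>tr \<beta> = 2 Re b\<close> and
  \<open>tr (J \<gamma>) = - 2 Im c\<close>.  An operator \<open>S\<close> close to the identity, built from multiplications and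
  powers of \<open>\<partial>\<^sup>-\<^sup>1\<close>, conjugates the spatial operator to the Fourier multiplier with symbol
  \<open>N n = \<i> n\<^sup>4 - n\<^sup>2 mean b + \<i> n mean c\<close> up to an operator that is bounded on \<open>L\<^sup>2\<close>.  The formal adjoint has
  the same form, with symbol \<open>- cnj (N n)\<close>.

  The two integrals vanish iff \<open>Re (N n) = 0\<close> for all \<open>n\<close>.  In this case the multiplier generates a
  unitary group, and existence follows by solving a Volterra equation for the conjugated unknown.
  Conjugating the adjoint instead shows that the modes of every distributional solution satisfy
  ordinary differential equations with a bounded coupling, and uniqueness follows from Gronwall's
  lemma.

  Otherwise \<open>\<bar>Re (N n)\<bar>\<close> grows at least linearly as \<open>n \<rightarrow> \<infinity>\<close>.  A mode that stays bounded for
  \<open>-1 \<le> t \<le> 1\<close> then has an initial value \<open>O(1/n)\<close>, since it grows in one of the two time directions; but the initial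
  datum can be chosen with Fourier coefficients \<open>n\<^bsup>-3/4\<^esup>\<close>.\<close>

subsection \<open>Smooth functions of one real variable\<close>

text \<open>The terms in w'' and w' are unbounded on L^2, so neither perturbation theory nor
  Gronwall's lemma applies to the equation as it stands; the operator S trades them for a bounded
  error. The obstruction shows in its construction: moving \<open>\<i> \<partial>^4\<close> past
  \<open>p1 \<partial>^-1\<close> produces \<open>4 \<i> p1' \<partial>^2\<close>, so a periodic p1
  absorbs exactly the part of b that has mean zero, and likewise p2 for c. Conjugate-linear terms
  meet no such condition, since r2 and r3 are found by division; this is why only b and c enter the
  criterion. A solution is merely continuous with values in L^2 and cannot be differentiated in x.
  Hence S is applied to test functions, for the adjoint operator, and reaches solutions as the
  bounded operator \<open>adjoint S\<close>. The terms with cnj make all operators only real-linear,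
  so L^2 is treated as a real Hilbert space and every mode is tested with both 1 and
  \<open>\<i>\<close>.\<close>

definition vderiv :: "(real \<Rightarrow> 'a::real_normed_vector) \<Rightarrow> real \<Rightarrow> 'a" where
  "vderiv f = (\<lambda>x. vector_derivative f (at x))"

text \<open>\<open>times_diff k\<close> is differentiability of order k + 1: already index 0
  provides a derivative, and continuity of each derivative comes from the next index.\<close>

primrec times_diff :: "nat \<Rightarrow> (real \<Rightarrow> 'a::real_normed_vector) \<Rightarrow> bool" where
  "times_diff 0 f \<longleftrightarrow> (\<forall>x. f differentiable at x)"
| "times_diff (Suc k) f \<longleftrightarrow> (\<forall>x. f differentiable at x) \<and> times_diff k (vderiv f)"

definition smooth :: "(real \<Rightarrow> 'a::real_normed_vector) \<Rightarrow> bool" where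
  "smooth f \<longleftrightarrow> (\<forall>k. times_diff k f)"

lemma vderivI: "(\<And>x. (f has_vector_derivative g x) (at x)) \<Longrightarrow> vderiv f = g"
  by (auto simp: vderiv_def intro: vector_derivative_at)

lemma times_diff_differentiable: "times_diff k f \<Longrightarrow> f differentiable at x"
  by (cases k) auto

lemma times_diff_has_vderiv: "times_diff k f \<Longrightarrow> (f has_vector_derivative vderiv f x) (at x)"
  unfolding vderiv_def using times_diff_differentiable vector_derivative_works by blast

lemma times_diff_SucD: "times_diff (Suc k) f \<Longrightarrow> times_diff k f"
  by (induction k arbitrary: f) auto

lemma times_diff_SucI:
  assumes "\<And>x. (f has_vector_derivative g x) (at x)" "times_diff k g"
  shows "times_diff (Suc k) f"
  using assms vderivI[OF assms(1)] by (auto intro: differentiableI_vector)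

lemma times_diff_0I: "(\<And>x. (f has_vector_derivative g x) (at x)) \<Longrightarrow> times_diff 0 f"
  by (auto intro: differentiableI_vector)

lemma smooth_vderiv: "smooth f \<Longrightarrow> smooth (vderiv f)"
  unfolding smooth_def by (metis times_diff.simps(2))

lemma smooth_has_vderiv: "smooth f \<Longrightarrow> (f has_vector_derivative vderiv f x) (at x)"
  unfolding smooth_def using times_diff_has_vderiv by blast

lemma smooth_continuous: "smooth f \<Longrightarrow> continuous_on A f"
  by (intro continuous_at_imp_continuous_on ballI has_vector_derivative_continuous[OF smooth_has_vderiv])

lemma smoothI: 
  assumes "\<And>x. (f has_vector_derivative g x) (at x)" "smooth g"
  shows "smooth f"
  unfolding smooth_def
proof
  fix k show "times_diff k f"
    using times_diff_SucI[OF assms(1)] assms(2) times_diff_SucD[of k f] by (auto simp: smooth_def)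
qed

lemma times_diff_add:
  "times_diff k f \<Longrightarrow> times_diff k g \<Longrightarrow> times_diff k (\<lambda>x. f x + g x)"
proof (induction k arbitrary: f g)
  case 0 then show ?case by (auto intro!: differentiable_add)
next
  case (Suc k)
  have "((\<lambda>x. f x + g x) has_vector_derivative vderiv f x + vderiv g x) (at x)" for x
    by (intro has_vector_derivative_add times_diff_has_vderiv[of "Suc k"] Suc.prems)
  then show ?case
    using Suc by (intro times_diff_SucI[of _ "\<lambda>x. vderiv f x + vderiv g x"]) auto
qed

lemma (in bounded_linear) times_diff: "times_diff k g \<Longrightarrow> times_diff k (\<lambda>x. f (g x))"
proof (induction k arbitrary: g)
  case 0
  have "((\<lambda>x. f (g x)) has_vector_derivative f (vderiv g x)) (at x)" for x
    by (intro has_vector_derivative times_diff_has_vderiv[of 0] 0)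
  then show ?case by (rule times_diff_0I)
next
  case (Suc k)
  have "((\<lambda>x. f (g x)) has_vector_derivative f (vderiv g x)) (at x)" for x
    by (intro has_vector_derivative times_diff_has_vderiv[of "Suc k"] Suc.prems)
  then show ?case
    using Suc by (intro times_diff_SucI[of _ "\<lambda>x. f (vderiv g x)"]) auto
qed

lemma (in bounded_bilinear) times_diff:
  "times_diff k f \<Longrightarrow> times_diff k g \<Longrightarrow> times_diff k (\<lambda>x. prod (f x) (g x))"
proof (induction k arbitrary: f g)
  case 0
  have "((\<lambda>x. prod (f x) (g x)) has_vector_derivative
      prod (f x) (vderiv g x) + prod (vderiv f x) (g x)) (at x)" for x
    by (intro has_vector_derivative times_diff_has_vderiv[of 0] 0)
  then show ?case by (rule times_diff_0I)
next
  case (Suc k)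
  have *: "times_diff k f" "times_diff k g" using Suc.prems times_diff_SucD by blast+
  have "((\<lambda>x. prod (f x) (g x)) has_vector_derivative
      prod (f x) (vderiv g x) + prod (vderiv f x) (g x)) (at x)" for x
    by (intro has_vector_derivative times_diff_has_vderiv[of "Suc k"] Suc.prems)
  then show ?case
    by (rule times_diff_SucI) (use * Suc in \<open>auto intro!: times_diff_add\<close>)
qed

lemma smooth_add: "smooth f \<Longrightarrow> smooth g \<Longrightarrow> smooth (\<lambda>x. f x + g x)"
  by (auto simp: smooth_def times_diff_add)

lemma vderiv_add: "smooth f \<Longrightarrow> smooth g \<Longrightarrow> vderiv (\<lambda>x. f x + g x) = (\<lambda>x. vderiv f x + vderiv g x)"
  by (intro vderivI has_vector_derivative_add smooth_has_vderiv)

lemma (in bounded_linear) smooth: "smooth g \<Longrightarrow> smooth (\<lambda>x. f (g x))"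
  by (auto simp: smooth_def times_diff)

lemma (in bounded_linear) vderiv: "smooth g \<Longrightarrow> vderiv (\<lambda>x. f (g x)) = (\<lambda>x. f (vderiv g x))"
  by (intro vderivI has_vector_derivative smooth_has_vderiv)

lemma (in bounded_bilinear) smooth: "smooth f \<Longrightarrow> smooth g \<Longrightarrow> smooth (\<lambda>x. prod (f x) (g x))"
  by (auto simp: smooth_def times_diff)

lemma (in bounded_bilinear) vderiv:
  "smooth f \<Longrightarrow> smooth g \<Longrightarrow>
    vderiv (\<lambda>x. prod (f x) (g x)) = (\<lambda>x. prod (f x) (vderiv g x) + prod (vderiv f x) (g x))"
  by (intro vderivI has_vector_derivative smooth_has_vderiv)

lemmas smooth_mult = bounded_bilinear.smooth[OF bounded_bilinear_mult]
lemmas vderiv_mult = bounded_bilinear.vderiv[OF bounded_bilinear_mult]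
lemmas smooth_cnj = bounded_linear.smooth[OF bounded_linear_cnj]
lemmas smooth_minus = bounded_linear.smooth[OF bounded_linear_minus[OF bounded_linear_ident]]

lemma smooth_diff: "smooth f \<Longrightarrow> smooth g \<Longrightarrow> smooth (\<lambda>x. f x - g x)"
  using smooth_add[of f "\<lambda>x. - g x"] smooth_minus by auto

lemma vderiv_const: "vderiv (\<lambda>x. c) = (\<lambda>x. 0)"
  by (intro vderivI) simp

lemma smooth_const: "smooth (\<lambda>x. c)"
proof -
  have 0: "times_diff k (\<lambda>x. 0 :: 'a)" for k
    by (induction k) (simp_all add: vderiv_const)
  have "smooth (\<lambda>x. 0 :: 'a)"
    using 0 by (simp add: smooth_def)
  then show ?thesis
    by (rule smoothI[rotated]) simp
qed

lemma has_vector_derivative_compose_affine: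
  fixes a b :: real
  assumes "(f has_vector_derivative d) (at (a * x + b))"
  shows "((\<lambda>x. f (a * x + b)) has_vector_derivative a *\<^sub>R d) (at x)"
proof -
  have "((\<lambda>x. a * x + b) has_vector_derivative a) (at x)"
    by (auto intro!: derivative_eq_intros simp flip: has_real_derivative_iff_has_vector_derivative)
  from vector_diff_chain_at[OF this assms] show ?thesis
    by (simp add: o_def)
qed

lemma times_diff_compose_affine:
  "times_diff k f \<Longrightarrow> times_diff k (\<lambda>x. f (a * x + b))"
proof (induction k arbitrary: f)
  case 0
  show ?case
    by (rule times_diff_0I, rule has_vector_derivative_compose_affine,
        rule times_diff_has_vderiv[OF 0])
next
  case (Suc k)
  show ?case
    by (rule times_diff_SucI, rule has_vector_derivative_compose_affine,
        rule times_diff_has_vderiv[OF Suc.prems])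
       (rule bounded_linear.times_diff[OF bounded_linear_scaleR_right], rule Suc.IH,
        use Suc.prems in simp)
qed

lemma smooth_compose_affine: "smooth f \<Longrightarrow> smooth (\<lambda>x. f (a * x + b))"
  unfolding smooth_def using times_diff_compose_affine[of _ f a b] by blast

lemma has_vderiv_cis: "((\<lambda>x. cis (a * x)) has_vector_derivative (\<i> * of_real a * cis (a * x))) (at x)"
proof -
  have "((\<lambda>x. cis (a * x)) has_derivative (\<lambda>h. (a * h) *\<^sub>R (\<i> * cis (a * x)))) (at x)"
    by (intro has_derivative_cis) (auto intro!: derivative_eq_intros)
  then show ?thesis
    by (simp add: has_vector_derivative_def scaleR_conv_of_real mult_ac)
qed

lemma vderiv_cis: "vderiv (\<lambda>x. cis (a * x)) = (\<lambda>x. \<i> * of_real a * cis (a * x))"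
  by (intro vderivI has_vderiv_cis)

lemma smooth_cis: "smooth (\<lambda>x. cis (a * x))"
  unfolding smooth_def
proof
  fix k show "times_diff k (\<lambda>x. cis (a * x))"
  proof (induction k)
    case 0 show ?case by (rule times_diff_0I) (rule has_vderiv_cis)
  next
    case (Suc k)
    show ?case
      by (rule times_diff_SucI, rule has_vderiv_cis)
         (intro bounded_linear.times_diff[OF bounded_linear_mult_right] Suc)
  qed
qed

text \<open>Translation by p matches the derivatives of f at x + p with those at x, so the choice in
  \<open>vector_derivative\<close> is made from the same candidates, also at points where there are
  none.\<close>

lemma vderiv_periodic:
  assumes "\<And>x. f (x + p) = f x"
  shows "vderiv f (x + p) = vderiv f x"
proof -
  have shift: "(g has_vector_derivative d) (at y)"
    if "(g has_vector_derivative d) (at (y + q))" "\<And>x. g (x + q) = g x"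
    for g :: "real \<Rightarrow> 'a" and d y q
  proof -
    have "((\<lambda>x. x + q) has_vector_derivative 1) (at y)"
      by (auto intro!: derivative_eq_intros)
    from vector_diff_chain_at[OF this that(1)] that(2) show ?thesis
      by (simp add: o_def)
  qed
  have "f (z + - p) = f z" for z
    using assms[of "z - p"] by simp
  then have "(f has_vector_derivative d) (at (x + p)) \<longleftrightarrow> (f has_vector_derivative d) (at x)" for d
    using shift[of f d x p] shift[of f d "x + p" "- p"] assms by auto
  then show ?thesis by (simp add: vderiv_def vector_derivative_def)
qed

subsection \<open>Primitives of locally integrable functions\<close>

text \<open>Differential equations are used in this integrated form: the right-hand sides contain h,
  which is only locally integrable in time, so F is merely absolutely continuous and a derivative
  need not exist at every point.\<close>

definition primitive :: "(real \<Rightarrow> 'a::{banach,second_countable_topology}) \<Rightarrow> (real \<Rightarrow> 'a) \<Rightarrow> bool" where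
  "primitive F f \<longleftrightarrow> (\<forall>a b. a \<le> b \<longrightarrow>
     set_integrable lborel {a..b} f \<and> F b - F a = (LINT s:{a..b}|lborel. f s))"

lemma primitiveD:
  assumes "primitive F f" "a \<le> b"
  shows "set_integrable lborel {a..b} f" "F b - F a = (LINT s:{a..b}|lborel. f s)"
  using assms by (auto simp: primitive_def)

lemma set_integrable_continuous:
  fixes f :: "real \<Rightarrow> 'a::{banach,second_countable_topology}"
  assumes "continuous_on {a..b} f"
  shows "set_integrable lborel {a..b} f"
  unfolding set_integrable_def
proof (rule borel_integrable_compact)
  show "compact {a..b}" by simp
qed (rule assms)

lemma primitive_of_deriv:
  fixes F :: "real \<Rightarrow> 'a::euclidean_space"
  assumes "\<And>x. (F has_vector_derivative f x) (at x)" "continuous_on UNIV f"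
  shows "primitive F f"
  unfolding primitive_def
proof (intro allI impI conjI)
  fix a b :: real assume ab: "a \<le> b"
  have c: "continuous_on {a..b} f" using assms(2) continuous_on_subset by blast
  then show "set_integrable lborel {a..b} f" by (rule set_integrable_continuous)
  show "F b - F a = (LINT s:{a..b}|lborel. f s)"
    unfolding set_lebesgue_integral_def
    by (rule integral_FTC_Icc[OF ab _ c, symmetric])
       (use assms(1) has_vector_derivative_at_within in blast)
qed

lemma primitive_linear:
  assumes "bounded_linear T" "primitive F f"
  shows "primitive (\<lambda>t. T (F t)) (\<lambda>t. T (f t))"
  unfolding primitive_def
proof (intro allI impI conjI)
  interpret T: bounded_linear T by fact
  fix a b :: real assume ab: "a \<le> b"
  note p = primitiveD[OF assms(2) ab]
  show "set_integrable lborel {a..b} (\<lambda>t. T (f t))"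
    using integrable_bounded_linear[OF assms(1) p(1)[unfolded set_integrable_def]]
    by (simp add: set_integrable_def T.scaleR)
  show "T (F b) - T (F a) = (LINT s:{a..b}|lborel. T (f s))"
    using integral_bounded_linear[OF assms(1) p(1)[unfolded set_integrable_def]] p(2)
    by (simp add: set_lebesgue_integral_def T.scaleR T.diff[symmetric])
qed

lemma primitive_add:
  "primitive F f \<Longrightarrow> primitive G g \<Longrightarrow> primitive (\<lambda>t. F t + G t) (\<lambda>t. f t + g t)"
  unfolding primitive_def by (auto simp: set_integral_add algebra_simps)

lemma primitive_diff:
  "primitive F f \<Longrightarrow> primitive G g \<Longrightarrow> primitive (\<lambda>t. F t - G t) (\<lambda>t. f t - g t)"
  unfolding primitive_def by (auto simp: set_integral_diff algebra_simps)

lemma primitive_const: "primitive (\<lambda>t. c) (\<lambda>t. 0)"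
  unfolding primitive_def by (auto simp: set_integrable_def set_lebesgue_integral_def)

lemma primitive_sum:
  assumes "\<And>i. i \<in> I \<Longrightarrow> primitive (F i) (f i)"
  shows "primitive (\<lambda>t. \<Sum>i\<in>I. F i t) (\<lambda>t. \<Sum>i\<in>I. f i t)"
  using assms
  by (induction I rule: infinite_finite_induct) (auto intro: primitive_const primitive_add)

lemma primitive_norm_le:
  assumes "primitive F f" "primitive P p" "a \<le> b"
    and "\<And>s. s \<in> {a..b} \<Longrightarrow> norm (f s) \<le> p s"
  shows "norm (F b - F a) \<le> P b - (P a :: real)"
proof -
  note f = primitiveD[OF assms(1,3)] and p = primitiveD[OF assms(2,3)]
  have "norm (F b - F a) \<le> (LINT s|lborel. indicator {a..b} s *\<^sub>R p s)"
    unfolding f(2) set_lebesgue_integral_def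
    by (rule Bochner_Integration.integral_norm_bound_integral)
       (use f(1) p(1) assms(4) in \<open>auto simp: set_integrable_def indicator_def\<close>)
  then show ?thesis
    unfolding p(2) set_lebesgue_integral_def .
qed

text \<open>Dominated convergence: as the end point tends to x, the indicators converge at every s
  except s = x, a null set, and the norm of f on the window of radius 1 around x dominates.\<close>

lemma primitive_continuous:
  assumes "primitive F f"
  shows "continuous_on UNIV F"
proof (intro continuous_at_imp_continuous_on ballI)
  fix x :: real
  let ?a = "x - 1" and ?b = "x + 1"
  have int: "integrable lborel (\<lambda>s. indicator {?a..?b} s *\<^sub>R f s)"
    using primitiveD(1)[OF assms, of ?a ?b] by (simp add: set_integrable_def)
  then have [measurable]: "(\<lambda>s. indicator {?a..?b} s *\<^sub>R f s) \<in> borel_measurable borel"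
    by (simp add: borel_measurable_integrable)
  \<comment> \<open>The inner indicator fixes one integrable function for the whole window, so that
    only the outer indicator depends on t.\<close>
  define H where "H t = (LINT s|lborel. indicator {?a..t} s *\<^sub>R (indicator {?a..?b} s *\<^sub>R f s))" for t
  have H: "F t = F ?a + H t" if "t \<in> {?a..?b}" for t
  proof -
    have "F t - F ?a = (LINT s|lborel. indicator {?a..t} s *\<^sub>R f s)"
      using primitiveD(2)[OF assms, of ?a t] that by (simp add: set_lebesgue_integral_def)
    also have "\<dots> = H t"
      unfolding H_def using that by (intro Bochner_Integration.integral_cong) (auto simp: indicator_def)
    finally show ?thesis by (simp only: diff_eq_eq add.commute)
  qed
  have "isCont H x"
    unfolding continuous_at_sequentially o_def
  proof (intro allI impI)
    fix X :: "nat \<Rightarrow> real" assume X: "X \<longlonglongrightarrow> x"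
    show "(\<lambda>n. H (X n)) \<longlonglongrightarrow> H x"
      unfolding H_def
    proof (rule integral_dominated_convergence)
      show "integrable lborel (\<lambda>s. norm (indicator {?a..?b} s *\<^sub>R f s))" by (rule integrable_norm[OF int])
      have "AE s in lborel. s \<noteq> x" by (rule AE_lborel_singleton)
      then show "AE s in lborel. (\<lambda>n. indicator {?a..X n} s *\<^sub>R (indicator {?a..?b} s *\<^sub>R f s))
          \<longlonglongrightarrow> indicator {?a..x} s *\<^sub>R (indicator {?a..?b} s *\<^sub>R f s)"
      proof eventually_elim
        case (elim s)
        have "\<forall>\<^sub>F n in sequentially. indicator {?a..X n} s = (indicator {?a..x} s :: real)"
        proof (cases "s < x")
          case True
          from order_tendstoD(1)[OF X this] show ?thesis
            by eventually_elim (use True in \<open>auto simp: indicator_def\<close>)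
        next
          case False
          then have "x < s" using elim by simp
          from order_tendstoD(2)[OF X this] show ?thesis
            by eventually_elim (use \<open>x < s\<close> in \<open>auto simp: indicator_def\<close>)
        qed
        then show ?case
          by (intro tendsto_eventually) (auto elim: eventually_mono)
      qed
      fix n
      show "AE s in lborel. norm (indicator {?a..X n} s *\<^sub>R (indicator {?a..?b} s *\<^sub>R f s))
          \<le> norm (indicator {?a..?b} s *\<^sub>R f s)"
        by (rule AE_I2) (simp add: indicator_def)
    qed measurable
  qed
  then have "isCont (\<lambda>t. F ?a + H t) x" by (intro continuous_intros)
  moreover have "\<forall>\<^sub>F t in nhds x. F ?a + H t = F t"
    using eventually_nhds_in_open[of "{?a<..<?b}" x] by (auto elim!: eventually_mono intro!: H[symmetric])
  ultimately show "isCont F x" by (subst isCont_cong[symmetric]) 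
qed

lemma primitive_exists:
  fixes f :: "real \<Rightarrow> 'a::{banach,second_countable_topology}"
  assumes "\<And>a b. set_integrable lborel {a..b} f"
  obtains F where "primitive F f" "F 0 = c"
proof
  define F where "F t = c + (LBINT s=0..t. f s)" for t :: real
  have i: "interval_lebesgue_integrable lborel (ereal a) (ereal b) f" for a b
  proof -
    have "set_integrable lborel {u<..<v} f" for u v
      by (rule set_integrable_subset[OF assms[of u v]]) auto
    then show ?thesis by (simp add: interval_lebesgue_integrable_def)
  qed
  show "F 0 = c" by (simp add: F_def flip: zero_ereal_def)
  show "primitive F f"
    unfolding primitive_def
  proof (intro allI impI conjI assms)
    fix a b :: real assume ab: "a \<le> b"
    have "(LBINT s=0..a. f s) + (LBINT s=a..b. f s) = (LBINT s=0..b. f s)"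
      using interval_integral_sum[of "ereal 0" "ereal a" "ereal b" f] i
      by (simp add: min_def max_def zero_ereal_def)
    then have "F b - F a = (LBINT s=a..b. f s)" by (simp add: F_def algebra_simps)
    then show "F b - F a = (LINT s:{a..b}|lborel. f s)"
      using ab by (simp add: interval_integral_Icc)
  qed
qed

text \<open>An increment that is superadditively small vanishes: split the interval into \<open>n\<close> pieces and
  let \<open>n\<close> tend to infinity.\<close>

lemma increment_zero:
  fixes D :: "real \<Rightarrow> 'a::real_normed_vector" and m :: "real \<Rightarrow> real"
  assumes le: "\<And>a b. \<alpha> \<le> a \<Longrightarrow> a \<le> b \<Longrightarrow> b \<le> \<beta> \<Longrightarrow> norm (D b - D a) \<le> (b - a) * (m b - m a)"
    and ab: "\<alpha> \<le> \<beta>"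
  shows "D \<beta> = D \<alpha>"
proof -
  have "norm (D \<beta> - D \<alpha>) \<le> ((\<beta> - \<alpha>) * (m \<beta> - m \<alpha>)) / real (Suc k)" for k
  proof -
    define n where "n = Suc k"
    define t where "t i = \<alpha> + real i * ((\<beta> - \<alpha>) / n)" for i
    have n: "n > 0" by (simp add: n_def)
    have t0: "t 0 = \<alpha>" and tn: "t n = \<beta>" using n by (auto simp: t_def)
    have step: "t (Suc i) - t i = (\<beta> - \<alpha>) / n" for i
      using n by (simp add: t_def field_simps)
    have mono: "t i \<le> t j" if "i \<le> j" for i j
      using that ab n by (auto simp: t_def intro!: mult_right_mono divide_right_mono)
    have "D \<beta> - D \<alpha> = (\<Sum>i<n. D (t (Suc i)) - D (t i))"
      using sum_lessThan_telescope[of "\<lambda>i. D (t i)" n] by (simp add: t0 tn)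
    also have "norm \<dots> \<le> (\<Sum>i<n. norm (D (t (Suc i)) - D (t i)))" by (rule norm_sum)
    also have "\<dots> \<le> (\<Sum>i<n. (\<beta> - \<alpha>) / n * (m (t (Suc i)) - m (t i)))"
    proof (rule sum_mono)
      fix i assume "i \<in> {..<n}"
      then show "norm (D (t (Suc i)) - D (t i)) \<le> (\<beta> - \<alpha>) / n * (m (t (Suc i)) - m (t i))"
        using le[of "t i" "t (Suc i)"] mono[of 0 i] mono[of i "Suc i"] mono[of "Suc i" n]
        by (auto simp: t0 tn step)
    qed
    also have "\<dots> = (\<beta> - \<alpha>) / n * (m \<beta> - m \<alpha>)"
      using sum_lessThan_telescope[of "\<lambda>i. m (t i)" n]
      by (simp only: t0 tn sum_distrib_left[symmetric])
    finally show ?thesis by (simp add: n_def)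
  qed
  moreover have "(\<lambda>k. ((\<beta> - \<alpha>) * (m \<beta> - m \<alpha>)) / real (Suc k)) \<longlonglongrightarrow> 0"
    by (rule LIMSEQ_Suc) (rule lim_const_over_n)
  ultimately have "norm (D \<beta> - D \<alpha>) \<le> 0"
    by (intro LIMSEQ_le_const[of _ 0]) auto
  then show ?thesis by simp
qed

lemma continuous_bounded_Icc:
  fixes h :: "real \<Rightarrow> 'a::real_normed_vector"
  assumes "continuous_on UNIV h"
  obtains B where "0 < B" "\<And>t. t \<in> {a..b} \<Longrightarrow> norm (h t) \<le> B"
proof -
  have "continuous_on {a..b} h" using assms continuous_on_subset by blast
  then have "bounded (h ` {a..b})"
    by (intro compact_imp_bounded compact_continuous_image) auto
  then show ?thesis using that unfolding bounded_pos by blast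
qed

text \<open>Product rule for an absolutely continuous F and a continuously differentiable g. The
  product is compared with a primitive Q of the expected derivative: increments of the difference
  are at most the length of the interval times the increment of an integral of the norm of f, so
  \<open>increment_zero\<close> applies.\<close>

lemma primitive_mult:
  fixes F f g g' :: "real \<Rightarrow> complex"
  assumes F: "primitive F f" and g: "\<And>t. (g has_vector_derivative g' t) (at t)" "continuous_on UNIV g'"
  shows "primitive (\<lambda>t. g t * F t) (\<lambda>t. g' t * F t + g t * f t)"
  unfolding primitive_def
proof (intro allI impI)
  fix \<alpha> \<beta> :: real assume \<alpha>\<beta>: "\<alpha> \<le> \<beta>"
  let ?q = "\<lambda>t. g' t * F t + g t * f t"
  have cg: "continuous_on UNIV g"
    by (intro continuous_at_imp_continuous_on ballI has_vector_derivative_continuous[OF g(1)])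
  have cF: "continuous_on UNIV F" by (rule primitive_continuous[OF F])
  have sub: "continuous_on A h" if "continuous_on UNIV h" for A and h :: "real \<Rightarrow> complex"
    by (rule continuous_on_subset[OF that]) simp
  have int1: "set_integrable lborel {a..b} (\<lambda>t. g' t * F t)" for a b
    by (rule set_integrable_continuous, rule sub) (intro continuous_intros g cF)
  have int2: "set_integrable lborel {a..b} (\<lambda>t. h t * f t)" if h: "continuous_on UNIV h" for a b h
  proof (cases "a \<le> b")
    case True
    note f = primitiveD(1)[OF F True]
    obtain B where B: "\<And>t. t \<in> {a..b} \<Longrightarrow> norm (h t) \<le> B"
      using continuous_bounded_Icc[OF h] by blast
    have [measurable]: "h \<in> borel_measurable borel" using h by (rule borel_measurable_continuous_onI)
    have [measurable]: "(\<lambda>x. indicator {a..b} x *\<^sub>R f x) \<in> borel_measurable borel"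
      using f by (simp add: set_integrable_def borel_measurable_integrable)
    show ?thesis
      unfolding set_integrable_def
    proof (rule Bochner_Integration.integrable_bound)
      show "integrable lborel (\<lambda>x. B * norm (indicator {a..b} x *\<^sub>R f x))"
        by (rule integrable_mult_right[OF integrable_norm[OF f[unfolded set_integrable_def]]])
      have "(\<lambda>x. h x * (indicator {a..b} x *\<^sub>R f x)) \<in> borel_measurable borel" by measurable
      then show "(\<lambda>x. indicator {a..b} x *\<^sub>R (h x * f x)) \<in> borel_measurable lborel" by simp
      show "AE x in lborel. norm (indicator {a..b} x *\<^sub>R (h x * f x)) \<le> norm (B * norm (indicator {a..b} x *\<^sub>R f x))"
      proof (rule AE_I2)
        fix x show "norm (indicator {a..b} x *\<^sub>R (h x * f x)) \<le> norm (B * norm (indicator {a..b} x *\<^sub>R f x))"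
        proof (cases "x \<in> {a..b}")
          case True
          then have "norm (h x * f x) \<le> B * norm (f x)"
            using B[OF True] by (auto simp: norm_mult intro: mult_right_mono)
          also have "\<dots> \<le> \<bar>B * norm (f x)\<bar>" by simp
          finally show ?thesis using True by (simp add: norm_mult)
        qed auto
      qed
    qed
  qed (simp add: set_integrable_def)
  have intq: "set_integrable lborel {a..b} ?q" for a b
    using set_integral_add(1)[OF int1 int2[OF cg]] by simp
  obtain Q where Q: "primitive Q ?q"
    using primitive_exists[of ?q, OF intq] by blast
  have "set_integrable lborel {a..b} (\<lambda>t. norm (f t))" for a b
  proof (cases "a \<le> b")
    case True then show ?thesis using primitiveD(1)[OF F True] set_integrable_norm by blast
  qed (simp add: set_integrable_def)
  then obtain m0 where m0: "primitive m0 (\<lambda>t. norm (f t))"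
    using primitive_exists[of "\<lambda>t. norm (f t)"] by blast
  obtain L where L0: "0 < L" and L: "\<And>t. t \<in> {\<alpha>..\<beta>} \<Longrightarrow> norm (g' t) \<le> L"
    using continuous_bounded_Icc[OF g(2)] by blast
  define D where "D t = g t * F t - Q t" for t
  have "D \<beta> = D \<alpha>"
  proof (rule increment_zero[of \<alpha> \<beta> D "\<lambda>t. 2 * L * m0 t"])
    fix a b assume ab: "\<alpha> \<le> a" "a \<le> b" "b \<le> \<beta>"
    have Fm: "norm (F t - F s) \<le> m0 t - m0 s" if "s \<le> t" for s t
      by (rule primitive_norm_le[OF F m0 that]) simp
    have m0m: "m0 s \<le> m0 t" if "s \<le> t" for s t
      using Fm[OF that] norm_ge_zero[of "F t - F s"] by linarith
    have gL: "norm (g t - g s) \<le> L * (t - s)" if "s \<le> t" "\<alpha> \<le> s" "t \<le> \<beta>" for s t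
    proof -
      have "primitive (\<lambda>t. L * t) (\<lambda>t. L)"
        by (rule primitive_of_deriv) (auto intro!: derivative_eq_intros simp flip: has_real_derivative_iff_has_vector_derivative)
      from primitive_norm_le[OF primitive_of_deriv[OF g] this that(1)] L that
      show ?thesis by (auto simp: algebra_simps)
    qed
    have P1: "primitive (\<lambda>t. (g t - g a) * F b + g a * (F t - F a)) (\<lambda>t. g' t * F b + g a * f t)"
    proof (rule primitive_add)
      show "primitive (\<lambda>t. (g t - g a) * F b) (\<lambda>t. g' t * F b)"
        using primitive_linear[OF bounded_linear_mult_left primitive_diff[OF primitive_of_deriv[OF g] primitive_const]]
        by simp
      show "primitive (\<lambda>t. g a * (F t - F a)) (\<lambda>t. g a * f t)"
        using primitive_linear[OF bounded_linear_mult_right primitive_diff[OF F primitive_const]] by simp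
    qed
    have P2: "primitive (\<lambda>t. L * (m0 b - m0 a) * t + L * (b - a) * m0 t)
        (\<lambda>t. L * (m0 b - m0 a) + L * (b - a) * norm (f t))"
    proof (rule primitive_add)
      show "primitive (\<lambda>t. L * (m0 b - m0 a) * t) (\<lambda>t. L * (m0 b - m0 a))"
        by (rule primitive_of_deriv) (auto intro!: derivative_eq_intros simp flip: has_real_derivative_iff_has_vector_derivative)
      show "primitive (\<lambda>t. L * (b - a) * m0 t) (\<lambda>t. L * (b - a) * norm (f t))"
        by (rule primitive_linear[OF bounded_linear_mult_right m0])
    qed
    \<comment> \<open>The increment of the product is written with F frozen at b and g frozen at a,
      so that the integrand of the difference contains only \<open>F b - F s\<close> and
      \<open>g s - g a\<close>, both small.\<close>
    have "D b - D a = (\<lambda>t. (g t - g a) * F b + g a * (F t - F a) - Q t) b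
        - (\<lambda>t. (g t - g a) * F b + g a * (F t - F a) - Q t) a"
      by (simp add: D_def algebra_simps)
    also have "norm \<dots> \<le> (\<lambda>t. L * (m0 b - m0 a) * t + L * (b - a) * m0 t) b
        - (\<lambda>t. L * (m0 b - m0 a) * t + L * (b - a) * m0 t) a"
    proof (rule primitive_norm_le[OF primitive_diff[OF P1 Q] P2 ab(2)])
      fix s assume s: "s \<in> {a..b}"
      have "g' s * F b + g a * f s - ?q s = g' s * (F b - F s) - (g s - g a) * f s"
        by (simp add: algebra_simps)
      also have "norm \<dots> \<le> norm (g' s) * norm (F b - F s) + norm (g s - g a) * norm (f s)"
        by (metis norm_mult norm_triangle_ineq4)
      also have "\<dots> \<le> L * (m0 b - m0 a) + L * (b - a) * norm (f s)"
      proof (intro add_mono mult_mono)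
        show "norm (F b - F s) \<le> m0 b - m0 a"
          using Fm[of s b] m0m[of a s] s by auto
        have "norm (g s - g a) \<le> L * (s - a)" using s ab by (intro gL) auto
        also have "\<dots> \<le> L * (b - a)" using s L0 by (intro mult_left_mono) auto
        finally show "norm (g s - g a) \<le> L * (b - a)" .
      qed (use L L0 s ab in auto)
      finally show "norm (g' s * F b + g a * f s - ?q s) \<le> L * (m0 b - m0 a) + L * (b - a) * norm (f s)" .
    qed
    also have "\<dots> = (b - a) * (2 * L * m0 b - 2 * L * m0 a)" by (simp add: algebra_simps)
    finally show "norm (D b - D a) \<le> (b - a) * (2 * L * m0 b - 2 * L * m0 a)" .
  qed (rule \<alpha>\<beta>)
  then have "g \<beta> * F \<beta> - g \<alpha> * F \<alpha> = Q \<beta> - Q \<alpha>" by (simp add: D_def algebra_simps)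
  then show "set_integrable lborel {\<alpha>..\<beta>} ?q \<and> g \<beta> * F \<beta> - g \<alpha> * F \<alpha> = (LINT s:{\<alpha>..\<beta>}|lborel. ?q s)"
    using primitiveD[OF Q \<alpha>\<beta>] by simp
qed

text \<open>Dominated convergence on each interval. It carries equations for finitely many Fourier
  modes, or for partial sums of the Picard series, over to the limit.\<close>

lemma primitive_limit:
  assumes prim: "\<And>n. primitive (F n) (f n)"
    and F: "\<And>t. (\<lambda>n. F n t) \<longlonglongrightarrow> G t" and f: "\<And>t. (\<lambda>n. f n t) \<longlonglongrightarrow> g t"
    and dom: "\<And>a b. \<exists>h. set_integrable lborel {a..b} h \<and> (\<forall>n. \<forall>t\<in>{a..b}. norm (f n t) \<le> h t)"
  shows "primitive G g"
  unfolding primitive_def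
proof (intro allI impI)
  fix a b :: real assume ab: "a \<le> b"
  obtain h where h: "set_integrable lborel {a..b} h" "\<And>n t. t \<in> {a..b} \<Longrightarrow> norm (f n t) \<le> h t"
    using dom[of a b] by blast
  note p = primitiveD[OF prim ab]
  have fm: "(\<lambda>t. indicator {a..b} t *\<^sub>R f n t) \<in> borel_measurable lborel" for n
    using p(1) by (simp add: set_integrable_def borel_measurable_integrable)
  have lim: "(\<lambda>n. indicator {a..b} t *\<^sub>R f n t) \<longlonglongrightarrow> indicator {a..b} t *\<^sub>R g t" for t
    by (intro tendsto_intros f)
  have gm: "(\<lambda>t. indicator {a..b} t *\<^sub>R g t) \<in> borel_measurable lborel"
    by (rule borel_measurable_LIMSEQ_metric[OF fm lim])
  note dc = gm fm h(1)[unfolded set_integrable_def] AE_I2[OF lim]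
  have bd: "AE t in lborel. norm (indicator {a..b} t *\<^sub>R f n t) \<le> indicator {a..b} t *\<^sub>R h t" for n
    using h(2) by (auto simp: indicator_def)
  have "(\<lambda>n. LINT t:{a..b}|lborel. f n t) \<longlonglongrightarrow> (LINT t:{a..b}|lborel. g t)"
    unfolding set_lebesgue_integral_def by (rule integral_dominated_convergence[OF dc bd])
  moreover have "(\<lambda>n. F n b - F n a) \<longlonglongrightarrow> G b - G a" by (intro tendsto_intros F)
  ultimately have "G b - G a = (LINT t:{a..b}|lborel. g t)"
    unfolding p(2) using LIMSEQ_unique by blast
  moreover have "set_integrable lborel {a..b} g"
    unfolding set_integrable_def by (rule integrable_dominated_convergence[OF dc bd])
  ultimately show "set_integrable lborel {a..b} g \<and> G b - G a = (LINT t:{a..b}|lborel. g t)" by simp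
qed

lemma primitive_power:
  "primitive (\<lambda>t. K * t ^ Suc j / real (Suc j)) (\<lambda>t. K * t ^ j)"
  "primitive (\<lambda>t. - (K * (- t) ^ Suc j / real (Suc j))) (\<lambda>t. K * (- t) ^ j)"
proof -
  have "((\<lambda>t. K * t ^ Suc j / real (Suc j)) has_real_derivative K * x ^ j) (at x)" for x
    by (rule derivative_eq_intros refl | simp)+
  then show "primitive (\<lambda>t. K * t ^ Suc j / real (Suc j)) (\<lambda>t. K * t ^ j)"
    by (intro primitive_of_deriv continuous_intros)
       (simp add: has_real_derivative_iff_has_vector_derivative)
  have "((\<lambda>t. - (K * (- t) ^ Suc j / real (Suc j))) has_real_derivative K * (- x) ^ j) (at x)" for x
    by (rule derivative_eq_intros refl | simp)+
  then show "primitive (\<lambda>t. - (K * (- t) ^ Suc j / real (Suc j))) (\<lambda>t. K * (- t) ^ j)"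
    by (intro primitive_of_deriv continuous_intros)
       (simp add: has_real_derivative_iff_has_vector_derivative)
qed

text \<open>One step of Picard iteration: each integration contributes a factor to the factorial in
  the denominator. Negative times are covered by the antiderivative of the powers of - t.\<close>

lemma primitive_power_bound:
  assumes F: "primitive F f" "F 0 = 0"
    and f: "\<And>s. \<bar>s\<bar> \<le> T \<Longrightarrow> norm (f s) \<le> K * \<bar>s\<bar> ^ j"
    and t: "\<bar>t\<bar> \<le> T"
  shows "norm (F t) \<le> K * \<bar>t\<bar> ^ Suc j / real (Suc j)"
proof (cases "0 \<le> t")
  case True
  have "norm (F t - F 0) \<le> K * t ^ Suc j / real (Suc j) - K * 0 ^ Suc j / real (Suc j)"
  proof (rule primitive_norm_le[OF F(1) primitive_power(1) True])
    fix s assume "s \<in> {0..t}"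
    then show "norm (f s) \<le> K * s ^ j" using f[of s] t by simp
  qed
  then show ?thesis using True F(2) by simp
next
  case False
  have "norm (F 0 - F t) \<le> - (K * (- 0) ^ Suc j / real (Suc j)) - (- (K * (- t) ^ Suc j / real (Suc j)))"
  proof (rule primitive_norm_le[OF F(1) primitive_power(2)])
    fix s assume "s \<in> {t..0}"
    then show "norm (f s) \<le> K * (- s) ^ j" using f[of s] t False by (auto simp: abs_of_nonpos)
  qed (use False in simp)
  then show ?thesis using False F(2) by (simp add: abs_if)
qed

text \<open>The zero set of y is closed. It is open because on an interval of radius \<delta> around
  a zero the maximum of the norm is at most half of itself. Connectedness of the line then gives
  both time directions at once.\<close>

lemma gronwall_zero:
  fixes y :: "real \<Rightarrow> 'a::real_normed_vector"
  assumes y: "continuous_on UNIV y" and M: "0 \<le> M"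
    and le: "\<And>a b. a \<le> b \<Longrightarrow> norm (y b - y a) \<le> M * (LINT s:{a..b}|lborel. norm (y s))"
    and y0: "y 0 = 0"
  shows "y t = 0"
proof -
  define Z where "Z = {t. y t = 0}"
  \<comment> \<open>Chosen such that \<open>M * \<delta> \<le> 1 / 2\<close>; adding 1 keeps the
    denominator positive for M = 0.\<close>
  define \<delta> where "\<delta> = 1 / (2 * (M + 1))"
  have \<delta>: "\<delta> > 0" using M by (simp add: \<delta>_def)
  have M\<delta>: "M * \<delta> \<le> 1 / 2" using M by (simp add: \<delta>_def field_simps)
  have "closed Z"
    unfolding Z_def using closed_Collect_eq[OF y continuous_on_const] .
  moreover have "open Z"
    unfolding open_dist
  proof (intro ballI exI conjI allI impI)
    fix t0 assume t0: "t0 \<in> Z"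
    show "0 < \<delta>" by fact
    let ?I = "{t0 - \<delta>..t0 + \<delta>}"
    have cn: "continuous_on A (\<lambda>t. norm (y t))" for A
      using continuous_on_norm[OF y] continuous_on_subset by blast
    have "\<exists>t1\<in>?I. \<forall>s\<in>?I. norm (y s) \<le> norm (y t1)"
      by (rule continuous_attains_sup[OF _ _ cn]) (use \<delta> in auto)
    then obtain t1 where t1: "t1 \<in> ?I" and max: "\<And>s. s \<in> ?I \<Longrightarrow> norm (y s) \<le> norm (y t1)" by blast
    have bound: "norm (y b - y a) \<le> M * ((b - a) * norm (y t1))" if "a \<le> b" "a \<in> ?I" "b \<in> ?I" for a b
    proof -
      have "(LINT s:{a..b}|lborel. norm (y s)) \<le> (LINT s:{a..b}|lborel. norm (y t1))"
        using that max
        by (intro set_integral_mono set_integrable_continuous cn continuous_on_const) auto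
      also have "\<dots> = (b - a) * norm (y t1)" using that(1) by (simp add: set_lebesgue_integral_def)
      finally show ?thesis using le[OF that(1)] mult_left_mono[OF _ M] order_trans by blast
    qed
    have "norm (y t1) \<le> M * (\<delta> * norm (y t1))"
    proof (cases "t0 \<le> t1")
      case True
      have "norm (y t1 - y t0) \<le> M * ((t1 - t0) * norm (y t1))" using True t1 \<delta> by (intro bound) auto
      also have "\<dots> \<le> M * (\<delta> * norm (y t1))"
        using t1 by (intro mult_left_mono mult_right_mono M) auto
      finally show ?thesis using t0 by (simp add: Z_def)
    next
      case False
      have "norm (y t0 - y t1) \<le> M * ((t0 - t1) * norm (y t1))" using False t1 \<delta> by (intro bound) auto
      also have "\<dots> \<le> M * (\<delta> * norm (y t1))"
        using t1 by (intro mult_left_mono mult_right_mono M) auto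
      finally show ?thesis using t0 by (simp add: Z_def)
    qed
    also have "\<dots> \<le> 1 / 2 * norm (y t1)"
      using mult_right_mono[OF M\<delta> norm_ge_zero, of "y t1"] by (simp add: mult.assoc)
    finally have "norm (y t1) = 0" by simp
    then show "s \<in> Z" if "dist s t0 < \<delta>" for s
      using max[of s] that by (auto simp: Z_def dist_real_def abs_less_iff)
  qed
  moreover have "0 \<in> Z" using y0 by (simp add: Z_def)
  ultimately have "Z = UNIV"
    using connected_clopen[of "UNIV :: real set"] by (auto simp: connected_UNIV)
  then show ?thesis by (auto simp: Z_def)
qed

text \<open>The solution is the Picard series: E 0 = g, and each further term is the integral from 0
  of G applied to the previous one. The bound C (M |t|)^j / j! makes the series converge uniformly
  on every bounded interval, so the solution is global in both time directions.\<close>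

lemma volterra_solution:
  fixes G :: "real \<Rightarrow> 'a \<Rightarrow> 'a::{banach,second_countable_topology}"
  assumes lin: "\<And>s. linear (G s)" and M: "\<And>s x. norm (G s x) \<le> M * norm x" "0 \<le> M"
    and cont: "\<And>y. continuous_on UNIV y \<Longrightarrow> continuous_on UNIV (\<lambda>s. G s (y s))"
    and g: "continuous_on UNIV g"
  obtains y where "continuous_on UNIV y" "y 0 = g 0" "primitive (\<lambda>t. y t - g t) (\<lambda>t. G t (y t))"
proof -
  have bl: "bounded_linear (G s)" for s
    using lin[of s] M(1)[of s] by (intro bounded_linear_intro[of _ M])
      (auto simp: linear_add linear_scale mult.commute)
  have li: "set_integrable lborel {a..b} h" if "continuous_on UNIV h" for h :: "real \<Rightarrow> 'a" and a b
    by (rule set_integrable_continuous, rule continuous_on_subset[OF that]) simp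
  \<comment> \<open>The integral of h from 0. The choice is determined for continuous h, and it is
    applied only to such functions.\<close>
  define I where "I h = (SOME F. primitive F h \<and> F 0 = 0)" for h :: "real \<Rightarrow> 'a"
  have I: "primitive (I h) h" "I h 0 = 0" if hc: "continuous_on UNIV h" for h
  proof -
    obtain F where "primitive F h \<and> F 0 = 0"
      using primitive_exists[where f = h and c = 0, OF li[OF hc]] by blast
    from someI[of "\<lambda>F. primitive F h \<and> F 0 = 0", OF this]
    show "primitive (I h) h" "I h 0 = 0" by (auto simp: I_def)
  qed
  define E where "E = rec_nat g (\<lambda>_ e. I (\<lambda>s. G s (e s)))"
  have E0: "E 0 = g" and ES: "E (Suc j) = I (\<lambda>s. G s (E j s))" for j by (auto simp: E_def)
  have cE: "continuous_on UNIV (E j)" for j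
    by (induction j) (auto simp: E0 ES g intro!: primitive_continuous[OF I(1)] cont)
  have ep: "primitive (E (Suc j)) (\<lambda>s. G s (E j s))" and e0: "E (Suc j) 0 = 0" for j
    using I[OF cont[OF cE]] by (auto simp: ES)
  have bnd: "\<exists>C>0. \<forall>j t. \<bar>t\<bar> \<le> T \<longrightarrow> norm (E j t) \<le> C * (M ^ j / fact j) * \<bar>t\<bar> ^ j" for T
  proof -
    obtain C where C: "0 < C" "\<And>t. t \<in> {-T..T} \<Longrightarrow> norm (g t) \<le> C"
      using continuous_bounded_Icc[OF g] by blast
    have "\<bar>t\<bar> \<le> T \<Longrightarrow> norm (E j t) \<le> C * (M ^ j / fact j) * \<bar>t\<bar> ^ j" for j t
    proof (induction j arbitrary: t)
      case 0 then show ?case using C(2)[of t] by (auto simp: E0 abs_le_iff)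
    next
      case (Suc j)
      have "norm (E (Suc j) t) \<le> (M * (C * (M ^ j / fact j))) * \<bar>t\<bar> ^ Suc j / real (Suc j)"
      proof (rule primitive_power_bound[OF ep e0 _ Suc.prems])
        fix s assume "\<bar>s\<bar> \<le> T"
        from mult_left_mono[OF Suc.IH[OF this] M(2)] M(1)[of s "E j s"]
        show "norm (G s (E j s)) \<le> M * (C * (M ^ j / fact j)) * \<bar>s\<bar> ^ j" by (simp add: mult.assoc)
      qed
      also have "\<dots> = C * (M ^ Suc j / fact (Suc j)) * \<bar>t\<bar> ^ Suc j"
        by (simp add: field_simps)
      finally show ?case .
    qed
    then show ?thesis using C(1) by blast
  qed
  have bnd2: "\<exists>B. summable B \<and> (\<forall>j t. \<bar>t\<bar> \<le> T \<longrightarrow> norm (E j t) \<le> B j)" for T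
  proof -
    obtain C where C: "C > 0" "\<And>j t. \<bar>t\<bar> \<le> T \<Longrightarrow> norm (E j t) \<le> C * (M ^ j / fact j) * \<bar>t\<bar> ^ j"
      using bnd by blast
    have "summable (\<lambda>j. C * (inverse (fact j) * (M * \<bar>T\<bar>) ^ j))"
      by (intro summable_mult summable_exp)
    moreover have "norm (E j t) \<le> C * (inverse (fact j) * (M * \<bar>T\<bar>) ^ j)" if "\<bar>t\<bar> \<le> T" for j t
    proof -
      have "norm (E j t) \<le> C * (M ^ j / fact j) * \<bar>T\<bar> ^ j"
        by (rule order_trans[OF C(2)[OF that]], intro mult_left_mono power_mono mult_nonneg_nonneg)
           (use that C(1) M(2) in simp_all)
      then show ?thesis by (simp add: field_simps)
    qed
    ultimately show ?thesis by blast
  qed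
  define y where "y t = (\<Sum>j. E j t)" for t
  have sums: "(\<lambda>j. E j t) sums y t" and nsum: "summable (\<lambda>j. norm (E j t))" for t
  proof -
    obtain B where B: "summable B" "\<And>j. norm (E j t) \<le> B j" using bnd2[of "\<bar>t\<bar>"] by blast
    show "summable (\<lambda>j. norm (E j t))"
      by (rule summable_comparison_test'[OF B(1), of 0]) (simp add: B(2))
    then show "(\<lambda>j. E j t) sums y t"
      unfolding y_def by (rule summable_sums[OF summable_norm_cancel])
  qed
  have cy: "continuous_on UNIV y"
  proof (intro continuous_at_imp_continuous_on ballI)
    fix x :: real
    let ?T = "\<bar>x\<bar> + 1"
    obtain B where B: "summable B" "\<And>j t. \<bar>t\<bar> \<le> ?T \<Longrightarrow> norm (E j t) \<le> B j" using bnd2[of ?T] by blast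
    have "uniform_limit {-?T<..<?T} (\<lambda>n t. \<Sum>j<n. E j t) y sequentially"
      unfolding y_def by (rule Weierstrass_m_test) (auto intro!: B)
    then have "continuous_on {-?T<..<?T} y"
    proof (rule uniform_limit_theorem[rotated])
      show "\<forall>\<^sub>F n in sequentially. continuous_on {-?T<..<?T} (\<lambda>t. \<Sum>j<n. E j t)"
        by (intro always_eventually allI continuous_on_sum continuous_on_subset[OF cE]) auto
    qed auto
    then show "isCont y x"
      by (rule continuous_on_interior) auto
  qed
  have "primitive (\<lambda>t. y t - g t) (\<lambda>t. G t (y t))"
  proof (rule primitive_limit)
    \<comment> \<open>The primitives lag by one: their sum starts at E 1, so its limit is y -
      g.\<close>
    show "primitive (\<lambda>t. \<Sum>j<n. E (Suc j) t) (\<lambda>t. \<Sum>j<n. G t (E j t))" for n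
      by (rule primitive_sum) (rule ep)
    show "(\<lambda>n. \<Sum>j<n. E (Suc j) t) \<longlonglongrightarrow> y t - g t" for t
      using sums_Suc_iff[of "\<lambda>j. E j t"] sums[of t] by (simp add: sums_def E0)
    show "(\<lambda>n. \<Sum>j<n. G t (E j t)) \<longlonglongrightarrow> G t (y t)" for t
      using bounded_linear.sums[OF bl sums[of t]] by (simp add: sums_def)
    fix a b :: real
    obtain B where B: "summable B" "\<And>j t. \<bar>t\<bar> \<le> max \<bar>a\<bar> \<bar>b\<bar> \<Longrightarrow> norm (E j t) \<le> B j"
      using bnd2[of "max \<bar>a\<bar> \<bar>b\<bar>"] by blast
    show "\<exists>h. set_integrable lborel {a..b} h \<and> (\<forall>n. \<forall>t\<in>{a..b}. norm (\<Sum>j<n. G t (E j t)) \<le> h t)"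
    proof (intro exI conjI allI ballI)
      show "set_integrable lborel {a..b} (\<lambda>_. M * (\<Sum>j. B j))"
        by (intro set_integrable_continuous continuous_on_const)
      fix n t assume "t \<in> {a..b}"
      then have t: "\<bar>t\<bar> \<le> max \<bar>a\<bar> \<bar>b\<bar>" by auto
      have "norm (\<Sum>j<n. G t (E j t)) \<le> (\<Sum>j<n. M * B j)"
        by (rule sum_norm_le) (rule order_trans[OF M(1) mult_left_mono[OF B(2)[OF t] M(2)]])
      also have "\<dots> \<le> M * (\<Sum>j. B j)"
        using sum_le_suminf[OF B(1), of "{..<n}"] order_trans[OF norm_ge_zero B(2)[OF t]]
        by (simp add: M(2) mult_left_mono flip: sum_distrib_left)
      finally show "norm (\<Sum>j<n. G t (E j t)) \<le> M * (\<Sum>j. B j)" .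
    qed
  qed
  moreover have "y 0 = g 0"
  proof -
    have "E j 0 = 0" if "j \<notin> {0}" for j
      using that e0[of "j - 1"] by (cases j) auto
    then have "(\<lambda>j. E j 0) sums (\<Sum>j\<in>{0}. E j 0)"
      by (intro sums_finite) auto
    then show ?thesis using sums[of 0] sums_unique2 by (auto simp: E0)
  qed
  ultimately show ?thesis using that cy by blast
qed

subsection \<open>Smooth cutoff functions\<close>

text \<open>The functions x^(-k) exp (-1/x), extended by 0. Derivatives stay inside the linear span
  of the family, which reduces the smoothness of exp (-1/x) to one induction with k
  arbitrary.\<close>

definition flat :: "nat \<Rightarrow> real \<Rightarrow> real" where
  "flat k x = (if 0 < x then (1 / x) ^ k * exp (- (1 / x)) else 0)"

lemma flat_tendsto_0: "(flat k \<longlongrightarrow> 0) (at_right 0)"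
proof -
  have "((\<lambda>x::real. (1 / x) ^ k / exp (1 / x)) \<longlongrightarrow> 0) (at_right 0)"
    using filterlim_compose[OF tendsto_power_div_exp_0[of k] filterlim_inverse_at_top_right]
    by (simp add: divide_inverse)
  moreover have "\<forall>\<^sub>F x in at_right 0. (1 / x) ^ k / exp (1 / x) = flat k x"
    by (auto simp: eventually_at_filter flat_def exp_minus field_simps)
  ultimately show ?thesis by (rule Lim_transform_eventually)
qed

text \<open>Away from 0 this is the product and chain rule. At 0 the difference quotient from the
  right is \<open>flat (Suc k)\<close>, because division by h only raises the index, and this tends
  to 0.\<close>

lemma flat_has_derivative:
  "(flat k has_vector_derivative (flat (k + 2) x - real k * flat (k + 1) x)) (at x)"
proof -
  consider "x > 0" | "x < 0" | "x = 0" by linarith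
  then have "(flat k has_real_derivative (flat (k + 2) x - real k * flat (k + 1) x)) (at x)"
  proof cases
    case 1
    have "((\<lambda>x. (1 / x) ^ k) has_real_derivative - (real k * (1 / x) ^ (k + 1))) (at x)"
    proof (cases k)
      case (Suc m)
      have "((\<lambda>x. 1 / x) has_real_derivative - (1 / x)\<^sup>2) (at x)"
        using 1 by (auto intro!: derivative_eq_intros simp: power2_eq_square)
      from DERIV_power[OF this, of k] show ?thesis
        using 1 by (simp add: Suc power2_eq_square field_simps)
    qed simp
    moreover have "((\<lambda>x. exp (- (1 / x))) has_real_derivative exp (- (1 / x)) * (1 / x)\<^sup>2) (at x)"
      using 1 by (auto intro!: derivative_eq_intros simp: power2_eq_square)
    ultimately have "((\<lambda>x. (1 / x) ^ k * exp (- (1 / x))) has_real_derivative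
        - (real k * (1 / x) ^ (k + 1)) * exp (- (1 / x)) + exp (- (1 / x)) * (1 / x)\<^sup>2 * (1 / x) ^ k) (at x)"
      by (rule DERIV_mult)
    also have "- (real k * (1 / x) ^ (k + 1)) * exp (- (1 / x)) + exp (- (1 / x)) * (1 / x)\<^sup>2 * (1 / x) ^ k
        = flat (k + 2) x - real k * flat (k + 1) x"
      using 1 by (simp add: flat_def power_add power2_eq_square algebra_simps)
    finally have "((\<lambda>x. (1 / x) ^ k * exp (- (1 / x))) has_real_derivative
        (flat (k + 2) x - real k * flat (k + 1) x)) (at x)" .
    then show ?thesis
      by (rule has_field_derivative_transform_within_open[of _ _ _ "{0<..}"])
         (use 1 in \<open>auto simp: flat_def\<close>)
  next
    case 2
    have "((\<lambda>x. 0) has_real_derivative (flat (k + 2) x - real k * flat (k + 1) x)) (at x)"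
      using 2 by (simp add: flat_def)
    then show ?thesis
      by (rule has_field_derivative_transform_within_open[of _ _ _ "{..<0}"])
         (use 2 in \<open>auto simp: flat_def\<close>)
  next
    case 3
    have "((\<lambda>h. (flat k (0 + h) - flat k 0) / h) \<longlongrightarrow> 0) (at 0)"
    proof (rule filterlim_split_at)
      have "\<forall>\<^sub>F h in at_left 0. 0 = (flat k (0 + h) - flat k 0) / h"
        by (auto simp: eventually_at_filter flat_def)
      then show "((\<lambda>h. (flat k (0 + h) - flat k 0) / h) \<longlongrightarrow> 0) (at_left 0)"
        by (rule Lim_transform_eventually[rotated]) simp
      have "\<forall>\<^sub>F h in at_right 0. flat (Suc k) h = (flat k (0 + h) - flat k 0) / h"
        by (auto simp: eventually_at_filter flat_def)
      then show "((\<lambda>h. (flat k (0 + h) - flat k 0) / h) \<longlongrightarrow> 0) (at_right 0)"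
        by (rule Lim_transform_eventually[rotated]) (rule flat_tendsto_0)
    qed
    then show ?thesis using 3 by (simp add: DERIV_def flat_def)
  qed
  then show ?thesis by (simp add: has_real_derivative_iff_has_vector_derivative)
qed

lemma smooth_flat: "smooth (flat k)"
  unfolding smooth_def
proof
  fix j show "times_diff j (flat k)"
  proof (induction j arbitrary: k)
    case 0 show ?case by (rule times_diff_0I, rule flat_has_derivative)
  next
    case (Suc j)
    have "times_diff j (\<lambda>x. - real k *\<^sub>R flat (k + 1) x)"
      by (rule bounded_linear.times_diff[OF bounded_linear_scaleR_right Suc])
    from times_diff_add[OF Suc[of "k + 2"] this] show ?case
      by (intro times_diff_SucI[OF flat_has_derivative]) simp
  qed
qed

lemma continuous_antiderivative:
  fixes f :: "real \<Rightarrow> 'a::euclidean_space"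
  assumes "continuous_on UNIV f"
  obtains F where "F 0 = 0" "\<And>x. (F has_vector_derivative f x) (at x)"
proof
  define F where "F t = (LBINT s=0..t. f s)" for t :: real
  show "F 0 = 0" by (simp add: F_def flip: zero_ereal_def)
  show "(F has_vector_derivative f x) (at x)" for x
  proof -
    have "((\<lambda>t. LBINT s=ereal 0..t. f s) has_vector_derivative f x)
        (at x within {min 0 x - 1..max 0 x + 1})"
      by (rule interval_integral_FTC2) (auto intro: continuous_on_subset[OF assms])
    then show ?thesis
      by (subst (asm) at_within_interior) (auto simp: F_def[abs_def] simp flip: zero_ereal_def)
  qed
qed

text \<open>The normalised integral of a smooth bump supported in [0, 1].\<close>

lemma smooth_step:
  obtains \<theta> :: "real \<Rightarrow> real" where "smooth \<theta>"
    "\<And>x. x \<le> 0 \<Longrightarrow> \<theta> x = 0" "\<And>x. 1 \<le> x \<Longrightarrow> \<theta> x = 1" "\<And>x. 0 \<le> \<theta> x" "\<And>x. \<theta> x \<le> 1"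
proof -
  define \<rho> where "\<rho> x = flat 0 x * flat 0 (- 1 * x + 1)" for x
  have \<rho>: "smooth \<rho>"
    unfolding \<rho>_def by (intro smooth_mult smooth_flat smooth_compose_affine)
  have cont: "continuous_on UNIV \<rho>" by (rule smooth_continuous[OF \<rho>])
  have \<rho>0: "0 \<le> \<rho> x" for x by (simp add: \<rho>_def flat_def)
  obtain F where F0: "F 0 = 0" and F: "\<And>x. (F has_vector_derivative \<rho> x) (at x)"
    using continuous_antiderivative[OF cont] by blast
  have Fd: "(F has_real_derivative \<rho> x) (at x)" for x
    using F by (simp add: has_real_derivative_iff_has_vector_derivative)
  have mono: "F x \<le> F y" if "x \<le> y" for x y
    by (rule DERIV_nonneg_imp_nondecreasing[OF that]) (use Fd \<rho>0 in blast)
  have Fl: "F x = 0" if "x \<le> 0" for x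
  proof (cases "x = 0")
    case False
    have "F 0 = F x"
      by (rule DERIV_isconst_end[of x 0 F]) (use that False in \<open>auto intro!: DERIV_continuous_on[of _ _ \<rho>] 
          has_field_derivative_at_within Fd DERIV_cong[OF Fd] simp: \<rho>_def flat_def\<close>)
    then show ?thesis using F0 by simp
  qed (simp add: F0)
  have Fr: "F x = F 1" if "1 \<le> x" for x
  proof (cases "x = 1")
    case False
    show ?thesis
      by (rule DERIV_isconst_end[of 1 x F]) (use that False in \<open>auto intro!: DERIV_continuous_on[of _ _ \<rho>] 
          has_field_derivative_at_within Fd DERIV_cong[OF Fd] simp: \<rho>_def flat_def\<close>)
  qed simp
  have "F 1 > 0"
  proof -
    \<comment> \<open>The bump vanishes at 0 and 1, so strict growth is claimed on an interior
      interval only; monotonicity does the rest.\<close>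
    have "F (1/4) < F (3/4)"
      by (rule DERIV_pos_imp_increasing) (auto intro!: exI[of _ "\<rho> _"] Fd simp: \<rho>_def flat_def)
    then show ?thesis using mono[of 0 "1/4"] mono[of "3/4" 1] F0 by simp
  qed
  show ?thesis
  proof
    show "smooth (\<lambda>x. F x / F 1)"
      using bounded_linear.smooth[OF bounded_linear_divide smoothI[OF F \<rho>]] .
    show "F x / F 1 = 0" if "x \<le> 0" for x using Fl[OF that] by simp
    show "F x / F 1 = 1" if "1 \<le> x" for x using Fr[OF that] \<open>F 1 > 0\<close> by simp
    show "0 \<le> F x / F 1" for x
      using mono[of 0 x] Fl[of x] F0 \<open>F 1 > 0\<close> by (cases "0 \<le> x") auto
    show "F x / F 1 \<le> 1" for x
      using mono[of x 1] Fr[of x] \<open>F 1 > 0\<close> by (cases "x \<le> 1") auto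
  qed
qed

subsection \<open>Fourier analysis on the torus\<close>

definition cvec :: "complex \<Rightarrow> real^2" where "cvec z = vector [Re z, Im z]"

definition uncvec :: "real^2 \<Rightarrow> complex" where "uncvec v = Complex (v $ 1) (v $ 2)"

lemma cvec_nth [simp]: "cvec z $ 1 = Re z" "cvec z $ 2 = Im z"
  by (auto simp: cvec_def)

lemma uncvec_cvec [simp]: "uncvec (cvec z) = z"
  by (simp add: uncvec_def complex_eq_iff)

lemma cvec_uncvec [simp]: "cvec (uncvec v) = v"
  by (simp add: uncvec_def vec_eq_iff forall_2)

lemma inner_cvec: "cvec z \<bullet> cvec w = Re (z * cnj w)"
  by (simp add: inner_vec_def sum_2)

lemma norm_cvec [simp]: "norm (cvec z) = cmod z"
  by (simp add: norm_eq_sqrt_inner[of "cvec z"] inner_cvec cmod_def power2_eq_square)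

lemma bounded_linear_cvec: "bounded_linear cvec"
  by (rule bounded_linear_intro[of _ 1]) (auto simp: vec_eq_iff forall_2)

lemma bounded_linear_uncvec: "bounded_linear uncvec"
proof (rule bounded_linear_intro[of _ 1])
  show "norm (uncvec x) \<le> norm x * 1" for x
    using norm_cvec[of "uncvec x"] by simp
qed (auto simp: uncvec_def complex_eq_iff)

lemmas cvec_add = linear_add[OF bounded_linear.linear[OF bounded_linear_cvec]]
lemmas cvec_diff = linear_diff[OF bounded_linear.linear[OF bounded_linear_cvec]]
lemmas cvec_scaleR = linear_scale[OF bounded_linear.linear[OF bounded_linear_cvec]]
lemmas cvec_zero = linear_0[OF bounded_linear.linear[OF bounded_linear_cvec]]
lemmas continuous_on_cvec = bounded_linear.continuous_on[OF bounded_linear_cvec]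
lemmas continuous_on_uncvec = bounded_linear.continuous_on[OF bounded_linear_uncvec]

definition fclass :: "(real \<Rightarrow> complex) \<Rightarrow> L2_torus" where
  "fclass f = L2_class (\<lambda>x. cvec (f x))"

definition sqint :: "(real \<Rightarrow> complex) \<Rightarrow> bool" where
  "sqint f \<longleftrightarrow> square_integrable (\<lambda>x. cvec (f x))"

lemma fclass_cases:
  obtains f where "sqint f" "u = fclass f"
proof -
  obtain g where "square_integrable g" "u = L2_class g" by (rule L2_class_cases)
  then show ?thesis using that[of "\<lambda>x. uncvec (g x)"] by (simp add: sqint_def fclass_def)
qed

lemma sqint_measurable: "sqint f \<Longrightarrow> f \<in> borel_measurable torus"
proof -
  assume "sqint f"
  then have "(\<lambda>x. cvec (f x)) \<in> borel_measurable torus"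
    by (simp add: sqint_def square_integrable_measurable)
  from measurable_compose[OF this borel_measurable_continuous_onI[OF continuous_on_uncvec[OF continuous_on_id]]]
  show ?thesis by simp
qed

lemma sqintI_bounded:
  assumes "f \<in> borel_measurable torus" "\<And>x. cmod (f x) \<le> B"
  shows "sqint f"
  unfolding sqint_def
proof (rule square_integrable_bounded[where B = B])
  show "(\<lambda>x. cvec (f x)) \<in> borel_measurable torus"
    by (rule measurable_compose[OF assms(1) borel_measurable_continuous_onI[OF continuous_on_cvec[OF continuous_on_id]]])
qed (simp add: assms(2))

lemma sqint_add: "sqint f \<Longrightarrow> sqint g \<Longrightarrow> sqint (\<lambda>x. f x + g x)"
  unfolding sqint_def using square_integrable_add by (simp add: cvec_add)

lemma sqint_diff: "sqint f \<Longrightarrow> sqint g \<Longrightarrow> sqint (\<lambda>x. f x - g x)"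
  unfolding sqint_def using square_integrable_diff by (simp add: cvec_diff)

lemma sqint_scaleR: "sqint f \<Longrightarrow> sqint (\<lambda>x. r *\<^sub>R f x)"
  unfolding sqint_def using square_integrable_scaleR by (simp add: cvec_scaleR)

lemma fclass_add: "sqint f \<Longrightarrow> sqint g \<Longrightarrow> fclass (\<lambda>x. f x + g x) = fclass f + fclass g"
  unfolding sqint_def fclass_def by (simp add: L2_class_add cvec_add)

lemma fclass_diff: "sqint f \<Longrightarrow> sqint g \<Longrightarrow> fclass (\<lambda>x. f x - g x) = fclass f - fclass g"
  unfolding sqint_def fclass_def by (simp add: L2_class_diff cvec_diff)

lemma fclass_scaleR: "sqint f \<Longrightarrow> fclass (\<lambda>x. r *\<^sub>R f x) = r *\<^sub>R fclass f"
  unfolding sqint_def fclass_def by (simp add: L2_class_scaleR cvec_scaleR)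

lemma fclass_0: "fclass (\<lambda>x. 0) = 0"
  by (simp add: fclass_def zero_L2_torus.abs_eq cvec_zero)

lemma fclass_inner:
  "sqint f \<Longrightarrow> sqint g \<Longrightarrow> fclass f \<bullet> fclass g = (LINT x|torus. Re (f x * cnj (g x)))"
  unfolding sqint_def fclass_def by (simp add: L2_class_inner inner_cvec)

lemma norm_fclass:
  "sqint f \<Longrightarrow> (norm (fclass f))\<^sup>2 = (LINT x|torus. (cmod (f x))\<^sup>2)"
  unfolding sqint_def fclass_def by (simp add: L2_class_norm)

lemma torus_integral:
  fixes f :: "real \<Rightarrow> 'a::{banach,second_countable_topology}"
  assumes "f \<in> borel_measurable borel"
  shows "(LINT x|torus. f x) = (LINT x:{0..2*pi}|lborel. f x)"
proof -
  have "(LINT x|torus. f x) = (LINT x|lborel. indicator {0..<2*pi} x *\<^sub>R f x)"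
    unfolding torus_def by (subst integral_restrict_space) auto
  also have "\<dots> = (LINT x|lborel. indicator {0..2*pi} x *\<^sub>R f x)"
  proof (rule integral_cong_AE)
    have "AE x in lborel. x \<noteq> 2 * pi" by (rule AE_lborel_singleton)
    then show "AE x in lborel. indicator {0..<2*pi} x *\<^sub>R f x = indicator {0..2*pi} x *\<^sub>R f x"
      by eventually_elim (auto simp: indicator_def)
  qed (use assms in measurable)
  finally show ?thesis by (simp add: set_lebesgue_integral_def)
qed

lemma torus_integral_primitive:
  fixes f :: "real \<Rightarrow> real"
  assumes "primitive F f" "continuous_on UNIV f"
  shows "(LINT x|torus. f x) = F (2*pi) - F 0"
  using primitiveD(2)[OF assms(1), of 0 "2*pi"] assms(2)
  by (simp add: torus_integral borel_measurable_continuous_onI)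

lemma torus_integral_const: "(LINT x|torus. (c::real)) = 2 * pi * c"
  by (subst torus_integral) (auto simp: set_lebesgue_integral_def)

lemma norm_fclass_le:
  assumes f: "sqint f" and B: "\<And>x. cmod (f x) \<le> B"
  shows "norm (fclass f) \<le> sqrt (2 * pi) * B"
proof -
  have B0: "0 \<le> B" using B[of 0] norm_ge_zero[of "f 0"] by linarith
  have "(norm (fclass f))\<^sup>2 \<le> (LINT x|torus. B\<^sup>2)"
    unfolding norm_fclass[OF f]
    by (rule integral_mono) (use f B in \<open>auto simp: sqint_def square_integrable_def intro: power_mono\<close>)
  also have "\<dots> = (sqrt (2 * pi) * B)\<^sup>2"
    unfolding torus_integral_const by (simp add: power_mult_distrib)
  finally show ?thesis
    by (rule power2_le_imp_le) (use B0 in simp)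
qed

definition periodic :: "(real \<Rightarrow> 'a) \<Rightarrow> bool" where
  "periodic f \<longleftrightarrow> (\<forall>x. f (x + 2*pi) = f x)"

definition cper :: "(real \<Rightarrow> complex) \<Rightarrow> bool" where
  "cper f \<longleftrightarrow> continuous_on UNIV f \<and> periodic f"

lemma cper_bounded:
  assumes "cper f"
  obtains B where "0 < B" "\<And>x. cmod (f x) \<le> B"
proof -
  have c: "continuous_on UNIV f" and p: "f (x + 2*pi) = f x" for x
    using assms by (auto simp: cper_def periodic_def)
  interpret periodic_fun_simple f "2*pi"
    by unfold_locales (rule p)
  obtain B where B: "0 < B" "\<And>t. t \<in> {0..2*pi} \<Longrightarrow> norm (f t) \<le> B"
    using continuous_bounded_Icc[OF c, of 0 "2*pi"] by blast
  have "cmod (f x) \<le> B" for x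
  proof -
    let ?k = "\<lfloor>x / (2*pi)\<rfloor>"
    have "of_int ?k \<le> x / (2*pi)" "x / (2*pi) \<le> of_int ?k + 1"
      by linarith+
    from mult_right_mono[OF this(1), of "2*pi"] mult_right_mono[OF this(2), of "2*pi"]
    have "of_int ?k * (2*pi) \<le> x" "x \<le> (of_int ?k + 1) * (2*pi)"
      by simp_all
    then have "x - of_int ?k * (2*pi) \<in> {0..2*pi}" by (simp add: algebra_simps)
    from B(2)[OF this] show ?thesis by (simp add: minus_of_int)
  qed
  with B(1) show ?thesis using that by blast
qed

lemma cper_measurable: "cper f \<Longrightarrow> f \<in> borel_measurable torus"
  unfolding cper_def by (intro borel_measurable_torusI borel_measurable_continuous_onI) simp

lemma cper_sqint: "cper f \<Longrightarrow> sqint f"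
  by (meson cper_bounded cper_measurable sqintI_bounded)

lemma cper_add: "cper f \<Longrightarrow> cper g \<Longrightarrow> cper (\<lambda>x. f x + g x)"
  by (auto simp: cper_def periodic_def intro: continuous_intros)

lemma cper_mult: "cper f \<Longrightarrow> cper g \<Longrightarrow> cper (\<lambda>x. f x * g x)"
  by (auto simp: cper_def periodic_def intro: continuous_intros)

lemma cper_const: "cper (\<lambda>x. c)"
  by (auto simp: cper_def periodic_def)

lemma cper_cnj: "cper f \<Longrightarrow> cper (\<lambda>x. cnj (f x))"
  by (auto simp: cper_def periodic_def intro: continuous_intros)

lemma cper_cis: "cper (\<lambda>x. cis (of_int n * x))"
proof -
  have "cis (of_int n * (2*pi)) = 1"
    using cis_multiple_2pi[of "of_int n"] by (simp add: mult.commute mult.left_commute)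
  then have "cis (of_int n * (x + 2*pi)) = cis (of_int n * x)" for x
    by (simp only: distrib_left cis_mult[symmetric] mult_1_right)
  then show ?thesis
    by (auto simp: cper_def periodic_def intro!: continuous_intros)
qed

section \<open>Fourier modes, coefficients and Bessel's inequality\<close>

definition fmode :: "int \<Rightarrow> complex \<Rightarrow> L2_torus" where
  "fmode n c = fclass (\<lambda>x. c * cis (of_int n * x))"

lemma cper_fmode: "cper (\<lambda>x. c * cis (of_int n * x))"
  by (intro cper_mult cper_const cper_cis)

lemma fmode_add: "fmode n (a + b) = fmode n a + fmode n b"
  unfolding fmode_def by (simp add: fclass_add[OF cper_sqint[OF cper_fmode] cper_sqint[OF cper_fmode], symmetric] ring_distribs)

lemma fmode_scaleR: "fmode n (r *\<^sub>R a) = r *\<^sub>R fmode n a"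
  unfolding fmode_def by (simp add: fclass_scaleR[OF cper_sqint[OF cper_fmode], symmetric])

lemma norm_fmode_le: "norm (fmode n a) \<le> sqrt (2*pi) * cmod a"
  unfolding fmode_def by (rule norm_fclass_le[OF cper_sqint[OF cper_fmode]]) (simp add: norm_mult)

lemma bounded_linear_fmode: "bounded_linear (fmode n)"
  by (rule bounded_linear_intro[of _ "sqrt (2*pi)"])
     (auto simp: fmode_add fmode_scaleR mult.commute intro: order_trans[OF norm_fmode_le])

lemmas fmode_diff = linear_diff[OF bounded_linear.linear[OF bounded_linear_fmode]]
lemmas fmode_zero = linear_0[OF bounded_linear.linear[OF bounded_linear_fmode]]

lemma inner_fmode: "fmode n c \<bullet> fmode m d = (if n = m then 2 * pi * Re (c * cnj d) else 0)"
proof -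
  have eq: "c * cis (of_int n * x) * cnj (d * cis (of_int m * x)) = (c * cnj d) * cis (of_int (n - m) * x)" for x
    by (simp add: cis_cnj cis_mult algebra_simps)
  have *: "fmode n c \<bullet> fmode m d = (LINT x|torus. Re ((c * cnj d) * cis (of_int (n - m) * x)))"
    unfolding fmode_def fclass_inner[OF cper_sqint[OF cper_fmode] cper_sqint[OF cper_fmode]] by (simp only: eq)
  show ?thesis
  proof (cases "n = m")
    case True
    then show ?thesis unfolding * using torus_integral_const[of "Re (c * cnj d)"] by simp
  next
    case False
    define a where "a = (c * cnj d) / (\<i> * of_int (n - m))"
    have nz: "\<i> * of_int (n - m) \<noteq> (0::complex)" using False by simp
    have "((\<lambda>x. Re (a * cis (of_int (n - m) * x))) has_vector_derivative Re ((c * cnj d) * cis (of_int (n - m) * x))) (at x)" for x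
    proof -
      have "((\<lambda>x. Re (a * cis (of_int (n - m) * x))) has_vector_derivative
          Re (a * (\<i> * of_real (of_int (n - m)) * cis (of_int (n - m) * x)))) (at x)"
        by (intro bounded_linear.has_vector_derivative[OF bounded_linear_Re]
            bounded_linear.has_vector_derivative[OF bounded_linear_mult_right] has_vderiv_cis)
      also have "a * (\<i> * of_real (of_int (n - m)) * cis (of_int (n - m) * x)) = (c * cnj d) * cis (of_int (n - m) * x)"
        using nz by (simp add: a_def)
      finally show ?thesis .
    qed
    moreover have "continuous_on UNIV (\<lambda>x. Re ((c * cnj d) * cis (of_int (n - m) * x)))"
      by (intro continuous_intros)
    ultimately have "fmode n c \<bullet> fmode m d = Re (a * cis (of_int (n - m) * (2*pi))) - Re (a * cis (of_int (n - m) * 0))"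
      unfolding * by (intro torus_integral_primitive primitive_of_deriv)
    also have "of_int (n - m) * (2*pi) = 2 * pi * of_int (n - m)" by (simp only: mult.commute)
    also have "cis (2 * pi * of_int (n - m)) = 1" by (rule cis_multiple_2pi) simp
    finally show ?thesis using False by simp
  qed
qed

text \<open>\<open>L2_torus\<close> is a real Hilbert space: the inner products with
  \<open>fmode n 1\<close> and \<open>fmode n \<i>\<close> are, up to the factor 2 pi, the real and
  the imaginary part of the usual complex Fourier coefficient.\<close>

definition coef :: "L2_torus \<Rightarrow> int \<Rightarrow> complex" where
  "coef u n = Complex (u \<bullet> fmode n 1) (u \<bullet> fmode n \<i>) / of_real (2 * pi)"

lemma inner_fmode_coef: "u \<bullet> fmode n c = 2 * pi * Re (coef u n * cnj c)"
proof -
  have "c = Re c *\<^sub>R 1 + Im c *\<^sub>R \<i>" by (simp add: complex_eq_iff)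
  then have "u \<bullet> fmode n c = Re c * (u \<bullet> fmode n 1) + Im c * (u \<bullet> fmode n \<i>)"
    by (metis fmode_add fmode_scaleR inner_add_right inner_scaleR_right)
  then show ?thesis by (simp add: coef_def field_simps Re_divide_of_real Im_divide_of_real)
qed

lemma coef_fmode: "coef (fmode m c) n = (if n = m then c else 0)"
  by (auto simp: coef_def inner_fmode complex_eq_iff)

lemma cmod_Complex_le: "cmod (Complex a b) \<le> \<bar>a\<bar> + \<bar>b\<bar>"
  using cmod_le[of "Complex a b"] by simp

lemma bounded_linear_coef: "bounded_linear (\<lambda>u. coef u n)"
proof (rule bounded_linear_intro)
  show "norm (coef u n) \<le> norm u * ((norm (fmode n 1) + norm (fmode n \<i>)) / (2*pi))" for u
  proof -
    have "cmod (Complex (u \<bullet> fmode n 1) (u \<bullet> fmode n \<i>)) \<le> norm u * norm (fmode n 1) + norm u * norm (fmode n \<i>)"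
      by (rule order_trans[OF cmod_Complex_le]) (intro add_mono Cauchy_Schwarz_ineq2)
    then show ?thesis by (simp add: coef_def norm_divide field_simps)
  qed
qed (auto simp: coef_def complex_eq_iff inner_add_left add_divide_distrib)

lemmas coef_add = linear_add[OF bounded_linear.linear[OF bounded_linear_coef]]
lemmas coef_diff = linear_diff[OF bounded_linear.linear[OF bounded_linear_coef]]
lemmas coef_scaleR = linear_scale[OF bounded_linear.linear[OF bounded_linear_coef]]
lemmas coef_zero = linear_0[OF bounded_linear.linear[OF bounded_linear_coef]]

definition proj :: "nat \<Rightarrow> L2_torus \<Rightarrow> L2_torus" where
  "proj N u = (\<Sum>n\<in>{-int N..int N}. fmode n (coef u n))"

lemma inner_sum_fmode:
  assumes "finite I"
  shows "(\<Sum>n\<in>I. fmode n (a n)) \<bullet> (\<Sum>n\<in>I. fmode n (b n)) = 2 * pi * (\<Sum>n\<in>I. Re (a n * cnj (b n)))"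
proof -
  have "(\<Sum>n\<in>I. fmode n (a n)) \<bullet> (\<Sum>n\<in>I. fmode n (b n)) = (\<Sum>n\<in>I. \<Sum>m\<in>I. fmode n (a n) \<bullet> fmode m (b m))"
    unfolding inner_sum_left inner_sum_right by (rule sum.swap)
  also have "\<dots> = (\<Sum>n\<in>I. 2 * pi * Re (a n * cnj (b n)))"
    using assms by (intro sum.cong refl) (simp add: inner_fmode)
  finally show ?thesis by (simp add: sum_distrib_left)
qed

lemma norm_sum_fmode:
  assumes "finite I"
  shows "(norm (\<Sum>n\<in>I. fmode n (a n)))\<^sup>2 = 2 * pi * (\<Sum>n\<in>I. (cmod (a n))\<^sup>2)"
  unfolding power2_norm_eq_inner inner_sum_fmode[OF assms]
  by (simp add: inner_complex_def)

lemma inner_sum_fmode_coef: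
  "u \<bullet> (\<Sum>n\<in>I. fmode n (a n)) = 2 * pi * (\<Sum>n\<in>I. Re (coef u n * cnj (a n)))"
  by (simp add: inner_sum_right inner_fmode_coef sum_distrib_left)

lemma norm_proj: "(norm (proj N u))\<^sup>2 = 2 * pi * (\<Sum>n\<in>{-int N..int N}. (cmod (coef u n))\<^sup>2)"
  unfolding proj_def by (rule norm_sum_fmode) simp

lemma norm_proj_le: "norm (proj N u) \<le> norm u"
proof -
  have "(norm (proj N u))\<^sup>2 = u \<bullet> proj N u"
    unfolding norm_proj unfolding proj_def inner_sum_fmode_coef
    by (simp add: complex_norm_square[symmetric] flip: of_real_power)
  also have "\<dots> \<le> norm u * norm (proj N u)" by (rule norm_cauchy_schwarz)
  finally have "norm (proj N u) * norm (proj N u) \<le> norm u * norm (proj N u)"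
    by (simp add: power2_eq_square)
  then show ?thesis
    by (metis mult_le_cancel_right norm_ge_zero not_less order_le_less)
qed

lemma bessel: "2 * pi * (\<Sum>n\<in>{-int N..int N}. (cmod (coef u n))\<^sup>2) \<le> (norm u)\<^sup>2"
  using norm_proj_le[of N u] by (simp flip: norm_proj) 

lemma proj_add: "proj N (u + v) = proj N u + proj N v"
  by (simp add: proj_def coef_add fmode_add sum.distrib)

lemma proj_diff: "proj N (u - v) = proj N u - proj N v"
  by (simp add: proj_def coef_diff fmode_diff sum_subtractf)

lemma proj_scaleR: "proj N (r *\<^sub>R u) = r *\<^sub>R proj N u"
  by (simp add: proj_def coef_scaleR fmode_scaleR scaleR_sum_right)

section \<open>Completeness of the trigonometric system\<close>

definition expandable :: "L2_torus set" where
  "expandable = {u. (\<lambda>N. proj N u) \<longlonglongrightarrow> u}"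

lemma expandable_fmode: "fmode n c \<in> expandable"
proof -
  have "proj N (fmode n c) = fmode n c" if "nat \<bar>n\<bar> \<le> N" for N
  proof -
    have "n \<in> {-int N..int N}" using that by auto
    then show ?thesis
      by (simp add: proj_def coef_fmode if_distrib[of "fmode _"] fmode_zero cong: if_cong)
  qed
  then have "\<forall>\<^sub>F N in sequentially. proj N (fmode n c) = fmode n c"
    by (auto simp: eventually_sequentially)
  then show ?thesis unfolding expandable_def by (simp add: tendsto_eventually)
qed

lemma subspace_expandable: "subspace expandable"
proof -
  have "proj N 0 = 0" for N by (simp add: proj_def coef_zero fmode_zero)
  then show ?thesis
    unfolding subspace_def expandable_def
    by (auto simp: proj_add proj_scaleR intro: tendsto_add tendsto_scaleR)
qed

text \<open>An \<epsilon>/3 argument, which works because all the projections are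
  contractions.\<close>

lemma closed_expandable: "closed expandable"
  unfolding closed_sequential_limits
proof (intro allI impI, elim conjE)
  fix x l assume x: "\<forall>n. x n \<in> expandable" and l: "x \<longlonglongrightarrow> l"
  show "l \<in> expandable"
    unfolding expandable_def mem_Collect_eq
  proof (rule LIMSEQ_I)
    fix r :: real assume r: "0 < r"
    obtain k where k: "norm (x k - l) < r / 3"
      using LIMSEQ_D[OF l, of "r / 3"] r by auto
    obtain N0 where N0: "\<And>N. N \<ge> N0 \<Longrightarrow> norm (proj N (x k) - x k) < r / 3"
      using LIMSEQ_D[of "\<lambda>N. proj N (x k)" "x k" "r / 3"] x r by (auto simp: expandable_def)
    have "norm (proj N l - l) < r" if "N \<ge> N0" for N
    proof -
      have "proj N l - l = (proj N (x k) - x k) + (x k - l) - proj N (x k - l)"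
        by (simp add: proj_diff)
      also have "norm \<dots> \<le> norm (proj N (x k) - x k) + norm (x k - l) + norm (proj N (x k - l))"
        by (intro order_trans[OF norm_triangle_ineq4] add_mono norm_triangle_ineq) simp
      also have "\<dots> < r"
        using N0[OF that] k norm_proj_le[of N "x k - l"] by linarith
      finally show ?thesis .
    qed
    then show "\<exists>no. \<forall>n\<ge>no. norm (proj n l - l) < r" by blast
  qed
qed

inductive trig_poly :: "(real \<Rightarrow> complex) \<Rightarrow> bool" where
  monom: "trig_poly (\<lambda>x. c * cis (of_int n * x))"
| add: "trig_poly f \<Longrightarrow> trig_poly g \<Longrightarrow> trig_poly (\<lambda>x. f x + g x)"

lemma trig_poly_mult: "trig_poly f \<Longrightarrow> trig_poly g \<Longrightarrow> trig_poly (\<lambda>x. f x * g x)"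
proof (induction rule: trig_poly.induct)
  case (monom c n)
  from monom show ?case
  proof (induction rule: trig_poly.induct)
    case (monom d m)
    have "(\<lambda>x. c * cis (of_int n * x) * (d * cis (of_int m * x))) = (\<lambda>x. (c * d) * cis (of_int (n + m) * x))"
      by (simp add: fun_eq_iff cis_mult[symmetric] algebra_simps)
    then show ?case by (simp only: trig_poly.monom)
  next
    case (add f g)
    from trig_poly.add[OF add.IH] show ?case by (simp add: algebra_simps)
  qed
next
  case (add f h)
  from trig_poly.add[OF add.IH[OF add.prems]] show ?case by (simp add: algebra_simps)
qed

lemma trig_poly_expandable: "trig_poly f \<Longrightarrow> cper f \<and> fclass f \<in> expandable"
proof (induction rule: trig_poly.induct)
  case (monom c n) then show ?case using cper_fmode expandable_fmode by (simp add: fmode_def)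
next
  case (add f g)
  then show ?case
    using subspace_add[OF subspace_expandable] by (auto simp: cper_add fclass_add cper_sqint)
qed

lemma trig_poly_const: "trig_poly (\<lambda>x. c)"
  using trig_poly.monom[of c 0] by simp

lemma trig_poly_cos: "trig_poly (\<lambda>x. of_real (cos (x - a)))"
proof -
  have "(\<lambda>x. complex_of_real (cos (x - a))) =
      (\<lambda>x. (cis (- a) / 2) * cis (of_int 1 * x) + (cis a / 2) * cis (of_int (- 1) * x))"
    by (auto simp: fun_eq_iff complex_eq_iff cis_mult cos_diff sin_diff field_simps)
  then show ?thesis by (simp only: trig_poly.add trig_poly.monom)
qed

lemma trig_poly_polynomial_cos:
  "real_polynomial_function p \<Longrightarrow> trig_poly (\<lambda>x. of_real (p (cos (x - a))))"
proof (induction rule: real_polynomial_function.induct)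
  case (linear f)
  have "f y = y * f 1" for y
    using linear_scale[OF bounded_linear.linear[OF linear], of y 1] by simp
  then have "(\<lambda>x. complex_of_real (f (cos (x - a)))) = (\<lambda>x. of_real (cos (x - a)) * of_real (f 1))"
    by (metis of_real_mult)
  then show ?case by (simp add: trig_poly_mult[OF trig_poly_cos trig_poly_const])
qed (auto intro: trig_poly_const trig_poly.add trig_poly_mult)

text \<open>Weierstrass approximation of h on [-1, 1] by a polynomial p makes
  \<open>p (cos (x - a))\<close> a trigonometric polynomial that is uniformly close to the given
  function.\<close>

lemma continuous_cos_expandable:
  assumes h: "continuous_on {-1..1} h"
  shows "sqint (\<lambda>x. c * of_real (h (cos (x - a))))"
    and "fclass (\<lambda>x. c * of_real (h (cos (x - a)))) \<in> expandable"
proof -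
  have cont: "continuous_on UNIV (\<lambda>x. h (cos (x - a)))"
    by (rule continuous_on_compose2[OF h]) (auto intro!: continuous_intros)
  have cp: "cper (\<lambda>x. c * of_real (h (cos (x - a))))"
    unfolding cper_def periodic_def
  proof (intro conjI allI)
    show "continuous_on UNIV (\<lambda>x. c * of_real (h (cos (x - a))))"
      by (intro continuous_intros cont)
    fix x
    have "cos (x + 2*pi - a) = cos (x - a)"
      using cos_periodic[of "x - a"] by (simp add: algebra_simps)
    then show "c * of_real (h (cos (x + 2*pi - a))) = c * of_real (h (cos (x - a)))" by simp
  qed
  then show sq: "sqint (\<lambda>x. c * of_real (h (cos (x - a))))" by (rule cper_sqint)
  have "fclass (\<lambda>x. c * of_real (h (cos (x - a)))) \<in> closure expandable"
    unfolding closure_approachable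
  proof (intro allI impI)
    fix r :: real assume r: "0 < r"
    \<comment> \<open>The added 1 keeps the denominator positive for c = 0 and makes the final
      inequality strict.\<close>
    define s where "s = r / (sqrt (2*pi) * (cmod c + 1))"
    have K: "0 < sqrt (2*pi) * (cmod c + 1)" by (intro mult_pos_pos add_nonneg_pos) auto
    have s: "0 < s" using r K by (simp add: s_def)
    obtain p where p: "real_polynomial_function p" "\<And>x. x \<in> {-1..1} \<Longrightarrow> \<bar>h x - p x\<bar> < s"
      using Stone_Weierstrass_real_polynomial_function[OF _ h s] by auto
    let ?p = "\<lambda>x. c * of_real (p (cos (x - a)))"
    have tp: "trig_poly ?p"
      by (intro trig_poly_mult trig_poly_const trig_poly_polynomial_cos p)
    note tp' = trig_poly_expandable[OF tp]
    have "fclass ?p - fclass (\<lambda>x. c * of_real (h (cos (x - a)))) =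
        fclass (\<lambda>x. ?p x - c * of_real (h (cos (x - a))))"
      by (rule fclass_diff[OF cper_sqint[OF conjunct1[OF tp']] sq, symmetric])
    also have "norm \<dots> \<le> sqrt (2*pi) * (cmod c * s)"
    proof (rule norm_fclass_le)
      show "sqint (\<lambda>x. ?p x - c * of_real (h (cos (x - a))))"
        by (rule sqint_diff[OF cper_sqint[OF conjunct1[OF tp']] sq])
      fix x
      have "?p x - c * of_real (h (cos (x - a))) = - c * of_real (h (cos (x - a)) - p (cos (x - a)))"
        by (simp add: algebra_simps)
      moreover have "\<bar>h (cos (x - a)) - p (cos (x - a))\<bar> \<le> s"
        using p(2)[of "cos (x - a)"] by simp
      ultimately show "cmod (?p x - c * of_real (h (cos (x - a)))) \<le> cmod c * s"
        by (simp add: norm_mult mult_left_mono del: of_real_diff)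
    qed
    also have "\<dots> < sqrt (2*pi) * (cmod c + 1) * s"
      using s by (simp add: algebra_simps)
    also have "\<dots> = r" using K less_imp_neq[OF K] unfolding s_def by (simp only: times_divide_eq_right nonzero_mult_div_cancel_left not_sym)
    finally show "\<exists>y\<in>expandable. dist y (fclass (\<lambda>x. c * of_real (h (cos (x - a))))) < r"
      using tp' by (auto simp: dist_norm)
  qed
  then show "fclass (\<lambda>x. c * of_real (h (cos (x - a)))) \<in> expandable"
    by (simp add: closed_expandable)
qed

lemma L2_class_eqI_AE:
  assumes "square_integrable f" "square_integrable g" "AE x in torus. f x = g x"
  shows "L2_class f = L2_class g"
  using assms by (intro Quotient_rel_abs[OF Quotient_L2_torus]) (simp add: L2_rel_def)

lemma AE_torus_neq: "AE x in torus. x \<noteq> a"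
  unfolding torus_def by (subst AE_restrict_space_iff) (auto intro: eventually_mono[OF AE_lborel_singleton])

text \<open>Since \<open>cos (x - q/2) - cos (q/2) = 2 sin (x/2) sin ((q - x)/2)\<close>, an arc of the circle is a
  superlevel set of a shifted cosine, and its indicator is a limit of functions of that cosine.\<close>

lemma indicator_expandable:
  assumes q: "0 < q" "q < 2*pi"
  shows "L2_class (\<lambda>x. indicator {..<q} x *\<^sub>R v) \<in> expandable"
proof -
  define c where "c = uncvec v"
  \<comment> \<open>Ramps converging pointwise to the indicator of
    \<open>y > cos (q/2)\<close>.\<close>
  define h where "h k y = min 1 (real k * max 0 (y - cos (q/2)))" for k y
  define s where "s k x = c * of_real (h k (cos (x - q/2)))" for k x
  have ch: "continuous_on {-1..1} (h k)" for k
    unfolding h_def by (intro continuous_intros)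
  have s: "sqint (s k)" "fclass (s k) \<in> expandable" for k
    unfolding s_def using continuous_cos_expandable[OF ch] by auto
  \<comment> \<open>The arc is open because the ramps vanish at x = 0, where the shifted cosine
    equals \<open>cos (q/2)\<close>; this single point is a null set and is restored at the
    end.\<close>
  have f: "square_integrable (\<lambda>x. indicator {0<..<q} x *\<^sub>R v)"
    by (rule square_integrable_indicator) simp
  have key: "cos (x - q/2) - cos (q/2) = 2 * sin (x/2) * sin ((q - x)/2)" for x
  proof -
    have "(x - q/2 + q/2) / 2 = x/2" "(q/2 - (x - q/2)) / 2 = (q - x)/2"
      by (simp_all add: field_simps)
    then show ?thesis using cos_diff_cos[of "x - q/2" "q/2"] by (simp only:)
  qed
  have "(\<lambda>k. L2_class (\<lambda>x. cvec (s k x))) \<longlonglongrightarrow> L2_class (\<lambda>x. indicator {0<..<q} x *\<^sub>R v)"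
  proof (rule L2_class_dominated)
    fix x assume "x \<in> space torus"
    then have x: "0 \<le> x" "x < 2*pi" by (auto simp: torus_def space_restrict_space)
    have out: "h k (cos (x - q/2)) = 0" if "x \<notin> {0<..<q}" for k
    proof -
      have "2 * sin (x/2) * sin ((q - x)/2) \<le> 0"
      proof (cases "x = 0")
        case False
        with that x have "q \<le> x" by auto
        have "0 \<le> sin (x/2)" using x by (intro sin_ge_zero) auto
        moreover have "0 \<le> sin ((x - q)/2)" using x q \<open>q \<le> x\<close> by (intro sin_ge_zero) auto
        moreover have "sin ((q - x)/2) = - sin ((x - q)/2)"
          using sin_minus[of "(x - q)/2"] by (simp add: minus_divide_left)
        ultimately show ?thesis by (simp add: mult_nonneg_nonneg)
      qed simp
      then show ?thesis using key[of x] by (simp add: h_def max_def)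
    qed
    have "0 \<le> h k y" "h k y \<le> 1" for k y by (auto simp: h_def)
    then show "norm (cvec (s k x)) \<le> 2 * norm (indicator {0<..<q} x *\<^sub>R v)" for k
      using out[of k] norm_cvec[of c] mult_left_le[of "h k (cos (x - q / 2))" "norm v"]
      by (cases "x \<in> {0<..<q}") (auto simp: s_def norm_mult c_def abs_of_nonneg intro: order_trans)
    show "(\<lambda>k. cvec (s k x)) \<longlonglongrightarrow> indicator {0<..<q} x *\<^sub>R v"
    proof (cases "x \<in> {0<..<q}")
      case False
      then show ?thesis using out by (simp add: s_def cvec_zero)
    next
      case True
      define d where "d = cos (x - q/2) - cos (q/2)"
      have "0 < sin (x/2)" using True x by (intro sin_gt_zero) auto
      moreover have "0 < sin ((q - x)/2)" using True q by (intro sin_gt_zero) auto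
      ultimately have d: "0 < d" unfolding d_def key by simp
      obtain k0 :: nat where "1 / d < k0" using reals_Archimedean2 by blast
      then have "h k (cos (x - q/2)) = 1" if "k0 \<le> k" for k
      proof -
        have "1 / d < real k" using that \<open>1 / d < k0\<close> by (simp add: order_less_le_trans)
        then have "1 \<le> real k * d" using d by (simp add: field_simps)
        then show ?thesis using d by (simp add: h_def d_def max_def)
      qed
      then have "\<forall>\<^sub>F k in sequentially. cvec (s k x) = indicator {0<..<q} x *\<^sub>R v"
        using True by (intro eventually_sequentiallyI[of k0]) (simp add: s_def c_def)
      then show ?thesis by (rule tendsto_eventually)
    qed
  qed (use s f in \<open>auto simp: sqint_def\<close>)
  then have "L2_class (\<lambda>x. indicator {0<..<q} x *\<^sub>R v) \<in> expandable"
    by (rule closed_sequentially[OF closed_expandable s(2)[unfolded fclass_def]])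
  moreover have "L2_class (\<lambda>x. indicator {0<..<q} x *\<^sub>R v) = L2_class (\<lambda>x. indicator {..<q} x *\<^sub>R v)"
  proof (rule L2_class_eqI_AE[OF f])
    show "square_integrable (\<lambda>x. indicator {..<q} x *\<^sub>R v)" by (rule square_integrable_indicator) simp
    have "AE x in torus. 0 \<le> x" by (rule AE_I2) (simp add: torus_def space_restrict_space)
    with AE_torus_neq[of 0] show "AE x in torus. indicator {0<..<q} x *\<^sub>R v = indicator {..<q} x *\<^sub>R v"
      by eventually_elim (auto simp: indicator_def)
  qed
  ultimately show ?thesis by simp
qed

lemma L2_generators_expandable: "L2_generators \<subseteq> expandable"
proof
  fix u assume "u \<in> L2_generators"
  then obtain q v where u: "u = L2_class (\<lambda>x. indicator {..<q} x *\<^sub>R v)"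
    by (auto simp: L2_generators_def)
  have sq: "square_integrable (\<lambda>x. indicator {..<q} x *\<^sub>R v)"
    by (rule square_integrable_indicator) simp
  consider "q \<le> 0" | "2*pi \<le> q" | "0 < q" "q < 2*pi" by linarith
  then show "u \<in> expandable"
  proof cases
    case 1
    have "u = L2_class (\<lambda>x. 0)"
      unfolding u by (rule L2_class_eqI[OF sq square_integrable_zero]) (use 1 in auto)
    then show ?thesis using subspace_0[OF subspace_expandable] by (simp add: zero_L2_torus.abs_eq)
  next
    case 2
    have "u = fclass (\<lambda>x. uncvec v)"
      unfolding u fclass_def
      by (rule L2_class_eqI[OF sq]) (use 2 cper_sqint[OF cper_const[of "uncvec v"]] in \<open>auto simp: sqint_def\<close>)
    then show ?thesis using trig_poly_expandable[OF trig_poly_const] by simp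
  next
    case 3
    then show ?thesis unfolding u by (rule indicator_expandable)
  qed
qed

text \<open>The closed subspace \<open>expandable\<close> contains the generators, whose rational
  combinations are dense.\<close>

theorem proj_tendsto: "(\<lambda>N. proj N u) \<longlonglongrightarrow> u"
proof -
  have "L2_dense \<subseteq> expandable"
  proof
    fix u assume "u \<in> L2_dense"
    then obtain l where l: "l \<in> lists (\<rat> \<times> L2_generators)" and u: "u = (\<Sum>(q, u)\<leftarrow>l. q *\<^sub>R u)"
      by (auto simp: L2_dense_def)
    have "(\<Sum>(q, u)\<leftarrow>l. q *\<^sub>R u) \<in> expandable"
      using l L2_generators_expandable subspace_expandable
      by (induction l) (auto simp: subspace_0 intro!: subspace_add subspace_scale)
    then show "u \<in> expandable" by (simp add: u)
  qed
  from closure_minimal[OF this closed_expandable] show ?thesis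
    by (auto simp: closure_L2_dense expandable_def)
qed

section \<open>Riesz-Fischer theorem, Fourier multipliers, adjoints and inverses\<close>

lemmas coef_sum = linear_sum[OF bounded_linear.linear[OF bounded_linear_coef]]

lemma coef_eqI:
  assumes "\<And>n. coef u n = coef v n"
  shows "u = v"
proof -
  have "proj N u = proj N v" for N using assms by (simp add: proj_def)
  then show ?thesis using LIMSEQ_unique[OF proj_tendsto[of u]] proj_tendsto[of v] by simp
qed

lemma coefI:
  assumes "\<And>c. u \<bullet> fmode n c = 2 * pi * Re (a * cnj c)"
  shows "coef u n = a"
  using assms[of 1] assms[of \<i>] by (simp add: inner_fmode_coef complex_eq_iff)

lemma coef_sum_fmode:
  assumes "finite I"
  shows "coef (\<Sum>m\<in>I. fmode m (a m)) n = (if n \<in> I then a n else 0)"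
proof -
  have "coef (\<Sum>m\<in>I. fmode m (a m)) n = (\<Sum>m\<in>I. if m = n then a m else 0)"
    unfolding coef_sum by (intro sum.cong) (auto simp: coef_fmode)
  then show ?thesis using assms by simp
qed

lemma coef_proj: "coef (proj N u) n = (if n \<in> {-int N..int N} then coef u n else 0)"
  unfolding proj_def by (rule coef_sum_fmode) simp

lemma norm_le_coef:
  assumes "\<And>n. cmod (coef v n) \<le> C * cmod (coef u n)" "0 \<le> C"
  shows "norm v \<le> C * norm u"
proof -
  have "norm (proj N v) \<le> C * norm u" for N
  proof -
    have "(norm (proj N v))\<^sup>2 \<le> 2 * pi * (\<Sum>n\<in>{-int N..int N}. (C * cmod (coef u n))\<^sup>2)"
      unfolding norm_proj by (intro mult_left_mono sum_mono power_mono assms) auto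
    also have "\<dots> = (C * norm (proj N u))\<^sup>2"
      by (simp add: norm_proj power_mult_distrib sum_distrib_left mult_ac)
    finally have "norm (proj N v) \<le> C * norm (proj N u)"
      by (rule power2_le_imp_le) (use assms(2) in simp)
    also have "\<dots> \<le> C * norm u" by (intro mult_left_mono norm_proj_le assms)
    finally show ?thesis .
  qed
  then show ?thesis
    using LIMSEQ_le_const2[OF tendsto_norm[OF proj_tendsto[of v]]] by blast
qed

text \<open>The sums of squares are monotone and bounded, hence Cauchy, and by orthogonality their
  differences are the squared distances of the partial Fourier sums up to the factor 2 pi.\<close>

lemma riesz_fischer:
  assumes "\<And>N. (\<Sum>n\<in>{-int N..int N}. (cmod (a n))\<^sup>2) \<le> B"
  obtains u where "\<And>n. coef u n = a n"
proof -
  define X where "X N = (\<Sum>n\<in>{-int N..int N}. fmode n (a n))" for N :: nat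
  define s where "s N = (\<Sum>n\<in>{-int N..int N}. (cmod (a n))\<^sup>2)" for N :: nat
  have "incseq s"
    unfolding s_def by (intro incseq_SucI sum_mono2) auto
  moreover have "s i \<le> B" for i by (simp add: s_def assms)
  ultimately obtain L where "s \<longlonglongrightarrow> L"
    using incseq_convergent by blast
  then have Cs: "Cauchy s" by (rule LIMSEQ_imp_Cauchy)
  have diff: "(norm (X M - X N))\<^sup>2 = 2 * pi * (s M - s N)" if "N \<le> M" for M N
  proof -
    have sub: "{-int N..int N} \<subseteq> {-int M..int M}" using that by auto
    have "X M - X N = (\<Sum>n\<in>{-int M..int M} - {-int N..int N}. fmode n (a n))"
      unfolding X_def using sum.subset_diff[OF sub, of "\<lambda>n. fmode n (a n)"] by simp
    moreover have "s M - s N = (\<Sum>n\<in>{-int M..int M} - {-int N..int N}. (cmod (a n))\<^sup>2)"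
      unfolding s_def using sum.subset_diff[OF sub, of "\<lambda>n. (cmod (a n))\<^sup>2"] by simp
    ultimately show ?thesis by (simp add: norm_sum_fmode)
  qed
  have "Cauchy X"
  proof (rule CauchyI')
    fix r :: real assume r: "0 < r"
    then have "0 < r\<^sup>2 / (2 * pi)" by simp
    from metric_CauchyD[OF Cs this] obtain K where
      K: "\<And>m n. K \<le> m \<Longrightarrow> K \<le> n \<Longrightarrow> dist (s m) (s n) < r\<^sup>2 / (2 * pi)" by blast
    have "dist (X m) (X n) < r" if "K \<le> m" "m < n" for m n
    proof -
      have "\<bar>s m - s n\<bar> < r\<^sup>2 / (2 * pi)" using K[of m n] that by (simp add: dist_real_def)
      then have "s n - s m < r\<^sup>2 / (2 * pi)" by linarith
      then have "(norm (X n - X m))\<^sup>2 < r\<^sup>2"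
        using diff[of m n] that by (simp add: field_simps)
      then have "norm (X n - X m) < r" using r by (simp add: power2_less_imp_less)
      then show ?thesis by (simp add: dist_norm norm_minus_commute)
    qed
    then show "\<exists>M. \<forall>m\<ge>M. \<forall>n>m. dist (X m) (X n) < r" by blast
  qed
  then obtain u where u: "X \<longlonglongrightarrow> u" using Cauchy_convergent convergent_def by blast
  have "coef u n = a n" for n
  proof -
    have "(\<lambda>N. coef (X N) n) \<longlonglongrightarrow> coef u n"
      by (rule bounded_linear.tendsto[OF bounded_linear_coef u])
    moreover have "\<forall>\<^sub>F N in sequentially. coef (X N) n = a n"
      by (rule eventually_sequentiallyI[of "nat \<bar>n\<bar>"]) (auto simp: X_def coef_sum_fmode)
    then have "(\<lambda>N. coef (X N) n) \<longlonglongrightarrow> a n" by (rule tendsto_eventually)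
    ultimately show ?thesis by (rule LIMSEQ_unique)
  qed
  then show ?thesis using that by blast
qed

text \<open>For bounded m the choice exists by Riesz-Fischer and is unique by
  \<open>coef_eqI\<close>. The symbol of the evolution is unbounded and therefore enters later only
  through its exponentials or mode by mode.\<close>

definition multiplier :: "(int \<Rightarrow> complex) \<Rightarrow> L2_torus \<Rightarrow> L2_torus" where
  "multiplier m u = (SOME v. \<forall>n. coef v n = m n * coef u n)"

lemma coef_multiplier:
  assumes "\<And>n. cmod (m n) \<le> C"
  shows "coef (multiplier m u) n = m n * coef u n"
proof -
  have C0: "0 \<le> C" using order_trans[OF norm_ge_zero assms[of 0]] .
  have "(\<Sum>n\<in>{-int N..int N}. (cmod (m n * coef u n))\<^sup>2) \<le> C\<^sup>2 * ((norm u)\<^sup>2 / (2 * pi))" for N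
  proof -
    have "(\<Sum>n\<in>{-int N..int N}. (cmod (m n * coef u n))\<^sup>2) \<le> (\<Sum>n\<in>{-int N..int N}. C\<^sup>2 * (cmod (coef u n))\<^sup>2)"
      by (intro sum_mono) (auto simp: norm_mult power_mult_distrib intro!: mult_right_mono power_mono assms)
    also have "\<dots> = C\<^sup>2 * (\<Sum>n\<in>{-int N..int N}. (cmod (coef u n))\<^sup>2)" by (simp add: sum_distrib_left)
    also have "\<dots> \<le> C\<^sup>2 * ((norm u)\<^sup>2 / (2 * pi))"
      using bessel[of u N] by (intro mult_left_mono) (auto simp: field_simps)
    finally show ?thesis .
  qed
  then obtain v where "\<And>n. coef v n = m n * coef u n"
    using riesz_fischer[of "\<lambda>n. m n * coef u n"] by blast
  then have "\<exists>v. \<forall>n. coef v n = m n * coef u n" by blast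
  from someI_ex[OF this] show ?thesis unfolding multiplier_def by blast
qed

lemma norm_multiplier_le:
  assumes "\<And>n. cmod (m n) \<le> C"
  shows "norm (multiplier m u) \<le> C * norm u"
proof (rule norm_le_coef)
  show "0 \<le> C" using order_trans[OF norm_ge_zero assms[of 0]] .
  show "cmod (coef (multiplier m u) n) \<le> C * cmod (coef u n)" for n
    by (simp add: coef_multiplier[of m, OF assms] norm_mult mult_right_mono assms)
qed

lemma bounded_linear_multiplier:
  assumes "\<And>n. cmod (m n) \<le> C"
  shows "bounded_linear (multiplier m)"
  by (rule bounded_linear_intro[of _ C])
     (auto intro!: coef_eqI simp: coef_multiplier[of m, OF assms] coef_add coef_scaleR ring_distribs
       mult.commute[of _ C] norm_multiplier_le[of m, OF assms])

lemma multiplier_fmode: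
  assumes "\<And>n. cmod (m n) \<le> C"
  shows "multiplier m (fmode n c) = fmode n (m n * c)"
  by (rule coef_eqI) (simp add: coef_multiplier[of m, OF assms] coef_fmode)

text \<open>The values of f on the modes prescribe the coefficients. Testing f on their own partial
  sum v shows that the square of \<open>norm v\<close> equals f v, which is at most K
  \<open>norm v\<close>; so the coefficients are square summable.\<close>

lemma riesz_representation:
  fixes f :: "L2_torus \<Rightarrow> real"
  assumes f: "bounded_linear f"
  obtains r where "\<And>v. f v = r \<bullet> v"
proof -
  obtain K where K: "0 < K" "\<And>v. norm (f v) \<le> norm v * K"
    using bounded_linear.pos_bounded[OF f] by blast
  note lin = bounded_linear.linear[OF f]
  define a where "a n = Complex (f (fmode n 1)) (f (fmode n \<i>)) / of_real (2 * pi)" for n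
  have fe: "f (fmode n c) = 2 * pi * Re (a n * cnj c)" for n c
  proof -
    have "c = Re c *\<^sub>R 1 + Im c *\<^sub>R \<i>" by (simp add: complex_eq_iff)
    then have "f (fmode n c) = Re c * f (fmode n 1) + Im c * f (fmode n \<i>)"
      by (metis fmode_add fmode_scaleR linear_add[OF lin] linear_scale[OF lin] real_scaleR_def)
    then show ?thesis by (simp add: a_def field_simps Re_divide_of_real Im_divide_of_real)
  qed
  have "(\<Sum>n\<in>{-int N..int N}. (cmod (a n))\<^sup>2) \<le> K\<^sup>2 / (2 * pi)" for N
  proof -
    define S where "S = (\<Sum>n\<in>{-int N..int N}. (cmod (a n))\<^sup>2)"
    define v where "v = (\<Sum>n\<in>{-int N..int N}. fmode n (a n))"
    have nv: "(norm v)\<^sup>2 = 2 * pi * S" unfolding v_def S_def by (rule norm_sum_fmode) simp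
    have "f v = 2 * pi * S"
      unfolding v_def S_def linear_sum[OF lin] fe sum_distrib_left
      by (intro sum.cong refl) (simp only: complex_norm_square[symmetric] Re_complex_of_real)
    then have "(norm v)\<^sup>2 \<le> norm v * K" using K(2)[of v] nv by simp
    then have "norm v \<le> K" using K(1)
      by (cases "norm v = 0") (auto simp: power2_eq_square)
    then have "(norm v)\<^sup>2 \<le> K\<^sup>2" by (intro power_mono) auto
    then show ?thesis using nv unfolding S_def[symmetric] by (simp add: field_simps)
  qed
  then obtain r where r: "\<And>n. coef r n = a n" using riesz_fischer[of a] by blast
  have "f (proj N v) = r \<bullet> proj N v" for N v
    unfolding proj_def linear_sum[OF lin] fe inner_sum_right inner_fmode_coef by (simp add: r)
  moreover have "(\<lambda>N. f (proj N v)) \<longlonglongrightarrow> f v" for v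
    by (rule bounded_linear.tendsto[OF f proj_tendsto])
  moreover have "(\<lambda>N. r \<bullet> proj N v) \<longlonglongrightarrow> r \<bullet> v" for v by (intro tendsto_intros proj_tendsto)
  ultimately have "f v = r \<bullet> v" for v using LIMSEQ_unique by fastforce
  then show ?thesis using that by blast
qed

text \<open>\<open>adjoint\<close> is defined by a choice; the Riesz representation supplies the
  witness that makes it the Hilbert space adjoint.\<close>

lemma inner_adjoint:
  fixes T :: "L2_torus \<Rightarrow> L2_torus"
  assumes T: "bounded_linear T"
  shows "T u \<bullet> v = u \<bullet> adjoint T v"
proof -
  have "\<exists>r. \<forall>u. T u \<bullet> v = u \<bullet> r" for v
    using riesz_representation[OF bounded_linear_compose[OF bounded_linear_inner_left T, of v]]
    by (metis inner_commute)
  then obtain T' where "\<And>u v. T u \<bullet> v = u \<bullet> T' v" by metis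
  then have "\<exists>T'. \<forall>u v. T u \<bullet> v = u \<bullet> T' v" by blast
  from someI_ex[OF this] show ?thesis unfolding adjoint_def by blast
qed

lemma norm_adjoint_le:
  fixes T :: "L2_torus \<Rightarrow> L2_torus"
  assumes T: "bounded_linear T" and K: "\<And>u. norm (T u) \<le> K * norm u"
  shows "norm (adjoint T v) \<le> K * norm v"
proof -
  have "norm (adjoint T v) * norm (adjoint T v) = T (adjoint T v) \<bullet> v"
    unfolding inner_adjoint[OF T] by (simp add: power2_norm_eq_inner flip: power2_eq_square)
  also have "\<dots> \<le> (K * norm (adjoint T v)) * norm v"
    by (rule order_trans[OF norm_cauchy_schwarz mult_right_mono[OF K]]) simp
  finally have *: "norm (adjoint T v) * norm (adjoint T v) \<le> norm (adjoint T v) * (K * norm v)"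
    by (simp add: mult_ac)
  show ?thesis
  proof (cases "norm (adjoint T v) = 0")
    case True
    have "0 \<le> K * norm v" using order_trans[OF norm_ge_zero K[of v]] .
    with True show ?thesis by simp
  next
    case False
    then show ?thesis using * by (simp only: mult_le_cancel_left) (auto simp: not_less)
  qed
qed

lemma bounded_linear_adjoint:
  fixes T :: "L2_torus \<Rightarrow> L2_torus"
  assumes T: "bounded_linear T"
  shows "bounded_linear (adjoint T)"
proof -
  obtain K where "\<And>u. norm (T u) \<le> norm u * K" using bounded_linear.bounded[OF T] by blast
  then have K: "norm (T u) \<le> K * norm u" for u by (simp add: mult.commute)
  have "adjoint T (u + v) = adjoint T u + adjoint T v" for u v
    by (subst vector_eq_ldot[symmetric]) (simp add: inner_adjoint[OF T, symmetric] inner_add_right)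
  moreover have "adjoint T (r *\<^sub>R u) = r *\<^sub>R adjoint T u" for r u
    by (subst vector_eq_ldot[symmetric]) (simp add: inner_adjoint[OF T, symmetric])
  ultimately show ?thesis
    by (intro bounded_linear_intro[of _ K]) (auto simp: mult.commute norm_adjoint_le[OF T K])
qed

text \<open>The solutions of S x = y are the fixed points of x \<mapsto> y - (S x - x), a
  contraction with constant 1/2. The bound 2 comes from absorbing half of \<open>norm (R u)\<close>
  into the left side.\<close>

lemma neumann_inverse:
  fixes S :: "'a::banach \<Rightarrow> 'a"
  assumes S: "bounded_linear S" and le: "\<And>u. norm (S u - u) \<le> norm u / 2"
  obtains R where "bounded_linear R" "\<And>u. S (R u) = u" "\<And>u. R (S u) = u"
    "\<And>u. norm (R u) \<le> 2 * norm u"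
proof -
  note lin = bounded_linear.linear[OF S]
  have ex: "\<exists>!x. S x = y" for y
  proof -
    have "\<exists>!x. y - (S x - x) = x"
    proof (rule banach_fix_type[of "1/2"])
      show "\<forall>x z. dist (y - (S x - x)) (y - (S z - z)) \<le> 1 / 2 * dist x z"
      proof (intro allI)
        fix x z
        have "(y - (S x - x)) - (y - (S z - z)) = - (S (x - z) - (x - z))"
          by (simp add: linear_diff[OF lin])
        then have "dist (y - (S x - x)) (y - (S z - z)) = norm (S (x - z) - (x - z))"
          by (simp only: dist_norm norm_minus_cancel)
        then show "dist (y - (S x - x)) (y - (S z - z)) \<le> 1 / 2 * dist x z"
          using le[of "x - z"] by (simp add: dist_norm)
      qed
    qed auto
    moreover have "y - (S x - x) = x \<longleftrightarrow> S x = y" for x by (auto simp: algebra_simps)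
    ultimately show ?thesis by simp
  qed
  define R where "R y = (THE x. S x = y)" for y
  have SR: "S (R y) = y" for y using theI'[OF ex[of y]] by (simp add: R_def)
  have RS: "R (S x) = x" for x using ex[of "S x"] SR by blast
  have bnd: "norm (R y) \<le> 2 * norm y" for y
  proof -
    have "norm (R y) \<le> norm (S (R y)) + norm (S (R y) - R y)"
      using norm_triangle_ineq4[of "S (R y)" "S (R y) - R y"] by simp
    also have "\<dots> \<le> norm y + norm (R y) / 2" using le[of "R y"] by (simp add: SR)
    finally show ?thesis by simp
  qed
  have "bounded_linear R"
  proof (rule bounded_linear_intro[of _ 2])
    show "R (x + y) = R x + R y" for x y
      by (metis RS SR linear_add[OF lin])
    show "R (r *\<^sub>R x) = r *\<^sub>R R x" for r x
      by (metis RS SR linear_scale[OF lin])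
    show "norm (R x) \<le> norm x * 2" for x by (metis bnd mult.commute)
  qed
  then show ?thesis using that SR RS bnd by blast
qed

subsection \<open>Operators of order zero\<close>

text \<open>The general real-linear multiplication operator, carrying a linear and a
  conjugate-linear coefficient together. It is defined through the chosen representative, and
  \<open>mop_fclass\<close> shows that any other one gives the same class.\<close>

definition mop :: "(real \<Rightarrow> complex) \<Rightarrow> (real \<Rightarrow> complex) \<Rightarrow> L2_torus \<Rightarrow> L2_torus" where
  "mop p q u = fclass (\<lambda>x. p x * uncvec (rep_L2 u x) + q x * cnj (uncvec (rep_L2 u x)))"

lemma sqint_mop:
  assumes "cper p" "cper q" "sqint f"
  shows "sqint (\<lambda>x. p x * f x + q x * cnj (f x))"
proof -
  obtain A B where A: "\<And>x. cmod (p x) \<le> A" and B: "\<And>x. cmod (q x) \<le> B"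
    using assms cper_bounded by metis
  have [measurable]: "p \<in> borel_measurable torus" "q \<in> borel_measurable torus" "f \<in> borel_measurable torus"
    using assms by (auto intro: cper_measurable sqint_measurable)
  have [measurable]: "cnj \<in> borel_measurable borel"
    by (intro borel_measurable_continuous_onI continuous_intros)
  have m: "(\<lambda>x. p x * f x + q x * cnj (f x)) \<in> borel_measurable torus" by measurable
  have "integrable torus (\<lambda>x. (cmod (p x * f x + q x * cnj (f x)))\<^sup>2)"
  proof (rule Bochner_Integration.integrable_bound)
    show "integrable torus (\<lambda>x. (A + B)\<^sup>2 * (cmod (f x))\<^sup>2)"
      using assms(3) by (auto simp: sqint_def square_integrable_def)
    show "AE x in torus. norm ((cmod (p x * f x + q x * cnj (f x)))\<^sup>2) \<le> norm ((A + B)\<^sup>2 * (cmod (f x))\<^sup>2)"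
    proof (rule AE_I2)
      fix x
      have "cmod (p x * f x + q x * cnj (f x)) \<le> A * cmod (f x) + B * cmod (f x)"
        by (rule order_trans[OF norm_triangle_ineq])
           (auto simp: norm_mult intro!: add_mono mult_right_mono A B)
      then have "(cmod (p x * f x + q x * cnj (f x)))\<^sup>2 \<le> ((A + B) * cmod (f x))\<^sup>2"
        by (intro power_mono) (auto simp: ring_distribs)
      then show "norm ((cmod (p x * f x + q x * cnj (f x)))\<^sup>2) \<le> norm ((A + B)\<^sup>2 * (cmod (f x))\<^sup>2)"
        by (simp add: power_mult_distrib)
    qed
  qed (use m in measurable)
  moreover have "(\<lambda>x. cvec (p x * f x + q x * cnj (f x))) \<in> borel_measurable torus"
    by (rule measurable_compose[OF m borel_measurable_continuous_onI[OF continuous_on_cvec[OF continuous_on_id]]])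
  ultimately show ?thesis by (simp add: sqint_def square_integrable_def)
qed

lemma rep_fclass:
  assumes "sqint f"
  shows "sqint (\<lambda>x. uncvec (rep_L2 (fclass f) x))" "AE x in torus. uncvec (rep_L2 (fclass f) x) = f x"
proof -
  have "L2_rel (rep_L2 (fclass f)) (\<lambda>x. cvec (f x))"
    unfolding fclass_def
    by (rule Quotient_rep_abs[OF Quotient_L2_torus]) (use assms in \<open>simp add: sqint_def L2_rel_refl\<close>)
  then have *: "square_integrable (rep_L2 (fclass f))" "AE x in torus. rep_L2 (fclass f) x = cvec (f x)"
    by (auto simp: L2_rel_def)
  show "sqint (\<lambda>x. uncvec (rep_L2 (fclass f) x))" using *(1) by (simp add: sqint_def)
  show "AE x in torus. uncvec (rep_L2 (fclass f) x) = f x" using *(2) by eventually_elim simp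
qed

lemma mop_fclass:
  assumes "cper p" "cper q" "sqint f"
  shows "mop p q (fclass f) = fclass (\<lambda>x. p x * f x + q x * cnj (f x))"
proof -
  note r = rep_fclass[OF assms(3)]
  show ?thesis
    unfolding mop_def
    by (subst (1 2) fclass_def, rule L2_class_eqI_AE)
       (use sqint_mop[OF assms(1,2) r(1)] sqint_mop[OF assms] r(2) in \<open>auto simp: sqint_def elim: eventually_mono\<close>)
qed

lemma bounded_mop:
  assumes p: "cper p" and q: "cper q" and A: "\<And>x. cmod (p x) \<le> A" and B: "\<And>x. cmod (q x) \<le> B"
  shows "bounded_linear (mop p q)" "norm (mop p q u) \<le> (A + B) * norm u"
proof -
  have nrm: "norm (mop p q u) \<le> (A + B) * norm u" for u
  proof -
    obtain f where f: "sqint f" "u = fclass f" by (rule fclass_cases)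
    note sq = sqint_mop[OF p q f(1)]
    have AB: "0 \<le> A" "0 \<le> B" using A[of 0] B[of 0] norm_ge_zero order_trans by blast+
    have "(norm (mop p q u))\<^sup>2 \<le> (LINT x|torus. (A + B)\<^sup>2 * (cmod (f x))\<^sup>2)"
      unfolding f(2) mop_fclass[OF p q f(1)] norm_fclass[OF sq]
    proof (rule integral_mono)
      fix x
      have "cmod (p x * f x + q x * cnj (f x)) \<le> A * cmod (f x) + B * cmod (f x)"
        by (rule order_trans[OF norm_triangle_ineq])
           (auto simp: norm_mult intro!: add_mono mult_right_mono A B)
      then have "(cmod (p x * f x + q x * cnj (f x)))\<^sup>2 \<le> ((A + B) * cmod (f x))\<^sup>2"
        by (intro power_mono) (auto simp: ring_distribs)
      then show "(cmod (p x * f x + q x * cnj (f x)))\<^sup>2 \<le> (A + B)\<^sup>2 * (cmod (f x))\<^sup>2"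
        by (simp add: power_mult_distrib)
    qed (use sq f(1) in \<open>auto simp: sqint_def square_integrable_def\<close>)
    also have "\<dots> = ((A + B) * norm u)\<^sup>2"
      by (simp add: f(2) power_mult_distrib norm_fclass[OF f(1)])
    finally show ?thesis by (rule power2_le_imp_le) (use AB in simp)
  qed
  then show "norm (mop p q u) \<le> (A + B) * norm u" .
  show "bounded_linear (mop p q)"
  proof (rule bounded_linear_intro[of _ "A + B"])
    fix u v r
    obtain f where f: "sqint f" "u = fclass f" by (rule fclass_cases)
    obtain g where g: "sqint g" "v = fclass g" by (rule fclass_cases)
    show "mop p q (u + v) = mop p q u + mop p q v"
      unfolding f(2) g(2) fclass_add[OF f(1) g(1), symmetric]
        mop_fclass[OF p q f(1)] mop_fclass[OF p q g(1)] mop_fclass[OF p q sqint_add[OF f(1) g(1)]]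
        fclass_add[OF sqint_mop[OF p q f(1)] sqint_mop[OF p q g(1)], symmetric]
      by (simp add: algebra_simps)
    show "mop p q (r *\<^sub>R u) = r *\<^sub>R mop p q u"
      unfolding f(2) fclass_scaleR[OF f(1), symmetric]
        mop_fclass[OF p q f(1)] mop_fclass[OF p q sqint_scaleR[OF f(1)]]
        fclass_scaleR[OF sqint_mop[OF p q f(1)], symmetric]
      by (simp add: algebra_simps)
    show "norm (mop p q u) \<le> norm u * (A + B)" by (metis nrm mult.commute)
  qed
qed

lemma bounded_linear_mop: "cper p \<Longrightarrow> cper q \<Longrightarrow> bounded_linear (mop p q)"
  by (metis bounded_mop(1) cper_bounded)

lemma mop_fmode:
  assumes "cper p" "cper q"
  shows "mop p q (fmode n c) = fclass (\<lambda>x. p x * (c * cis (of_int n * x)) + q x * cnj (c * cis (of_int n * x)))"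
  unfolding fmode_def by (rule mop_fclass[OF assms cper_sqint[OF cper_fmode]])

subsection \<open>Smooth periodic functions\<close>

definition smp :: "(real \<Rightarrow> complex) \<Rightarrow> bool" where
  "smp f \<longleftrightarrow> smooth f \<and> periodic f"

lemma smp_smooth: "smp f \<Longrightarrow> smooth f" by (simp add: smp_def)

lemma smp_cper: "smp f \<Longrightarrow> cper f" by (auto simp: smp_def cper_def smooth_continuous)

lemma smp_add: "smp f \<Longrightarrow> smp g \<Longrightarrow> smp (\<lambda>x. f x + g x)"
  by (auto simp: smp_def periodic_def smooth_add)

lemma smp_diff: "smp f \<Longrightarrow> smp g \<Longrightarrow> smp (\<lambda>x. f x - g x)"
  by (auto simp: smp_def periodic_def smooth_diff)

lemma smp_minus: "smp f \<Longrightarrow> smp (\<lambda>x. - f x)"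
  by (auto simp: smp_def periodic_def smooth_minus)

lemma smp_mult: "smp f \<Longrightarrow> smp g \<Longrightarrow> smp (\<lambda>x. f x * g x)"
  by (auto simp: smp_def periodic_def smooth_mult)

lemma smp_cnj: "smp f \<Longrightarrow> smp (\<lambda>x. cnj (f x))"
  by (auto simp: smp_def periodic_def smooth_cnj)

lemma smp_const: "smp (\<lambda>x. c)"
  by (auto simp: smp_def periodic_def smooth_const)

lemma smp_vderiv: "smp f \<Longrightarrow> smp (vderiv f)"
  by (auto simp: smp_def periodic_def smooth_vderiv vderiv_periodic)

lemma smp_cis: "smp (\<lambda>x. cis (of_int n * x))"
  using cper_cis[of n] by (auto simp: smp_def cper_def smooth_cis)

lemmas smp_intros = smp_add smp_diff smp_minus smp_mult smp_cnj smp_const smp_vderiv smp_cis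

definition mean :: "(real \<Rightarrow> complex) \<Rightarrow> complex" where
  "mean f = integral {0..2*pi} f / of_real (2 * pi)"

lemma smp_integrable: "smp f \<Longrightarrow> f integrable_on {0..2*pi}"
  by (intro integrable_continuous_interval smooth_continuous smp_smooth)

lemma mean_diff: "smp f \<Longrightarrow> smp g \<Longrightarrow> mean (\<lambda>x. f x - g x) = mean f - mean g"
  by (simp add: mean_def integral_diff smp_integrable diff_divide_distrib)

lemma mean_const: "mean (\<lambda>x. c) = c"
  by (simp add: mean_def scaleR_conv_of_real)

lemma mean_cmult: "mean (\<lambda>x. c * f x) = c * mean f"
  by (simp add: mean_def integral_mult_right)

lemma mean_cnj: "smp f \<Longrightarrow> mean (\<lambda>x. cnj (f x)) = cnj (mean f)"
  unfolding mean_def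
  using integral_linear[OF smp_integrable bounded_linear_cnj, of f] by (simp add: o_def)

lemma mean_vderiv:
  assumes "smp F"
  shows "mean (vderiv F) = 0"
proof -
  have "(vderiv F has_integral (F (2*pi) - F 0)) {0..2*pi}"
    by (rule fundamental_theorem_of_calculus)
       (use smooth_has_vderiv[OF smp_smooth[OF assms]] in \<open>auto intro: has_vector_derivative_at_within\<close>)
  moreover have "F (2*pi) = F 0"
    using assms unfolding smp_def periodic_def by (metis add_0)
  ultimately show ?thesis by (simp add: mean_def integral_unique)
qed

text \<open>The increment of an antiderivative over one period is a constant, namely the integral of
  f over a period. This is the solvability condition behind the whole criterion: it allows only
  coefficients with mean zero to be removed.\<close>

lemma smp_antiderivative:
  assumes f: "smp f" and m: "mean f = 0"
  obtains F where "smp F" "vderiv F = f"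
proof -
  obtain F where F: "\<And>x. (F has_vector_derivative f x) (at x)"
    using continuous_antiderivative[OF smooth_continuous[OF smp_smooth[OF f]]] by blast
  have vF: "vderiv F = f" by (rule vderivI[OF F])
  have sF: "smooth F" by (rule smoothI[OF F smp_smooth[OF f]])
  have per: "f (x + 2*pi) = f x" for x using f by (auto simp: smp_def periodic_def)
  have "((\<lambda>x. F (x + 2*pi) - F x) has_vector_derivative 0) (at x)" for x
  proof -
    have "((\<lambda>x. F (1 * x + 2*pi)) has_vector_derivative 1 *\<^sub>R f (1 * x + 2*pi)) (at x)"
      by (rule has_vector_derivative_compose_affine[OF F])
    then have "((\<lambda>x. F (x + 2*pi)) has_vector_derivative f x) (at x)"
      by (simp only: mult_1 scaleR_one per)
    from has_vector_derivative_diff[OF this F[of x]] show ?thesis by simp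
  qed
  then obtain c where c: "\<And>x. F (x + 2*pi) - F x = c"
    using has_vector_derivative_zero_constant[of UNIV "\<lambda>x. F (x + 2*pi) - F x"] by auto
  have "(f has_integral (F (2*pi) - F 0)) {0..2*pi}"
    by (rule fundamental_theorem_of_calculus) (auto intro: has_vector_derivative_at_within F)
  then have "F (2*pi) - F 0 = 0" using m by (simp add: mean_def integral_unique)
  then have "c = 0" using c[of 0] by simp
  then have "periodic F" using c by (simp add: periodic_def)
  then show ?thesis using that sF vF by (simp add: smp_def)
qed

lemma integration_by_parts:
  assumes u: "smp u" and v: "smp v"
  shows "fclass (vderiv u) \<bullet> fclass v = - (fclass u \<bullet> fclass (vderiv v))"
proof -
  note su = smp_smooth[OF u] and sv = smp_smooth[OF v]
  note sq = cper_sqint[OF smp_cper]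
  let ?f = "\<lambda>x. Re (u x * cnj (vderiv v x) + vderiv u x * cnj (v x))"
  have d: "((\<lambda>x. Re (u x * cnj (v x))) has_vector_derivative ?f x) (at x)" for x
    by (intro bounded_linear.has_vector_derivative[OF bounded_linear_Re] has_vector_derivative_mult
        bounded_linear.has_vector_derivative[OF bounded_linear_cnj] smooth_has_vderiv su sv)
  have "smp (\<lambda>x. u x * cnj (vderiv v x) + vderiv u x * cnj (v x))"
    by (intro smp_intros u v)
  then have "continuous_on UNIV ?f"
    by (intro continuous_on_Re smooth_continuous smp_smooth)
  from torus_integral_primitive[OF primitive_of_deriv[OF d this] this]
  have "(LINT x|torus. ?f x) = Re (u (2*pi) * cnj (v (2*pi))) - Re (u 0 * cnj (v 0))" .
  moreover have "u (2*pi) = u 0" "v (2*pi) = v 0"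
    using u v unfolding smp_def periodic_def by (metis add_0)+
  ultimately have 0: "(LINT x|torus. ?f x) = 0" by simp
  have i: "integrable torus (\<lambda>x. Re (f x * cnj (g x)))" if "smp f" "smp g" for f g
    using square_integrable_inner[of "\<lambda>x. cvec (f x)" "\<lambda>x. cvec (g x)"] sq[OF that(1)] sq[OF that(2)]
    by (simp add: sqint_def inner_cvec)
  have "fclass u \<bullet> fclass (vderiv v) + fclass (vderiv u) \<bullet> fclass v = (LINT x|torus. ?f x)"
    using Bochner_Integration.integral_add[OF i[OF u smp_vderiv[OF v]] i[OF smp_vderiv[OF u] v]]
    by (simp add: fclass_inner sq u v smp_vderiv)
  then show ?thesis using 0 by simp
qed

lemma vderiv_times_cis:
  assumes "smooth p"
  shows "vderiv (\<lambda>x. p x * (a * cis (of_int n * x))) =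
    (\<lambda>x. (vderiv p x + \<i> * of_int n * p x) * (a * cis (of_int n * x)))"
proof -
  have s: "smooth (\<lambda>x. a * cis (of_int n * x))" by (intro smooth_mult smooth_const smooth_cis)
  have "vderiv (\<lambda>x. a * cis (of_int n * x)) = (\<lambda>x. \<i> * of_int n * (a * cis (of_int n * x)))"
    by (subst vderiv_mult) (auto simp: smooth_const smooth_cis vderiv_const vderiv_cis)
  then show ?thesis
    by (subst vderiv_mult[OF assms s]) (auto simp: algebra_simps)
qed

lemma coef_vderiv:
  assumes "smp u"
  shows "coef (fclass (vderiv u)) n = \<i> * of_int n * coef (fclass u) n"
proof (rule coefI)
  fix c
  have "smp (\<lambda>x. c * cis (of_int n * x))" by (intro smp_intros)
  from integration_by_parts[OF assms this]
  have "fclass (vderiv u) \<bullet> fmode n c = - (fclass u \<bullet> fclass (vderiv (\<lambda>x. c * cis (of_int n * x))))"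
    by (simp add: fmode_def)
  also have "vderiv (\<lambda>x. c * cis (of_int n * x)) = (\<lambda>x. (\<i> * of_int n * c) * cis (of_int n * x))"
    using vderiv_times_cis[OF smooth_const[of 1], of c n] by (simp add: vderiv_const mult_ac)
  also have "fclass \<dots> = fmode n (\<i> * of_int n * c)" by (simp add: fmode_def)
  finally show "fclass (vderiv u) \<bullet> fmode n c = 2 * pi * Re (\<i> * of_int n * coef (fclass u) n * cnj c)"
    by (simp add: inner_fmode_coef algebra_simps)
qed

subsection \<open>The normal form\<close>

text \<open>In the next two identities \<open>l\<close> stands for the symbol of \<open>\<partial>\<^sup>-\<^sup>1\<close>, and the digits in \<open>pjk\<close> (and likewise
  \<open>rjk\<close>, \<open>sjk\<close>, \<open>tjk\<close>) denote the \<open>k\<close>-th derivative of the coefficient of \<open>\<partial>\<^sup>-\<^sup>j\<close> in the conjugating operator.  The assumptions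
  make all terms with positive powers of the frequency cancel, up to the constant-coefficient symbol.\<close>

lemma symbol_identity_linear:
  fixes \<nu> l :: complex
  assumes \<nu>: "\<nu> * l = 1"
    and b: "b = B - 4 * \<i> * p11" and c: "c = C - 6 * \<i> * p12 + 4 * \<i> * p11 * p10 - 4 * \<i> * p21"
  shows "\<i> * ((p14 * l + p24 * l^2) + 4 * \<nu> * (p13 * l + p23 * l^2) + 6 * \<nu>^2 * (p12 * l + p22 * l^2)
        + 4 * \<nu>^3 * (p11 * l + p21 * l^2) + \<nu>^4 * (1 + p10 * l + p20 * l^2))
      + b * ((p12 * l + p22 * l^2) + 2 * \<nu> * (p11 * l + p21 * l^2) + \<nu>^2 * (1 + p10 * l + p20 * l^2))
      + bt * ((s22 * l^2 + s32 * l^3) + 2 * \<nu> * (s21 * l^2 + s31 * l^3) + \<nu>^2 * (s20 * l^2 + s30 * l^3))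
      + c * ((p11 * l + p21 * l^2) + \<nu> * (1 + p10 * l + p20 * l^2))
      + ct * ((s21 * l^2 + s31 * l^3) + \<nu> * (s20 * l^2 + s30 * l^3))
      + d * (1 + p10 * l + p20 * l^2) + dt * (s20 * l^2 + s30 * l^3)
    = (\<i> * \<nu>^4 + B * \<nu>^2 + C * \<nu>) * (1 + p10 * l + p20 * l^2)
      + (\<i> * (4 * p13 + 6 * p22) + (b - B) * p20 + 2 * b * p11 + (c - C) * p10 + d + bt * s20)
      + (\<i> * (p14 + 4 * p23) + b * p12 + 2 * b * p21 + c * p11 + (c - C) * p20 + d * p10
          + bt * (2 * s21 + s30) + ct * s20) * l
      + (\<i> * p24 + b * p22 + c * p21 + d * p20 + bt * (s22 + 2 * s31) + ct * (s21 + s30) + dt * s20) * l^2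
      + (bt * s32 + ct * s31 + dt * s30) * l^3"
proof -
  have r: "\<nu>^2 * l = \<nu>" "\<nu>^2 * l^2 = 1" "\<nu>^3 * l = \<nu>^2" "\<nu>^3 * l^2 = \<nu>"
      "\<nu> * l^2 = l" "\<nu> * l^3 = l^2" "\<nu>^2 * l^3 = l"
    using \<nu> by algebra+
  show ?thesis unfolding b c using \<nu> r by algebra
qed

lemma symbol_identity_antilinear:
  fixes \<mu> m :: complex
  assumes \<mu>: "\<mu> * m = 1"
    and bt: "bt = - 2 * \<i> * r20" and ct: "ct = - 2 * \<i> * r30 - 4 * \<i> * r21 - bt * t10"
  shows "\<i> * ((r24 * m^2 + r34 * m^3) + 4 * \<mu> * (r23 * m^2 + r33 * m^3) + 6 * \<mu>^2 * (r22 * m^2 + r32 * m^3)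
        + 4 * \<mu>^3 * (r21 * m^2 + r31 * m^3) + \<mu>^4 * (r20 * m^2 + r30 * m^3))
      + b * ((r22 * m^2 + r32 * m^3) + 2 * \<mu> * (r21 * m^2 + r31 * m^3) + \<mu>^2 * (r20 * m^2 + r30 * m^3))
      + bt * ((t12 * m + t22 * m^2) + 2 * \<mu> * (t11 * m + t21 * m^2) + \<mu>^2 * (1 + t10 * m + t20 * m^2))
      + c * ((r21 * m^2 + r31 * m^3) + \<mu> * (r20 * m^2 + r30 * m^3))
      + ct * ((t11 * m + t21 * m^2) + \<mu> * (1 + t10 * m + t20 * m^2))
      + d * (r20 * m^2 + r30 * m^3) + dt * (1 + t10 * m + t20 * m^2)
    = (- \<i> * \<mu>^4 + B * \<mu>^2 + C * \<mu>) * (r20 * m^2 + r30 * m^3)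
      + (6 * \<i> * r22 + 4 * \<i> * r31 + (b - B) * r20 + 2 * bt * t11 + bt * t20 + ct * t10 + dt)
      + (4 * \<i> * r23 + 6 * \<i> * r32 + (b - B) * r30 + 2 * b * r21 + bt * t12 + 2 * bt * t21
          + (c - C) * r20 + ct * t11 + ct * t20 + dt * t10) * m
      + (\<i> * r24 + 4 * \<i> * r33 + 2 * b * r31 + b * r22 + bt * t22 + (c - C) * r30 + c * r21
          + ct * t21 + d * r20 + dt * t20) * m^2
      + (\<i> * r34 + b * r32 + c * r31 + d * r30) * m^3"
proof -
  have r: "\<mu>^2 * m = \<mu>" "\<mu>^2 * m^2 = 1" "\<mu>^3 * m^2 = \<mu>" "\<mu>^3 * m^3 = 1" "\<mu>^4 * m^2 = \<mu>^2" "\<mu>^4 * m^3 = \<mu>"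
      "\<mu> * m^2 = m" "\<mu> * m^3 = m^2" "\<mu>^2 * m^3 = m"
    using \<mu> by algebra+
  show ?thesis unfolding ct unfolding bt using \<mu> r by algebra
qed

text \<open>Wide enough for both the spatial operator and minus its formal adjoint: the zero-order
  coefficients d and d' are 0 for the former and arise in the latter when derivatives fall on the
  coefficients.\<close>

definition dop ::
  "(real \<Rightarrow> complex) \<Rightarrow> (real \<Rightarrow> complex) \<Rightarrow> (real \<Rightarrow> complex) \<Rightarrow> (real \<Rightarrow> complex) \<Rightarrow>
    (real \<Rightarrow> complex) \<Rightarrow> (real \<Rightarrow> complex) \<Rightarrow> (real \<Rightarrow> complex) \<Rightarrow> real \<Rightarrow> complex" where
  "dop b b' c c' d d' u = (\<lambda>x. \<i> * (vderiv ^^ 4) u x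
     + b x * (vderiv ^^ 2) u x + b' x * cnj ((vderiv ^^ 2) u x)
     + c x * vderiv u x + c' x * cnj (vderiv u x) + d x * u x + d' x * cnj (u x))"

lemma smp_vderiv_pow: "smp u \<Longrightarrow> smp ((vderiv ^^ k) u)"
  by (induction k) (auto intro: smp_vderiv)

lemma smp_dop:
  "smp b \<Longrightarrow> smp b' \<Longrightarrow> smp c \<Longrightarrow> smp c' \<Longrightarrow> smp d \<Longrightarrow> smp d' \<Longrightarrow> smp u \<Longrightarrow> smp (dop b b' c c' d d' u)"
  unfolding dop_def by (intro smp_intros smp_vderiv_pow)

lemma vderiv_pow_times_cis:
  assumes "smooth p"
  shows "(vderiv ^^ 2) (\<lambda>x. p x * (a * cis (of_int n * x))) = (\<lambda>x.
      ((vderiv ^^ 2) p x + 2 * (\<i> * of_int n) * vderiv p x + (\<i> * of_int n)^2 * p x) * (a * cis (of_int n * x)))"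
    and "(vderiv ^^ 4) (\<lambda>x. p x * (a * cis (of_int n * x))) = (\<lambda>x.
      ((vderiv ^^ 4) p x + 4 * (\<i> * of_int n) * (vderiv ^^ 3) p x + 6 * (\<i> * of_int n)^2 * (vderiv ^^ 2) p x
        + 4 * (\<i> * of_int n)^3 * vderiv p x + (\<i> * of_int n)^4 * p x) * (a * cis (of_int n * x)))"
proof -
  define \<nu> where "\<nu> = \<i> * of_int n"
  have step: "vderiv (\<lambda>x. q x * (a * cis (of_int n * x))) =
      (\<lambda>x. (vderiv q x + \<nu> * q x) * (a * cis (of_int n * x)))" if "smooth q" for q
    unfolding \<nu>_def by (rule vderiv_times_cis[OF that])
  have tw: "smooth (\<lambda>x. vderiv q x + \<nu> * q x)"
      "vderiv (\<lambda>x. vderiv q x + \<nu> * q x) = (\<lambda>x. vderiv (vderiv q) x + \<nu> * vderiv q x)" if "smooth q" for q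
    using that by (auto simp: smooth_add smooth_mult smooth_const smooth_vderiv vderiv_add vderiv_mult vderiv_const)
  have two: "vderiv (vderiv (\<lambda>x. q x * (a * cis (of_int n * x)))) = (\<lambda>x.
      (vderiv (vderiv q) x + 2 * \<nu> * vderiv q x + \<nu>^2 * q x) * (a * cis (of_int n * x)))" if q: "smooth q" for q
    unfolding step[OF q] step[OF tw(1)[OF q]] tw(2)[OF q]
    by (auto simp: fun_eq_iff power2_eq_square algebra_simps)
  have pw: "(vderiv ^^ 2) q = vderiv (vderiv q)" "(vderiv ^^ 3) q = vderiv (vderiv (vderiv q))"
    "(vderiv ^^ 4) q = vderiv (vderiv (vderiv (vderiv q)))" for q :: "real \<Rightarrow> complex"
    by (simp_all add: eval_nat_numeral)
  show "(vderiv ^^ 2) (\<lambda>x. p x * (a * cis (of_int n * x))) = (\<lambda>x.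
      ((vderiv ^^ 2) p x + 2 * (\<i> * of_int n) * vderiv p x + (\<i> * of_int n)^2 * p x) * (a * cis (of_int n * x)))"
    unfolding \<nu>_def[symmetric] pw by (rule two[OF assms])
  have s2: "smooth (\<lambda>x. vderiv (vderiv p) x + 2 * \<nu> * vderiv p x + \<nu>^2 * p x)"
    by (intro smooth_add smooth_mult smooth_const smooth_vderiv assms)
  have d2: "vderiv (\<lambda>x. vderiv (vderiv q) x + 2 * \<nu> * vderiv q x + \<nu>^2 * q x) =
      (\<lambda>x. vderiv (vderiv (vderiv q)) x + 2 * \<nu> * vderiv (vderiv q) x + \<nu>^2 * vderiv q x)" if "smooth q" for q
    using that by (simp add: smooth_add smooth_mult smooth_const smooth_vderiv vderiv_add vderiv_mult vderiv_const)
  show "(vderiv ^^ 4) (\<lambda>x. p x * (a * cis (of_int n * x))) = (\<lambda>x.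
      ((vderiv ^^ 4) p x + 4 * (\<i> * of_int n) * (vderiv ^^ 3) p x + 6 * (\<i> * of_int n)^2 * (vderiv ^^ 2) p x
        + 4 * (\<i> * of_int n)^3 * vderiv p x + (\<i> * of_int n)^4 * p x) * (a * cis (of_int n * x)))"
    unfolding \<nu>_def[symmetric] pw two[OF assms] two[OF s2] d2[OF assms] d2[OF smooth_vderiv[OF assms]]
    by (auto simp: fun_eq_iff power2_eq_square power3_eq_cube power4_eq_xxxx algebra_simps)
qed

lemma vderiv_combination:
  fixes p q :: "real \<Rightarrow> complex"
  assumes "smooth p" "smooth q"
  shows "(vderiv ^^ k) (\<lambda>x. p x * l + q x * l') = (\<lambda>x. (vderiv ^^ k) p x * l + (vderiv ^^ k) q x * l')"
    "smooth (\<lambda>x. p x * l + q x * l')"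
proof -
  show "(vderiv ^^ k) (\<lambda>x. p x * l + q x * l') = (\<lambda>x. (vderiv ^^ k) p x * l + (vderiv ^^ k) q x * l')"
    using assms
  proof (induction k arbitrary: p q)
    case (Suc k)
    have "vderiv (\<lambda>x. p x * l + q x * l') = (\<lambda>x. vderiv p x * l + vderiv q x * l')"
      by (intro vderivI has_vector_derivative_add smooth_has_vderiv Suc.prems
          bounded_linear.has_vector_derivative[OF bounded_linear_mult_left])
    then show ?case
      using Suc.IH[of "vderiv p" "vderiv q"] Suc.prems by (simp add: funpow_Suc_right smooth_vderiv del: funpow.simps)
  qed simp
qed (intro smooth_add smooth_mult smooth_const assms)

lemma vderiv_pow_1_plus:
  fixes p :: "real \<Rightarrow> complex"
  assumes "smooth p"
  shows "(vderiv ^^ Suc k) (\<lambda>x. 1 + p x) = (vderiv ^^ Suc k) p"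
  using vderiv_add[OF smooth_const[of 1] assms] by (simp add: funpow_Suc_right vderiv_const del: funpow.simps)

text \<open>For a single mode g the functions P g + R cnj g form an invariant class. Conjugation
  exchanges the two summands, so b', c' and d' couple R into the coefficient of g and P into that of
  cnj g, on which a derivative acts with the symbol \<open>cnj \<nu>\<close>.\<close>

lemma dop_exponential:
  fixes a :: complex and n :: int
  assumes P: "smooth P" and R: "smooth R"
  defines "g \<equiv> \<lambda>x. a * cis (of_int n * x)" and "\<nu> \<equiv> \<i> * of_int n"
  shows "dop b b' c c' d d' (\<lambda>x. P x * g x + R x * cnj (g x)) = (\<lambda>x.
    (\<i> * ((vderiv ^^ 4) P x + 4 * \<nu> * (vderiv ^^ 3) P x + 6 * \<nu>^2 * (vderiv ^^ 2) P x + 4 * \<nu>^3 * vderiv P x + \<nu>^4 * P x)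
      + b x * ((vderiv ^^ 2) P x + 2 * \<nu> * vderiv P x + \<nu>^2 * P x)
      + b' x * cnj ((vderiv ^^ 2) R x + 2 * cnj \<nu> * vderiv R x + (cnj \<nu>)^2 * R x)
      + c x * (vderiv P x + \<nu> * P x) + c' x * cnj (vderiv R x + cnj \<nu> * R x)
      + d x * P x + d' x * cnj (R x)) * g x
    + (\<i> * ((vderiv ^^ 4) R x + 4 * cnj \<nu> * (vderiv ^^ 3) R x + 6 * (cnj \<nu>)^2 * (vderiv ^^ 2) R x
        + 4 * (cnj \<nu>)^3 * vderiv R x + (cnj \<nu>)^4 * R x)
      + b x * ((vderiv ^^ 2) R x + 2 * cnj \<nu> * vderiv R x + (cnj \<nu>)^2 * R x)
      + b' x * cnj ((vderiv ^^ 2) P x + 2 * \<nu> * vderiv P x + \<nu>^2 * P x)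
      + c x * (vderiv R x + cnj \<nu> * R x) + c' x * cnj (vderiv P x + \<nu> * P x)
      + d x * R x + d' x * cnj (P x)) * cnj (g x))"
proof -
  have cg: "cnj (g x) = cnj a * cis (of_int (- n) * x)" for x
    by (simp add: g_def cis_cnj)
  have gx: "a * cis (of_int n * x) = g x" for x by (simp add: g_def)
  have c\<nu>: "cnj \<nu> = \<i> * of_int (- n)" by (simp add: \<nu>_def)
  let ?u = "\<lambda>x. P x * g x + R x * cnj (g x)"
  have sg: "smooth g" "smooth (\<lambda>x. cnj (g x))"
    unfolding g_def by (intro smooth_mult smooth_const smooth_cis smooth_cnj)+
  have dk: "(vderiv ^^ k) ?u = (\<lambda>x. (vderiv ^^ k) (\<lambda>x. P x * g x) x + (vderiv ^^ k) (\<lambda>x. R x * cnj (g x)) x)" for k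
    using vderiv_combination(1)[OF smooth_mult[OF P sg(1)] smooth_mult[OF R sg(2)], of k 1 1] by simp
  note dP = vderiv_times_cis[OF P, of a n, unfolded gx, folded \<nu>_def]
    vderiv_pow_times_cis[OF P, of a n, unfolded gx, folded \<nu>_def]
  note dR = vderiv_times_cis[OF R, of "cnj a" "- n", folded cg c\<nu>]
    vderiv_pow_times_cis[OF R, of "cnj a" "- n", folded cg c\<nu>]
  show ?thesis
    unfolding dop_def dk dk[of 1, simplified] dP dR
    by (rule ext) (simp add: algebra_simps)
qed

lemma fclass_add4:
  assumes "sqint f" "sqint g" "sqint h" "sqint k"
  shows "fclass f + fclass g + fclass h + fclass k = fclass (\<lambda>x. f x + g x + h x + k x)"
  by (simp add: fclass_add sqint_add assms)

text \<open>With \<open>\<partial>\<^sup>-\<^sup>1\<close> acting on frequencies \<open>\<bar>n\<bar> > M\<close> only, take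
  \<open>S u = u + p1 \<partial>\<^sup>-\<^sup>1 u + (p2 \<partial>\<^sup>-\<^sup>2 u + r2 cnj (\<partial>\<^sup>-\<^sup>2 u)) + r3 cnj (\<partial>\<^sup>-\<^sup>3 u)\<close>.  The coefficients \<open>r2\<close> and \<open>r3\<close> remove
  the conjugate-linear terms, because \<open>\<i> \<partial>\<^sup>4\<close> anticommutes with conjugation; \<open>p1\<close> and \<open>p2\<close> solve first order
  equations whose right-hand sides have mean zero, hence are periodic, and replace \<open>b\<close> and \<open>c\<close> by their means.
  A large \<open>M\<close> makes \<open>S - 1\<close> small.\<close>

theorem normal_form:
  fixes b b' c c' d d' :: "real \<Rightarrow> complex"
  assumes smp: "smp b" "smp b'" "smp c" "smp c'" "smp d" "smp d'"
  obtains S Q s where "bounded_linear S" "bounded_linear Q" "\<And>u. norm (S u - u) \<le> norm u / 2"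
    "\<And>n a. smp (s n a)" "\<And>n a. S (fmode n a) = fclass (s n a)"
    "\<And>n a. fclass (dop b b' c c' d d' (s n a)) =
      S (fmode n ((\<i> * of_int n ^ 4 - of_int n ^ 2 * mean b + \<i> * of_int n * mean c) * a)) + Q (fmode n a)"
proof -
  define B C where "B = mean b" and "C = mean c"
  define \<nu> where "\<nu> n = \<i> * of_int n" for n :: int
  define N where "N n = \<i> * \<nu> n ^ 4 + B * \<nu> n ^ 2 + C * \<nu> n" for n
  have N: "\<i> * of_int n ^ 4 - of_int n ^ 2 * mean b + \<i> * of_int n * mean c = N n" for n
  proof -
    have "\<i> ^ 4 = (1::complex)" by (simp add: power4_eq_xxxx)
    then show ?thesis by (simp add: N_def \<nu>_def B_def C_def power_mult_distrib)
  qed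
  have "mean (\<lambda>x. \<i> / 4 * (b x - B)) = 0" "mean (\<lambda>x. \<i> / 4 * (c x - C)) = 0"
    by (simp_all only: mean_cmult mean_diff smp smp_const mean_const B_def C_def) simp_all
  moreover have "smp (\<lambda>x. \<i> / 4 * (b x - B))" "smp (\<lambda>x. \<i> / 4 * (c x - C))"
    by (intro smp_intros smp)+
  ultimately obtain p1 h where p1: "smp p1" "vderiv p1 = (\<lambda>x. \<i> / 4 * (b x - B))"
    and h: "smp h" "vderiv h = (\<lambda>x. \<i> / 4 * (c x - C))"
    by (metis smp_antiderivative)
  \<comment> \<open>The explicit integral of the second cancellation equation: p1'' and p1 p1' are
    derivatives already, so only \<open>c - C\<close> calls for an antiderivative, namely h, and p2
    is periodic.\<close>
  define p2 where "p2 = (\<lambda>x. - 3 / 2 * vderiv p1 x + (1 / 2 * p1 x) * p1 x + h x)"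
  \<comment> \<open>The factor \<open>\<i> / 2\<close> inverts the \<open>- 2 \<i>\<close> that
    anticommutation leaves in front of r2.\<close>
  define r2 where "r2 = (\<lambda>x. \<i> / 2 * b' x)"
  define r3 where "r3 = (\<lambda>x. \<i> / 2 * (4 * \<i> * vderiv r2 x + b' x * cnj (p1 x) + c' x))"
  have p2: "smp p2" and r2: "smp r2" and r3: "smp r3"
    unfolding p2_def r2_def r3_def by (intro smp_intros smp p1 h)+
  have sm: "smooth p1" "smooth p2" "smooth r2" "smooth r3" "smooth h"
    using p1 p2 r2 r3 h by (auto intro: smp_smooth)
  have p1b: "b x = B - 4 * \<i> * vderiv p1 x" for x
    by (simp add: p1(2) field_simps)
  have vp2: "vderiv p2 x = - 3 / 2 * (vderiv ^^ 2) p1 x + p1 x * vderiv p1 x + \<i> / 4 * (c x - C)" for x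
  proof -
    have "vderiv p2 = (\<lambda>x. - 3 / 2 * vderiv (vderiv p1) x + (1 / 2 * p1 x * vderiv p1 x + 1 / 2 * vderiv p1 x * p1 x) + vderiv h x)"
      unfolding p2_def
      by (intro vderivI has_vector_derivative_add has_vector_derivative_mult smooth_has_vderiv
          bounded_linear.has_vector_derivative[OF bounded_linear_mult_right] smooth_vderiv sm)
    then show ?thesis by (simp add: h(2) numeral_2_eq_2)
  qed
  have p2c: "c x = C - 6 * \<i> * (vderiv ^^ 2) p1 x + 4 * \<i> * vderiv p1 x * p1 x - 4 * \<i> * vderiv p2 x" for x
    unfolding vp2 by (simp add: field_simps)
  have r2b: "b' x = - 2 * \<i> * r2 x" for x by (simp add: r2_def)
  have r3c: "c' x = - 2 * \<i> * r3 x - 4 * \<i> * vderiv r2 x - b' x * cnj (p1 x)" for x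
    by (simp add: r3_def algebra_simps)
  let ?D = "\<lambda>k f x. (vderiv ^^ k) f x"
  \<comment> \<open>The remainders are read off from the right-hand sides of the two symbol
    identities: \<open>wk\<close> belongs to the k-th power of the inverse symbol in front of the
    mode, \<open>vk\<close> to that in front of the conjugate mode.\<close>
  define w0 where "w0 = (\<lambda>x. \<i> * (4 * ?D 3 p1 x + 6 * ?D 2 p2 x) + (b x - B) * p2 x + 2 * b x * vderiv p1 x
    + (c x - C) * p1 x + d x + b' x * cnj (r2 x))"
  define w1 where "w1 = (\<lambda>x. \<i> * (?D 4 p1 x + 4 * ?D 3 p2 x) + b x * ?D 2 p1 x + 2 * b x * vderiv p2 x
    + c x * vderiv p1 x + (c x - C) * p2 x + d x * p1 x + b' x * (2 * cnj (vderiv r2 x) + cnj (r3 x)) + c' x * cnj (r2 x))"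
  define w2 where "w2 = (\<lambda>x. \<i> * ?D 4 p2 x + b x * ?D 2 p2 x + c x * vderiv p2 x + d x * p2 x
    + b' x * (cnj (?D 2 r2 x) + 2 * cnj (vderiv r3 x)) + c' x * (cnj (vderiv r2 x) + cnj (r3 x)) + d' x * cnj (r2 x))"
  define w3 where "w3 = (\<lambda>x. b' x * cnj (?D 2 r3 x) + c' x * cnj (vderiv r3 x) + d' x * cnj (r3 x))"
  define v0 where "v0 = (\<lambda>x. 6 * \<i> * ?D 2 r2 x + 4 * \<i> * vderiv r3 x + (b x - cnj B) * r2 x
    + 2 * b' x * cnj (vderiv p1 x) + b' x * cnj (p2 x) + c' x * cnj (p1 x) + d' x)"
  define v1 where "v1 = (\<lambda>x. 4 * \<i> * ?D 3 r2 x + 6 * \<i> * ?D 2 r3 x + (b x - cnj B) * r3 x + 2 * b x * vderiv r2 x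
    + b' x * cnj (?D 2 p1 x) + 2 * b' x * cnj (vderiv p2 x) + (c x - cnj C) * r2 x + c' x * cnj (vderiv p1 x)
    + c' x * cnj (p2 x) + d' x * cnj (p1 x))"
  define v2 where "v2 = (\<lambda>x. \<i> * ?D 4 r2 x + 4 * \<i> * ?D 3 r3 x + 2 * b x * vderiv r3 x + b x * ?D 2 r2 x
    + b' x * cnj (?D 2 p2 x) + (c x - cnj C) * r3 x + c x * vderiv r2 x + c' x * cnj (vderiv p2 x) + d x * r2 x
    + d' x * cnj (p2 x))"
  define v3 where "v3 = (\<lambda>x. \<i> * ?D 4 r3 x + b x * ?D 2 r3 x + c x * vderiv r3 x + d x * r3 x)"
  \<comment> \<open>Low frequencies: S is the identity on these modes, so the whole difference
    between the operator and its model \<open>N n\<close> is put into the remainder.\<close>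
  define wf vf where "wf n = (\<lambda>x. \<i> * \<nu> n ^ 4 + b x * \<nu> n ^ 2 + c x * \<nu> n + d x - N n)"
    and "vf n = (\<lambda>x. b' x * cnj (\<nu> n) ^ 2 + c' x * cnj (\<nu> n) + d' x)" for n
  have cp0: "cper (\<lambda>x. 0)" by (rule cper_const)
  have cpp: "cper p1" "cper p2" "cper r2" "cper r3" using p1 p2 r2 r3 by (auto intro: smp_cper)
  have cw: "cper w0" "cper w1" "cper w2" "cper w3" "cper v0" "cper v1" "cper v2" "cper v3"
    unfolding w0_def w1_def w2_def w3_def v0_def v1_def v2_def v3_def
    by (intro smp_cper smp_intros smp_vderiv_pow smp p1 p2 r2 r3)+
  have cwf: "cper (wf n)" "cper (vf n)" for n
    unfolding wf_def vf_def by (intro smp_cper smp_intros smp)+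
  obtain A1 A2 A2' A3 where A: "\<And>x. cmod (p1 x) \<le> A1" "\<And>x. cmod (p2 x) \<le> A2"
      "\<And>x. cmod (r2 x) \<le> A2'" "\<And>x. cmod (r3 x) \<le> A3" "0 < A1" "0 < A2" "0 < A2'" "0 < A3"
    using cpp cper_bounded by metis
  \<comment> \<open>Each power of the cut-off inverse derivative has norm at most 1 / (M + 1), so
    this size of M bounds \<open>S - 1\<close> by 1/2.\<close>
  obtain M :: nat where M: "2 * (A1 + (A2 + A2') + A3) \<le> real M"
    using real_arch_simple by blast
  define l where "l n = (if \<bar>n\<bar> > int M then 1 / \<nu> n else 0)" for n
  have l1: "cmod (l n) \<le> 1 / (real M + 1)" for n
  proof (cases "\<bar>n\<bar> > int M")
    case True
    then have "real M + 1 \<le> \<bar>of_int n\<bar>" by linarith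
    then show ?thesis using True
      by (simp add: l_def \<nu>_def norm_divide norm_mult frac_le)
  qed (simp add: l_def)
  have lk: "cmod (l n ^ Suc k) \<le> 1 / (real M + 1)" for n k
  proof -
    have "cmod (l n) \<le> 1" by (rule order_trans[OF l1]) simp
    then have "cmod (l n) ^ k \<le> 1" by (intro power_le_one) auto
    then have "cmod (l n) * cmod (l n) ^ k \<le> cmod (l n) * 1" by (intro mult_left_mono) auto
    then show ?thesis using l1[of n] by (simp add: norm_power norm_mult)
  qed
  define z where "z n = (if \<bar>n\<bar> > int M then 1 else 0 :: complex)" for n
  define \<delta> where "\<delta> m n = (if n = m then 1 else 0 :: complex)" for m n :: int
  have z1: "cmod (z n) \<le> 1" for n by (simp add: z_def)
  have \<delta>1: "cmod (\<delta> m n) \<le> 1" for m n by (simp add: \<delta>_def)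
  let ?M = "\<lambda>k. multiplier (\<lambda>n. l n ^ Suc k)"
  have blM: "bounded_linear (?M k)" for k by (rule bounded_linear_multiplier[OF lk])
  have nM: "norm (?M k u) \<le> norm u / (real M + 1)" for k u
    using norm_multiplier_le[of "\<lambda>n. l n ^ Suc k", OF lk, of u] by simp
  have Me: "?M k (fmode n a) = fmode n (l n ^ Suc k * a)" for k n a by (rule multiplier_fmode[OF lk])
  define S where "S u = u + (mop p1 (\<lambda>x. 0) (?M 0 u) + mop p2 r2 (?M 1 u) + mop (\<lambda>x. 0) r3 (?M 2 u))" for u
  \<comment> \<open>\<open>z\<close> restricts the order-zero remainder to high frequencies, the
    next three terms carry the cut-off inside \<open>l\<close>, and \<open>\<delta> m\<close>
    isolates the finitely many low modes.\<close>
  define Q where "Q u = mop w0 v0 (multiplier z u) + mop w1 v1 (?M 0 u) + mop w2 v2 (?M 1 u) + mop w3 v3 (?M 2 u)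
     + (\<Sum>m\<in>{-int M..int M}. mop (wf m) (vf m) (multiplier (\<delta> m) u))" for u
  have blS: "bounded_linear S"
    unfolding S_def
    by (intro bounded_linear_add bounded_linear_ident bounded_linear_compose[OF bounded_linear_mop blM] cpp cp0)
  have blQ: "bounded_linear Q"
    unfolding Q_def
    by (intro bounded_linear_add bounded_linear_sum bounded_linear_compose[OF bounded_linear_mop blM]
        bounded_linear_compose[OF bounded_linear_mop bounded_linear_multiplier[OF z1]]
        bounded_linear_compose[OF bounded_linear_mop bounded_linear_multiplier[OF \<delta>1]] cw cwf)
  have nS: "norm (S u - u) \<le> norm u / 2" for u
  proof -
    define K where "K = norm u / (real M + 1)"
    have bm: "norm (mop p q (?M k u)) \<le> (A + A') * K"
      if "cper p" "cper q" "\<And>x. cmod (p x) \<le> A" "\<And>x. cmod (q x) \<le> A'" "0 \<le> A" "0 \<le> A'" for p q A A' k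
      unfolding K_def
      by (rule order_trans[OF bounded_mop(2)[OF that(1-4)] mult_left_mono[OF nM]]) (use that in simp)
    have a: "norm (mop p1 (\<lambda>x. 0) (?M 0 u)) \<le> (A1 + 0) * K"
      by (rule bm) (use A cpp cp0 in \<open>simp_all add: less_imp_le\<close>)
    have b: "norm (mop p2 r2 (?M 1 u)) \<le> (A2 + A2') * K"
      by (rule bm) (use A cpp cp0 in \<open>simp_all add: less_imp_le\<close>)
    have c: "norm (mop (\<lambda>x. 0) r3 (?M 2 u)) \<le> (0 + A3) * K"
      by (rule bm) (use A cpp cp0 in \<open>simp_all add: less_imp_le\<close>)
    have "norm (S u - u) \<le> norm (mop p1 (\<lambda>x. 0) (?M 0 u)) + norm (mop p2 r2 (?M 1 u)) + norm (mop (\<lambda>x. 0) r3 (?M 2 u))"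
      unfolding S_def add_diff_cancel_left' by (intro order_trans[OF norm_triangle_ineq] add_mono norm_triangle_ineq order_refl)
    also have "\<dots> \<le> (A1 + (A2 + A2') + A3) * K"
      by (rule order_trans[OF add_mono[OF add_mono[OF a b] c]])
         (simp only: distrib_right add_0 add_0_right order_refl)
    also have "\<dots> \<le> (real M + 1) / 2 * K"
      using M by (intro mult_right_mono) (auto simp: K_def)
    also have "\<dots> = norm u / 2" by (simp add: K_def divide_simps)
    finally show ?thesis .
  qed
  define P where "P n = (\<lambda>x. 1 + (p1 x * l n + p2 x * l n ^ 2))" for n
  define R where "R n = (\<lambda>x. r2 x * cnj (l n) ^ 2 + r3 x * cnj (l n) ^ 3)" for n
  have Px: "P n x = 1 + (p1 x * l n + p2 x * l n ^ 2)"
    and Rx: "R n x = r2 x * cnj (l n) ^ 2 + r3 x * cnj (l n) ^ 3" for n x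
    by (simp_all add: P_def R_def)
  define s where "s n a = (\<lambda>x. P n x * (a * cis (of_int n * x)) + R n x * cnj (a * cis (of_int n * x)))" for n a
  have sP: "smooth (P n)" and sR: "smooth (R n)" for n
    unfolding P_def R_def by (intro smooth_add smooth_const vderiv_combination(2) sm)+
  have smps: "smp (s n a)" for n a
    unfolding s_def P_def R_def by (intro smp_intros p1 p2 r2 r3)
  have Se: "S (fmode n a) = fclass (s n a)" for n a
  proof -
    let ?E = "\<lambda>x. a * cis (of_int n * x)"
    have "S (fmode n a) = fclass ?E + fclass (\<lambda>x. p1 x * (l n ^ 1 * a * cis (of_int n * x)) + 0 * cnj (l n ^ 1 * a * cis (of_int n * x)))
      + fclass (\<lambda>x. p2 x * (l n ^ 2 * a * cis (of_int n * x)) + r2 x * cnj (l n ^ 2 * a * cis (of_int n * x)))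
      + fclass (\<lambda>x. 0 * (l n ^ 3 * a * cis (of_int n * x)) + r3 x * cnj (l n ^ 3 * a * cis (of_int n * x)))"
      unfolding S_def Me mop_fmode[OF cpp(1) cp0] mop_fmode[OF cpp(2,3)] mop_fmode[OF cp0 cpp(4)] 
      by (simp add: fmode_def numeral_2_eq_2 numeral_3_eq_3 add.assoc)
    also have "\<dots> = fclass (\<lambda>x. ?E x + (p1 x * (l n ^ 1 * a * cis (of_int n * x)) + 0 * cnj (l n ^ 1 * a * cis (of_int n * x)))
      + (p2 x * (l n ^ 2 * a * cis (of_int n * x)) + r2 x * cnj (l n ^ 2 * a * cis (of_int n * x)))
      + (0 * (l n ^ 3 * a * cis (of_int n * x)) + r3 x * cnj (l n ^ 3 * a * cis (of_int n * x))))"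
      by (rule fclass_add4; intro cper_sqint smp_cper smp_intros p1 p2 r2 r3)
    also have "\<dots> = fclass (s n a)"
      unfolding s_def P_def R_def by (rule arg_cong[of _ _ fclass]) (auto simp: fun_eq_iff algebra_simps)
    finally show ?thesis .
  qed
  have DP: "?D 4 (P n) x = ?D 4 p1 x * l n + ?D 4 p2 x * l n ^ 2"
      "?D 3 (P n) x = ?D 3 p1 x * l n + ?D 3 p2 x * l n ^ 2"
      "?D 2 (P n) x = ?D 2 p1 x * l n + ?D 2 p2 x * l n ^ 2"
      "vderiv (P n) x = vderiv p1 x * l n + vderiv p2 x * l n ^ 2" for n x
  proof -
    have "(vderiv ^^ Suc k) (P n) x = (vderiv ^^ Suc k) p1 x * l n + (vderiv ^^ Suc k) p2 x * l n ^ 2" for k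
      unfolding P_def
      by (subst vderiv_pow_1_plus[OF vderiv_combination(2)[OF sm(1,2)]],
          subst vderiv_combination(1)[OF sm(1,2)]) simp
    from this[of 3] this[of 2] this[of 1] this[of 0]
    show "?D 4 (P n) x = ?D 4 p1 x * l n + ?D 4 p2 x * l n ^ 2"
      "?D 3 (P n) x = ?D 3 p1 x * l n + ?D 3 p2 x * l n ^ 2"
      "?D 2 (P n) x = ?D 2 p1 x * l n + ?D 2 p2 x * l n ^ 2"
      "vderiv (P n) x = vderiv p1 x * l n + vderiv p2 x * l n ^ 2"
      by (simp_all add: eval_nat_numeral)
  qed
  have DR: "?D k (R n) x = ?D k r2 x * cnj (l n) ^ 2 + ?D k r3 x * cnj (l n) ^ 3" for k n x
    unfolding R_def by (subst vderiv_combination(1)[OF sm(3,4)]) simp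
  note DR1 = DR[of 1, simplified]
  have Qe1: "Q (fmode n a) = fclass (\<lambda>x. (w0 x + w1 x * l n + w2 x * l n ^ 2 + w3 x * l n ^ 3) * (a * cis (of_int n * x))
      + (v0 x + v1 x * cnj (l n) + v2 x * cnj (l n) ^ 2 + v3 x * cnj (l n) ^ 3) * cnj (a * cis (of_int n * x)))"
    if n: "\<bar>n\<bar> > int M" for n a
  proof -
    have "(\<Sum>m\<in>{-int M..int M}. mop (wf m) (vf m) (multiplier (\<delta> m) (fmode n a))) = 0"
    proof (rule sum.neutral, rule ballI)
      fix m assume "m \<in> {-int M..int M}"
      then have "n \<noteq> m" using n by auto
      then show "mop (wf m) (vf m) (multiplier (\<delta> m) (fmode n a)) = 0"
        by (simp add: multiplier_fmode[OF \<delta>1] \<delta>_def fmode_zero linear_0[OF bounded_linear.linear[OF bounded_linear_mop]] cwf)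
    qed
    then have "Q (fmode n a) = fclass (\<lambda>x. w0 x * (a * cis (of_int n * x)) + v0 x * cnj (a * cis (of_int n * x)))
      + fclass (\<lambda>x. w1 x * (l n ^ 1 * a * cis (of_int n * x)) + v1 x * cnj (l n ^ 1 * a * cis (of_int n * x)))
      + fclass (\<lambda>x. w2 x * (l n ^ 2 * a * cis (of_int n * x)) + v2 x * cnj (l n ^ 2 * a * cis (of_int n * x)))
      + fclass (\<lambda>x. w3 x * (l n ^ 3 * a * cis (of_int n * x)) + v3 x * cnj (l n ^ 3 * a * cis (of_int n * x)))"
      unfolding Q_def Me multiplier_fmode[OF z1] mop_fmode[OF cw(1,5)] mop_fmode[OF cw(2,6)] mop_fmode[OF cw(3,7)] mop_fmode[OF cw(4,8)]
      using n by (simp add: z_def numeral_2_eq_2 numeral_3_eq_3)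
    also have "\<dots> = fclass (\<lambda>x. (w0 x * (a * cis (of_int n * x)) + v0 x * cnj (a * cis (of_int n * x)))
      + (w1 x * (l n ^ 1 * a * cis (of_int n * x)) + v1 x * cnj (l n ^ 1 * a * cis (of_int n * x)))
      + (w2 x * (l n ^ 2 * a * cis (of_int n * x)) + v2 x * cnj (l n ^ 2 * a * cis (of_int n * x)))
      + (w3 x * (l n ^ 3 * a * cis (of_int n * x)) + v3 x * cnj (l n ^ 3 * a * cis (of_int n * x))))"
      by (rule fclass_add4; intro cper_sqint cper_add cper_mult cper_const cper_cnj cper_cis cw)
    also have "\<dots> = fclass (\<lambda>x. (w0 x + w1 x * l n + w2 x * l n ^ 2 + w3 x * l n ^ 3) * (a * cis (of_int n * x))
      + (v0 x + v1 x * cnj (l n) + v2 x * cnj (l n) ^ 2 + v3 x * cnj (l n) ^ 3) * cnj (a * cis (of_int n * x)))"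
      by (rule arg_cong[of _ _ fclass]) (auto simp: fun_eq_iff algebra_simps)
    finally show ?thesis .
  qed
  have Qe2: "Q (fmode n a) = fclass (\<lambda>x. wf n x * (a * cis (of_int n * x)) + vf n x * cnj (a * cis (of_int n * x)))"
    if n: "\<not> \<bar>n\<bar> > int M" for n a
  proof -
    have m0: "mop w v 0 = 0" if "cper w" "cper v" for w v
      using linear_0[OF bounded_linear.linear[OF bounded_linear_mop[OF that]]] .
    have "(\<Sum>m\<in>{-int M..int M}. mop (wf m) (vf m) (multiplier (\<delta> m) (fmode n a)))
        = (\<Sum>m\<in>{-int M..int M}. if m = n then mop (wf n) (vf n) (fmode n a) else 0)"
      by (intro sum.cong refl) (auto simp: multiplier_fmode[OF \<delta>1] \<delta>_def fmode_zero m0 cwf)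
    also have "\<dots> = mop (wf n) (vf n) (fmode n a)"
    proof -
      have "n \<in> {-int M..int M}" using n by auto
      then show ?thesis by (simp del: atLeastAtMost_iff)
    qed
    finally have "Q (fmode n a) = mop (wf n) (vf n) (fmode n a)"
      using n unfolding Q_def Me multiplier_fmode[OF z1] by (simp add: z_def l_def fmode_zero m0 cw)
    then show ?thesis by (simp only: mop_fmode[OF cwf])
  qed
  have main: "fclass (dop b b' c c' d d' (s n a)) = S (fmode n (N n * a)) + Q (fmode n a)" for n a
  proof -
    note dopE = dop_exponential[OF sP[of n] sR[of n], of b b' c c' d d' a n, folded \<nu>_def s_def]
    \<comment> \<open>S is only real-linear: multiplying the amplitude by \<open>N n\<close>
      multiplies the conjugate mode by \<open>cnj (N n)\<close>. This is the symbol on the right of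
      the antilinear identity.\<close>
    have SN: "S (fmode n (N n * a)) = fclass (\<lambda>x. N n * P n x * (a * cis (of_int n * x)) + cnj (N n) * R n x * cnj (a * cis (of_int n * x)))"
      unfolding Se s_def by (rule arg_cong[of _ _ fclass]) (auto simp: fun_eq_iff algebra_simps)
    have cpPR: "cper (P n)" "cper (R n)" unfolding P_def R_def by (intro smp_cper smp_intros p1 p2 r2 r3)+
    show ?thesis
    proof (cases "\<bar>n\<bar> > int M")
      case True
      then have nz: "\<nu> n * l n = 1" "cnj (\<nu> n) * cnj (l n) = 1" by (auto simp: l_def \<nu>_def)
      have eq: "dop b b' c c' d d' (s n a) = (\<lambda>x. 
          (N n * P n x * (a * cis (of_int n * x)) + cnj (N n) * R n x * cnj (a * cis (of_int n * x))) +
          ((w0 x + w1 x * l n + w2 x * l n ^ 2 + w3 x * l n ^ 3) * (a * cis (of_int n * x))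
          + (v0 x + v1 x * cnj (l n) + v2 x * cnj (l n) ^ 2 + v3 x * cnj (l n) ^ 3) * cnj (a * cis (of_int n * x))))"
      proof (rule ext)
        fix x
        have X: "\<i> * (?D 4 (P n) x + 4 * \<nu> n * ?D 3 (P n) x + 6 * \<nu> n ^ 2 * ?D 2 (P n) x + 4 * \<nu> n ^ 3 * vderiv (P n) x + \<nu> n ^ 4 * P n x)
      + b x * (?D 2 (P n) x + 2 * \<nu> n * vderiv (P n) x + \<nu> n ^ 2 * P n x)
      + b' x * cnj (?D 2 (R n) x + 2 * cnj (\<nu> n) * vderiv (R n) x + (cnj (\<nu> n))^2 * R n x)
      + c x * (vderiv (P n) x + \<nu> n * P n x) + c' x * cnj (vderiv (R n) x + cnj (\<nu> n) * R n x)
      + d x * P n x + d' x * cnj (R n x)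
      = N n * P n x + (w0 x + w1 x * l n + w2 x * l n ^ 2 + w3 x * l n ^ 3)"
          by (rule trans[OF _ trans[OF symbol_identity_linear[OF nz(1) p1b[of x] p2c[of x],
              of "?D 4 p1 x" "?D 4 p2 x" "?D 3 p1 x" "?D 3 p2 x" "?D 2 p2 x" "p2 x" "b' x"
              "cnj (?D 2 r2 x)" "cnj (?D 2 r3 x)" "cnj (vderiv r2 x)" "cnj (vderiv r3 x)" "cnj (r2 x)" "cnj (r3 x)"
              "c' x" "d x" "d' x"]]])
            (simp_all only: DP DR DR1 Px Rx N_def w0_def w1_def w2_def w3_def add.assoc
              complex_cnj_add complex_cnj_mult complex_cnj_power complex_cnj_cnj complex_cnj_numeral)
        have Y: "\<i> * (?D 4 (R n) x + 4 * cnj (\<nu> n) * ?D 3 (R n) x + 6 * (cnj (\<nu> n))^2 * ?D 2 (R n) x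
        + 4 * (cnj (\<nu> n))^3 * vderiv (R n) x + (cnj (\<nu> n))^4 * R n x)
      + b x * (?D 2 (R n) x + 2 * cnj (\<nu> n) * vderiv (R n) x + (cnj (\<nu> n))^2 * R n x)
      + b' x * cnj (?D 2 (P n) x + 2 * \<nu> n * vderiv (P n) x + \<nu> n ^ 2 * P n x)
      + c x * (vderiv (R n) x + cnj (\<nu> n) * R n x) + c' x * cnj (vderiv (P n) x + \<nu> n * P n x)
      + d x * R n x + d' x * cnj (P n x)
      = cnj (N n) * R n x + (v0 x + v1 x * cnj (l n) + v2 x * cnj (l n) ^ 2 + v3 x * cnj (l n) ^ 3)"
          by (rule trans[OF _ trans[OF symbol_identity_antilinear[OF nz(2) r2b[of x] r3c[of x],
              of "?D 4 r2 x" "?D 4 r3 x" "?D 3 r2 x" "?D 3 r3 x" "?D 2 r2 x" "?D 2 r3 x" "vderiv r3 x" "b x"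
              "cnj (?D 2 p1 x)" "cnj (?D 2 p2 x)" "cnj (vderiv p1 x)" "cnj (vderiv p2 x)" "cnj (p2 x)"
              "c x" "d x" "d' x" "cnj B" "cnj C"]]])
            (simp_all only: DP DR DR1 Px Rx N_def v0_def v1_def v2_def v3_def add.assoc
              complex_cnj_add complex_cnj_mult complex_cnj_power complex_cnj_cnj complex_cnj_numeral
              complex_cnj_one complex_cnj_i complex_cnj_minus)
        show "dop b b' c c' d d' (s n a) x = 
          (N n * P n x * (a * cis (of_int n * x)) + cnj (N n) * R n x * cnj (a * cis (of_int n * x))) +
          ((w0 x + w1 x * l n + w2 x * l n ^ 2 + w3 x * l n ^ 3) * (a * cis (of_int n * x))
          + (v0 x + v1 x * cnj (l n) + v2 x * cnj (l n) ^ 2 + v3 x * cnj (l n) ^ 3) * cnj (a * cis (of_int n * x)))"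
          unfolding dopE X Y by (simp add: algebra_simps)
      qed
      show ?thesis
        unfolding eq SN Qe1[OF True]
        by (rule fclass_add; intro cper_sqint cper_add cper_mult cper_const cper_cnj cper_cis cw cpPR)
    next
      case False
      then have l0: "l n = 0" by (simp add: l_def)
      have eq: "dop b b' c c' d d' (s n a) = (\<lambda>x. 
          (N n * P n x * (a * cis (of_int n * x)) + cnj (N n) * R n x * cnj (a * cis (of_int n * x))) +
          (wf n x * (a * cis (of_int n * x)) + vf n x * cnj (a * cis (of_int n * x))))"
        unfolding dopE DP DR DR1 Px Rx l0 wf_def vf_def
        by (rule ext) (simp add: algebra_simps)
      show ?thesis
        unfolding eq SN Qe2[OF False]
        by (rule fclass_add; intro cper_sqint cper_add cper_mult cper_const cper_cnj cper_cis cwf cpPR)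
    qed
  qed
  show ?thesis
    by (rule that[OF blS blQ nS smps Se]) (simp only: main N)
qed

subsection \<open>The system in complex form\<close>

text \<open>A real \<open>2 \<times> 2\<close> matrix acts on \<open>\<complex>\<close> as \<open>z \<mapsto> p z + q cnj z\<close>.\<close>

definition mlin :: "real^2^2 \<Rightarrow> complex" where
  "mlin A = Complex ((A $ 1 $ 1 + A $ 2 $ 2) / 2) ((A $ 2 $ 1 - A $ 1 $ 2) / 2)"

definition manti :: "real^2^2 \<Rightarrow> complex" where
  "manti A = Complex ((A $ 1 $ 1 - A $ 2 $ 2) / 2) ((A $ 2 $ 1 + A $ 1 $ 2) / 2)"

lemma transpose_mult_cvec:
  "transpose A *v cvec z = cvec (cnj (mlin A) * z + manti A * cnj z)"
  by (simp add: vec_eq_iff forall_2 matrix_vector_mult_def sum_2 transpose_def mlin_def manti_def field_simps)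

lemma transpose_J_mult_cvec: "transpose J *v cvec z = cvec (- \<i> * z)"
proof -
  have "J $ 1 $ 1 = 0" "J $ 1 $ 2 = -1" "J $ 2 $ 1 = 1" "J $ 2 $ 2 = 0" by (simp_all add: J_def)
  then have "mlin J = \<i>" "manti J = 0" by (simp_all add: mlin_def manti_def complex_eq_iff)
  then show ?thesis by (simp only: transpose_mult_cvec) simp
qed

text \<open>The statement measures smoothness by iterates of \<open>deriv\<close>, the proof by
  iterates of \<open>vderiv\<close>. The induction takes derivatives off at the inner end, so that
  the hypothesis on g passes to \<open>deriv g\<close>.\<close>

lemma smooth_periodic_smp:
  assumes "smooth_periodic f"
  shows "smp (\<lambda>x. complex_of_real (f x))"
proof -
  have "times_diff k g" if "\<And>n x. (deriv ^^ n) g field_differentiable (at x)" for k and g :: "real \<Rightarrow> real"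
    using that
  proof (induction k arbitrary: g)
    case (0 g)
    have "(g has_real_derivative deriv g x) (at x)" for x
      using 0[of 0 x] by (simp add: DERIV_deriv_iff_field_differentiable)
    then show ?case
      by (intro times_diff_0I) (simp add: has_real_derivative_iff_has_vector_derivative)
  next
    case (Suc k g)
    have "(g has_real_derivative deriv g x) (at x)" for x
      using Suc.prems[of 0 x] by (simp add: DERIV_deriv_iff_field_differentiable)
    moreover have "times_diff k (deriv g)"
    proof (rule Suc.IH)
      show "(deriv ^^ n) (deriv g) field_differentiable at x" for n x
        using Suc.prems[of "Suc n" x] by (simp add: funpow_Suc_right del: funpow.simps)
    qed
    ultimately show ?case
      by (intro times_diff_SucI) (simp_all add: has_real_derivative_iff_has_vector_derivative)
  qed
  then have "smooth f" using assms by (auto simp: smooth_def smooth_periodic_def)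
  then show ?thesis
    using assms bounded_linear.smooth[OF bounded_linear_of_real]
    by (auto simp: smp_def periodic_def smooth_periodic_def)
qed

lemma Complex_of_real: "Complex a b = of_real a + \<i> * of_real b"
  by (simp add: complex_eq_iff)

definition smooth_matrix :: "(real \<Rightarrow> real^2^2) \<Rightarrow> bool" where
  "smooth_matrix A \<longleftrightarrow> (\<forall>j k. smooth_periodic (\<lambda>x. A x $ j $ k))"

lemma smp_mlin:
  assumes "smooth_matrix A"
  shows "smp (\<lambda>x. mlin (A x))" "smp (\<lambda>x. manti (A x))"
proof -
  note s = smooth_periodic_smp[OF assms[unfolded smooth_matrix_def, rule_format]]
  have "mlin (A x) = (1/2) * (of_real (A x $ 1 $ 1) + of_real (A x $ 2 $ 2))
      + (\<i> * (1/2)) * (of_real (A x $ 2 $ 1) - of_real (A x $ 1 $ 2))" for x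
    by (simp add: mlin_def complex_eq_iff)
  moreover have "smp (\<lambda>x. (1/2) * (of_real (A x $ 1 $ 1) + of_real (A x $ 2 $ 2))
      + (\<i> * (1/2)) * (of_real (A x $ 2 $ 1) - of_real (A x $ 1 $ 2)))"
    by (intro smp_intros s)
  ultimately show "smp (\<lambda>x. mlin (A x))" by simp
  have "manti (A x) = (1/2) * (of_real (A x $ 1 $ 1) - of_real (A x $ 2 $ 2))
      + (\<i> * (1/2)) * (of_real (A x $ 2 $ 1) + of_real (A x $ 1 $ 2))" for x
    by (simp add: manti_def complex_eq_iff)
  moreover have "smp (\<lambda>x. (1/2) * (of_real (A x $ 1 $ 1) - of_real (A x $ 2 $ 2))
      + (\<i> * (1/2)) * (of_real (A x $ 2 $ 1) + of_real (A x $ 1 $ 2)))"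
    by (intro smp_intros s)
  ultimately show "smp (\<lambda>x. manti (A x))" by simp
qed

definition sop :: "(real \<Rightarrow> real^2^2) \<Rightarrow> (real \<Rightarrow> real^2^2) \<Rightarrow> (real \<Rightarrow> complex) \<Rightarrow> real \<Rightarrow> complex" where
  "sop \<beta> \<gamma> = dop (\<lambda>x. mlin (\<beta> x)) (\<lambda>x. manti (\<beta> x)) (\<lambda>x. mlin (\<gamma> x)) (\<lambda>x. manti (\<gamma> x)) (\<lambda>x. 0) (\<lambda>x. 0)"

text \<open>\<open>sop_adj\<close> is minus the formal adjoint of \<open>sop\<close>.\<close>

definition sop_adj :: "(real \<Rightarrow> real^2^2) \<Rightarrow> (real \<Rightarrow> real^2^2) \<Rightarrow> (real \<Rightarrow> complex) \<Rightarrow> real \<Rightarrow> complex" where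
  "sop_adj \<beta> \<gamma> = dop
     (\<lambda>x. - cnj (mlin (\<beta> x)))
     (\<lambda>x. - manti (\<beta> x))
     (\<lambda>x. cnj (mlin (\<gamma> x)) - 2 * vderiv (\<lambda>x. cnj (mlin (\<beta> x))) x)
     (\<lambda>x. manti (\<gamma> x) - 2 * vderiv (\<lambda>x. manti (\<beta> x)) x)
     (\<lambda>x. vderiv (\<lambda>x. cnj (mlin (\<gamma> x))) x - (vderiv ^^ 2) (\<lambda>x. cnj (mlin (\<beta> x))) x)
     (\<lambda>x. vderiv (\<lambda>x. manti (\<gamma> x)) x - (vderiv ^^ 2) (\<lambda>x. manti (\<beta> x)) x)"

lemma smp_coefs:
  assumes "smooth_matrix \<beta>" "smooth_matrix \<gamma>"
  shows "smp (\<lambda>x. - cnj (mlin (\<beta> x)))" "smp (\<lambda>x. - manti (\<beta> x))"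
     "smp (\<lambda>x. cnj (mlin (\<gamma> x)) - 2 * vderiv (\<lambda>x. cnj (mlin (\<beta> x))) x)"
     "smp (\<lambda>x. manti (\<gamma> x) - 2 * vderiv (\<lambda>x. manti (\<beta> x)) x)"
     "smp (\<lambda>x. vderiv (\<lambda>x. cnj (mlin (\<gamma> x))) x - (vderiv ^^ 2) (\<lambda>x. cnj (mlin (\<beta> x))) x)"
     "smp (\<lambda>x. vderiv (\<lambda>x. manti (\<gamma> x)) x - (vderiv ^^ 2) (\<lambda>x. manti (\<beta> x)) x)"
  by (intro smp_intros smp_vderiv_pow smp_mlin assms)+

lemma smp_sop_adj: "smooth_matrix \<beta> \<Longrightarrow> smooth_matrix \<gamma> \<Longrightarrow> smp u \<Longrightarrow> smp (sop_adj \<beta> \<gamma> u)"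
  unfolding sop_adj_def by (intro smp_dop smp_coefs)

text \<open>The right-hand side is what transposition produces, with the derivatives outside the
  coefficients. Expansion by the Leibniz rule yields the form \<open>dop\<close>, to which
  \<open>normal_form\<close> applies.\<close>

lemma sop_adj_eq:
  assumes \<beta>: "smooth_matrix \<beta>" and \<gamma>: "smooth_matrix \<gamma>" and u: "smp u"
  shows "sop_adj \<beta> \<gamma> u x = - ((vderiv ^^ 4) (\<lambda>x. - \<i> * u x) x
    + (vderiv ^^ 2) (\<lambda>x. cnj (mlin (\<beta> x)) * u x + manti (\<beta> x) * cnj (u x)) x
    - vderiv (\<lambda>x. cnj (mlin (\<gamma> x)) * u x + manti (\<gamma> x) * cnj (u x)) x)"
proof -
  have one: "vderiv (\<lambda>x. p x * v x + q x * cnj (v x)) =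
      (\<lambda>x. p x * vderiv v x + vderiv p x * v x + (q x * cnj (vderiv v x) + vderiv q x * cnj (v x)))"
    if "smooth p" "smooth q" "smooth v" for p q v :: "real \<Rightarrow> complex"
    by (intro vderivI has_vector_derivative_add has_vector_derivative_mult smooth_has_vderiv
        bounded_linear.has_vector_derivative[OF bounded_linear_cnj] that)
  have two: "(vderiv ^^ 2) (\<lambda>x. p x * v x + q x * cnj (v x)) =
      (\<lambda>x. p x * (vderiv ^^ 2) v x + 2 * vderiv p x * vderiv v x + (vderiv ^^ 2) p x * v x
        + (q x * cnj ((vderiv ^^ 2) v x) + 2 * vderiv q x * cnj (vderiv v x) + (vderiv ^^ 2) q x * cnj (v x)))"
    if s: "smooth p" "smooth q" "smooth v" for p q v :: "real \<Rightarrow> complex"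
  proof -
    have "vderiv (\<lambda>x. p x * vderiv v x + vderiv p x * v x + (q x * cnj (vderiv v x) + vderiv q x * cnj (v x)))
      = (\<lambda>x. (p x * vderiv (vderiv v) x + vderiv p x * vderiv v x) + (vderiv p x * vderiv v x + vderiv (vderiv p) x * v x)
        + ((q x * cnj (vderiv (vderiv v) x) + vderiv q x * cnj (vderiv v x))
          + (vderiv q x * cnj (vderiv v x) + vderiv (vderiv q) x * cnj (v x))))"
      by (intro vderivI has_vector_derivative_add has_vector_derivative_mult smooth_has_vderiv smooth_vderiv
          bounded_linear.has_vector_derivative[OF bounded_linear_cnj] s)
    then show ?thesis
      by (simp add: numeral_2_eq_2 one[OF s] fun_eq_iff algebra_simps)
  qed
  have four: "(vderiv ^^ 4) (\<lambda>x. - \<i> * u x) = (\<lambda>x. - \<i> * (vderiv ^^ 4) u x)"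
  proof -
    have "(vderiv ^^ k) (\<lambda>x. - \<i> * v x) = (\<lambda>x. - \<i> * (vderiv ^^ k) v x)" if "smooth v" for k v
      using that
    proof (induction k arbitrary: v)
      case (Suc k)
      then show ?case
        using Suc.IH[of "vderiv v"] bounded_linear.vderiv[OF bounded_linear_mult_right[of "- \<i>"], of v]
        by (simp add: funpow_Suc_right smooth_vderiv del: funpow.simps)
    qed simp
    then show ?thesis using smp_smooth[OF u] by blast
  qed
  have s: "smooth (\<lambda>x. cnj (mlin (\<beta> x)))" "smooth (\<lambda>x. manti (\<beta> x))" "smooth (\<lambda>x. cnj (mlin (\<gamma> x)))"
    "smooth (\<lambda>x. manti (\<gamma> x))" "smooth u"
    using smp_mlin[OF \<beta>] smp_mlin[OF \<gamma>] u by (auto intro: smp_smooth smp_cnj)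
  show ?thesis
    unfolding four two[OF s(1,2,5)] one[OF s(3,4,5)] sop_adj_def dop_def
    by (simp add: algebra_simps)
qed

text \<open>For the real inner product, multiplication by p has multiplication by cnj p as its
  adjoint, while f \<mapsto> q cnj f is self-adjoint, because Re (q cnj f cnj g) is symmetric in f
  and g.\<close>

lemma inner_mop_adjoint:
  assumes "smp p" "smp q" "smp f" "smp g"
  shows "fclass (\<lambda>x. p x * f x + q x * cnj (f x)) \<bullet> fclass g
    = fclass f \<bullet> fclass (\<lambda>x. cnj (p x) * g x + q x * cnj (g x))"
proof -
  have "Re ((p x * f x + q x * cnj (f x)) * cnj (g x)) = Re (f x * cnj (cnj (p x) * g x + q x * cnj (g x)))" for x
    by (simp add: algebra_simps)
  moreover have "sqint (\<lambda>x. p x * f x + q x * cnj (f x))" "sqint (\<lambda>x. cnj (p x) * g x + q x * cnj (g x))"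
      "sqint f" "sqint g"
    by (intro cper_sqint smp_cper smp_intros assms)+
  ultimately show ?thesis by (simp only: fclass_inner)
qed

lemma integration_by_parts_pow:
  assumes "smp u" "smp v"
  shows "fclass ((vderiv ^^ k) u) \<bullet> fclass v = (-1) ^ k * (fclass u \<bullet> fclass ((vderiv ^^ k) v))"
  using assms
proof (induction k arbitrary: u)
  case (Suc k)
  have "fclass ((vderiv ^^ Suc k) u) \<bullet> fclass v = (-1) ^ k * (fclass (vderiv u) \<bullet> fclass ((vderiv ^^ k) v))"
    using Suc.IH[of "vderiv u"] Suc.prems by (simp add: funpow_Suc_right smp_vderiv del: funpow.simps)
  then show ?case
    using integration_by_parts[OF Suc.prems(1) smp_vderiv_pow[OF Suc.prems(2)]] by simp
qed simp

text \<open>Integration by parts, with sign + for the even orders and - for the first order. In the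
  existence proof it moves the spatial operator onto a test mode.\<close>

lemma inner_sop:
  assumes \<beta>: "smooth_matrix \<beta>" and \<gamma>: "smooth_matrix \<gamma>" and f: "smp f" and g: "smp g"
  shows "fclass (sop \<beta> \<gamma> f) \<bullet> fclass g = - (fclass f \<bullet> fclass (sop_adj \<beta> \<gamma> g))"
proof -
  note m = smp_mlin[OF \<beta>] smp_mlin[OF \<gamma>]
  have i0: "smp (\<lambda>x. \<i>)" "smp (\<lambda>x. 0)" by (intro smp_const)+
  define f4 where "f4 = (\<lambda>x. \<i> * (vderiv ^^ 4) f x + 0 * cnj ((vderiv ^^ 4) f x))"
  define f2 where "f2 = (\<lambda>x. mlin (\<beta> x) * (vderiv ^^ 2) f x + manti (\<beta> x) * cnj ((vderiv ^^ 2) f x))"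
  define f1 where "f1 = (\<lambda>x. mlin (\<gamma> x) * (vderiv ^^ 1) f x + manti (\<gamma> x) * cnj ((vderiv ^^ 1) f x))"
  define g4 where "g4 = (\<lambda>x. cnj \<i> * g x + 0 * cnj (g x))"
  define g2 where "g2 = (\<lambda>x. cnj (mlin (\<beta> x)) * g x + manti (\<beta> x) * cnj (g x))"
  define g1 where "g1 = (\<lambda>x. cnj (mlin (\<gamma> x)) * g x + manti (\<gamma> x) * cnj (g x))"
  have sf: "smp f4" "smp f2" "smp f1" "smp g4" "smp g2" "smp g1"
    unfolding f4_def f2_def f1_def g4_def g2_def g1_def by (intro smp_intros smp_vderiv_pow m f g)+
  have "fclass f4 \<bullet> fclass g = fclass ((vderiv ^^ 4) f) \<bullet> fclass g4"
    unfolding f4_def g4_def by (rule inner_mop_adjoint[OF i0 smp_vderiv_pow[OF f] g])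
  then have e4: "fclass f4 \<bullet> fclass g = fclass f \<bullet> fclass ((vderiv ^^ 4) g4)"
    using integration_by_parts_pow[OF f sf(4), of 4] by simp
  have "fclass f2 \<bullet> fclass g = fclass ((vderiv ^^ 2) f) \<bullet> fclass g2"
    unfolding f2_def g2_def by (rule inner_mop_adjoint[OF m(1,2) smp_vderiv_pow[OF f] g])
  then have e2: "fclass f2 \<bullet> fclass g = fclass f \<bullet> fclass ((vderiv ^^ 2) g2)"
    using integration_by_parts_pow[OF f sf(5), of 2] by simp
  have "fclass f1 \<bullet> fclass g = fclass ((vderiv ^^ 1) f) \<bullet> fclass g1"
    unfolding f1_def g1_def by (rule inner_mop_adjoint[OF m(3,4) smp_vderiv_pow[OF f] g])
  then have e1: "fclass f1 \<bullet> fclass g = - (fclass f \<bullet> fclass ((vderiv ^^ 1) g1))"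
    using integration_by_parts_pow[OF f sf(6), of 1] by simp
  note sq = cper_sqint[OF smp_cper]
  have "sop \<beta> \<gamma> f = (\<lambda>x. f4 x + f2 x + f1 x)"
    by (simp add: sop_def dop_def f4_def f2_def f1_def fun_eq_iff)
  then have "fclass (sop \<beta> \<gamma> f) = fclass f4 + fclass f2 + fclass f1"
    by (simp add: fclass_add sqint_add sq sf)
  moreover have "fclass ((vderiv ^^ 4) g4) + fclass ((vderiv ^^ 2) g2) - fclass (vderiv g1) + fclass (sop_adj \<beta> \<gamma> g) = 0"
  proof -
    have z: "(\<lambda>x. (vderiv ^^ 4) g4 x + (vderiv ^^ 2) g2 x - vderiv g1 x + sop_adj \<beta> \<gamma> g x) = (\<lambda>x. 0)"
      unfolding sop_adj_eq[OF \<beta> \<gamma> g] g4_def g2_def g1_def by (simp add: fun_eq_iff)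
    have "fclass ((vderiv ^^ 4) g4) + fclass ((vderiv ^^ 2) g2) - fclass (vderiv g1) + fclass (sop_adj \<beta> \<gamma> g)
        = fclass (\<lambda>x. (vderiv ^^ 4) g4 x + (vderiv ^^ 2) g2 x - vderiv g1 x + sop_adj \<beta> \<gamma> g x)"
      using sq[OF smp_vderiv_pow[OF sf(4), of 4]] sq[OF smp_vderiv_pow[OF sf(5), of 2]] sq[OF smp_vderiv[OF sf(6)]]
        sq[OF smp_sop_adj[OF \<beta> \<gamma> g]]
      by (simp add: fclass_add fclass_diff sqint_add sqint_diff)
    then show ?thesis by (simp add: z fclass_0)
  qed
  then have "fclass f \<bullet> (fclass ((vderiv ^^ 4) g4) + fclass ((vderiv ^^ 2) g2) - fclass (vderiv g1) + fclass (sop_adj \<beta> \<gamma> g)) = 0"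
    by simp
  ultimately show ?thesis using e4 e2 e1
    by (simp add: inner_add_left inner_add_right inner_diff_right)
qed

subsection \<open>The distributional equation tested against products\<close>

lemma vderiv_pow_cvec:
  "smooth f \<Longrightarrow> (vderiv ^^ k) (\<lambda>x. cvec (f x)) = (\<lambda>x. cvec ((vderiv ^^ k) f x))"
proof (induction k arbitrary: f)
  case (Suc k)
  then show ?case
    using Suc.IH[of "vderiv f"] bounded_linear.vderiv[OF bounded_linear_cvec, of f]
    by (simp add: funpow_Suc_right smooth_vderiv del: funpow.simps)
qed simp

lemma dist_deriv_x_pow: "(dist_deriv_x ^^ k) u \<phi> = (-1) ^ k * u ((partial_x ^^ k) \<phi>)"
proof (induction k arbitrary: \<phi>)
  case (Suc k)
  then show ?case by (simp add: dist_deriv_x_def funpow_swap1)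
qed simp

lemma partial_x_pow: "(partial_x ^^ k) \<phi> t = (vderiv ^^ k) (\<phi> t)"
proof (induction k)
  case (Suc k)
  have "(partial_x ^^ Suc k) \<phi> t = vderiv ((partial_x ^^ k) \<phi> t)"
    by (simp add: partial_x_def vderiv_def)
  then show ?case using Suc by simp
qed simp

lemma operator_L_eq:
  "operator_L \<beta> \<gamma> (distribution_of w) \<phi> =
     - (LINT t|lborel. w t \<bullet> L2_class (partial_t \<phi> t))
     + (LINT t|lborel. w t \<bullet> L2_class ((vderiv ^^ 4) (\<lambda>x. transpose J *v \<phi> t x)))
     + (LINT t|lborel. w t \<bullet> L2_class ((vderiv ^^ 2) (\<lambda>x. transpose (\<beta> x) *v \<phi> t x)))
     - (LINT t|lborel. w t \<bullet> L2_class (vderiv (\<lambda>x. transpose (\<gamma> x) *v \<phi> t x)))"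
  using dist_deriv_x_pow[of 1 "distribution_of w"] partial_x_pow[of 1]
  by (simp add: operator_L_def dist_mult_def dist_deriv_x_pow dist_deriv_t_def distribution_of_def partial_x_pow)

text \<open>Links the transposed spatial terms of \<open>operator_L\<close>, acting on a slice of a
  test function, with \<open>sop_adj\<close>, acting on complex functions.\<close>

lemma spatial_operator:
  assumes \<beta>: "smooth_matrix \<beta>" and \<gamma>: "smooth_matrix \<gamma>" and u: "smp u"
  shows "square_integrable ((vderiv ^^ 4) (\<lambda>x. transpose J *v cvec (u x)))"
    "square_integrable ((vderiv ^^ 2) (\<lambda>x. transpose (\<beta> x) *v cvec (u x)))"
    "square_integrable (vderiv (\<lambda>x. transpose (\<gamma> x) *v cvec (u x)))"
    "L2_class ((vderiv ^^ 4) (\<lambda>x. transpose J *v cvec (u x)))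
     + L2_class ((vderiv ^^ 2) (\<lambda>x. transpose (\<beta> x) *v cvec (u x)))
     - L2_class (vderiv (\<lambda>x. transpose (\<gamma> x) *v cvec (u x))) = - fclass (sop_adj \<beta> \<gamma> u)"
proof -
  note m = smp_mlin[OF \<beta>] smp_mlin[OF \<gamma>]
  define g4 where "g4 = (\<lambda>x. - \<i> * u x)"
  define g2 where "g2 = (\<lambda>x. cnj (mlin (\<beta> x)) * u x + manti (\<beta> x) * cnj (u x))"
  define g1 where "g1 = (\<lambda>x. cnj (mlin (\<gamma> x)) * u x + manti (\<gamma> x) * cnj (u x))"
  have sg: "smp g4" "smp g2" "smp g1"
    unfolding g4_def g2_def g1_def by (intro smp_intros m u)+
  have eq: "(vderiv ^^ 4) (\<lambda>x. transpose J *v cvec (u x)) = (\<lambda>x. cvec ((vderiv ^^ 4) g4 x))"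
    "(vderiv ^^ 2) (\<lambda>x. transpose (\<beta> x) *v cvec (u x)) = (\<lambda>x. cvec ((vderiv ^^ 2) g2 x))"
    "vderiv (\<lambda>x. transpose (\<gamma> x) *v cvec (u x)) = (\<lambda>x. cvec (vderiv g1 x))"
    unfolding transpose_J_mult_cvec unfolding transpose_mult_cvec
    using vderiv_pow_cvec[OF smp_smooth[OF sg(1)], of 4] vderiv_pow_cvec[OF smp_smooth[OF sg(2)], of 2]
      vderiv_pow_cvec[OF smp_smooth[OF sg(3)], of 1]
    by (simp_all add: g4_def g2_def g1_def)
  note sq = cper_sqint[OF smp_cper]
  have sqs: "sqint ((vderiv ^^ 4) g4)" "sqint ((vderiv ^^ 2) g2)" "sqint (vderiv g1)" "sqint (sop_adj \<beta> \<gamma> u)"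
    by (intro sq smp_vderiv_pow smp_vderiv smp_sop_adj sg \<beta> \<gamma> u)+
  show "square_integrable ((vderiv ^^ 4) (\<lambda>x. transpose J *v cvec (u x)))"
    "square_integrable ((vderiv ^^ 2) (\<lambda>x. transpose (\<beta> x) *v cvec (u x)))"
    "square_integrable (vderiv (\<lambda>x. transpose (\<gamma> x) *v cvec (u x)))"
    unfolding eq using sqs by (simp_all add: sqint_def)
  have z: "(\<lambda>x. (vderiv ^^ 4) g4 x + (vderiv ^^ 2) g2 x - vderiv g1 x + sop_adj \<beta> \<gamma> u x) = (\<lambda>x. 0)"
    unfolding sop_adj_eq[OF \<beta> \<gamma> u] g4_def g2_def g1_def by (simp add: fun_eq_iff)
  have "fclass ((vderiv ^^ 4) g4) + fclass ((vderiv ^^ 2) g2) - fclass (vderiv g1) + fclass (sop_adj \<beta> \<gamma> u)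
      = fclass (\<lambda>x. (vderiv ^^ 4) g4 x + (vderiv ^^ 2) g2 x - vderiv g1 x + sop_adj \<beta> \<gamma> u x)"
    using sqs by (simp add: fclass_add fclass_diff sqint_add sqint_diff)
  then show "L2_class ((vderiv ^^ 4) (\<lambda>x. transpose J *v cvec (u x)))
     + L2_class ((vderiv ^^ 2) (\<lambda>x. transpose (\<beta> x) *v cvec (u x)))
     - L2_class (vderiv (\<lambda>x. transpose (\<gamma> x) *v cvec (u x))) = - fclass (sop_adj \<beta> \<gamma> u)"
    unfolding eq fclass_def[symmetric] by (simp only: z fclass_0 eq_neg_iff_add_eq_0)
qed

lemma primitive_mult_real:
  fixes F f g g' :: "real \<Rightarrow> real"
  assumes F: "primitive F f" and g: "\<And>t. (g has_vector_derivative g' t) (at t)" "continuous_on UNIV g'"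
  shows "primitive (\<lambda>t. g t * F t) (\<lambda>t. g' t * F t + g t * f t)"
proof -
  have "primitive (\<lambda>t. complex_of_real (g t) * complex_of_real (F t))
      (\<lambda>t. complex_of_real (g' t) * complex_of_real (F t) + complex_of_real (g t) * complex_of_real (f t))"
    by (rule primitive_mult[OF primitive_linear[OF bounded_linear_of_real F]
          bounded_linear.has_vector_derivative[OF bounded_linear_of_real g(1)]])
       (intro continuous_intros g(2))
  from primitive_linear[OF bounded_linear_Re this] show ?thesis by simp
qed

lemma integrable_compact_support:
  fixes f :: "real \<Rightarrow> 'a::{banach,second_countable_topology}"
  assumes "continuous_on UNIV f" "\<And>t. t \<notin> {a..b} \<Longrightarrow> f t = 0"
  shows "integrable lborel f"
proof -
  have "set_integrable lborel {a..b} f"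
    by (rule set_integrable_continuous[OF continuous_on_subset[OF assms(1)]]) simp
  moreover have "(\<lambda>t. indicator {a..b} t *\<^sub>R f t) = f"
    using assms(2) by (auto simp: fun_eq_iff indicator_def)
  ultimately show ?thesis by (simp add: set_integrable_def)
qed

subsection \<open>Curves of functions in \<open>L\<^sup>2\<close>\<close>

lemma norm_L2_class_le:
  assumes f: "square_integrable f" and B: "\<And>x. x \<in> {0..2*pi} \<Longrightarrow> norm (f x) \<le> B"
  shows "norm (L2_class f) \<le> sqrt (2 * pi) * B"
proof -
  have B0: "0 \<le> B" using order_trans[OF norm_ge_zero B[of 0]] by simp
  have "(norm (L2_class f))\<^sup>2 \<le> (LINT x|torus. B\<^sup>2)"
    unfolding L2_class_norm[OF f]
  proof (rule integral_mono)
    show "integrable torus (\<lambda>x. (norm (f x))\<^sup>2)" using f by (simp add: square_integrable_def)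
    fix x assume "x \<in> space torus"
    then have "x \<in> {0..2*pi}" by (simp add: torus_def space_restrict_space)
    then show "(norm (f x))\<^sup>2 \<le> B\<^sup>2" by (intro power_mono B) simp_all
  qed simp
  also have "\<dots> = (sqrt (2 * pi) * B)\<^sup>2"
    unfolding torus_integral_const by (simp add: power_mult_distrib)
  finally show ?thesis by (rule power2_le_imp_le) (use B0 in simp)
qed

lemma uniformly_close_slices:
  fixes \<Psi> :: "real \<Rightarrow> real \<Rightarrow> 'a::metric_space"
  assumes c: "continuous_on UNIV (\<lambda>(t, x). \<Psi> t x)" and \<epsilon>: "0 < \<epsilon>"
  obtains \<delta> where "0 < \<delta>" "\<And>t x. \<bar>t - t0\<bar> < \<delta> \<Longrightarrow> x \<in> {0..2*pi} \<Longrightarrow> dist (\<Psi> t x) (\<Psi> t0 x) < \<epsilon>"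
proof -
  let ?K = "{t0 - 1..t0 + 1} \<times> {0..2*pi}"
  have "uniformly_continuous_on ?K (\<lambda>(t, x). \<Psi> t x)"
    by (intro compact_uniformly_continuous continuous_on_subset[OF c] compact_Times) auto
  then obtain d where d: "0 < d" "\<And>p q. p \<in> ?K \<Longrightarrow> q \<in> ?K \<Longrightarrow> dist q p < d \<Longrightarrow>
      dist (case q of (t, x) \<Rightarrow> \<Psi> t x) (case p of (t, x) \<Rightarrow> \<Psi> t x) < \<epsilon>"
    unfolding uniformly_continuous_on_def using \<epsilon> by blast
  show ?thesis
  proof
    show "0 < min d 1" using d by simp
    fix t x assume t: "\<bar>t - t0\<bar> < min d 1" and x: "x \<in> {0..2*pi}"
    have "dist (t, x) (t0, x) < d" using t by (simp add: dist_Pair_Pair dist_real_def)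
    then show "dist (\<Psi> t x) (\<Psi> t0 x) < \<epsilon>"
      using d(2)[of "(t0, x)" "(t, x)"] t x by (auto simp: abs_less_iff)
  qed
qed

definition joint_periodic :: "(real \<Rightarrow> real \<Rightarrow> real^2) \<Rightarrow> bool" where
  "joint_periodic \<Psi> \<longleftrightarrow> continuous_on UNIV (\<lambda>(t, x). \<Psi> t x) \<and> (\<forall>t x. \<Psi> t (x + 2*pi) = \<Psi> t x)"

lemma joint_periodic_slice:
  assumes "joint_periodic \<Psi>"
  shows "square_integrable (\<Psi> t)"
proof -
  have c: "continuous_on UNIV (\<lambda>(t, x). \<Psi> t x)" using assms by (simp add: joint_periodic_def)
  have "continuous_on UNIV (\<lambda>x. (\<lambda>(t, x). \<Psi> t x) (t, x))"
    by (rule continuous_on_compose2[OF c]) (auto intro!: continuous_intros)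
  then have "cper (\<lambda>x. uncvec (\<Psi> t x))"
    using assms unfolding cper_def periodic_def joint_periodic_def
    by (auto intro: bounded_linear.continuous_on[OF bounded_linear_uncvec])
  from cper_sqint[OF this] show ?thesis by (simp add: sqint_def)
qed

lemma L2_curve_continuous:
  assumes \<Psi>: "joint_periodic \<Psi>"
  shows "continuous_on UNIV (\<lambda>t. L2_class (\<Psi> t))"
  unfolding continuous_on_iff
proof (intro ballI allI impI)
  fix t0 \<epsilon> :: real assume \<epsilon>: "0 < \<epsilon>"
  define r where "r = \<epsilon> / (2 * sqrt (2*pi))"
  have r: "0 < r" using \<epsilon> by (simp add: r_def)
  have c: "continuous_on UNIV (\<lambda>(t, x). \<Psi> t x)" using \<Psi> by (simp add: joint_periodic_def)
  obtain \<delta> where \<delta>: "0 < \<delta>" "\<And>t x. \<bar>t - t0\<bar> < \<delta> \<Longrightarrow> x \<in> {0..2*pi} \<Longrightarrow> dist (\<Psi> t x) (\<Psi> t0 x) < r"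
    using uniformly_close_slices[OF c r, of t0] by blast
  have "dist (L2_class (\<Psi> t)) (L2_class (\<Psi> t0)) < \<epsilon>" if "dist t t0 < \<delta>" for t
  proof -
    note sq = joint_periodic_slice[OF \<Psi>]
    have "norm (L2_class (\<lambda>x. \<Psi> t x - \<Psi> t0 x)) \<le> sqrt (2*pi) * r"
      by (rule norm_L2_class_le[OF square_integrable_diff[OF sq sq]])
         (use \<delta>(2)[of t] that in \<open>auto simp: dist_norm dist_real_def intro: less_imp_le\<close>)
    then have "norm (L2_class (\<Psi> t) - L2_class (\<Psi> t0)) \<le> sqrt (2*pi) * r"
      by (simp add: L2_class_diff sq)
    also have "\<dots> = \<epsilon> / 2" by (simp add: r_def)
    finally show ?thesis using \<epsilon> by (simp add: dist_norm)
  qed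
  then show "\<exists>d>0. \<forall>x'\<in>UNIV. dist x' t0 < d \<longrightarrow> dist (L2_class (\<Psi> x')) (L2_class (\<Psi> t0)) < \<epsilon>"
    using \<delta>(1) by blast
qed

text \<open>Over one compact period the t-derivative is continuous in t uniformly in x. The mean
  value bound for the linearisation error is therefore uniform in x and passes to the L^2
  norm.\<close>

lemma L2_curve_derivative:
  assumes \<phi>: "joint_periodic \<phi>" and \<phi>t: "joint_periodic (partial_t \<phi>)"
    and d: "\<And>t x. (\<lambda>s. \<phi> s x) differentiable (at t)"
  shows "((\<lambda>t. L2_class (\<phi> t)) has_vector_derivative L2_class (partial_t \<phi> t0)) (at t0)"
  unfolding has_vector_derivative_def has_derivative_at_alt
proof (intro conjI allI impI)
  show "bounded_linear (\<lambda>x. x *\<^sub>R L2_class (partial_t \<phi> t0))" by (rule bounded_linear_scaleR_left)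
  fix \<epsilon> :: real assume \<epsilon>: "0 < \<epsilon>"
  define r where "r = \<epsilon> / sqrt (2*pi)"
  have r: "0 < r" using \<epsilon> by (simp add: r_def)
  have c: "continuous_on UNIV (\<lambda>(t, x). partial_t \<phi> t x)" using \<phi>t by (simp add: joint_periodic_def)
  obtain \<delta> where \<delta>: "0 < \<delta>" "\<And>t x. \<bar>t - t0\<bar> < \<delta> \<Longrightarrow> x \<in> {0..2*pi} \<Longrightarrow>
      dist (partial_t \<phi> t x) (partial_t \<phi> t0 x) < r"
    using uniformly_close_slices[OF c r, of t0] by blast
  note sq = joint_periodic_slice[OF \<phi>] joint_periodic_slice[OF \<phi>t]
  have dv: "((\<lambda>s. \<phi> s x) has_vector_derivative partial_t \<phi> t x) (at t)" for t x
    using d[where t = t and x = x] by (simp add: partial_t_def vector_derivative_works)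
  have "norm (L2_class (\<phi> t) - L2_class (\<phi> t0) - (t - t0) *\<^sub>R L2_class (partial_t \<phi> t0)) \<le> \<epsilon> * norm (t - t0)"
    if t: "norm (t - t0) < \<delta>" for t
  proof -
    have "L2_class (\<phi> t) - L2_class (\<phi> t0) - (t - t0) *\<^sub>R L2_class (partial_t \<phi> t0)
        = L2_class (\<lambda>x. \<phi> t x - \<phi> t0 x - (t - t0) *\<^sub>R partial_t \<phi> t0 x)"
      by (simp add: L2_class_diff L2_class_scaleR sq square_integrable_diff square_integrable_scaleR)
    also have "norm \<dots> \<le> sqrt (2*pi) * (norm (t - t0) * r)"
    proof (rule norm_L2_class_le)
      show "square_integrable (\<lambda>x. \<phi> t x - \<phi> t0 x - (t - t0) *\<^sub>R partial_t \<phi> t0 x)"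
        by (intro square_integrable_diff square_integrable_scaleR sq)
      fix x :: real assume x: "x \<in> {0..2*pi}"
      show "norm (\<phi> t x - \<phi> t0 x - (t - t0) *\<^sub>R partial_t \<phi> t0 x) \<le> norm (t - t0) * r"
      proof (rule vector_differentiable_bound_linearization[where f = "\<lambda>s. \<phi> s x" and
            f' = "\<lambda>s. partial_t \<phi> s x" and S = "{t0 - \<bar>t - t0\<bar>..t0 + \<bar>t - t0\<bar>}"])
        show "closed_segment t0 t \<subseteq> {t0 - \<bar>t - t0\<bar>..t0 + \<bar>t - t0\<bar>}"
          by (auto simp: closed_segment_eq_real_ivl split: if_splits)
        show "((\<lambda>s. \<phi> s x) has_vector_derivative partial_t \<phi> s x) (at s within {t0 - \<bar>t - t0\<bar>..t0 + \<bar>t - t0\<bar>})" for s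
          by (rule has_vector_derivative_at_within[OF dv])
        fix s assume "s \<in> {t0 - \<bar>t - t0\<bar>..t0 + \<bar>t - t0\<bar>}"
        then have "\<bar>s - t0\<bar> < \<delta>" using t by (auto simp: abs_le_iff)
        from \<delta>(2)[OF this x] show "norm (partial_t \<phi> s x - partial_t \<phi> t0 x) \<le> r"
          by (simp add: dist_norm)
      qed auto
    qed
    also have "\<dots> = \<epsilon> * norm (t - t0)" by (simp add: r_def)
    finally show ?thesis .
  qed
  then show "\<exists>\<delta>>0. \<forall>y. norm (y - t0) < \<delta> \<longrightarrow>
      norm (L2_class (\<phi> y) - L2_class (\<phi> t0) - (y - t0) *\<^sub>R L2_class (partial_t \<phi> t0)) \<le> \<epsilon> * norm (y - t0)"
    using \<delta>(1) by blast
qed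

lemma test_function_partial_x:
  assumes \<phi>: "test_function \<phi>"
  shows "test_function (partial_x \<phi>)"
proof -
  have ck: "C_k k (partial_x \<phi>)" for k
    using \<phi> unfolding test_function_def by (metis C_k.simps(2))
  have per: "vderiv (\<phi> t) (x + 2*pi) = vderiv (\<phi> t) x" for t x
    by (rule vderiv_periodic) (use \<phi> in \<open>auto simp: test_function_def\<close>)
  obtain R where R: "\<And>t x. R < \<bar>t\<bar> \<Longrightarrow> \<phi> t x = 0" using \<phi> unfolding test_function_def by blast
  have "vderiv (\<phi> t) x = 0" if "R < \<bar>t\<bar>" for t x
  proof -
    have "\<phi> t = (\<lambda>x. 0)" using R[OF that] by auto
    then show ?thesis by (simp add: vderiv_const)
  qed
  then show ?thesis
    using ck per unfolding test_function_def partial_x_def vderiv_def by blast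
qed

lemma test_function_partial_t:
  assumes \<phi>: "test_function \<phi>"
  shows "joint_periodic (partial_t \<phi>)" "\<And>t x. (\<lambda>s. \<phi> s x) differentiable (at t)"
    "\<exists>R. \<forall>t x. R < \<bar>t\<bar> \<longrightarrow> partial_t \<phi> t x = 0"
proof -
  have c: "C_k (Suc (Suc k)) \<phi>" for k using \<phi> by (auto simp: test_function_def simp del: C_k.simps)
  show "(\<lambda>s. \<phi> s x) differentiable (at t)" for t x
    using c[of 0] by simp
  have "continuous_on UNIV (\<lambda>(t, x). partial_t \<phi> t x)"
    using c[of 0] by simp
  moreover have "partial_t \<phi> t (x + 2*pi) = partial_t \<phi> t x" for t x
    using \<phi> by (simp add: partial_t_def test_function_def)
  ultimately show "joint_periodic (partial_t \<phi>)" by (simp add: joint_periodic_def)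
  obtain R where R: "\<And>t x. R < \<bar>t\<bar> \<Longrightarrow> \<phi> t x = 0" using \<phi> unfolding test_function_def by blast
  have "partial_t \<phi> t x = 0" if t: "R < \<bar>t\<bar>" for t x
  proof -
    have "open {s::real. R < \<bar>s\<bar>}" by (intro open_Collect_less continuous_intros)
    then have "((\<lambda>s. \<phi> s x) has_vector_derivative 0) (at t)"
      by (rule has_vector_derivative_transform_within_open[OF has_vector_derivative_const[of 0]])
         (use t R in auto)
    then show ?thesis by (simp add: partial_t_def vector_derivative_at)
  qed
  then show "\<exists>R. \<forall>t x. R < \<bar>t\<bar> \<longrightarrow> partial_t \<phi> t x = 0" by blast
qed

lemma test_function_joint: "test_function \<phi> \<Longrightarrow> joint_periodic \<phi>"
  unfolding test_function_def joint_periodic_def by (metis C_k.simps(1))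

lemma test_function_partial_x_pow: "test_function \<phi> \<Longrightarrow> test_function ((partial_x ^^ k) \<phi>)"
  by (induction k) (auto intro: test_function_partial_x)

definition slice :: "(real \<Rightarrow> real \<Rightarrow> real^2) \<Rightarrow> real \<Rightarrow> real \<Rightarrow> complex" where
  "slice \<phi> t = (\<lambda>x. uncvec (\<phi> t x))"

lemma smp_slice:
  assumes "test_function \<phi>"
  shows "smp (slice \<phi> t)"
proof -
  have "times_diff k (\<phi> t)" if "C_k (Suc k) \<phi>" for k \<phi>
    using that
  proof (induction k arbitrary: \<phi>)
    case (Suc k)
    have "times_diff k (partial_x \<phi> t)" using Suc by auto
    then show ?case using Suc.prems by (auto simp: partial_x_def vderiv_def)
  qed auto
  then have "smooth (\<phi> t)" using assms unfolding smooth_def test_function_def by blast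
  then show ?thesis
    using assms bounded_linear.smooth[OF bounded_linear_uncvec]
    by (auto simp: smp_def slice_def periodic_def test_function_def)
qed

lemma cvec_slice: "cvec (slice \<phi> t x) = \<phi> t x"
  by (simp add: slice_def)

lemma fclass_slice: "fclass (slice \<phi> t) = L2_class (\<phi> t)"
  by (simp add: fclass_def slice_def)

lemma fclass_slice_pow:
  assumes "test_function \<phi>"
  shows "fclass ((vderiv ^^ k) (slice \<phi> t)) = L2_class ((partial_x ^^ k) \<phi> t)"
  using vderiv_pow_cvec[OF smp_smooth[OF smp_slice[OF assms]], of k t]
  by (simp add: fclass_def cvec_slice partial_x_pow)

lemma continuous_fclass_slice:
  "test_function \<phi> \<Longrightarrow> continuous_on UNIV (\<lambda>t. fclass ((vderiv ^^ k) (slice \<phi> t)))"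
  by (simp add: fclass_slice_pow L2_curve_continuous test_function_joint test_function_partial_x_pow)

lemma derivative_fclass_slice:
  "test_function \<phi> \<Longrightarrow> ((\<lambda>t. fclass (slice \<phi> t)) has_vector_derivative L2_class (partial_t \<phi> t)) (at t)"
  unfolding fclass_slice
  by (intro L2_curve_derivative test_function_joint test_function_partial_t)

text \<open>The Leibniz rule with all derivatives of the coefficients absorbed into bounded
  operators that do not depend on u. Continuity in time of a spatial term then follows from that of
  the x-derivatives of the slice.\<close>

lemma order_zero_expansion:
  "smp p \<Longrightarrow> smp q \<Longrightarrow> \<exists>T. (\<forall>j. bounded_linear (T j)) \<and>
    (\<forall>u. smp u \<longrightarrow> fclass ((vderiv ^^ k) (\<lambda>x. p x * u x + q x * cnj (u x)))
      = (\<Sum>j\<le>k. T j (fclass ((vderiv ^^ j) u))))"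
proof (induction k arbitrary: p q)
  case 0
  show ?case
    by (intro exI[of _ "\<lambda>_. mop p q"]) (use 0 in \<open>auto intro: bounded_linear_mop smp_cper simp: mop_fclass smp_cper cper_sqint\<close>)
next
  case (Suc k)
  obtain T where T: "\<And>j. bounded_linear (T j)" "\<And>u. smp u \<Longrightarrow>
      fclass ((vderiv ^^ k) (\<lambda>x. p x * u x + q x * cnj (u x))) = (\<Sum>j\<le>k. T j (fclass ((vderiv ^^ j) u)))"
    using Suc.IH[OF Suc.prems] by blast
  obtain U where U: "\<And>j. bounded_linear (U j)" "\<And>u. smp u \<Longrightarrow>
      fclass ((vderiv ^^ k) (\<lambda>x. vderiv p x * u x + vderiv q x * cnj (u x))) = (\<Sum>j\<le>k. U j (fclass ((vderiv ^^ j) u)))"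
    using Suc.IH[of "vderiv p" "vderiv q"] Suc.prems smp_vderiv by blast
  define V where "V j = (\<lambda>v. (if j = 0 then 0 else T (j - 1) v) + (if j = Suc k then 0 else U j v))" for j
  have "bounded_linear (V j)" for j
    unfolding V_def by (cases "j = 0"; cases "j = Suc k") (auto intro!: bounded_linear_add T U)
  moreover have "fclass ((vderiv ^^ Suc k) (\<lambda>x. p x * u x + q x * cnj (u x))) = (\<Sum>j\<le>Suc k. V j (fclass ((vderiv ^^ j) u)))"
    if u: "smp u" for u
  proof -
    let ?a = "\<lambda>x. p x * vderiv u x + q x * cnj (vderiv u x)" and ?b = "\<lambda>x. vderiv p x * u x + vderiv q x * cnj (u x)"
    have s: "smp ?a" "smp ?b" by (intro smp_intros Suc.prems u)+
    have "vderiv (\<lambda>x. p x * u x + q x * cnj (u x)) = (\<lambda>x. (p x * vderiv u x + vderiv p x * u x) + (q x * cnj (vderiv u x) + vderiv q x * cnj (u x)))"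
      by (intro vderivI has_vector_derivative_add has_vector_derivative_mult smooth_has_vderiv
        bounded_linear.has_vector_derivative[OF bounded_linear_cnj] smp_smooth Suc.prems u)
    also have "\<dots> = (\<lambda>x. ?a x * 1 + ?b x * 1)" by (simp add: algebra_simps)
    finally have "(vderiv ^^ Suc k) (\<lambda>x. p x * u x + q x * cnj (u x)) = (\<lambda>x. (vderiv ^^ k) ?a x + (vderiv ^^ k) ?b x)"
      using vderiv_combination(1)[OF smp_smooth[OF s(1)] smp_smooth[OF s(2)], of k 1 1]
      by (simp add: funpow_Suc_right del: funpow.simps)
    then have "fclass ((vderiv ^^ Suc k) (\<lambda>x. p x * u x + q x * cnj (u x))) = fclass ((vderiv ^^ k) ?a) + fclass ((vderiv ^^ k) ?b)"
      by (simp only: fclass_add cper_sqint smp_cper smp_vderiv_pow s)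
    also have "fclass ((vderiv ^^ k) ?a) = (\<Sum>j\<le>k. T j (fclass ((vderiv ^^ Suc j) u)))"
      using T(2)[OF smp_vderiv[OF u]] by (simp add: funpow_Suc_right del: funpow.simps)
    also have "\<dots> = (\<Sum>j\<le>Suc k. (if j = 0 then 0 else T (j - 1) (fclass ((vderiv ^^ j) u))))"
      unfolding sum.atMost_Suc_shift by simp
    also have "fclass ((vderiv ^^ k) ?b) = (\<Sum>j\<le>Suc k. (if j = Suc k then 0 else U j (fclass ((vderiv ^^ j) u))))"
      using U(2)[OF u] by simp
    finally show ?thesis by (simp only: V_def sum.distrib)
  qed
  ultimately show ?case by blast
qed

lemma continuous_order_zero:
  assumes "smp p" "smp q" "test_function \<phi>"
  shows "continuous_on UNIV (\<lambda>t. fclass ((vderiv ^^ k) (\<lambda>x. p x * slice \<phi> t x + q x * cnj (slice \<phi> t x))))"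
proof -
  obtain T where T: "\<And>j. bounded_linear (T j)" "\<And>u. smp u \<Longrightarrow>
      fclass ((vderiv ^^ k) (\<lambda>x. p x * u x + q x * cnj (u x))) = (\<Sum>j\<le>k. T j (fclass ((vderiv ^^ j) u)))"
    using order_zero_expansion[OF assms(1,2), of k] by blast
  show ?thesis
    unfolding T(2)[OF smp_slice[OF assms(3)]]
    by (intro continuous_on_sum bounded_linear.continuous_on[OF T(1)] continuous_fclass_slice assms(3))
qed

text \<open>Each of the three spatial terms is continuous in time with compact support, so the integrals
  may be collected.\<close>

lemma operator_L_test:
  assumes \<beta>: "smooth_matrix \<beta>" and \<gamma>: "smooth_matrix \<gamma>" and \<phi>: "test_function \<phi>"
    and w: "continuous_on UNIV w"
  shows "integrable lborel (\<lambda>t. w t \<bullet> L2_class (partial_t \<phi> t))"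
    and "integrable lborel (\<lambda>t. w t \<bullet> fclass (sop_adj \<beta> \<gamma> (slice \<phi> t)))"
    and "continuous_on UNIV (\<lambda>t. fclass (sop_adj \<beta> \<gamma> (slice \<phi> t)))"
    and "operator_L \<beta> \<gamma> (distribution_of w) \<phi> =
      - (LINT t|lborel. w t \<bullet> L2_class (partial_t \<phi> t)) - (LINT t|lborel. w t \<bullet> fclass (sop_adj \<beta> \<gamma> (slice \<phi> t)))"
proof -
  note m = smp_mlin[OF \<beta>] smp_mlin[OF \<gamma>]
  obtain R1 where R1: "\<And>t x. R1 < \<bar>t\<bar> \<Longrightarrow> \<phi> t x = 0" using \<phi> unfolding test_function_def by blast
  obtain R2 where R2: "\<And>t x. R2 < \<bar>t\<bar> \<Longrightarrow> partial_t \<phi> t x = 0" using test_function_partial_t(3)[OF \<phi>] by auto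
  have int: "integrable lborel (\<lambda>t. w t \<bullet> G t)" if "continuous_on UNIV G" "\<And>t. R < \<bar>t\<bar> \<Longrightarrow> G t = 0" for G R
    by (rule integrable_compact_support[of _ "-R" R])
       (use that in \<open>auto intro!: continuous_on_inner w\<close>)
  show "integrable lborel (\<lambda>t. w t \<bullet> L2_class (partial_t \<phi> t))"
  proof (rule int[OF L2_curve_continuous[OF test_function_partial_t(1)[OF \<phi>]], of R2])
    fix t assume "R2 < \<bar>t\<bar>"
    then have "partial_t \<phi> t = (\<lambda>x. 0)" using R2 by auto
    then show "L2_class (partial_t \<phi> t) = 0" by (simp add: zero_L2_torus.abs_eq)
  qed
  define X4 where "X4 t = L2_class ((vderiv ^^ 4) (\<lambda>x. transpose J *v \<phi> t x))" for t
  define X2 where "X2 t = L2_class ((vderiv ^^ 2) (\<lambda>x. transpose (\<beta> x) *v \<phi> t x))" for t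
  define X1 where "X1 t = L2_class (vderiv (\<lambda>x. transpose (\<gamma> x) *v \<phi> t x))" for t
  have X: "X4 t + X2 t - X1 t = - fclass (sop_adj \<beta> \<gamma> (slice \<phi> t))" for t
    using spatial_operator(4)[OF \<beta> \<gamma> smp_slice[OF \<phi>, of t]] by (simp add: X4_def X2_def X1_def cvec_slice)
  have cX: "X4 t = fclass ((vderiv ^^ 4) (\<lambda>x. - \<i> * slice \<phi> t x + 0 * cnj (slice \<phi> t x)))"
    "X2 t = fclass ((vderiv ^^ 2) (\<lambda>x. cnj (mlin (\<beta> x)) * slice \<phi> t x + manti (\<beta> x) * cnj (slice \<phi> t x)))"
    "X1 t = fclass ((vderiv ^^ 1) (\<lambda>x. cnj (mlin (\<gamma> x)) * slice \<phi> t x + manti (\<gamma> x) * cnj (slice \<phi> t x)))" for t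
  proof -
    have s: "smooth (\<lambda>x. - \<i> * slice \<phi> t x + 0 * cnj (slice \<phi> t x))"
      "smooth (\<lambda>x. cnj (mlin (\<beta> x)) * slice \<phi> t x + manti (\<beta> x) * cnj (slice \<phi> t x))"
      "smooth (\<lambda>x. cnj (mlin (\<gamma> x)) * slice \<phi> t x + manti (\<gamma> x) * cnj (slice \<phi> t x))"
      by (intro smp_smooth smp_intros m smp_slice[OF \<phi>])+
    have fmode: "transpose J *v \<phi> t x = cvec (- \<i> * slice \<phi> t x + 0 * cnj (slice \<phi> t x))"
      "transpose (\<beta> x) *v \<phi> t x = cvec (cnj (mlin (\<beta> x)) * slice \<phi> t x + manti (\<beta> x) * cnj (slice \<phi> t x))"
      "transpose (\<gamma> x) *v \<phi> t x = cvec (cnj (mlin (\<gamma> x)) * slice \<phi> t x + manti (\<gamma> x) * cnj (slice \<phi> t x))" for x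
      using transpose_J_mult_cvec[of "slice \<phi> t x"] transpose_mult_cvec[of "\<beta> x" "slice \<phi> t x"]
        transpose_mult_cvec[of "\<gamma> x" "slice \<phi> t x"] by (simp_all add: cvec_slice)
    show "X4 t = fclass ((vderiv ^^ 4) (\<lambda>x. - \<i> * slice \<phi> t x + 0 * cnj (slice \<phi> t x)))"
      unfolding X4_def fmode(1) fclass_def by (simp only: vderiv_pow_cvec[OF s(1)])
    show "X2 t = fclass ((vderiv ^^ 2) (\<lambda>x. cnj (mlin (\<beta> x)) * slice \<phi> t x + manti (\<beta> x) * cnj (slice \<phi> t x)))"
      unfolding X2_def fmode(2) fclass_def by (simp only: vderiv_pow_cvec[OF s(2)])
    show "X1 t = fclass ((vderiv ^^ 1) (\<lambda>x. cnj (mlin (\<gamma> x)) * slice \<phi> t x + manti (\<gamma> x) * cnj (slice \<phi> t x)))"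
      unfolding X1_def fmode(3) fclass_def using vderiv_pow_cvec[OF s(3), of 1] by simp
  qed
  have cont: "continuous_on UNIV X4" "continuous_on UNIV X2" "continuous_on UNIV X1"
    unfolding cX by (intro continuous_order_zero smp_intros m \<phi>)+
  have zero: "X4 t = 0" "X2 t = 0" "X1 t = 0" if t: "R1 < \<bar>t\<bar>" for t
  proof -
    have "\<phi> t = (\<lambda>x. 0)" using R1[OF t] by auto
    moreover have "(vderiv ^^ k) (\<lambda>x. 0 :: real^2) = (\<lambda>x. 0)" for k
      by (induction k) (auto simp: vderiv_const)
    ultimately show "X4 t = 0" "X2 t = 0" "X1 t = 0"
      by (simp_all add: X4_def X2_def X1_def vderiv_const zero_L2_torus.abs_eq)
  qed
  note i = int[OF cont(1) zero(1)] int[OF cont(2) zero(2)] int[OF cont(3) zero(3)]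
  have eq: "w t \<bullet> fclass (sop_adj \<beta> \<gamma> (slice \<phi> t)) = - (w t \<bullet> X4 t + w t \<bullet> X2 t - w t \<bullet> X1 t)" for t
    using X[of t] by (metis add.inverse_inverse inner_add_right inner_diff_right inner_minus_right)
  show "integrable lborel (\<lambda>t. w t \<bullet> fclass (sop_adj \<beta> \<gamma> (slice \<phi> t)))"
    unfolding eq using i by simp
  have "fclass (sop_adj \<beta> \<gamma> (slice \<phi> t)) = - (X4 t + X2 t - X1 t)" for t
    using X[of t] by (simp add: minus_equation_iff)
  then show "continuous_on UNIV (\<lambda>t. fclass (sop_adj \<beta> \<gamma> (slice \<phi> t)))"
    using cont by (auto intro!: continuous_intros)
  show "operator_L \<beta> \<gamma> (distribution_of w) \<phi> =
      - (LINT t|lborel. w t \<bullet> L2_class (partial_t \<phi> t)) - (LINT t|lborel. w t \<bullet> fclass (sop_adj \<beta> \<gamma> (slice \<phi> t)))"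
    unfolding operator_L_eq X4_def[symmetric] X2_def[symmetric] X1_def[symmetric] eq
    using i by simp
qed

section \<open>From distributional solutions to equations in time\<close>

lemma C_k_tensor:
  fixes \<psi> :: "real \<Rightarrow> real^2"
  shows "smooth \<eta> \<Longrightarrow> smooth \<psi> \<Longrightarrow> C_k k (\<lambda>t x. \<eta> t *\<^sub>R \<psi> x)"
proof (induction k arbitrary: \<eta> \<psi>)
  have cont: "continuous_on UNIV (\<lambda>(t, x). \<eta> t *\<^sub>R \<psi> x)" if "smooth \<eta>" "smooth \<psi>" for \<eta> and \<psi> :: "real \<Rightarrow> real^2"
    unfolding case_prod_beta
    by (intro continuous_on_scaleR continuous_on_compose2[OF smooth_continuous[OF that(1), of UNIV]]
        continuous_on_compose2[OF smooth_continuous[OF that(2), of UNIV]] continuous_intros) auto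
  case 0 then show ?case using cont by simp
  case (Suc k)
  have t: "((\<lambda>s. \<eta> s *\<^sub>R \<psi> x) has_vector_derivative vderiv \<eta> t *\<^sub>R \<psi> x) (at t)" for t x
    by (rule bounded_linear.has_vector_derivative[OF bounded_linear_scaleR_left smooth_has_vderiv[OF Suc.prems(1)]])
  have x: "((\<lambda>y. \<eta> t *\<^sub>R \<psi> y) has_vector_derivative \<eta> t *\<^sub>R vderiv \<psi> x) (at x)" for t x
    by (rule bounded_linear.has_vector_derivative[OF bounded_linear_scaleR_right smooth_has_vderiv[OF Suc.prems(2)]])
  have "partial_t (\<lambda>t x. \<eta> t *\<^sub>R \<psi> x) = (\<lambda>t x. vderiv \<eta> t *\<^sub>R \<psi> x)"
    "partial_x (\<lambda>t x. \<eta> t *\<^sub>R \<psi> x) = (\<lambda>t x. \<eta> t *\<^sub>R vderiv \<psi> x)"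
    unfolding partial_t_def partial_x_def by (simp_all add: vector_derivative_at[OF t] vector_derivative_at[OF x])
  then show ?case
    using cont[OF Suc.prems] Suc.IH[OF smooth_vderiv[OF Suc.prems(1)] Suc.prems(2)]
      Suc.IH[OF Suc.prems(1) smooth_vderiv[OF Suc.prems(2)]] differentiableI_vector[OF t] differentiableI_vector[OF x]
    by auto
qed

lemma test_function_tensor:
  assumes "smooth \<eta>" "\<And>t. R < \<bar>t\<bar> \<Longrightarrow> \<eta> t = 0" "smp u"
  shows "test_function (\<lambda>t x. \<eta> t *\<^sub>R cvec (u x))"
proof -
  have s: "smooth (\<lambda>x. cvec (u x))"
    by (rule bounded_linear.smooth[OF bounded_linear_cvec smp_smooth[OF assms(3)]])
  have "C_k k (\<lambda>t x. \<eta> t *\<^sub>R cvec (u x))" for k by (rule C_k_tensor[OF assms(1) s])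
  moreover have "u (x + 2*pi) = u x" for x using assms(3) by (simp add: smp_def periodic_def)
  ultimately show ?thesis unfolding test_function_def using assms(2) by auto
qed

lemma dop_scaleR:
  assumes "smooth u"
  shows "dop b b' c c' d d' (\<lambda>x. r *\<^sub>R u x) = (\<lambda>x. r *\<^sub>R dop b b' c c' d d' u x)"
proof -
  have "(vderiv ^^ k) (\<lambda>x. r *\<^sub>R u x) = (\<lambda>x. r *\<^sub>R (vderiv ^^ k) u x)" for k
    using vderiv_combination(1)[OF assms assms, of k "of_real r" 0]
    by (simp add: scaleR_conv_of_real mult.commute)
  note this this[of 1]
  then show ?thesis by (simp add: dop_def fun_eq_iff algebra_simps)
qed

text \<open>Separated test functions \<eta>(t) u(x) turn the distributional equation into the weak
  form of a scalar equation for the inner product of w t with u.\<close>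

lemma solution_tested:
  assumes \<beta>: "smooth_matrix \<beta>" and \<gamma>: "smooth_matrix \<gamma>" and sol: "is_solution \<beta> \<gamma> h w0 w"
    and li: "locally_integrable h" and u: "smp u"
    and \<eta>: "smooth \<eta>" "\<And>t. R < \<bar>t\<bar> \<Longrightarrow> \<eta> t = 0"
  shows "- (LINT t|lborel. vderiv \<eta> t * (w t \<bullet> fclass u))
    = (LINT t|lborel. \<eta> t * (w t \<bullet> fclass (sop_adj \<beta> \<gamma> u) + h t \<bullet> fclass u))"
    and "integrable lborel (\<lambda>t. \<eta> t * (w t \<bullet> fclass (sop_adj \<beta> \<gamma> u) + h t \<bullet> fclass u))"
proof -
  define \<phi> where "\<phi> = (\<lambda>t x. \<eta> t *\<^sub>R cvec (u x))"
  have \<phi>: "test_function \<phi>" unfolding \<phi>_def by (rule test_function_tensor[OF \<eta> u])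
  have w: "continuous_on UNIV w" using sol by (simp add: is_solution_def)
  have sq: "sqint u" "sqint (sop_adj \<beta> \<gamma> u)" by (intro cper_sqint smp_cper smp_sop_adj \<beta> \<gamma> u)+
  have "partial_t \<phi> t = (\<lambda>x. cvec (vderiv \<eta> t *\<^sub>R u x))" for t
    unfolding \<phi>_def partial_t_def cvec_scaleR
    by (intro ext vector_derivative_at bounded_linear.has_vector_derivative[OF bounded_linear_scaleR_left]
        smooth_has_vderiv \<eta>)
  then have pt: "L2_class (partial_t \<phi> t) = vderiv \<eta> t *\<^sub>R fclass u" for t
    using fclass_scaleR[OF sq(1)] by (simp add: fclass_def)
  have sl: "slice \<phi> t = (\<lambda>x. \<eta> t *\<^sub>R u x)" for t
    by (simp add: slice_def \<phi>_def flip: cvec_scaleR)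
  have sp: "fclass (sop_adj \<beta> \<gamma> (slice \<phi> t)) = \<eta> t *\<^sub>R fclass (sop_adj \<beta> \<gamma> u)" for t
    using fclass_scaleR[OF sq(2), of "\<eta> t"] unfolding sl
    by (simp add: sop_adj_def dop_scaleR[OF smp_smooth[OF u]])
  have h\<phi>: "h t \<bullet> L2_class (\<phi> t) = \<eta> t * (h t \<bullet> fclass u)" for t
    using fclass_scaleR[OF sq(1), of "\<eta> t"] by (simp add: fclass_slice[symmetric] sl)
  have ih: "integrable lborel (\<lambda>t. \<eta> t * (h t \<bullet> fclass u))"
  proof -
    have hi: "set_integrable lborel {-R..R} h" using li by (simp add: locally_integrable_def)
    obtain B where B: "0 < B" "\<And>t. t \<in> {-R..R} \<Longrightarrow> norm (\<eta> t) \<le> B"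
      using continuous_bounded_Icc[OF smooth_continuous[OF \<eta>(1)]] by blast
    have [measurable]: "(\<lambda>t. indicator {-R..R} t *\<^sub>R h t) \<in> borel_measurable lborel"
      using hi by (simp add: set_integrable_def borel_measurable_integrable)
    have [measurable]: "\<eta> \<in> borel_measurable lborel"
      using borel_measurable_continuous_onI[OF smooth_continuous[OF \<eta>(1)]] by simp
    have z: "\<eta> t = 0" if "t \<notin> {-R..R}" for t using \<eta>(2)[of t] that by (auto simp: abs_if split: if_splits)
    have eq: "\<eta> t * (h t \<bullet> fclass u) = \<eta> t * ((indicator {-R..R} t *\<^sub>R h t) \<bullet> fclass u)" for t
      using z[of t] by (auto simp: indicator_def)
    show ?thesis
      unfolding eq
    proof (rule Bochner_Integration.integrable_bound)
      show "integrable lborel (\<lambda>t. (B * norm (fclass u)) *\<^sub>R (indicator {-R..R} t *\<^sub>R h t))"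
        using integrable_scaleR_right[OF hi[unfolded set_integrable_def]] by blast
      show "AE t in lborel. norm (\<eta> t * ((indicator {-R..R} t *\<^sub>R h t) \<bullet> fclass u))
          \<le> norm ((B * norm (fclass u)) *\<^sub>R (indicator {-R..R} t *\<^sub>R h t))"
      proof (rule AE_I2)
        fix t
        have "\<bar>\<eta> t\<bar> \<le> B" using B z[of t] by (cases "t \<in> {-R..R}") auto
        then have "\<bar>\<eta> t\<bar> * \<bar>(indicator {-R..R} t *\<^sub>R h t) \<bullet> fclass u\<bar> \<le> B * (norm (indicator {-R..R} t *\<^sub>R h t) * norm (fclass u))"
          using Cauchy_Schwarz_ineq2[of "indicator {-R..R} t *\<^sub>R h t" "fclass u"] B(1) by (intro mult_mono) auto
        then show "norm (\<eta> t * ((indicator {-R..R} t *\<^sub>R h t) \<bullet> fclass u))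
          \<le> norm ((B * norm (fclass u)) *\<^sub>R (indicator {-R..R} t *\<^sub>R h t))"
          using B(1) by (simp add: abs_mult mult_ac)
      qed
    qed measurable
  qed
  note L = operator_L_test[OF \<beta> \<gamma> \<phi> w]
  have ia: "integrable lborel (\<lambda>t. \<eta> t * (w t \<bullet> fclass (sop_adj \<beta> \<gamma> u)))"
    using L(2) by (simp add: sp)
  have "operator_L \<beta> \<gamma> (distribution_of w) \<phi> = distribution_of h \<phi>"
    using sol \<phi> by (simp add: is_solution_def)
  from this[unfolded L(4)] have "- (LINT t|lborel. vderiv \<eta> t * (w t \<bullet> fclass u)) =
      (LINT t|lborel. \<eta> t * (w t \<bullet> fclass (sop_adj \<beta> \<gamma> u))) + (LINT t|lborel. \<eta> t * (h t \<bullet> fclass u))"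
    unfolding distribution_of_def h\<phi> pt sp by simp
  then show "- (LINT t|lborel. vderiv \<eta> t * (w t \<bullet> fclass u))
    = (LINT t|lborel. \<eta> t * (w t \<bullet> fclass (sop_adj \<beta> \<gamma> u) + h t \<bullet> fclass u))"
    using Bochner_Integration.integral_add[OF ia ih] by (simp add: distrib_left)
  show "integrable lborel (\<lambda>t. \<eta> t * (w t \<bullet> fclass (sop_adj \<beta> \<gamma> u) + h t \<bullet> fclass u))"
    using Bochner_Integration.integrable_add[OF ia ih] by (simp add: distrib_left)
qed

text \<open>The derivative of a smooth step is supported in [0, 1] and has integral 1. Rescaled, it
  concentrates on [a, a + 1/k] and approximates the Dirac mass at a. Such functions are the
  derivatives of the cut-offs used in time.\<close>

lemma mollifier_tendsto:
  fixes p :: "real \<Rightarrow> real"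
  assumes \<theta>: "smooth \<theta>" "\<And>x. x \<le> 0 \<Longrightarrow> \<theta> x = 0" "\<And>x. 1 \<le> x \<Longrightarrow> \<theta> x = 1" and p: "continuous_on UNIV p"
  shows "(\<lambda>j. LINT t|lborel. (real (Suc j) * vderiv \<theta> (real (Suc j) * t + - (real (Suc j) * a))) * p t) \<longlonglongrightarrow> p a"
    and "integrable lborel (\<lambda>t. (real (Suc j) * vderiv \<theta> (real (Suc j) * t + - (real (Suc j) * a))) * p t)"
proof -
  let ?\<rho> = "vderiv \<theta>"
  have c\<rho>: "continuous_on UNIV ?\<rho>" by (rule smooth_continuous[OF smooth_vderiv[OF \<theta>(1)]])
  have supp: "?\<rho> x = 0" if "x \<notin> {0..1}" for x
  proof (cases "x < 0")
    case True
    have "(\<theta> has_vector_derivative 0) (at x)"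
      by (rule has_vector_derivative_transform_within_open[OF has_vector_derivative_const[of 0], of "{..<0}"])
         (use True \<theta>(2) in auto)
    then show ?thesis by (simp add: vderiv_def vector_derivative_at)
  next
    case False
    have "(\<theta> has_vector_derivative 0) (at x)"
      by (rule has_vector_derivative_transform_within_open[OF has_vector_derivative_const[of 1], of "{1<..}"])
         (use False that \<theta>(3) in auto)
    then show ?thesis by (simp add: vderiv_def vector_derivative_at)
  qed
  have total: "(LINT x|lborel. ?\<rho> x) = 1"
  proof -
    have "\<theta> 1 - \<theta> 0 = (LINT s:{0..1}|lborel. ?\<rho> s)"
      by (rule primitiveD(2)[OF primitive_of_deriv[OF smooth_has_vderiv[OF \<theta>(1)] c\<rho>]]) simp
    moreover have "(LINT s:{0..1}|lborel. ?\<rho> s) = (LINT s|lborel. ?\<rho> s)"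
      unfolding set_lebesgue_integral_def
      by (rule Bochner_Integration.integral_cong) (use supp in \<open>auto simp: indicator_def\<close>)
    ultimately show ?thesis using \<theta>(2)[of 0] \<theta>(3)[of 1] by simp
  qed
  \<comment> \<open>The substitution t = a + x / k moves the scaling from the bump into p.\<close>
  have change: "(LINT t|lborel. (real (Suc j) * ?\<rho> (real (Suc j) * t + - (real (Suc j) * a))) * p t)
      = (LINT x|lborel. ?\<rho> x * p (a + 1 / real (Suc j) * x))" for j
  proof -
    define k where "k = real (Suc j)"
    have k: "k > 0" by (simp add: k_def)
    have arg: "k * (a + 1 / k * x) + - (k * a) = x" for x using k by (simp add: algebra_simps)
    have "(LINT t|lborel. (k * ?\<rho> (k * t + - (k * a))) * p t)
        = \<bar>1 / k\<bar> *\<^sub>R (LINT x|lborel. (k * ?\<rho> x) * p (a + 1 / k * x))"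
      by (subst lborel_integral_real_affine[of "1 / k" _ a]) (use k in \<open>simp_all only: arg, simp_all\<close>)
    also have "\<dots> = (LINT x|lborel. ?\<rho> x * p (a + 1 / k * x))"
      using k by (simp add: mult.assoc)
    finally show ?thesis by (simp only: k_def)
  qed
  obtain B where B: "0 < B" "\<And>t. t \<in> {a..a + 1} \<Longrightarrow> norm (p t) \<le> B"
    using continuous_bounded_Icc[OF p] by blast
  have \<rho>int: "integrable lborel ?\<rho>" by (rule integrable_compact_support[OF c\<rho> supp])
  have [measurable]: "?\<rho> \<in> borel_measurable borel" "p \<in> borel_measurable borel"
    using c\<rho> p by (auto intro: borel_measurable_continuous_onI)
  have "(\<lambda>j. LINT x|lborel. ?\<rho> x * p (a + 1 / real (Suc j) * x)) \<longlonglongrightarrow> (LINT x|lborel. ?\<rho> x * p a)"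
  proof (rule integral_dominated_convergence)
    show "integrable lborel (\<lambda>x. B * norm (?\<rho> x))"
      by (rule integrable_mult_right[OF integrable_norm[OF \<rho>int]])
    have "(\<lambda>j. a + 1 / real (Suc j) * x) \<longlonglongrightarrow> a + 0 * x" for x
      by (intro tendsto_intros) (rule lim_1_over_n[THEN LIMSEQ_Suc])
    then have "(\<lambda>j. p (a + 1 / real (Suc j) * x)) \<longlonglongrightarrow> p (a + 0 * x)" for x
      by (rule isCont_tendsto_compose[rotated]) (use p in \<open>simp add: continuous_on_eq_continuous_at\<close>)
    then show "AE x in lborel. (\<lambda>j. ?\<rho> x * p (a + 1 / real (Suc j) * x)) \<longlonglongrightarrow> ?\<rho> x * p a"
      by (intro AE_I2 tendsto_mult tendsto_const) simp
    fix j
    show "AE x in lborel. norm (?\<rho> x * p (a + 1 / real (Suc j) * x)) \<le> B * norm (?\<rho> x)"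
    proof (rule AE_I2)
      fix x
      show "norm (?\<rho> x * p (a + 1 / real (Suc j) * x)) \<le> B * norm (?\<rho> x)"
      proof (cases "x \<in> {0..1}")
        case True
        then have "1 / real (Suc j) * x \<le> 1 * 1" by (intro mult_mono) auto
        then have "norm (p (a + 1 / real (Suc j) * x)) \<le> B" using True by (intro B) auto
        then have "norm (?\<rho> x) * norm (p (a + 1 / real (Suc j) * x)) \<le> norm (?\<rho> x) * B"
          by (rule mult_left_mono) simp
        then show ?thesis by (simp add: abs_mult mult.commute)
      qed (simp add: supp)
    qed
  qed measurable
  moreover have "(LINT x|lborel. ?\<rho> x * p a) = p a" by (simp add: total)
  ultimately show "(\<lambda>j. LINT t|lborel. (real (Suc j) * ?\<rho> (real (Suc j) * t + - (real (Suc j) * a))) * p t) \<longlonglongrightarrow> p a"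
    by (simp only: change)
  show "integrable lborel (\<lambda>t. (real (Suc j) * ?\<rho> (real (Suc j) * t + - (real (Suc j) * a))) * p t)"
  proof (rule integrable_compact_support[where a = a and b = "a + 1"])
    show "continuous_on UNIV (\<lambda>t. (real (Suc j) * ?\<rho> (real (Suc j) * t + - (real (Suc j) * a))) * p t)"
      by (intro continuous_intros p continuous_on_compose2[OF c\<rho>]) auto
    fix t assume t: "t \<notin> {a..a + 1}"
    define k where "k = real (Suc j)"
    have k: "1 \<le> k" by (simp add: k_def)
    have "k * t + - (k * a) \<notin> {0..1}"
    proof (cases "t < a")
      case True
      then have "k * (t - a) < 0" using k by (intro mult_pos_neg) auto
      then show ?thesis by (simp add: algebra_simps)
    next
      case False
      then have "1 < t - a" using t by auto
      then have "1 * 1 < k * (t - a)" using k by (intro mult_le_less_imp_less) auto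
      then show ?thesis by (simp add: algebra_simps)
    qed
    from supp[OF this] show "(real (Suc j) * ?\<rho> (real (Suc j) * t + - (real (Suc j) * a))) * p t = 0"
      by (simp only: k_def)
  qed
qed

text \<open>Testing with smooth approximations of the indicator of \<open>(a, b]\<close> recovers the integrated equation.\<close>

theorem solution_weak:
  assumes \<beta>: "smooth_matrix \<beta>" and \<gamma>: "smooth_matrix \<gamma>" and sol: "is_solution \<beta> \<gamma> h w0 w"
    and li: "locally_integrable h" and u: "smp u"
  shows "primitive (\<lambda>t. w t \<bullet> fclass u) (\<lambda>t. w t \<bullet> fclass (sop_adj \<beta> \<gamma> u) + h t \<bullet> fclass u)"
  unfolding primitive_def
proof (intro allI impI)
  fix a b :: real assume ab: "a \<le> b"
  define p where "p t = w t \<bullet> fclass u" for t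
  define q where "q t = w t \<bullet> fclass (sop_adj \<beta> \<gamma> u) + h t \<bullet> fclass u" for t
  have w: "continuous_on UNIV w" using sol by (simp add: is_solution_def)
  have p: "continuous_on UNIV p" unfolding p_def by (intro continuous_intros w)
  have q: "set_integrable lborel {c..d} q" for c d
  proof -
    have "set_integrable lborel {c..d} (\<lambda>t. w t \<bullet> fclass (sop_adj \<beta> \<gamma> u))"
      by (intro set_integrable_continuous continuous_on_inner continuous_on_subset[OF w] continuous_on_const) auto
    moreover have "set_integrable lborel {c..d} (\<lambda>t. h t \<bullet> fclass u)"
      using li integrable_inner_left[of "fclass u" lborel "\<lambda>t. indicator {c..d} t *\<^sub>R h t"]
      by (simp add: locally_integrable_def set_integrable_def)
    ultimately show ?thesis unfolding q_def by (rule set_integral_add(1))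
  qed
  obtain \<theta> :: "real \<Rightarrow> real" where \<theta>: "smooth \<theta>" "\<And>x. x \<le> 0 \<Longrightarrow> \<theta> x = 0" "\<And>x. 1 \<le> x \<Longrightarrow> \<theta> x = 1"
    and \<theta>01: "\<And>x. 0 \<le> \<theta> x" "\<And>x. \<theta> x \<le> 1"
    by (rule smooth_step) blast
  define k where "k j = real (Suc j)" for j
  have k1: "1 \<le> k j" for j by (simp add: k_def)
  \<comment> \<open>A step up just after a and a step down just after b. All supports lie in
    [a, b + 1], which gives one dominating function for all j.\<close>
  define \<eta> where "\<eta> j t = \<theta> (k j * t + - (k j * a)) - \<theta> (k j * t + - (k j * b))" for j t
  have \<eta>s: "smooth (\<eta> j)" for j
    unfolding \<eta>_def by (intro smooth_diff smooth_compose_affine \<theta>)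
  have \<eta>': "vderiv (\<eta> j) t = k j * vderiv \<theta> (k j * t + - (k j * a)) - k j * vderiv \<theta> (k j * t + - (k j * b))" for j t
  proof -
    have d: "((\<lambda>t. \<theta> (k j * t + - (k j * c))) has_vector_derivative k j *\<^sub>R vderiv \<theta> (k j * t + - (k j * c))) (at t)" for c
      by (rule has_vector_derivative_compose_affine[OF smooth_has_vderiv[OF \<theta>(1)]])
    have "(\<eta> j has_vector_derivative k j *\<^sub>R vderiv \<theta> (k j * t + - (k j * a)) - k j *\<^sub>R vderiv \<theta> (k j * t + - (k j * b))) (at t)"
      unfolding \<eta>_def by (rule has_vector_derivative_diff[OF d d])
    then show ?thesis by (simp only: vderiv_def vector_derivative_at real_scaleR_def)
  qed
  have below: "k j * t + - (k j * c) \<le> 0" if "t \<le> c" for j t c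
    using k1[of j] that by (simp add: mult_left_mono)
  have above: "1 \<le> k j * t + - (k j * c)" if "c + 1 \<le> t" for j t c
  proof -
    have "1 * 1 \<le> k j * (t - c)" using k1[of j] that by (intro mult_mono) auto
    then show ?thesis by (simp add: algebra_simps)
  qed
  have \<eta>0: "\<eta> j t = 0" if "t \<notin> {a..b + 1}" for j t
    using that ab below[of t a j] below[of t b j] above[of a t j] above[of b t j]
    by (cases "t < a") (auto simp: \<eta>_def \<theta>)
  have \<eta>R: "\<eta> j t = 0" if "\<bar>a\<bar> + \<bar>b\<bar> + 1 < \<bar>t\<bar>" for j t
    using that ab by (intro \<eta>0) auto
  have \<eta>1: "\<bar>\<eta> j t\<bar> \<le> 1" for j t
    using \<theta>01(1)[of "k j * t + - (k j * a)"] \<theta>01(2)[of "k j * t + - (k j * a)"]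
      \<theta>01(1)[of "k j * t + - (k j * b)"] \<theta>01(2)[of "k j * t + - (k j * b)"]
    unfolding \<eta>_def by (intro abs_leI) linarith+
  have T: "- (LINT t|lborel. vderiv (\<eta> j) t * p t) = (LINT t|lborel. \<eta> j t * q t)"
    "integrable lborel (\<lambda>t. \<eta> j t * q t)" for j
    unfolding p_def q_def
    by (rule solution_tested[OF \<beta> \<gamma> sol li u \<eta>s[of j], of "\<bar>a\<bar> + \<bar>b\<bar> + 1"], erule \<eta>R)+
  have m2[measurable]: "(\<lambda>t. indicator {a..b} t *\<^sub>R q t) \<in> borel_measurable lborel"
    using q[of a b] unfolding set_integrable_def by (rule borel_measurable_integrable)
  have "(\<lambda>t. indicator {a<..b} t *\<^sub>R (indicator {a..b} t *\<^sub>R q t)) \<in> borel_measurable lborel"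
    by measurable
  also have "(\<lambda>t. indicator {a<..b} t *\<^sub>R (indicator {a..b} t *\<^sub>R q t)) = (\<lambda>t. indicator {a<..b} t * q t)"
    by (auto simp: fun_eq_iff indicator_def)
  finally have m1: "(\<lambda>t. indicator {a<..b} t * q t) \<in> borel_measurable lborel" .
  have "(\<lambda>j. LINT t|lborel. \<eta> j t * q t) \<longlonglongrightarrow> (LINT t|lborel. indicator {a<..b} t * q t)"
  proof (rule integral_dominated_convergence)
    show "integrable lborel (\<lambda>t. norm (indicator {a..b + 1} t *\<^sub>R q t))"
      using q[of a "b + 1"] by (simp add: set_integrable_def)
    show "(\<lambda>t. \<eta> j t * q t) \<in> borel_measurable lborel" for j
      by (rule borel_measurable_integrable[OF T(2)])
    show "(\<lambda>t. indicator {a<..b} t * q t) \<in> borel_measurable lborel" by (rule m1)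
    show "AE t in lborel. norm (\<eta> j t * q t) \<le> norm (indicator {a..b + 1} t *\<^sub>R q t)" for j
    proof (rule AE_I2)
      fix t show "norm (\<eta> j t * q t) \<le> norm (indicator {a..b + 1} t *\<^sub>R q t)"
        using \<eta>1[of j t] \<eta>0[of t j] by (cases "t \<in> {a..b + 1}") (auto simp: abs_mult mult_left_le_one_le)
    qed
    have lim: "(\<lambda>j. \<theta> (k j * t + - (k j * c))) \<longlonglongrightarrow> (if c < t then 1 else 0)" for t c
    proof (cases "c < t")
      case True
      obtain j0 where j0: "1 / (t - c) < real j0" using reals_Archimedean2 by blast
      have "\<theta> (k j * t + - (k j * c)) = 1" if "j0 \<le> j" for j
      proof (rule \<theta>(3))
        have "1 / (t - c) \<le> k j" using j0 that unfolding k_def by linarith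
        then show "1 \<le> k j * t + - (k j * c)" using True by (simp add: field_simps)
      qed
      then have "\<forall>\<^sub>F j in sequentially. \<theta> (k j * t + - (k j * c)) = 1"
        by (rule eventually_sequentiallyI)
      then show ?thesis using True by (simp add: tendsto_eventually)
    qed (use below \<theta>(2) in auto)
    have "(\<lambda>j. \<eta> j t * q t) \<longlonglongrightarrow> ((if a < t then 1 else 0) - (if b < t then 1 else 0)) * q t" for t
      unfolding \<eta>_def by (intro tendsto_intros lim)
    moreover have "((if a < t then 1 else 0) - (if b < t then 1 else 0)) * q t = indicator {a<..b} t * q t" for t
      using ab by (auto simp: indicator_def)
    ultimately show "AE t in lborel. (\<lambda>j. \<eta> j t * q t) \<longlonglongrightarrow> indicator {a<..b} t * q t"
      by (intro AE_I2) simp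
  qed
  moreover have "(LINT t|lborel. indicator {a<..b} t * q t) = (LINT t:{a..b}|lborel. q t)"
    unfolding set_lebesgue_integral_def
  proof (rule integral_cong_AE[OF m1 m2])
    have "AE t in lborel. t \<noteq> a" by (rule AE_lborel_singleton)
    then show "AE t in lborel. indicator {a<..b} t * q t = indicator {a..b} t *\<^sub>R q t"
      by eventually_elim (auto simp: indicator_def)
  qed
  \<comment> \<open>By the tested equation the same integrals are approximate Dirac masses at b
    minus those at a, applied to p; the two limits are then compared.\<close>
  moreover have "(\<lambda>j. LINT t|lborel. \<eta> j t * q t) \<longlonglongrightarrow> p b - p a"
  proof -
    note M = mollifier_tendsto[OF \<theta> p, folded k_def]
    have eq: "(LINT t|lborel. \<eta> j t * q t) = (LINT t|lborel. (k j * vderiv \<theta> (k j * t + - (k j * b))) * p t)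
        - (LINT t|lborel. (k j * vderiv \<theta> (k j * t + - (k j * a))) * p t)" for j
    proof -
      have "(LINT t|lborel. \<eta> j t * q t) = - (LINT t|lborel. vderiv (\<eta> j) t * p t)"
        by (rule T(1)[of j, symmetric])
      also have "\<dots> = - ((LINT t|lborel. (k j * vderiv \<theta> (k j * t + - (k j * a))) * p t)
          - (LINT t|lborel. (k j * vderiv \<theta> (k j * t + - (k j * b))) * p t))"
        unfolding \<eta>' left_diff_distrib
        by (simp only: Bochner_Integration.integral_diff[OF M(2)[of j a] M(2)[of j b]])
      finally show ?thesis by simp
    qed
    show ?thesis unfolding eq by (intro tendsto_diff M(1))
  qed
  ultimately have "p b - p a = (LINT t:{a..b}|lborel. q t)" using LIMSEQ_unique by metis
  moreover have "q = (\<lambda>t. w t \<bullet> fclass (sop_adj \<beta> \<gamma> u) + h t \<bullet> fclass u)"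
    by (simp add: q_def fun_eq_iff)
  ultimately show "set_integrable lborel {a..b} (\<lambda>t. w t \<bullet> fclass (sop_adj \<beta> \<gamma> u) + h t \<bullet> fclass u) \<and>
      w b \<bullet> fclass u - w a \<bullet> fclass u = (LINT s:{a..b}|lborel. w s \<bullet> fclass (sop_adj \<beta> \<gamma> u) + h s \<bullet> fclass u)"
    using q[of a b] by (simp only: p_def)
qed

section \<open>From Fourier modes back to distributional solutions\<close>

lemma fclass_dop:
  assumes "smp b" "smp b'" "smp c" "smp c'" "smp d" "smp d'" "smp u"
  shows "fclass (dop b b' c c' d d' u) = mop (\<lambda>x. \<i>) (\<lambda>x. 0) (fclass ((vderiv ^^ 4) u))
    + mop b b' (fclass ((vderiv ^^ 2) u)) + mop c c' (fclass ((vderiv ^^ 1) u)) + mop d d' (fclass ((vderiv ^^ 0) u))"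
proof -
  have s: "smp ((vderiv ^^ k) u)" for k by (rule smp_vderiv_pow[OF assms(7)])
  note cp = assms(1-6)[THEN smp_cper] cper_const[of \<i>] cper_const[of 0]
  note sq = s[THEN smp_cper, THEN cper_sqint]
  note m = mop_fclass[OF cp(7,8) sq] mop_fclass[OF cp(1,2) sq] mop_fclass[OF cp(3,4) sq] mop_fclass[OF cp(5,6) sq]
  show ?thesis
    unfolding m
    by (subst fclass_add4; (rule sqint_mop[OF _ _ sq]; rule cp)?)
       (simp add: dop_def add.assoc)
qed

lemma vderiv_pow_exponential:
  "(vderiv ^^ k) (\<lambda>x. a * cis (of_int n * x)) = (\<lambda>x. ((\<i> * of_int n) ^ k * a) * cis (of_int n * x))"
proof (induction k)
  case (Suc k)
  have d: "vderiv (\<lambda>x. c * cis (of_int n * x)) = (\<lambda>x. (\<i> * of_int n * c) * cis (of_int n * x))" for c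
    using vderiv_times_cis[OF smooth_const[of 1], of c n] by (simp add: vderiv_const mult_ac)
  have "(vderiv ^^ Suc k) (\<lambda>x. a * cis (of_int n * x)) = vderiv ((vderiv ^^ k) (\<lambda>x. a * cis (of_int n * x)))"
    by simp
  also have "\<dots> = (\<lambda>x. (\<i> * of_int n * ((\<i> * of_int n) ^ k * a)) * cis (of_int n * x))"
    unfolding Suc by (rule d)
  finally show ?case by (simp only: power_Suc mult.assoc)
qed simp

lemma coef_vderiv_pow:
  "smp u \<Longrightarrow> coef (fclass ((vderiv ^^ k) u)) n = (\<i> * of_int n) ^ k * coef (fclass u) n"
  by (induction k) (auto simp: coef_vderiv smp_vderiv_pow)

lemma complex_linear_basis:
  "bounded_linear f \<Longrightarrow> f a = Re a *\<^sub>R f 1 + Im a *\<^sub>R f \<i>"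
proof -
  assume f: "bounded_linear f"
  have "a = Re a *\<^sub>R 1 + Im a *\<^sub>R \<i>" by (simp add: complex_eq_iff)
  then show ?thesis
    using linear_add[OF bounded_linear.linear[OF f]] linear_scale[OF bounded_linear.linear[OF f]] by metis
qed

lemma inner_complex_linear:
  assumes "bounded_linear f"
  shows "v \<bullet> f a = Re a * (v \<bullet> f 1) + Im a * (v \<bullet> f \<i>)"
proof -
  have "v \<bullet> f a = v \<bullet> (Re a *\<^sub>R f 1 + Im a *\<^sub>R f \<i>)"
    by (rule arg_cong[OF complex_linear_basis[OF assms]])
  then show ?thesis by (simp only: inner_add_right inner_scaleR_right)
qed

lemma locally_integrable_norm:
  "locally_integrable h \<Longrightarrow> set_integrable lborel {a..b} (\<lambda>t. norm (h t))"
  unfolding locally_integrable_def by (rule set_integrable_norm) simp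

text \<open>Truncating the Fourier series of a test function in \<open>x\<close> reduces the distributional equation to
  finitely many modes.\<close>

theorem weak_solution:
  assumes \<beta>: "smooth_matrix \<beta>" and \<gamma>: "smooth_matrix \<gamma>"
    and w: "continuous_on UNIV w" and li: "locally_integrable h"
    and modes: "\<And>n c. primitive (\<lambda>t. w t \<bullet> fmode n c)
        (\<lambda>t. w t \<bullet> fclass (sop_adj \<beta> \<gamma> (\<lambda>x. c * cis (of_int n * x))) + h t \<bullet> fmode n c)"
    and \<phi>: "test_function \<phi>"
  shows "operator_L \<beta> \<gamma> (distribution_of w) \<phi> = distribution_of h \<phi>"
proof -
  define \<Phi> where "\<Phi> k t = fclass ((vderiv ^^ k) (slice \<phi> t))" for k t
  define \<Theta> where "\<Theta> t = L2_class (partial_t \<phi> t)" for t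
  note c = smp_coefs[OF \<beta> \<gamma>]
  define T4 T2 T1 T0 where "T4 = mop (\<lambda>x. \<i>) (\<lambda>x. 0)"
    and "T2 = mop (\<lambda>x. - cnj (mlin (\<beta> x))) (\<lambda>x. - manti (\<beta> x))"
    and "T1 = mop (\<lambda>x. cnj (mlin (\<gamma> x)) - 2 * vderiv (\<lambda>x. cnj (mlin (\<beta> x))) x)
        (\<lambda>x. manti (\<gamma> x) - 2 * vderiv (\<lambda>x. manti (\<beta> x)) x)"
    and "T0 = mop (\<lambda>x. vderiv (\<lambda>x. cnj (mlin (\<gamma> x))) x - (vderiv ^^ 2) (\<lambda>x. cnj (mlin (\<beta> x))) x)
        (\<lambda>x. vderiv (\<lambda>x. manti (\<gamma> x)) x - (vderiv ^^ 2) (\<lambda>x. manti (\<beta> x)) x)"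
  have bl: "bounded_linear T4" "bounded_linear T2" "bounded_linear T1" "bounded_linear T0"
    unfolding T4_def T2_def T1_def T0_def by (intro bounded_linear_mop smp_cper c smp_const)+
  have T: "fclass (sop_adj \<beta> \<gamma> u) = T4 (fclass ((vderiv ^^ 4) u)) + T2 (fclass ((vderiv ^^ 2) u))
      + T1 (fclass ((vderiv ^^ 1) u)) + T0 (fclass ((vderiv ^^ 0) u))" if "smp u" for u
    unfolding sop_adj_def T4_def T2_def T1_def T0_def by (rule fclass_dop[OF c that])
  define L where "L n a = T4 (fmode n ((\<i> * of_int n) ^ 4 * a)) + T2 (fmode n ((\<i> * of_int n) ^ 2 * a))
      + T1 (fmode n ((\<i> * of_int n) ^ 1 * a)) + T0 (fmode n ((\<i> * of_int n) ^ 0 * a))" for n a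
  have Le: "fclass (sop_adj \<beta> \<gamma> (\<lambda>x. a * cis (of_int n * x))) = L n a" for n a
  proof -
    have "smp (\<lambda>x. a * cis (of_int n * x))" by (intro smp_intros)
    from T[OF this] show ?thesis unfolding vderiv_pow_exponential L_def fmode_def .
  qed
  have blL: "bounded_linear (L n)" for n
    unfolding L_def
    by (intro bounded_linear_add bounded_linear_compose[OF bl(1)] bounded_linear_compose[OF bl(2)]
        bounded_linear_compose[OF bl(3)] bounded_linear_compose[OF bl(4)]
        bounded_linear_compose[OF bounded_linear_fmode] bounded_linear_mult_right)
  define a where "a n t = coef (\<Phi> 0 t) n" for n t
  have \<Phi>d: "(\<Phi> 0 has_vector_derivative \<Theta> t) (at t)" for t
  proof -
    have "\<Phi> 0 = (\<lambda>t. fclass (slice \<phi> t))" by (simp add: \<Phi>_def fun_eq_iff)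
    then show ?thesis using derivative_fclass_slice[OF \<phi>, of t] by (simp add: \<Theta>_def)
  qed
  have ad: "(a n has_vector_derivative coef (\<Theta> t) n) (at t)" for n t
    unfolding a_def by (rule bounded_linear.has_vector_derivative[OF bounded_linear_coef \<Phi>d])
  have c\<Theta>: "continuous_on UNIV \<Theta>"
    unfolding \<Theta>_def by (rule L2_curve_continuous[OF test_function_partial_t(1)[OF \<phi>]])
  have c\<Phi>: "continuous_on UNIV (\<Phi> k)" for k
    unfolding \<Phi>_def by (rule continuous_fclass_slice[OF \<phi>])
  \<comment> \<open>The amplitude \<open>a n t\<close> of the test function depends on time and
    enters only real-linearly, so the product rule is applied to its real and imaginary parts
    separately.\<close>
  have mode: "primitive (\<lambda>t. w t \<bullet> fmode n (a n t))
      (\<lambda>t. w t \<bullet> fmode n (coef (\<Theta> t) n) + w t \<bullet> L n (a n t) + h t \<bullet> fmode n (a n t))" for n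
  proof -
    have cc: "continuous_on UNIV (\<lambda>t. coef (\<Theta> t) n)"
      by (rule bounded_linear.continuous_on[OF bounded_linear_coef c\<Theta>])
    have P: "primitive (\<lambda>t. Re (a n t) * (w t \<bullet> fmode n 1) + Im (a n t) * (w t \<bullet> fmode n \<i>))
      (\<lambda>t. (Re (coef (\<Theta> t) n) * (w t \<bullet> fmode n 1) + Re (a n t) * (w t \<bullet> L n 1 + h t \<bullet> fmode n 1))
         + (Im (coef (\<Theta> t) n) * (w t \<bullet> fmode n \<i>) + Im (a n t) * (w t \<bullet> L n \<i> + h t \<bullet> fmode n \<i>)))"
      by (intro primitive_add primitive_mult_real modes[unfolded Le] continuous_intros cc
          bounded_linear.has_vector_derivative[OF bounded_linear_Re] bounded_linear.has_vector_derivative[OF bounded_linear_Im] ad)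
    note l = inner_complex_linear[OF bounded_linear_fmode, of _ n] inner_complex_linear[OF blL, of _ n]
    show ?thesis
      unfolding l(1)[of _ "a n t" for t] l(1)[of _ "coef (\<Theta> t) n" for t] l(2)[of _ "a n t" for t]
      using P by (simp only: distrib_left add.assoc add.commute add.left_commute)
  qed
  have coefs: "coef (\<Phi> k t) n = (\<i> * of_int n) ^ k * a n t" for k n t
    unfolding \<Phi>_def a_def using coef_vderiv_pow[OF smp_slice[OF \<phi>], of k t n] by simp
  \<comment> \<open>Truncation commutes with \<partial>: the spatial operator is unbounded, but on a
    truncated slice it consists of bounded operators applied to projections of the derivatives of
    the slice, and all of these converge.\<close>
  have sumL: "(\<Sum>n\<in>{-int N..int N}. L n (a n t)) = T4 (proj N (\<Phi> 4 t)) + T2 (proj N (\<Phi> 2 t)) + T1 (proj N (\<Phi> 1 t)) + T0 (proj N (\<Phi> 0 t))" for N t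
    unfolding proj_def coefs L_def sum.distrib
    by (simp only: linear_sum[OF bounded_linear.linear[OF bl(1)]] linear_sum[OF bounded_linear.linear[OF bl(2)]]
        linear_sum[OF bounded_linear.linear[OF bl(3)]] linear_sum[OF bounded_linear.linear[OF bl(4)]])
  define q where "q N t = w t \<bullet> proj N (\<Theta> t) + w t \<bullet> (T4 (proj N (\<Phi> 4 t)) + T2 (proj N (\<Phi> 2 t)) + T1 (proj N (\<Phi> 1 t)) + T0 (proj N (\<Phi> 0 t)))
      + h t \<bullet> proj N (\<Phi> 0 t)" for N t
  have prim: "primitive (\<lambda>t. w t \<bullet> \<Phi> 0 t) (\<lambda>t. w t \<bullet> \<Theta> t + w t \<bullet> fclass (sop_adj \<beta> \<gamma> (slice \<phi> t)) + h t \<bullet> \<Phi> 0 t)"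
  proof (rule primitive_limit)
    show "primitive (\<lambda>t. w t \<bullet> proj N (\<Phi> 0 t)) (q N)" for N
    proof -
      have "primitive (\<lambda>t. \<Sum>n\<in>{-int N..int N}. w t \<bullet> fmode n (a n t))
        (\<lambda>t. \<Sum>n\<in>{-int N..int N}. w t \<bullet> fmode n (coef (\<Theta> t) n) + w t \<bullet> L n (a n t) + h t \<bullet> fmode n (a n t))"
        by (rule primitive_sum) (rule mode)
      moreover have "(\<Sum>n\<in>{-int N..int N}. w t \<bullet> fmode n (coef (\<Theta> t) n) + w t \<bullet> L n (a n t) + h t \<bullet> fmode n (a n t)) = q N t" for t
        unfolding q_def sum.distrib sumL[symmetric]
        by (simp add: inner_sum_right proj_def a_def)
      moreover have "(\<Sum>n\<in>{-int N..int N}. w t \<bullet> fmode n (a n t)) = w t \<bullet> proj N (\<Phi> 0 t)" for t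
        by (simp add: inner_sum_right proj_def a_def)
      ultimately show ?thesis by simp
    qed
    show "(\<lambda>N. w t \<bullet> proj N (\<Phi> 0 t)) \<longlonglongrightarrow> w t \<bullet> \<Phi> 0 t" for t
      by (intro tendsto_intros proj_tendsto)
    show "(\<lambda>N. q N t) \<longlonglongrightarrow> w t \<bullet> \<Theta> t + w t \<bullet> fclass (sop_adj \<beta> \<gamma> (slice \<phi> t)) + h t \<bullet> \<Phi> 0 t" for t
      unfolding q_def T[OF smp_slice[OF \<phi>]] \<Phi>_def
      by (intro tendsto_intros proj_tendsto bounded_linear.tendsto[OF bl(1)] bounded_linear.tendsto[OF bl(2)]
          bounded_linear.tendsto[OF bl(3)] bounded_linear.tendsto[OF bl(4)])
    fix x y :: real
    obtain W where W: "0 < W" "\<And>t. t \<in> {x..y} \<Longrightarrow> norm (w t) \<le> W" using continuous_bounded_Icc[OF w] by blast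
    obtain D where D: "0 < D" "\<And>t. t \<in> {x..y} \<Longrightarrow> norm (\<Theta> t) \<le> D" using continuous_bounded_Icc[OF c\<Theta>] by blast
    have "\<exists>E>0. \<forall>t\<in>{x..y}. norm (\<Phi> k t) \<le> E" for k using continuous_bounded_Icc[OF c\<Phi>[of k]] by metis
    then obtain E where E: "\<And>k t. t \<in> {x..y} \<Longrightarrow> norm (\<Phi> k t) \<le> E k" "\<And>k. 0 < E k" by metis
    obtain K4 where K4: "0 < K4" "\<And>v. norm (T4 v) \<le> norm v * K4" using bounded_linear.pos_bounded[OF bl(1)] by blast
    obtain K2 where K2: "0 < K2" "\<And>v. norm (T2 v) \<le> norm v * K2" using bounded_linear.pos_bounded[OF bl(2)] by blast
    obtain K1 where K1: "0 < K1" "\<And>v. norm (T1 v) \<le> norm v * K1" using bounded_linear.pos_bounded[OF bl(3)] by blast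
    obtain K0 where K0: "0 < K0" "\<And>v. norm (T0 v) \<le> norm v * K0" using bounded_linear.pos_bounded[OF bl(4)] by blast
    show "\<exists>g. set_integrable lborel {x..y} g \<and> (\<forall>N. \<forall>t\<in>{x..y}. norm (q N t) \<le> g t)"
    proof (intro exI conjI allI ballI)
      show "set_integrable lborel {x..y} (\<lambda>t. (W * D + W * (E 4 * K4 + E 2 * K2 + E 1 * K1 + E 0 * K0)) + E 0 * norm (h t))"
        by (intro set_integral_add(1) set_integrable_continuous continuous_on_const set_integrable_mult_right
            locally_integrable_norm[OF li])
      fix N t assume t: "t \<in> {x..y}"
      have pr: "norm (proj N (\<Phi> k t)) \<le> E k" for k by (rule order_trans[OF norm_proj_le E(1)[OF t]])
      have Tb: "norm (T4 (proj N (\<Phi> 4 t)) + T2 (proj N (\<Phi> 2 t)) + T1 (proj N (\<Phi> 1 t)) + T0 (proj N (\<Phi> 0 t)))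
          \<le> E 4 * K4 + E 2 * K2 + E 1 * K1 + E 0 * K0"
        by (intro order_trans[OF norm_triangle_ineq] add_mono order_trans[OF K4(2) mult_right_mono[OF pr]]
            order_trans[OF K2(2) mult_right_mono[OF pr]] order_trans[OF K1(2) mult_right_mono[OF pr]]
            order_trans[OF K0(2) mult_right_mono[OF pr]] less_imp_le K4 K2 K1 K0)
      have in_le: "\<bar>v \<bullet> v'\<bar> \<le> A * B" if "norm v \<le> A" "norm v' \<le> B" for v v' :: L2_torus and A B
        using Cauchy_Schwarz_ineq2[of v v'] mult_mono[OF that order_trans[OF norm_ge_zero that(1)] norm_ge_zero] by linarith
      have "\<bar>w t \<bullet> proj N (\<Theta> t)\<bar> \<le> W * D"
        by (rule in_le[OF W(2)[OF t] order_trans[OF norm_proj_le D(2)[OF t]]])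
      moreover note in_le[OF W(2)[OF t] Tb]
      moreover have "\<bar>h t \<bullet> proj N (\<Phi> 0 t)\<bar> \<le> norm (h t) * E 0" by (rule in_le[OF order_refl pr])
      ultimately show "norm (q N t) \<le> (W * D + W * (E 4 * K4 + E 2 * K2 + E 1 * K1 + E 0 * K0)) + E 0 * norm (h t)"
        unfolding q_def real_norm_def by (simp only: mult.commute[of "E 0" "norm (h t)"])
    qed
  qed
  obtain R1 where R1: "\<And>t x. R1 < \<bar>t\<bar> \<Longrightarrow> \<phi> t x = 0" using \<phi> unfolding test_function_def by blast
  obtain R2 where R2: "\<And>t x. R2 < \<bar>t\<bar> \<Longrightarrow> partial_t \<phi> t x = 0" using test_function_partial_t(3)[OF \<phi>] by auto
  \<comment> \<open>The maximum with 0 gives \<open>-R \<le> R\<close>, and the added 1 puts both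
    end points strictly outside the supports, so that no boundary terms remain.\<close>
  define R where "R = max 0 (max R1 R2) + 1"
  have zero: "\<Phi> 0 t = 0" "\<Theta> t = 0" "fclass (sop_adj \<beta> \<gamma> (slice \<phi> t)) = 0" if t: "t \<notin> {-R<..<R}" for t
  proof -
    have "R1 < \<bar>t\<bar>" "R2 < \<bar>t\<bar>" using t by (auto simp: R_def abs_if)
    then have z: "\<phi> t = (\<lambda>x. 0)" "partial_t \<phi> t = (\<lambda>x. 0)" using R1 R2 by auto
    have s0: "slice \<phi> t = (\<lambda>x. 0)" by (simp add: slice_def z uncvec_def fun_eq_iff complex_eq_iff)
    show "\<Phi> 0 t = 0" by (simp add: \<Phi>_def s0 fclass_0)
    show "\<Theta> t = 0" by (simp add: \<Theta>_def z zero_L2_torus.abs_eq)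
    have "(vderiv ^^ k) (\<lambda>x. 0 :: complex) = (\<lambda>x. 0)" for k by (induction k) (auto simp: vderiv_const)
    then show "fclass (sop_adj \<beta> \<gamma> (slice \<phi> t)) = 0"
      by (simp add: sop_adj_def dop_def s0 vderiv_const fclass_0)
  qed
  have R0: "-R \<le> R" by (simp add: R_def)
  note p = primitiveD[OF prim R0]
  note O = operator_L_test[OF \<beta> \<gamma> \<phi> w, folded \<Theta>_def]
  have ind: "indicator {-R..R} t *\<^sub>R (w t \<bullet> \<Theta> t + w t \<bullet> fclass (sop_adj \<beta> \<gamma> (slice \<phi> t)) + h t \<bullet> \<Phi> 0 t)
      = w t \<bullet> \<Theta> t + w t \<bullet> fclass (sop_adj \<beta> \<gamma> (slice \<phi> t)) + h t \<bullet> \<Phi> 0 t" for t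
    using zero[of t] by (cases "t \<in> {-R..R}") (auto simp: indicator_def)
  have iq: "integrable lborel (\<lambda>t. w t \<bullet> \<Theta> t + w t \<bullet> fclass (sop_adj \<beta> \<gamma> (slice \<phi> t)) + h t \<bullet> \<Phi> 0 t)"
    using p(1) unfolding set_integrable_def ind .
  have Iq: "(LINT t|lborel. w t \<bullet> \<Theta> t + w t \<bullet> fclass (sop_adj \<beta> \<gamma> (slice \<phi> t)) + h t \<bullet> \<Phi> 0 t) = 0"
    using p(2) zero(1)[of R] zero(1)[of "-R"] unfolding set_lebesgue_integral_def ind by simp
  have ih: "integrable lborel (\<lambda>t. h t \<bullet> \<Phi> 0 t)"
    using Bochner_Integration.integrable_diff[OF Bochner_Integration.integrable_diff[OF iq O(1)] O(2)]
    by (simp add: algebra_simps)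
  have "(LINT t|lborel. w t \<bullet> \<Theta> t) + (LINT t|lborel. w t \<bullet> fclass (sop_adj \<beta> \<gamma> (slice \<phi> t))) + (LINT t|lborel. h t \<bullet> \<Phi> 0 t) = 0"
    using Iq Bochner_Integration.integral_add[OF Bochner_Integration.integrable_add[OF O(1,2)] ih]
      Bochner_Integration.integral_add[OF O(1,2)] by simp
  moreover have "(LINT t|lborel. h t \<bullet> \<Phi> 0 t) = distribution_of h \<phi>"
    by (simp add: distribution_of_def \<Phi>_def fclass_slice)
  ultimately show ?thesis unfolding O(4) by simp
qed

subsection \<open>Unimodular multipliers in time\<close>

definition symb :: "complex \<Rightarrow> complex \<Rightarrow> int \<Rightarrow> complex" where
  "symb B C n = \<i> * of_int n ^ 4 - of_int n ^ 2 * B + \<i> * of_int n * C"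

text \<open>The quartic term, Im B and Re C contribute phases only. Growth is governed by the real
  numbers Re B and Im C, one for each integral condition.\<close>

lemma Re_symb: "Re (symb B C n) = - (of_int n ^ 2 * Re B + of_int n * Im C)"
proof -
  have "of_int n ^ 4 = complex_of_real (of_int n ^ 4)" "of_int n ^ 2 = complex_of_real (of_int n ^ 2)" by simp_all
  then show ?thesis unfolding symb_def by (simp only: minus_complex.simps plus_complex.simps) simp
qed

lemma has_vderiv_exp:
  fixes N :: complex
  shows "((\<lambda>t. exp (of_real t * N)) has_vector_derivative N * exp (of_real t * N)) (at t)"
proof -
  have "((\<lambda>z. exp (z * N)) has_field_derivative N * exp (of_real t * N)) (at (of_real t))"
    by (auto intro!: derivative_eq_intros)
  then show ?thesis
    using has_vector_derivative_real_field by blast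
qed

lemma primitive_exp:
  fixes \<zeta> \<rho> :: "real \<Rightarrow> complex"
  assumes "primitive \<zeta> (\<lambda>t. - N * \<zeta> t + \<rho> t)"
  shows "primitive (\<lambda>t. exp (of_real t * N) * \<zeta> t) (\<lambda>t. exp (of_real t * N) * \<rho> t)"
proof -
  have "primitive (\<lambda>t. exp (of_real t * N) * \<zeta> t)
      (\<lambda>t. N * exp (of_real t * N) * \<zeta> t + exp (of_real t * N) * (- N * \<zeta> t + \<rho> t))"
    by (rule primitive_mult[OF assms has_vderiv_exp]) (intro continuous_intros)
  moreover have "N * exp (of_real t * N) * \<zeta> t + exp (of_real t * N) * (- N * \<zeta> t + \<rho> t) = exp (of_real t * N) * \<rho> t" for t
    by (simp add: algebra_simps)
  ultimately show ?thesis by simp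
qed

lemma inner_adjoint_left:
  fixes T :: "L2_torus \<Rightarrow> L2_torus"
  assumes "bounded_linear T"
  shows "adjoint T u \<bullet> v = u \<bullet> T v"
  unfolding inner_commute[of _ v] inner_commute[of u] by (rule inner_adjoint[OF assms, symmetric])

text \<open>Local integrability of f in L^2 supplies a primitive F, and y has the same increments as
  F because all their coefficients agree.\<close>

lemma primitive_coefs:
  assumes f: "locally_integrable f" and c: "\<And>n. primitive (\<lambda>t. coef (y t) n) (\<lambda>t. coef (f t) n)"
  shows "primitive y f"
proof -
  obtain F where F: "primitive F f"
    using primitive_exists[of f] f unfolding locally_integrable_def by blast
  have "y b - y a = F b - F a" if ab: "a \<le> b" for a b
  proof (rule coef_eqI)
    fix n
    show "coef (y b - y a) n = coef (F b - F a) n"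
      unfolding coef_diff primitiveD(2)[OF c ab]
      using primitiveD(2)[OF primitive_linear[OF bounded_linear_coef F] ab] by simp
  qed
  then show ?thesis using F unfolding primitive_def by simp
qed

lemma continuous_locally_integrable:
  "continuous_on UNIV f \<Longrightarrow> locally_integrable f"
  unfolding locally_integrable_def
  by (intro allI set_integrable_continuous) (rule continuous_on_subset, auto)

locale time_multiplier =
  fixes \<mu> :: "int \<Rightarrow> complex"
  assumes imaginary: "\<And>n. Re (\<mu> n) = 0"
begin

definition V :: "real \<Rightarrow> L2_torus \<Rightarrow> L2_torus" where
  "V t = multiplier (\<lambda>n. exp (of_real t * \<mu> n))"

lemma cmod_exp: "cmod (exp (of_real t * \<mu> n)) \<le> 1"
  by (simp add: norm_exp_eq_Re imaginary)

lemma coef_V: "coef (V t u) n = exp (of_real t * \<mu> n) * coef u n"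
  unfolding V_def by (rule coef_multiplier[OF cmod_exp])

lemma bounded_linear_V: "bounded_linear (V t)"
  unfolding V_def by (rule bounded_linear_multiplier[OF cmod_exp])

lemma V_add: "V s (V t u) = V (s + t) u"
  by (rule coef_eqI) (simp add: coef_V exp_add distrib_right)

lemma V_0: "V 0 u = u"
  by (rule coef_eqI) (simp add: coef_V)

lemma norm_V_le: "norm (V t u) \<le> norm u"
  using norm_multiplier_le[of "\<lambda>n. exp (of_real t * \<mu> n)", OF cmod_exp, of u] by (simp add: V_def)

lemma norm_V: "norm (V t u) = norm u"
  using norm_V_le[of t u] norm_V_le[of "- t" "V t u"] by (simp add: V_add V_0)

lemma proj_V: "proj N (V t u) = (\<Sum>n\<in>{-int N..int N}. fmode n (exp (of_real t * \<mu> n) * coef u n))"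
  by (simp add: proj_def coef_V)

text \<open>The exponents may be unbounded, so continuity is to be expected only strongly. For fixed
  u the truncations converge uniformly in t, because V t is isometric and commutes with
  \<open>proj\<close>. A moving argument is split as V t (x t0) + V t (x t - x t0).\<close>

lemma continuous_V:
  assumes x: "continuous_on UNIV x"
  shows "continuous_on UNIV (\<lambda>t. V t (x t))"
proof -
  have fixed: "continuous_on UNIV (\<lambda>t. V t u)" for u
  proof (rule uniform_limit_theorem)
    show "\<forall>\<^sub>F N in sequentially. continuous_on UNIV (\<lambda>t. proj N (V t u))"
      unfolding proj_V
      by (intro always_eventually allI continuous_on_sum bounded_linear.continuous_on[OF bounded_linear_fmode] continuous_intros)
    show "uniform_limit UNIV (\<lambda>N t. proj N (V t u)) (\<lambda>t. V t u) sequentially"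
    proof (rule uniform_limitI)
      fix r :: real assume "0 < r"
      then have "\<forall>\<^sub>F N in sequentially. dist (proj N u) u < r"
        using tendstoD[OF proj_tendsto] by blast
      then show "\<forall>\<^sub>F N in sequentially. \<forall>t\<in>UNIV. dist (proj N (V t u)) (V t u) < r"
      proof eventually_elim
        case (elim N)
        have "proj N (V t u) = V t (proj N u)" for t
          by (rule coef_eqI) (simp add: coef_proj coef_V)
        then have "dist (proj N (V t u)) (V t u) = norm (V t (proj N u - u))" for t
          by (simp add: dist_norm linear_diff[OF bounded_linear.linear[OF bounded_linear_V]])
        then show ?case using elim by (simp add: norm_V dist_norm)
      qed
    qed
  qed simp
  show ?thesis
    unfolding continuous_on_def
  proof (intro ballI)
    fix t0
    have "((\<lambda>t. V t (x t0)) \<longlongrightarrow> V t0 (x t0)) (at t0 within UNIV)"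
      using fixed[of "x t0"] by (simp add: continuous_on_def)
    moreover have "((\<lambda>t. V t (x t - x t0)) \<longlongrightarrow> 0) (at t0 within UNIV)"
    proof (rule tendsto_norm_zero_cancel)
      have "((\<lambda>t. x t - x t0) \<longlongrightarrow> 0) (at t0 within UNIV)"
        using x by (simp add: continuous_on_def LIM_zero)
      from tendsto_norm_zero[OF this] show "((\<lambda>t. norm (V t (x t - x t0))) \<longlongrightarrow> 0) (at t0 within UNIV)"
        by (simp add: norm_V)
    qed
    ultimately have "((\<lambda>t. V t (x t0) + V t (x t - x t0)) \<longlongrightarrow> V t0 (x t0) + 0) (at t0 within UNIV)"
      by (rule tendsto_add)
    then show "((\<lambda>t. V t (x t)) \<longlongrightarrow> V t0 (x t0)) (at t0 within UNIV)"
      by (simp add: linear_diff[OF bounded_linear.linear[OF bounded_linear_V]])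
  qed
qed

text \<open>Measurability is the point, since t also enters through V: the truncated Fourier series
  is measurable term by term. The norm is unchanged by V.\<close>

lemma locally_integrable_V:
  assumes h: "locally_integrable h"
  shows "locally_integrable (\<lambda>t. V t (h t))"
  unfolding locally_integrable_def set_integrable_def
proof (intro allI)
  fix a b :: real
  define k where "k t = indicator {a..b} t *\<^sub>R h t" for t
  have k: "integrable lborel k" using h by (simp add: locally_integrable_def set_integrable_def k_def[abs_def])
  then have km: "k \<in> borel_measurable lborel" by (rule borel_measurable_integrable)
  have "(\<lambda>t. V t (k t)) \<in> borel_measurable lborel"
  proof (rule borel_measurable_LIMSEQ_metric[OF _ proj_tendsto])
    fix N
    have "(\<lambda>t. fmode n (exp (of_real t * \<mu> n) * coef (k t) n)) \<in> borel_measurable lborel" for n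
    proof -
      have "(\<lambda>t. coef (k t) n) \<in> borel_measurable lborel"
        by (rule measurable_compose[OF km borel_measurable_continuous_onI[OF bounded_linear.continuous_on[OF bounded_linear_coef continuous_on_id]]])
      moreover have "(\<lambda>t. exp (complex_of_real t * \<mu> n)) \<in> borel_measurable lborel"
        using borel_measurable_continuous_onI[of "\<lambda>t. exp (complex_of_real t * \<mu> n)"] by (simp add: continuous_intros)
      ultimately have "(\<lambda>t. exp (of_real t * \<mu> n) * coef (k t) n) \<in> borel_measurable lborel" by measurable
      from measurable_compose[OF this borel_measurable_continuous_onI[OF bounded_linear.continuous_on[OF bounded_linear_fmode continuous_on_id]]]
      show ?thesis .
    qed
    then show "(\<lambda>t. proj N (V t (k t))) \<in> borel_measurable lborel"
      unfolding proj_V by (intro borel_measurable_sum)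
  qed
  then have "integrable lborel (\<lambda>t. V t (k t))"
    by (rule Bochner_Integration.integrable_bound[OF k]) (simp add: norm_V)
  then show "integrable lborel (\<lambda>t. indicator {a..b} t *\<^sub>R V t (h t))"
    by (simp add: k_def linear_scale[OF bounded_linear.linear[OF bounded_linear_V]])
qed

end

subsection \<open>Conjugated form of the equation\<close>

locale fourth_order_system =
  fixes \<beta> \<gamma> :: "real \<Rightarrow> real^2^2"
  assumes \<beta>: "smooth_matrix \<beta>" and \<gamma>: "smooth_matrix \<gamma>"
begin

definition B :: complex where "B = mean (\<lambda>x. mlin (\<beta> x))"
definition C :: complex where "C = mean (\<lambda>x. mlin (\<gamma> x))"

abbreviation N :: "int \<Rightarrow> complex" where "N \<equiv> symb B C"

lemma normal_form_sop:
  obtains S Q s where "bounded_linear S" "bounded_linear Q" "\<And>u. norm (S u - u) \<le> norm u / 2"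
    "\<And>n a. smp (s n a)" "\<And>n a. S (fmode n a) = fclass (s n a)"
    "\<And>n a. fclass (sop \<beta> \<gamma> (s n a)) = S (fmode n (N n * a)) + Q (fmode n a)"
proof -
  show ?thesis
  proof (rule normal_form[OF smp_mlin[OF \<beta>] smp_mlin[OF \<gamma>] smp_const[of 0] smp_const[of 0]], goal_cases)
    case (1 S Q s)
    show ?case
      by (rule that[OF 1(1-5)]) (use 1(6) in \<open>simp only: sop_def symb_def B_def C_def\<close>)
  qed
qed

text \<open>The adjoint alters the first-order coefficient by a derivative of a periodic function,
  which has mean zero. The means are thus \<open>- cnj B\<close> and \<open>cnj C\<close>, and they
  produce the symbol \<open>- cnj (N n)\<close>.\<close>

lemma normal_form_sop_adj:
  obtains S Q s where "bounded_linear S" "bounded_linear Q" "\<And>u. norm (S u - u) \<le> norm u / 2"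
    "\<And>n a. smp (s n a)" "\<And>n a. S (fmode n a) = fclass (s n a)"
    "\<And>n a. fclass (sop_adj \<beta> \<gamma> (s n a)) = S (fmode n (- cnj (N n) * a)) + Q (fmode n a)"
proof -
  note m = smp_mlin[OF \<beta>] smp_mlin[OF \<gamma>]
  have m1: "mean (\<lambda>x. - cnj (mlin (\<beta> x))) = - cnj B"
    using mean_cmult[of "-1" "\<lambda>x. cnj (mlin (\<beta> x))"] mean_cnj[OF m(1)] by (simp add: B_def)
  have m2: "mean (\<lambda>x. cnj (mlin (\<gamma> x)) - 2 * vderiv (\<lambda>x. cnj (mlin (\<beta> x))) x) = cnj C"
    using mean_diff[OF smp_cnj[OF m(3)] smp_mult[OF smp_const[of 2] smp_vderiv[OF smp_cnj[OF m(1)]]]]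
      mean_cmult[of 2 "vderiv (\<lambda>x. cnj (mlin (\<beta> x)))"] mean_vderiv[OF smp_cnj[OF m(1)]] mean_cnj[OF m(3)]
    by (simp add: C_def)
  have m3: "\<i> * of_int n ^ 4 - of_int n ^ 2 * (- cnj B) + \<i> * of_int n * cnj C = - cnj (N n)" for n
    by (simp add: symb_def)
  show ?thesis
  proof (rule normal_form[OF smp_coefs[OF \<beta> \<gamma>]], goal_cases)
    case (1 S Q s)
    show ?case
      by (rule that[OF 1(1-5)]) (use 1(6) in \<open>simp only: sop_adj_def m1 m2 m3\<close>)
  qed
qed

text \<open>The adjoint of the conjugating operator turns every solution into a solution of a bounded
  perturbation of a Fourier multiplier equation.\<close>

lemma conjugated_modes:
  assumes S: "bounded_linear S" "bounded_linear Q" "\<And>n a. smp (s n a)" "\<And>n a. S (fmode n a) = fclass (s n a)"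
    "\<And>n a. fclass (sop_adj \<beta> \<gamma> (s n a)) = S (fmode n (- cnj (N n) * a)) + Q (fmode n a)"
    and sol: "is_solution \<beta> \<gamma> h w0 w" "locally_integrable h"
  shows "primitive (\<lambda>t. coef (adjoint S (w t)) n)
    (\<lambda>t. - N n * coef (adjoint S (w t)) n + coef (adjoint Q (w t) + adjoint S (h t)) n)"
proof -
  define z r where "z t = adjoint S (w t)" and "r t = adjoint Q (w t) + adjoint S (h t)" for t
  \<comment> \<open>The test functions are the images of modes under S, which are smooth. Adjunction
    moves S and Q onto w and h, so that no x-derivative ever falls on the solution.\<close>
  have p: "primitive (\<lambda>t. z t \<bullet> fmode n c) (\<lambda>t. z t \<bullet> fmode n (- cnj (N n) * c) + r t \<bullet> fmode n c)" for c
    using solution_weak[OF \<beta> \<gamma> sol S(3)[of n c]]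
    by (simp only: S(4)[symmetric] S(5) z_def r_def inner_adjoint_left[OF S(1)] inner_adjoint_left[OF S(2)] inner_add_left inner_add_right add.assoc)
  have cf: "coef u n = (1 / of_real (2 * pi)) * (of_real (u \<bullet> fmode n 1) + \<i> * of_real (u \<bullet> fmode n \<i>))" for u
    by (simp add: coef_def Complex_of_real)
  have "primitive (\<lambda>t. (1 / of_real (2 * pi)) * (of_real (z t \<bullet> fmode n 1) + \<i> * of_real (z t \<bullet> fmode n \<i>)))
    (\<lambda>t. (1 / of_real (2 * pi)) * (of_real (z t \<bullet> fmode n (- cnj (N n) * 1) + r t \<bullet> fmode n 1)
       + \<i> * of_real (z t \<bullet> fmode n (- cnj (N n) * \<i>) + r t \<bullet> fmode n \<i>)))"
    by (intro primitive_linear[OF bounded_linear_mult_right] primitive_add primitive_linear[OF bounded_linear_of_real] p)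
  moreover have "(1 / of_real (2 * pi)) * (of_real (z t \<bullet> fmode n (- cnj (N n) * 1) + r t \<bullet> fmode n 1)
       + \<i> * of_real (z t \<bullet> fmode n (- cnj (N n) * \<i>) + r t \<bullet> fmode n \<i>)) = - N n * coef (z t) n + coef (r t) n" for t
    by (simp add: inner_fmode_coef complex_eq_iff Re_divide_of_real Im_divide_of_real field_simps)
  ultimately have "primitive (\<lambda>t. coef (z t) n) (\<lambda>t. - N n * coef (z t) n + coef (r t) n)"
    by (simp only: cf[symmetric])
  then show ?thesis by (simp only: z_def r_def)
qed

text \<open>The adjoint of S - 1 is \<open>adjoint S\<close> - 1 and obeys the same norm bound, so
  \<open>adjoint S\<close> is invertible by the same contraction argument as S.\<close>

lemma near_identity_adjoint:
  fixes S :: "L2_torus \<Rightarrow> L2_torus"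
  assumes S: "bounded_linear S" and le: "\<And>u. norm (S u - u) \<le> norm u / 2"
  shows "norm (adjoint S u - u) \<le> norm u / 2"
proof -
  have bl: "bounded_linear (\<lambda>u. S u - u)" by (intro bounded_linear_sub S bounded_linear_ident)
  have "adjoint (\<lambda>u. S u - u) v = adjoint S v - v" for v
    by (subst vector_eq_ldot[symmetric])
       (simp add: inner_adjoint[OF bl, symmetric] inner_adjoint[OF S, symmetric] inner_diff_left inner_diff_right)
  then show ?thesis using norm_adjoint_le[OF bl, of "1/2" u] le by simp
qed

theorem solution_unique:
  assumes re: "\<And>n. Re (N n) = 0" and li: "locally_integrable h"
    and w1: "is_solution \<beta> \<gamma> h w0 w1" and w2: "is_solution \<beta> \<gamma> h w0 w2"
  shows "w1 = w2"
proof -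
  interpret time_multiplier N by unfold_locales (rule re)
  obtain S Q s where S: "bounded_linear S" "bounded_linear Q" "\<And>u. norm (S u - u) \<le> norm u / 2"
    "\<And>n a. smp (s n a)" "\<And>n a. S (fmode n a) = fclass (s n a)"
    "\<And>n a. fclass (sop_adj \<beta> \<gamma> (s n a)) = S (fmode n (- cnj (N n) * a)) + Q (fmode n a)"
    using normal_form_sop_adj by blast
  let ?S = "adjoint S" and ?Q = "adjoint Q"
  note blS = bounded_linear_adjoint[OF S(1)] and blQ = bounded_linear_adjoint[OF S(2)]
  obtain R where R: "\<And>u. R (?S u) = u" "\<And>u. norm (R u) \<le> 2 * norm u"
    using neumann_inverse[OF blS near_identity_adjoint[OF S(1,3)]] by metis
  obtain K where K: "0 < K" "\<And>u. norm (?Q u) \<le> norm u * K" using bounded_linear.pos_bounded[OF blQ] by blast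
  define w where "w t = w1 t - w2 t" for t
  \<comment> \<open>\<open>V\<close> is the integrating factor for all modes at once: y is a
    primitive of the f defined next, in which the unbounded symbol no longer occurs.\<close>
  define y where "y t = V t (?S (w t))" for t
  define f where "f t = V t (?Q (w t))" for t
  have cw: "continuous_on UNIV w"
    using w1 w2 unfolding w_def is_solution_def by (intro continuous_on_diff) auto
  have cy: "continuous_on UNIV y" and cf: "continuous_on UNIV f"
    unfolding y_def f_def by (intro continuous_V bounded_linear.continuous_on[OF blS] bounded_linear.continuous_on[OF blQ] cw)+
  have "primitive (\<lambda>t. coef (y t) n) (\<lambda>t. coef (f t) n)" for n
  proof -
    note p = conjugated_modes[OF S(1,2,4,5,6) _ li, of w0 _ n]
    have "primitive (\<lambda>t. coef (?S (w1 t)) n - coef (?S (w2 t)) n)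
      (\<lambda>t. (- N n * coef (?S (w1 t)) n + coef (?Q (w1 t) + ?S (h t)) n)
         - (- N n * coef (?S (w2 t)) n + coef (?Q (w2 t) + ?S (h t)) n))"
      by (rule primitive_diff[OF p[OF w1] p[OF w2]])
    moreover have "coef (?S (w1 t)) n - coef (?S (w2 t)) n = coef (?S (w t)) n" for t
      by (simp add: w_def linear_diff[OF bounded_linear.linear[OF blS]] coef_diff)
    moreover have "(- N n * coef (?S (w1 t)) n + coef (?Q (w1 t) + ?S (h t)) n)
         - (- N n * coef (?S (w2 t)) n + coef (?Q (w2 t) + ?S (h t)) n) = - N n * coef (?S (w t)) n + coef (?Q (w t)) n" for t
      by (simp add: w_def linear_diff[OF bounded_linear.linear[OF blS]] linear_diff[OF bounded_linear.linear[OF blQ]]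
          coef_diff coef_add algebra_simps)
    ultimately have "primitive (\<lambda>t. coef (?S (w t)) n) (\<lambda>t. - N n * coef (?S (w t)) n + coef (?Q (w t)) n)"
      by (simp only:)
    from primitive_exp[OF this] show ?thesis by (simp only: y_def f_def coef_V)
  qed
  then have pf: "primitive y f" by (rule primitive_coefs[OF continuous_locally_integrable[OF cf]])
  \<comment> \<open>The inverse of \<open>adjoint S\<close>, of norm at most 2, controls w by y and
    closes the estimate.\<close>
  have fy: "norm (f t) \<le> 2 * K * norm (y t)" for t
  proof -
    have "norm (f t) \<le> norm (w t) * K" using K(2)[of "w t"] by (simp add: f_def norm_V)
    also have "norm (w t) \<le> 2 * norm (y t)" using R(2)[of "?S (w t)"] by (simp add: R(1) y_def norm_V)
    finally show ?thesis using K(1) by (simp add: mult_ac)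
  qed
  have "y t = 0" for t
  proof (rule gronwall_zero[OF cy])
    show "0 \<le> 2 * K" using K by simp
    have "locally_integrable y" by (rule continuous_locally_integrable[OF cy])
    then obtain P where P: "primitive P (\<lambda>t. norm (y t))"
      using primitive_exists[of "\<lambda>t. norm (y t)", OF locally_integrable_norm] by blast
    show "norm (y b - y a) \<le> 2 * K * (LINT s:{a..b}|lborel. norm (y s))" if "a \<le> b" for a b
    proof -
      have "norm (y b - y a) \<le> 2 * K * P b - 2 * K * P a"
        by (rule primitive_norm_le[OF pf primitive_linear[OF bounded_linear_mult_right P] that fy])
      also have "\<dots> = 2 * K * (P b - P a)" by (simp only: right_diff_distrib)
      finally show ?thesis unfolding primitiveD(2)[OF P that] .
    qed
    show "y 0 = 0"
      using w1 w2 linear_0[OF bounded_linear.linear[OF blS]] by (simp add: y_def V_0 w_def is_solution_def)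
  qed
  then have "?S (w t) = 0" for t by (metis y_def norm_V norm_eq_zero)
  then have "w t = 0" for t using R(1)[of "w t"] R(2)[of "?S (w t)"] by simp
  then show ?thesis by (simp add: w_def fun_eq_iff)
qed

text \<open>With w = S z and R the inverse of S, the normal form turns the equation into z' = - N z
  - R Q z + R h; filtering by V leaves a Volterra equation with a bounded kernel. Since z need not
  be smooth in x, the equation for w is verified against single modes, from which
  \<open>weak_solution\<close> recovers the distributional one.\<close>

theorem solution_exists:
  assumes re: "\<And>n. Re (N n) = 0" and li: "locally_integrable h"
  obtains w where "is_solution \<beta> \<gamma> h w0 w"
proof -
  interpret time_multiplier N by unfold_locales (rule re)
  obtain S Q s where S: "bounded_linear S" "bounded_linear Q" "\<And>u. norm (S u - u) \<le> norm u / 2"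
    "\<And>n a. smp (s n a)" "\<And>n a. S (fmode n a) = fclass (s n a)"
    "\<And>n a. fclass (sop \<beta> \<gamma> (s n a)) = S (fmode n (N n * a)) + Q (fmode n a)"
    using normal_form_sop by blast
  obtain R where R: "bounded_linear R" "\<And>u. S (R u) = u" "\<And>u. norm (R u) \<le> 2 * norm u"
    using neumann_inverse[OF S(1,3)] by metis
  obtain K where K: "0 < K" "\<And>u. norm (Q u) \<le> norm u * K" using bounded_linear.pos_bounded[OF S(2)] by blast
  have lik: "locally_integrable (\<lambda>t. R (h t))"
    unfolding locally_integrable_def set_integrable_def
  proof (intro allI)
    fix a b :: real
    have "integrable lborel (\<lambda>t. R (indicator {a..b} t *\<^sub>R h t))"
      using li unfolding locally_integrable_def set_integrable_def by (intro integrable_bounded_linear[OF R(1)]) auto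
    then show "integrable lborel (\<lambda>t. indicator {a..b} t *\<^sub>R R (h t))"
      by (simp add: linear_scale[OF bounded_linear.linear[OF R(1)]])
  qed
  define f where "f t = V t (R (h t))" for t
  have lif: "locally_integrable f" unfolding f_def by (rule locally_integrable_V[OF lik])
  obtain F where F: "primitive F f" "F 0 = R w0"
    using primitive_exists[of f "R w0"] lif unfolding locally_integrable_def by blast
  \<comment> \<open>The remainder - R Q expressed in the filtered unknown y = V z, hence
    \<open>V (- t)\<close> on the inside.\<close>
  define G where "G t u = - V t (R (Q (V (- t) u)))" for t u
  have blG: "bounded_linear (G t)" for t
    unfolding G_def
    by (intro bounded_linear_minus bounded_linear_compose[OF bounded_linear_V] bounded_linear_compose[OF R(1)]
        bounded_linear_compose[OF S(2)] bounded_linear_V)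
  have cVm: "continuous_on UNIV (\<lambda>t. V (- t) (x t))" if x: "continuous_on UNIV x" for x
  proof -
    have "continuous_on UNIV (\<lambda>t. V t (x (- t)))"
      by (rule continuous_V, rule continuous_on_compose2[OF x]) (auto intro!: continuous_intros)
    then have "continuous_on UNIV (\<lambda>t. (\<lambda>t. V t (x (- t))) (- t))"
      by (rule continuous_on_compose2) (auto intro!: continuous_intros)
    then show ?thesis by simp
  qed
  obtain y where y: "continuous_on UNIV y" "y 0 = F 0" "primitive (\<lambda>t. y t - F t) (\<lambda>t. G t (y t))"
  proof (rule volterra_solution[of G "2 * K" F])
    show "linear (G t)" for t by (rule bounded_linear.linear[OF blG])
    show "norm (G t u) \<le> 2 * K * norm u" for t u
    proof -
      have "norm (G t u) \<le> 2 * norm (Q (V (- t) u))" unfolding G_def by (simp add: norm_V R(3))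
      also have "\<dots> \<le> 2 * (norm u * K)" using K(2)[of "V (- t) u"] by (simp add: norm_V)
      finally show ?thesis by (simp add: mult_ac)
    qed
    show "continuous_on UNIV (\<lambda>t. G t (x t))" if "continuous_on UNIV x" for x
      unfolding G_def
      by (intro continuous_on_minus continuous_V bounded_linear.continuous_on[OF R(1)] bounded_linear.continuous_on[OF S(2)] cVm that)
    show "continuous_on UNIV F" by (rule primitive_continuous[OF F(1)])
  qed (use K in auto)
  define z where "z t = V (- t) (y t)" for t
  define r where "r t = R (h t) - R (Q (z t))" for t
  define w where "w t = S (z t)" for t
  have cz: "continuous_on UNIV z" unfolding z_def by (rule cVm[OF y(1)])
  have cw: "continuous_on UNIV w" unfolding w_def by (rule bounded_linear.continuous_on[OF S(1) cz])
  have lir: "locally_integrable r"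
    using lik continuous_locally_integrable[OF bounded_linear.continuous_on[OF R(1) bounded_linear.continuous_on[OF S(2) cz]]]
    unfolding locally_integrable_def r_def by (auto intro: set_integral_diff(1))
  have py: "primitive y (\<lambda>t. V t (r t))"
  proof -
    have "primitive (\<lambda>t. (y t - F t) + F t) (\<lambda>t. G t (y t) + f t)" by (rule primitive_add[OF y(3) F(1)])
    moreover have "G t (y t) + f t = V t (r t)" for t
      by (simp add: G_def f_def r_def z_def linear_diff[OF bounded_linear.linear[OF bounded_linear_V]])
    ultimately show ?thesis by simp
  qed
  have modes: "primitive (\<lambda>t. coef (z t) n) (\<lambda>t. - N n * coef (z t) n + coef (r t) n)" for n
  proof -
    have "primitive (\<lambda>t. coef (y t) n) (\<lambda>t. - 0 * coef (y t) n + coef (V t (r t)) n)"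
      using primitive_linear[OF bounded_linear_coef py] by simp
    then have "primitive (\<lambda>t. exp (of_real t * - N n) * coef (y t) n)
        (\<lambda>t. - N n * exp (of_real t * - N n) * coef (y t) n + exp (of_real t * - N n) * coef (V t (r t)) n)"
      by (intro primitive_mult has_vderiv_exp) (auto intro!: continuous_intros)
    moreover have "exp (of_real t * - N n) * coef (y t) n = coef (z t) n"
      "- N n * exp (of_real t * - N n) * coef (y t) n + exp (of_real t * - N n) * coef (V t (r t)) n
        = - N n * coef (z t) n + coef (r t) n" for t
      by (simp_all add: z_def coef_V exp_minus)
    ultimately show ?thesis by simp
  qed
  have "primitive (\<lambda>t. w t \<bullet> fmode m d)
      (\<lambda>t. w t \<bullet> fclass (sop_adj \<beta> \<gamma> (\<lambda>x. d * cis (of_int m * x))) + h t \<bullet> fmode m d)" for m d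
  proof -
    let ?\<psi> = "\<lambda>x. d * cis (of_int m * x)"
    have \<psi>: "smp ?\<psi>" by (intro smp_intros)
    \<comment> \<open>As w = S z, testing w with a mode means testing z with \<xi>. The adjoint of
      the model operator is unbounded, but duality with the normal form identifies its value on
      \<xi>, coefficient by coefficient, as the element - \<kappa> of L^2.\<close>
    define \<xi> where "\<xi> = adjoint S (fmode m d)"
    define \<kappa> where "\<kappa> = adjoint S (fclass (sop_adj \<beta> \<gamma> ?\<psi>)) + adjoint Q (fmode m d)"
    have "\<xi> \<bullet> fmode n (N n * c) = - (\<kappa> \<bullet> fmode n c)" for n c
    proof -
      have "\<xi> \<bullet> fmode n (N n * c) = S (fmode n (N n * c)) \<bullet> fmode m d"
        by (simp only: \<xi>_def inner_adjoint_left[OF S(1)] inner_commute[of "fmode m d"])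
      also have "S (fmode n (N n * c)) = fclass (sop \<beta> \<gamma> (s n c)) - Q (fmode n c)" by (simp add: S(6))
      also have "\<dots> \<bullet> fmode m d = - (S (fmode n c) \<bullet> fclass (sop_adj \<beta> \<gamma> ?\<psi>)) - Q (fmode n c) \<bullet> fmode m d"
        using inner_sop[OF \<beta> \<gamma> S(4)[of n c] \<psi>, folded fmode_def S(5)] by (simp add: inner_diff_left)
      also have "\<dots> = - (\<kappa> \<bullet> fmode n c)"
        by (simp add: \<kappa>_def inner_add_left inner_adjoint_left[OF S(1)] inner_adjoint_left[OF S(2)]
            inner_commute[of "fclass (sop_adj \<beta> \<gamma> ?\<psi>)"] inner_commute[of "fmode m d"])
      finally show ?thesis .
    qed
    then have ck: "- N n * cnj (coef \<xi> n) = cnj (coef \<kappa> n)" for n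
    proof -
      have k: "Re (coef \<xi> n * cnj (N n * c)) = - Re (coef \<kappa> n * cnj c)" for c
      proof -
        have "2 * pi * (Re (coef \<xi> n * cnj (N n * c)) + Re (coef \<kappa> n * cnj c)) = 0"
          using \<open>\<And>n c. \<xi> \<bullet> fmode n (N n * c) = - (\<kappa> \<bullet> fmode n c)\<close>[of n c, unfolded inner_fmode_coef]
          unfolding distrib_left by linarith
        then have "Re (coef \<xi> n * cnj (N n * c)) + Re (coef \<kappa> n * cnj c) = 0"
          by (metis mult_eq_0_iff pi_neq_zero zero_neq_numeral)
        then show ?thesis by linarith
      qed
      show ?thesis using k[of 1] k[of \<i>] by (simp add: complex_eq_iff algebra_simps)
    qed
    \<comment> \<open>\<xi> may have infinitely many modes, so the scalar equations are summed over
      a truncation; the limit can be taken because \<kappa> lies in L^2.\<close>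
    have "primitive (\<lambda>t. z t \<bullet> \<xi>) (\<lambda>t. z t \<bullet> \<kappa> + r t \<bullet> \<xi>)"
    proof (rule primitive_limit)
      let ?I = "\<lambda>k. {- int k..int k}"
      have inner_proj: "u \<bullet> proj k v = 2 * pi * (\<Sum>n\<in>?I k. Re (coef u n * cnj (coef v n)))" for u v k
        unfolding proj_def by (rule inner_sum_fmode_coef)
      show "primitive (\<lambda>t. z t \<bullet> proj k \<xi>) (\<lambda>t. z t \<bullet> proj k \<kappa> + r t \<bullet> proj k \<xi>)" for k
      proof -
        have "primitive (\<lambda>t. Re (cnj (coef \<xi> n) * coef (z t) n)) (\<lambda>t. Re (cnj (coef \<xi> n) * (- N n * coef (z t) n + coef (r t) n)))" for n
          by (intro primitive_linear[OF bounded_linear_Re] primitive_linear[OF bounded_linear_mult_right] modes)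
        from primitive_linear[OF bounded_linear_mult_right[of "2 * pi"] primitive_sum[where I = "?I k", OF this]]
        have P: "primitive (\<lambda>t. 2 * pi * (\<Sum>n\<in>?I k. Re (cnj (coef \<xi> n) * coef (z t) n)))
          (\<lambda>t. 2 * pi * (\<Sum>n\<in>?I k. Re (cnj (coef \<xi> n) * (- N n * coef (z t) n + coef (r t) n))))" .
        have eq: "cnj (coef \<xi> n) * (- N n * coef (z t) n + coef (r t) n)
            = coef (z t) n * cnj (coef \<kappa> n) + coef (r t) n * cnj (coef \<xi> n)" for n t
          unfolding ck[of n, symmetric] by (simp add: algebra_simps)
        show ?thesis
          using P unfolding eq inner_proj by (simp only: plus_complex.simps sum.distrib distrib_left mult.commute[of "cnj (coef \<xi> n)" for n])
      qed
      show "(\<lambda>k. z t \<bullet> proj k \<xi>) \<longlonglongrightarrow> z t \<bullet> \<xi>" "(\<lambda>k. z t \<bullet> proj k \<kappa> + r t \<bullet> proj k \<xi>) \<longlonglongrightarrow> z t \<bullet> \<kappa> + r t \<bullet> \<xi>" for t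
        by (intro tendsto_intros proj_tendsto)+
      fix a b :: real
      show "\<exists>g. set_integrable lborel {a..b} g \<and> (\<forall>k. \<forall>t\<in>{a..b}. norm (z t \<bullet> proj k \<kappa> + r t \<bullet> proj k \<xi>) \<le> g t)"
      proof (intro exI conjI allI ballI)
        show "set_integrable lborel {a..b} (\<lambda>t. norm \<kappa> * norm (z t) + norm \<xi> * norm (r t))"
          by (intro set_integral_add(1) set_integrable_mult_right locally_integrable_norm lir continuous_locally_integrable cz)
        fix k t
        have "\<bar>z t \<bullet> proj k \<kappa>\<bar> \<le> norm \<kappa> * norm (z t)" "\<bar>r t \<bullet> proj k \<xi>\<bar> \<le> norm \<xi> * norm (r t)"
          using Cauchy_Schwarz_ineq2[of "z t" "proj k \<kappa>"] Cauchy_Schwarz_ineq2[of "r t" "proj k \<xi>"]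
            mult_left_mono[OF norm_proj_le[of k \<kappa>] norm_ge_zero[of "z t"]] mult_left_mono[OF norm_proj_le[of k \<xi>] norm_ge_zero[of "r t"]]
          by (simp_all add: mult.commute)
        then show "norm (z t \<bullet> proj k \<kappa> + r t \<bullet> proj k \<xi>) \<le> norm \<kappa> * norm (z t) + norm \<xi> * norm (r t)"
          unfolding real_norm_def by linarith
      qed
    qed
    moreover have "z t \<bullet> \<xi> = w t \<bullet> fmode m d" for t
      by (simp add: w_def \<xi>_def inner_adjoint[OF S(1)])
    moreover have "z t \<bullet> \<kappa> + r t \<bullet> \<xi> = w t \<bullet> fclass (sop_adj \<beta> \<gamma> ?\<psi>) + h t \<bullet> fmode m d" for t
    proof -
      have "S (r t) = h t - Q (z t)"
        by (simp add: r_def linear_diff[OF bounded_linear.linear[OF S(1)]] R(2))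
      then have "r t \<bullet> \<xi> = (h t - Q (z t)) \<bullet> fmode m d" by (simp add: \<xi>_def inner_adjoint[OF S(1), symmetric])
      moreover have "z t \<bullet> \<kappa> = w t \<bullet> fclass (sop_adj \<beta> \<gamma> ?\<psi>) + Q (z t) \<bullet> fmode m d"
        by (simp add: \<kappa>_def w_def inner_add_right inner_adjoint[OF S(1), symmetric] inner_adjoint[OF S(2), symmetric])
      ultimately show ?thesis by (simp add: inner_diff_left)
    qed
    ultimately show ?thesis by simp
  qed
  then have "operator_L \<beta> \<gamma> (distribution_of w) \<phi> = distribution_of h \<phi>" if "test_function \<phi>" for \<phi>
    by (rule weak_solution[OF \<beta> \<gamma> cw li _ that])
  moreover have "w 0 = w0" by (simp add: w_def z_def V_0 y(2) F(2) R(2))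
  ultimately have "is_solution \<beta> \<gamma> h w0 w" using cw by (simp add: is_solution_def)
  then show ?thesis by (rule that)
qed

end

section \<open>Failure of existence when the real part of the symbol grows\<close>

lemma cmod_coef_le: "cmod (coef u n) \<le> norm u"
proof -
  have "n \<in> {- int (nat \<bar>n\<bar>)..int (nat \<bar>n\<bar>)}" by auto
  then have "(cmod (coef u n))\<^sup>2 \<le> (\<Sum>m\<in>{- int (nat \<bar>n\<bar>)..int (nat \<bar>n\<bar>)}. (cmod (coef u m))\<^sup>2)"
    by (intro member_le_sum) auto
  also have "\<dots> \<le> 2 * pi * \<dots>"
    using pi_gt3 by (intro mult_right_mono[of 1 "2 * pi", simplified] sum_nonneg) auto
  also have "\<dots> \<le> (norm u)\<^sup>2" by (rule bessel)
  finally show ?thesis by (rule power2_le_imp_le) simp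
qed

text \<open>A mode with growth rate \<open>\<kappa>\<close> can stay bounded on one side of \<open>t = 0\<close> only if its initial value is
  \<open>O(1/\<kappa>)\<close>.\<close>

lemma growing_mode_bound:
  fixes \<zeta> \<rho> :: "real \<Rightarrow> complex"
  assumes p: "primitive \<zeta> (\<lambda>t. - N * \<zeta> t + \<rho> t)"
    and K: "\<And>t. t \<in> {-1..1} \<Longrightarrow> cmod (\<zeta> t) \<le> K" "\<And>t. t \<in> {-1..1} \<Longrightarrow> cmod (\<rho> t) \<le> K"
  shows "cmod (\<zeta> 0) * \<bar>Re N\<bar> \<le> 2 * K"
proof (cases "Re N = 0")
  case True
  have "0 \<le> K" using order_trans[OF norm_ge_zero K(1)[of 0]] by simp
  with True show ?thesis by simp
next
  case False
  define \<kappa> where "\<kappa> = Re N"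
  have K0: "0 \<le> K" using order_trans[OF norm_ge_zero K(1)[of 0]] by simp
  have nE: "cmod (exp (of_real t * N)) = exp (t * \<kappa>)" for t
    by (simp add: norm_exp_eq_Re \<kappa>_def)
  note P = primitive_exp[OF p]
  have "((\<lambda>t. K / \<kappa> * exp (t * \<kappa>)) has_real_derivative exp (t * \<kappa>) * K) (at t)" for t
    using False by (auto intro!: derivative_eq_intros simp: \<kappa>_def)
  then have Q: "primitive (\<lambda>t. K / \<kappa> * exp (t * \<kappa>)) (\<lambda>t. exp (t * \<kappa>) * K)"
    by (intro primitive_of_deriv continuous_intros) (simp add: has_real_derivative_iff_has_vector_derivative)
  have b: "cmod (exp (of_real t * N) * \<rho> t) \<le> exp (t * \<kappa>) * K" if "t \<in> {-1..1}" for t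
    unfolding norm_mult nE by (intro mult_left_mono K(2) that) simp
  \<comment> \<open>Absorbs the exponential boundary term and leads to the constant 2.\<close>
  have small: "\<bar>\<kappa>\<bar> * exp (- \<bar>\<kappa>\<bar>) \<le> 1"
  proof -
    have "\<bar>\<kappa>\<bar> \<le> exp \<bar>\<kappa>\<bar>" using exp_ge_add_one_self[of "\<bar>\<kappa>\<bar>"] by linarith
    then show ?thesis by (simp add: exp_minus field_simps)
  qed
  have main: "cmod (\<zeta> 0) \<le> exp (- \<bar>\<kappa>\<bar>) * K + K / \<bar>\<kappa>\<bar>"
  \<comment> \<open>The sign of \<kappa> selects the time direction in which the weight exp (t
    \<kappa>) decays: forward for negative \<kappa>, backward for positive.\<close>
  proof (cases "\<kappa> < 0")
    case True
    have "cmod (exp (of_real 1 * N) * \<zeta> 1 - exp (of_real 0 * N) * \<zeta> 0) \<le> K / \<kappa> * exp (1 * \<kappa>) - K / \<kappa> * exp (0 * \<kappa>)"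
      by (rule primitive_norm_le[OF P Q]) (use b in auto)
    moreover have "cmod (exp (of_real 1 * N) * \<zeta> 1) \<le> exp (1 * \<kappa>) * K"
      unfolding norm_mult nE using K(1)[of 1] by (intro mult_left_mono) auto
    moreover have "K / \<kappa> * exp (1 * \<kappa>) \<le> 0"
      using True K0 by (intro mult_nonpos_nonneg divide_nonneg_neg) auto
    moreover have "\<bar>\<kappa>\<bar> = - \<kappa>" "K / - \<kappa> = - (K / \<kappa>)" using True by auto
    ultimately show ?thesis
      using norm_triangle_ineq2[of "exp (of_real 0 * N) * \<zeta> 0" "exp (of_real 1 * N) * \<zeta> 1"]
      by (simp add: norm_minus_commute)
  next
    case neg: False
    then have pos: "\<kappa> > 0" using False by (simp add: \<kappa>_def)
    have "cmod (exp (of_real 0 * N) * \<zeta> 0 - exp (of_real (-1) * N) * \<zeta> (-1)) \<le> K / \<kappa> * exp (0 * \<kappa>) - K / \<kappa> * exp ((-1) * \<kappa>)"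
      by (rule primitive_norm_le[OF P Q]) (use b in auto)
    moreover have "cmod (exp (of_real (-1) * N) * \<zeta> (-1)) \<le> exp ((-1) * \<kappa>) * K"
      unfolding norm_mult nE using K(1)[of "-1"] by (intro mult_left_mono) auto
    moreover have "0 \<le> K / \<kappa> * exp ((-1) * \<kappa>)"
      using pos K0 by (intro mult_nonneg_nonneg divide_nonneg_pos) auto
    moreover have "\<bar>\<kappa>\<bar> = \<kappa>" using pos by auto
    ultimately show ?thesis
      using norm_triangle_ineq2[of "exp (of_real 0 * N) * \<zeta> 0" "exp (of_real (-1) * N) * \<zeta> (-1)"]
      by simp
  qed
  have "cmod (\<zeta> 0) * \<bar>\<kappa>\<bar> \<le> (exp (- \<bar>\<kappa>\<bar>) * K + K / \<bar>\<kappa>\<bar>) * \<bar>\<kappa>\<bar>"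
    by (rule mult_right_mono[OF main]) simp
  also have "\<dots> = (\<bar>\<kappa>\<bar> * exp (- \<bar>\<kappa>\<bar>)) * K + K"
    using False by (simp add: \<kappa>_def field_simps)
  also have "\<dots> \<le> 1 * K + K" by (intro add_mono mult_right_mono small K0) simp
  finally show ?thesis by (simp add: \<kappa>_def)
qed

text \<open>Any exponent strictly between -1 and -1/2 would serve: the squares are summable, while n
  times the coefficient is unbounded.\<close>

lemma slowly_decaying_coefs:
  obtains u where "\<And>n. 1 \<le> n \<Longrightarrow> cmod (coef u n) = real_of_int n powr (-3/4)"
proof -
  define a where "a n = (if 1 \<le> n then complex_of_real (real_of_int n powr (-3/4)) else 0)" for n :: int
  have sm: "summable (\<lambda>n. real n powr (-3/2))" by (simp add: summable_real_powr_iff)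
  have "(\<Sum>n\<in>{-int N..int N}. (cmod (a n))\<^sup>2) \<le> (\<Sum>n. real n powr (-3/2))" for N
  proof -
    have "(\<Sum>n\<in>{-int N..int N}. (cmod (a n))\<^sup>2) = (\<Sum>n\<in>int ` {1..N}. (cmod (a n))\<^sup>2)"
    proof (rule sum.mono_neutral_right)
      show "\<forall>i\<in>{-int N..int N} - int ` {1..N}. (cmod (a i))\<^sup>2 = 0"
      proof
        fix i assume i: "i \<in> {-int N..int N} - int ` {1..N}"
        have "\<not> 1 \<le> i"
        proof
          assume "1 \<le> i"
          then have "i = int (nat i)" "nat i \<in> {1..N}" using i by auto
          then show False using i by blast
        qed
        then show "(cmod (a i))\<^sup>2 = 0" by (simp add: a_def)
      qed
    qed auto
    also have "\<dots> = (\<Sum>n\<in>{1..N}. (cmod (a (int n)))\<^sup>2)"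
      by (rule sum.reindex_cong[of int]) auto
    also have "\<dots> = (\<Sum>n\<in>{1..N}. real n powr (-3/2))"
    proof (rule sum.cong[OF refl])
      fix n assume "n \<in> {1..N}"
      then show "(cmod (a (int n)))\<^sup>2 = real n powr (-3/2)"
        by (simp add: a_def power2_eq_square flip: powr_add)
    qed
    also have "\<dots> \<le> (\<Sum>n. real n powr (-3/2))"
      by (rule sum_le_suminf[OF sm]) auto
    finally show ?thesis .
  qed
  then obtain u where "\<And>n. coef u n = a n" using riesz_fischer[of a] by blast
  then show ?thesis using that[of u] by (simp add: a_def)
qed

context fourth_order_system
begin

text \<open>It is existence that fails: already for h = 0 there is an initial datum that admits no
  continuous solution.\<close>

theorem well_posed_imp_imaginary:
  assumes wp: "L2_well_posed \<beta> \<gamma>"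
  shows "Re B = 0 \<and> Im C = 0"
proof (rule ccontr)
  assume neg: "\<not> (Re B = 0 \<and> Im C = 0)"
  obtain S Q s where S: "bounded_linear S" "bounded_linear Q" "\<And>u. norm (S u - u) \<le> norm u / 2"
    "\<And>n a. smp (s n a)" "\<And>n a. S (fmode n a) = fclass (s n a)"
    "\<And>n a. fclass (sop_adj \<beta> \<gamma> (s n a)) = S (fmode n (- cnj (N n) * a)) + Q (fmode n a)"
    using normal_form_sop_adj by blast
  let ?S = "adjoint S" and ?Q = "adjoint Q"
  note blS = bounded_linear_adjoint[OF S(1)] and blQ = bounded_linear_adjoint[OF S(2)]
  obtain R where R: "\<And>u. ?S (R u) = u"
    using neumann_inverse[OF blS near_identity_adjoint[OF S(1,3)]] by metis
  obtain z0 where z0: "\<And>n. 1 \<le> n \<Longrightarrow> cmod (coef z0 n) = real_of_int n powr (-3/4)"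
    using slowly_decaying_coefs by blast
  have l0: "locally_integrable (\<lambda>t. 0)" by (rule continuous_locally_integrable) simp
  \<comment> \<open>The datum R z0 makes \<open>adjoint S\<close> applied to the solution start
    exactly at z0.\<close>
  obtain w where w: "is_solution \<beta> \<gamma> (\<lambda>t. 0) (R z0) w"
    using wp l0 unfolding L2_well_posed_def by blast
  have cw: "continuous_on UNIV w" and w0: "w 0 = R z0" using w by (auto simp: is_solution_def)
  obtain K1 where K1: "\<And>t. t \<in> {-1..1} \<Longrightarrow> norm (?S (w t)) \<le> K1"
    using continuous_bounded_Icc[OF bounded_linear.continuous_on[OF blS cw]] by blast
  obtain K2 where K2: "\<And>t. t \<in> {-1..1} \<Longrightarrow> norm (?Q (w t)) \<le> K2"
    using continuous_bounded_Icc[OF bounded_linear.continuous_on[OF blQ cw]] by blast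
  define K where "K = max K1 K2"
  have bound: "cmod (coef z0 n) * \<bar>Re (N n)\<bar> \<le> 2 * K" for n
  proof -
    have "primitive (\<lambda>t. coef (?S (w t)) n) (\<lambda>t. - N n * coef (?S (w t)) n + coef (?Q (w t)) n)"
      using conjugated_modes[OF S(1,2,4,5,6) w l0, of n] by (simp add: linear_0[OF bounded_linear.linear[OF blS]])
    moreover have "cmod (coef (?S (w t)) n) \<le> K" "cmod (coef (?Q (w t)) n) \<le> K" if "t \<in> {-1..1}" for t
      using order_trans[OF cmod_coef_le K1[OF that]] order_trans[OF cmod_coef_le K2[OF that]]
      by (auto simp: K_def le_max_iff_disj)
    ultimately show ?thesis
      using growing_mode_bound[of "\<lambda>t. coef (?S (w t)) n" "N n" "\<lambda>t. coef (?Q (w t)) n" K] by (simp add: w0 R)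
  qed
  obtain \<delta> n0 where \<delta>: "0 < \<delta>" and grow: "\<And>n::int. n0 \<le> n \<Longrightarrow> 1 \<le> n \<Longrightarrow> \<delta> * real_of_int n \<le> \<bar>Re (N n)\<bar>"
  proof (cases "Re B = 0")
    case True
    show ?thesis
    proof (rule that[of "\<bar>Im C\<bar>" 1])
      show "0 < \<bar>Im C\<bar>" using neg True by simp
      show "\<bar>Im C\<bar> * real_of_int n \<le> \<bar>Re (N n)\<bar>" if "1 \<le> n" for n :: int
        using that True by (simp add: Re_symb abs_mult)
    qed
  next
    case False
    \<comment> \<open>From this frequency on, n |Re B| exceeds |Im C| by at least 1, so the linear
      term cannot cancel the quadratic one.\<close>
    define n1 where "n1 = \<lceil>(1 + \<bar>Im C\<bar>) / \<bar>Re B\<bar>\<rceil>"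
    show ?thesis
    proof (rule that[of 1 n1])
      fix n :: int assume n: "n1 \<le> n" "1 \<le> n"
      have "(1 + \<bar>Im C\<bar>) / \<bar>Re B\<bar> \<le> real_of_int n" using n by (simp add: n1_def ceiling_le_iff)
      then have "1 + \<bar>Im C\<bar> \<le> real_of_int n * \<bar>Re B\<bar>" using False by (simp add: field_simps)
      also have "real_of_int n * \<bar>Re B\<bar> = \<bar>of_int n * Re B\<bar>" using n by (simp add: abs_mult)
      finally have "1 \<le> \<bar>of_int n * Re B + Im C\<bar>" by linarith
      then have "real_of_int n * 1 \<le> real_of_int n * \<bar>of_int n * Re B + Im C\<bar>"
        using n by (intro mult_left_mono) auto
      also have "\<dots> = \<bar>of_int n * (of_int n * Re B + Im C)\<bar>" using n by (simp add: abs_mult)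
      also have "\<dots> = \<bar>Re (N n)\<bar>" unfolding Re_symb abs_minus_cancel by (simp add: power2_eq_square algebra_simps)
      finally show "1 * real_of_int n \<le> \<bar>Re (N n)\<bar>" by simp
    qed simp
  qed
  \<comment> \<open>Coefficients n^(-3/4) and growth at least \<delta> n force \<delta> n^(1/4)
    \<le> 2 K, so a frequency above x^4 gives the contradiction. The maximum with 1 keeps x positive
    for the laws of \<open>powr\<close>.\<close>
  define x where "x = max 1 (2 * K / \<delta>)"
  obtain m0 :: nat where m0: "x ^ 4 < real m0" using reals_Archimedean2 by blast
  define m where "m = max m0 (max 1 (nat n0))"
  have x1: "1 \<le> x" by (simp add: x_def)
  have "x = x powr (4 * (1/4))" using x1 by simp
  also have "\<dots> = (x powr 4) powr (1/4)" by (simp only: powr_powr)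
  also have "x powr 4 = x ^ 4" using x1 by simp
  also have "(x ^ 4) powr (1/4) < real m powr (1/4)"
    using m0 by (intro powr_less_mono2) (auto simp: m_def x_def)
  finally have m: "2 * K / \<delta> < real m powr (1/4)" "max 1 (nat n0) \<le> m" by (auto simp: x_def m_def)
  have m1: "1 \<le> int m" "n0 \<le> int m" using m(2) by auto
  have "\<delta> * real m powr (1/4) = real m powr (-3/4) * (\<delta> * real m)"
  proof -
    have "real m powr (1/4) = real m powr (-3/4 + 1)" by simp
    also have "\<dots> = real m powr (-3/4) * real m powr 1" by (rule powr_add)
    finally show ?thesis by (simp add: mult_ac)
  qed
  also have "\<dots> \<le> cmod (coef z0 (int m)) * \<bar>Re (N (int m))\<bar>"
    using z0[OF m1(1)] grow[OF m1(2,1)] by (simp add: mult_left_mono)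
  also have "\<dots> \<le> 2 * K" by (rule bound)
  finally show False using m(1) \<delta> by (simp add: field_simps)
qed

theorem imaginary_imp_well_posed:
  assumes "Re B = 0" "Im C = 0"
  shows "L2_well_posed \<beta> \<gamma>"
  unfolding L2_well_posed_def
proof (intro allI impI)
  fix w0 h assume li: "locally_integrable h"
  have re: "Re (N n) = 0" for n using assms by (simp add: Re_symb)
  obtain w where "is_solution \<beta> \<gamma> h w0 w" using solution_exists[OF re li] by blast
  then show "\<exists>!w. is_solution \<beta> \<gamma> h w0 w" using solution_unique[OF re li] by blast
qed

end

lemma Re_mean:
  assumes "smp f"
  shows "Re (mean f) = integral {0..2*pi} (\<lambda>x. Re (f x)) / (2 * pi)"
    and "Im (mean f) = integral {0..2*pi} (\<lambda>x. Im (f x)) / (2 * pi)"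
  using integral_linear[OF smp_integrable[OF assms] bounded_linear_Re]
    integral_linear[OF smp_integrable[OF assms] bounded_linear_Im]
  by (simp_all add: mean_def o_def Re_divide_of_real[of _ "2 * pi", simplified] Im_divide_of_real[of _ "2 * pi", simplified])

theorem theorem3:
  fixes \<beta> \<gamma> :: "real \<Rightarrow> real^2^2"
  assumes "\<And>j k. smooth_periodic (\<lambda>x. \<beta> x $ j $ k)"
    and "\<And>j k. smooth_periodic (\<lambda>x. \<gamma> x $ j $ k)"
  shows "L2_well_posed \<beta> \<gamma> \<longleftrightarrow>
    integral {0..2*pi} (\<lambda>x. trace (\<beta> x)) = 0 \<and>
    integral {0..2*pi} (\<lambda>x. trace (J ** \<gamma> x)) = 0"
proof -
  interpret fourth_order_system \<beta> \<gamma>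
    by unfold_locales (use assms in \<open>auto simp: smooth_matrix_def\<close>)
  have "trace (\<beta> x) = 2 * Re (mlin (\<beta> x))" "trace (J ** \<gamma> x) = - 2 * Im (mlin (\<gamma> x))" for x
    by (simp_all add: trace_J_mult mlin_def) (simp add: trace_def sum_2)
  then have "integral {0..2*pi} (\<lambda>x. trace (\<beta> x)) = 2 * (2 * pi * Re B)"
    "integral {0..2*pi} (\<lambda>x. trace (J ** \<gamma> x)) = - 2 * (2 * pi * Im C)"
    using Re_mean(1)[OF smp_mlin(1)[OF \<beta>]] Re_mean(2)[OF smp_mlin(1)[OF \<gamma>]]
    by (simp_all add: B_def C_def)
  then show ?thesis using well_posed_imp_imaginary imaginary_imp_well_posed by auto
qed

end
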